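(* Let $\mu^*$ be a non-degenerate probability distribution on $[-1,1]$ (i.e. not a point mass). Suppose there are constants $C_1\in(0,1]$, $C_2\in[1,\infty)$, free of $n,p$, with $C_1\le \lambda_{\min}(\mathbf X^\top\mathbf X)/\sigma^2\le\lambda_{\max}(\mathbf X^\top\mathbf X)/\sigma^2\le C_2$; that $\mathcal P$ is a closed subset of the set of all probability measures supported on $[-1,1]$; and that $\mathrm{Tr}(A^2)=o(p)$. Let $\{\mu^{(p)}\}\subset\mathcal P$ converge weakly to $\mu^*$ as $p\to\infty$. Assume that $\mathcal M_p(\cdot,\mathbf w,\mu^* )$ has a well-separated optimizer. Let $\mathbf u^{(p)}$ be any global optimizer (maximizer) of $\mathcal M_p(\cdot,\mathbf w,\mu^{(p)})$ on $I_{\mu^{(p)}}^p$ and $\tau_i^{(p)}:=h_{\mu^{(p)},d_i}(u_i^{(p)})$ for $i\in[p]$. Then: (i) Let $L$ be any positive integer and let $f_{p,i}:[-1,1]^L\to\mathbb R$, $1\le i\le p$, satisfy $|f_{p,i}(s_1,\dots,s_L)-f_{p,i}(t_1,\dots,t_L)|\le\sum_{l=1}^L|s_l-t_l|$ and $\|f_{p,i}\|_\infty\le1$. For any $\varepsilon>0$, as $p\to\infty$, $$\mathbb P_{\mu^*}\bigg(\Big|\frac1p\sum_{i=1}^pf_{p,i}(\beta_i^{(1)},\dots,\beta_i^{(L)})-\frac1p\sum_{i=1}^p\mathbb E_{\mu^{(p)}_{\tau_i^{(p)},d_i}}[f_{p,i}(\zeta_i^{(1)},\dots,\zeta_i^{(L)})]\Big|>\varepsilon\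 \Big|\ \mathbf y\bigg)\stackrel{\mathbb P_{\mu^*}}{\to}0,$$ where $\boldsymbol\beta^{(1)},\dots,\boldsymbol\beta^{(L)}$ are i.i.d. samples from the posterior $\mathbb P_{\mu^*}(\cdot\mid\mathbf y)$ and $\zeta_i^{(1)},\dots,\zeta_i^{(L)}$ are i.i.d. samples from $\mu^{(p)}_{\tau_i^{(p)},d_i}$. (ii) Let $\alpha\in(0,1)$. For $i\in[p]$ and $\varepsilon>0$ let $\mathcal I_i^\varepsilon:=(q_i^{(\alpha/2)}-\varepsilon,\ q_i^{(1-\alpha/2)}+\varepsilon)$, where $q_i^{(\alpha/2)}$ and $q_i^{(1-\alpha/2)}$ are the $\alpha/2$ and $1-\alpha/2$ quantiles of $\mu^{(p)}_{\tau_i^{(p)},d_i}$. Then $$\mathbb P_{\mu^*}\bigg(\frac1p\sum_{i=1}^p\mathbf 1(\beta_i\in\mathcal I_i^\varepsilon)\ge 1-\alpha-\varepsilon\ \Big|\ \mathbf y\bigg)\stackrel{\mathbb P_{\mu^*}}{\to}1.$$ (iii) For $i\in[p]$ let $\hat\beta_i:=\mathbb E_{\mu^{(p)}_{\tau_i^{(p)},d_i}}[\beta_i]$ (the mean of $\mu^{(p)}_{\tau_i^{(p)},d_i}$) and $\hat{\boldsymbol\beta}:=(\hat\beta_1,\dots,\hat\beta_p)$. Then $\hat{\boldsymbol\beta}$ is asymptotically Bayes optimal under $L^2$ loss, i.e., as $p\to\infty$, $$\frac1p\mathbb E_{\mathbb P_{\mu^*}}\Big[\|\boldsymbol\beta-\mathbb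 E_{\mathbb P_{\mu^*}}[\boldsymbol\beta\mid\mathbf y]\|_2^2\Big]-\frac1p\mathbb E_{\mathbb P_{\mu^*}}\Big[\|\boldsymbol\beta-\hat{\boldsymbol\beta}\|_2^2\Big]\to0.$$
   Context: Model: $\mathbf y=\mathbf X\boldsymbol\beta+\boldsymbol\varepsilon\in\mathbb R^n$, with $\mathbf X\in\mathbb R^{n\times p}$ deterministic ($n$ and $\mathbf X$ depend on $p$), $\boldsymbol\varepsilon\sim N_n(\mathbf 0,\sigma^2\mathbf I)$, $\sigma^2>0$ known, and, independently of $\boldsymbol\varepsilon$, $\beta_1,\dots,\beta_p\stackrel{iid}{\sim}\mu$. $\mathbb P_\mu$ denotes the joint law of $(\mathbf y,\boldsymbol\beta)$ when the prior is $\mu$, and $\mathbb P_\mu(\cdot\mid\mathbf y)$ the posterior law of $\boldsymbol\beta$ given $\mathbf y$. $\stackrel{\mathbb P_{\mu^*}}{\to}$ is convergence in probability under $\mathbb P_{\mu^*}$. "Closed" refers to the topology of weak convergence. Notation: $A\in\mathbb R^{p\times p}$ is the off-diagonal part of $\sigma^{-2}\mathbf X^\top\mathbf X$ (zero diagonal), $\mathbf w:=\sigma^{-2}\mathbf X^\top\mathbf y$, $d_i:=\sigma^{-2}(\mathbf X^\top\mathbf X)_{ii}$, $[p]=\{1,\dots,p\}$. For a probability measure $\mu$ on $\mathbb R$ and $(\gamma,d)\in\mathbb R\times(0,\infty)$, $c_\mu(\gamma,d):=\log\int\exp(\gamma\beta-\frac d2\beta^2)d\mu(\beta)$, and $\mu_{\gamma,d}$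 is the probability measure with $\frac{d\mu_{\gamma,d}}{d\mu}(\beta)=\exp(\gamma\beta-\frac d2\beta^2-c_\mu(\gamma,d))$. Its mean is $\dot c_\mu(\gamma,d):=\partial c_\mu(\gamma,d)/\partial\gamma$. Let $I_\mu:=(\inf\mathrm{Supp}(\mu),\sup\mathrm{Supp}(\mu))$. For $\mu$ non-degenerate with compact support, $\dot c_\mu(\cdot,d)$ is strictly increasing from $\mathbb R$ onto $I_\mu$; $h_{\mu,d}:I_\mu\to\mathbb R$ is its inverse. (Since $\mu^{(p)}\to\mu^*$ weakly with $\mu^*$ non-degenerate, $\mu^{(p)}$ is non-degenerate for all large $p$, which is all that matters for the limits.) For $\mathbf u\in I_\mu^p$, $\mathbf v\in\mathbb R^p$, $$\mathcal M_p(\mathbf u,\mathbf v,\mu):=-\frac12\mathbf u^\top A\mathbf u+\mathbf u^\top\mathbf v-\sum_{i=1}^p\mathrm{D_{KL}}(\mu_{h_{\mu,d_i}(u_i),d_i}\|\mu_{0,d_i}),$$ with $\mathrm{D_{KL}}$ the Kullback–Leibler divergence. Well-separated optimizer: $\mathcal M_p(\cdot,\mathbf w,\mu^* )$ has a well-separated optimizer if there is a sequence of random vectors $\mathbf u^*=\mathbf u^*_p\in I_{\mu^*}^p$ such that for every $\delta>0$ there is $\varepsilon>0$ with $$\mathbb P_{\mu^*}\Big(\sup_{\mathbf u\in I_{\mu^*}^p:\ \|\mathbf u-\mathbf u^*\|_2^2>p\delta}\mathcal M_p(\mathbf u,\mathbf w,\mu^* )<\sup_{\mathbf u\in I_{\mu^*}^p}\mathcal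 M_p(\mathbf u,\mathbf w,\mu^* )-p\varepsilon\Big)\to1\quad\text{as }p\to\infty.$$ *)

theory Defs
  imports
    "HOL-Probability.Probability"
    "HOL-Library.Landau_Symbols"
    "Jordan_Normal_Form.Spectral_Radius"
begin

text \<open>
  Matrices are those of \<open>Jordan_Normal_Form\<close>, whose dimensions are values. A random vector of
  dimension \<open>n\<close> is an element of the product space \<open>\<Pi>\<^sub>M i\<in>{..<n}. borel\<close>, i.e. an extensional
  function on \<open>{..<n}\<close>; coordinates are therefore numbered from 0.
\<close>

section \<open>Probability measures on \<open>[-1, 1]\<close> and the weak topology\<close>

definition prob_on_interval :: "real measure set" where
  "prob_on_interval = {\<mu>. real_distribution \<mu> \<and> measure \<mu> {-1..1} = 1}"

definition weak_topology :: "real measure topology" where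
  "weak_topology = topology_generated_by
     {{\<mu> \<in> prob_on_interval. (\<integral>x. g x \<partial>\<mu>) \<in> U} | g U.
        continuous_on UNIV g \<and> bounded (range g) \<and> open (U :: real set)}"

definition nondegenerate :: "real measure \<Rightarrow> bool" where
  "nondegenerate \<mu> \<longleftrightarrow> (\<forall>a. \<mu> \<noteq> return borel a)"

definition supp :: "real measure \<Rightarrow> real set" where
  "supp \<mu> = {x. \<forall>U. open U \<longrightarrow> x \<in> U \<longrightarrow> 0 < emeasure \<mu> U}"

definition mean_range :: "real measure \<Rightarrow> real set" where
  "mean_range \<mu> = {Inf (supp \<mu>) <..< Sup (supp \<mu>)}"

definition quantile :: "real measure \<Rightarrow> real \<Rightarrow> real" where
  "quantile \<mu> a = Inf {x. a \<le> cdf \<mu> x}"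

section \<open>Quadratic exponential tilts\<close>

definition log_mgf :: "real measure \<Rightarrow> real \<Rightarrow> real \<Rightarrow> real" where
  "log_mgf \<mu> \<gamma> d = ln (\<integral>b. exp (\<gamma> * b - d / 2 * b\<^sup>2) \<partial>\<mu>)"

definition tilt :: "real measure \<Rightarrow> real \<Rightarrow> real \<Rightarrow> real measure" where
  "tilt \<mu> \<gamma> d = density \<mu> (\<lambda>b. ennreal (exp (\<gamma> * b - d / 2 * b\<^sup>2 - log_mgf \<mu> \<gamma> d)))"

definition tilt_mean :: "real measure \<Rightarrow> real \<Rightarrow> real \<Rightarrow> real" where
  "tilt_mean \<mu> \<gamma> d = deriv (\<lambda>\<gamma>'. log_mgf \<mu> \<gamma>' d) \<gamma>"

definition tilt_param :: "real measure \<Rightarrow> real \<Rightarrow> real \<Rightarrow> real" where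
  "tilt_param \<mu> d = the_inv_into UNIV (\<lambda>\<gamma>. tilt_mean \<mu> \<gamma> d)"

section \<open>The linear model\<close>

definition gram :: "real mat \<Rightarrow> real mat" where
  "gram X = transpose_mat X * X"

definition lambda_min :: "real mat \<Rightarrow> real" where
  "lambda_min M = Min (spectrum M)"

definition lambda_max :: "real mat \<Rightarrow> real" where
  "lambda_max M = Max (spectrum M)"

definition mat_trace :: "real mat \<Rightarrow> real" where
  "mat_trace M = (\<Sum>i<dim_row M. M $$ (i, i))"

definition offdiag :: "real \<Rightarrow> real mat \<Rightarrow> real mat" where
  "offdiag \<sigma> X = mat (dim_col X) (dim_col X)
     (\<lambda>(i, j). if i = j then 0 else gram X $$ (i, j) / \<sigma>\<^sup>2)"

definition diag_coeff :: "real \<Rightarrow> real mat \<Rightarrow> nat \<Rightarrow> real" where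
  "diag_coeff \<sigma> X i = gram X $$ (i, i) / \<sigma>\<^sup>2"

definition score :: "real \<Rightarrow> real mat \<Rightarrow> (nat \<Rightarrow> real) \<Rightarrow> nat \<Rightarrow> real" where
  "score \<sigma> X y i = (\<Sum>j<dim_row X. X $$ (j, i) * y j) / \<sigma>\<^sup>2"

abbreviation vec_space :: "nat \<Rightarrow> (nat \<Rightarrow> real) measure" where
  "vec_space n \<equiv> Pi\<^sub>M {..<n} (\<lambda>_. borel)"

definition joint_law ::
    "real \<Rightarrow> real mat \<Rightarrow> real measure \<Rightarrow> ((nat \<Rightarrow> real) \<times> (nat \<Rightarrow> real)) measure" where
  "joint_law \<sigma> X \<mu> = distr
     (Pi\<^sub>M {..<dim_col X} (\<lambda>_. \<mu>) \<Otimes>\<^sub>M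
      Pi\<^sub>M {..<dim_row X} (\<lambda>_. density lborel (\<lambda>x. ennreal (normal_density 0 \<sigma> x))))
     (vec_space (dim_row X) \<Otimes>\<^sub>M vec_space (dim_col X))
     (\<lambda>(\<beta>, e). (\<lambda>j\<in>{..<dim_row X}. (\<Sum>i<dim_col X. X $$ (j, i) * \<beta> i) + e j, \<beta>))"

text \<open>
  A posterior is any regular conditional distribution of \<open>\<beta>\<close> given \<open>y\<close>; two of them agree for
  almost every \<open>y\<close>.
\<close>

definition is_posterior ::
    "real \<Rightarrow> real mat \<Rightarrow> real measure \<Rightarrow> ((nat \<Rightarrow> real) \<Rightarrow> (nat \<Rightarrow> real) measure) \<Rightarrow> bool" where
  "is_posterior \<sigma> X \<mu> K \<longleftrightarrow>
     K \<in> vec_space (dim_row X) \<rightarrow>\<^sub>M prob_algebra (vec_space (dim_col X)) \<and>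
     (\<forall>S\<in>sets (vec_space (dim_row X)). \<forall>T\<in>sets (vec_space (dim_col X)).
        emeasure (joint_law \<sigma> X \<mu>) (S \<times> T) =
        (\<integral>\<^sup>+y\<in>S. emeasure (K y) T \<partial>distr (joint_law \<sigma> X \<mu>) (vec_space (dim_row X)) fst))"

definition cond_mean :: "real \<Rightarrow> real mat \<Rightarrow> real measure \<Rightarrow> nat \<Rightarrow>
    (nat \<Rightarrow> real) \<times> (nat \<Rightarrow> real) \<Rightarrow> real" where
  "cond_mean \<sigma> X \<mu> i = real_cond_exp (joint_law \<sigma> X \<mu>)
     (vimage_algebra (space (joint_law \<sigma> X \<mu>)) fst (vec_space (dim_row X)))
     (\<lambda>\<omega>. snd \<omega> i)"

definition conv_in_prob :: "(nat \<Rightarrow> 'a measure) \<Rightarrow> (nat \<Rightarrow> 'a \<Rightarrow> real) \<Rightarrow> real \<Rightarrow> bool" where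
  "conv_in_prob M Z c \<longleftrightarrow>
     (\<forall>\<delta>>0. (\<lambda>p. measure (M p) {\<omega> \<in> space (M p). \<bar>Z p \<omega> - c\<bar> > \<delta>}) \<longlonglongrightarrow> 0)"

section \<open>The mean-field objective\<close>

abbreviation mean_box :: "real measure \<Rightarrow> nat \<Rightarrow> (nat \<Rightarrow> real) set" where
  "mean_box \<mu> p \<equiv> PiE {..<p} (\<lambda>_. mean_range \<mu>)"

text \<open>
  The library's \<^term>\<open>KL_divergence b M N\<close> is the divergence of \<open>N\<close> from \<open>M\<close>, i.e.
  \<open>D(N \<parallel> M)\<close>, with logarithms to base \<open>b\<close>.
\<close>

definition mf_objective ::
    "real \<Rightarrow> real mat \<Rightarrow> real measure \<Rightarrow> (nat \<Rightarrow> real) \<Rightarrow> (nat \<Rightarrow> real) \<Rightarrow> real" where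
  "mf_objective \<sigma> X \<mu> v u =
     - (1 / 2) * (\<Sum>i<dim_col X. \<Sum>j<dim_col X. u i * offdiag \<sigma> X $$ (i, j) * u j)
     + (\<Sum>i<dim_col X. u i * v i)
     - (\<Sum>i<dim_col X. KL_divergence (exp 1)
          (tilt \<mu> 0 (diag_coeff \<sigma> X i))
          (tilt \<mu> (tilt_param \<mu> (diag_coeff \<sigma> X i) (u i)) (diag_coeff \<sigma> X i)))"

text \<open>
  The suprema are taken in \<^typ>\<open>ereal\<close>, so that the supremum over the empty set is \<open>-\<infinity>\<close>
  (the set of far-away points is empty once \<open>\<delta>\<close> is large).
\<close>

definition well_separated_optimizer :: "real \<Rightarrow> (nat \<Rightarrow> real mat) \<Rightarrow> real measure \<Rightarrow> bool" where
  "well_separated_optimizer \<sigma> X \<mu> \<longleftrightarrow>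
     (\<exists>us. (\<forall>p>0. us p \<in> joint_law \<sigma> (X p) \<mu> \<rightarrow>\<^sub>M vec_space p \<and>
               (\<forall>\<omega>\<in>space (joint_law \<sigma> (X p) \<mu>). us p \<omega> \<in> mean_box \<mu> p)) \<and>
       (\<forall>\<delta>>0. \<exists>\<epsilon>>0.
          (\<lambda>p. measure (joint_law \<sigma> (X p) \<mu>)
             {\<omega> \<in> space (joint_law \<sigma> (X p) \<mu>).
                (SUP u \<in> {u \<in> mean_box \<mu> p. (\<Sum>i<p. (u i - us p \<omega> i)\<^sup>2) > real p * \<delta>}.
                   ereal (mf_objective \<sigma> (X p) \<mu> (score \<sigma> (X p) (fst \<omega>)) u))
                < (SUP u \<in> mean_box \<mu> p.
                   ereal (mf_objective \<sigma> (X p) \<mu> (score \<sigma> (X p) (fst \<omega>)) u))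
                  - ereal (real p * \<epsilon>)})
          \<longlonglongrightarrow> 1))"

section \<open>Product approximation of the posterior\<close>

text \<open>
  Here \<open>u\<close> is the optimizer as a function of \<open>y\<close>, and \<^term>\<open>mf_marginal \<sigma> X \<mu> u y i\<close> is the
  \<open>i\<close>-th tilted prior at \<open>\<tau>\<^sub>i\<close>, the tilting parameter whose tilted mean is \<open>u\<^sub>i\<close>.
\<close>

definition mf_marginal :: "real \<Rightarrow> real mat \<Rightarrow> real measure \<Rightarrow>
    ((nat \<Rightarrow> real) \<Rightarrow> nat \<Rightarrow> real) \<Rightarrow> (nat \<Rightarrow> real) \<Rightarrow> nat \<Rightarrow> real measure" where
  "mf_marginal \<sigma> X \<mu> u y i =
     tilt \<mu> (tilt_param \<mu> (diag_coeff \<sigma> X i) (u y i)) (diag_coeff \<sigma> X i)"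

definition mf_mean :: "real \<Rightarrow> real mat \<Rightarrow> real measure \<Rightarrow>
    ((nat \<Rightarrow> real) \<Rightarrow> nat \<Rightarrow> real) \<Rightarrow> (nat \<Rightarrow> real) \<Rightarrow> nat \<Rightarrow> real" where
  "mf_mean \<sigma> X \<mu> u y i = (\<integral>b. b \<partial>mf_marginal \<sigma> X \<mu> u y i)"

definition credible_interval :: "real \<Rightarrow> real mat \<Rightarrow> real measure \<Rightarrow>
    ((nat \<Rightarrow> real) \<Rightarrow> nat \<Rightarrow> real) \<Rightarrow> real \<Rightarrow> real \<Rightarrow> (nat \<Rightarrow> real) \<Rightarrow> nat \<Rightarrow> real set" where
  "credible_interval \<sigma> X \<mu> u \<alpha> \<epsilon> y i =
     {quantile (mf_marginal \<sigma> X \<mu> u y i) (\<alpha> / 2) - \<epsilon> <..<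
      quantile (mf_marginal \<sigma> X \<mu> u y i) (1 - \<alpha> / 2) + \<epsilon>}"

abbreviation cube :: "nat \<Rightarrow> (nat \<Rightarrow> real) set" where
  "cube L \<equiv> PiE {..<L} (\<lambda>_. {-1..1})"

definition test_function :: "nat \<Rightarrow> ((nat \<Rightarrow> real) \<Rightarrow> real) \<Rightarrow> bool" where
  "test_function L f \<longleftrightarrow>
     (\<forall>s\<in>cube L. \<forall>t\<in>cube L. \<bar>f s - f t\<bar> \<le> (\<Sum>l<L. \<bar>s l - t l\<bar>)) \<and>
     (\<forall>s\<in>cube L. \<bar>f s\<bar> \<le> 1)"

text \<open>
  Test functions are functions on \<^term>\<open>cube L\<close>, hence the indicators below: a HOL function also
  has arbitrary, possibly non-measurable, values off the cube. All laws involved are concentrated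
  on the cube. In \<open>replica_average\<close>, \<open>b l i\<close> is the \<open>i\<close>-th coordinate of the \<open>l\<close>-th sample.
\<close>

definition replica_average ::
    "nat \<Rightarrow> nat \<Rightarrow> (nat \<Rightarrow> (nat \<Rightarrow> real) \<Rightarrow> real) \<Rightarrow> (nat \<Rightarrow> nat \<Rightarrow> real) \<Rightarrow> real" where
  "replica_average p L f b =
     (\<Sum>i<p. indicat_real (cube L) (\<lambda>l\<in>{..<L}. b l i) * f i (\<lambda>l\<in>{..<L}. b l i)) / real p"

definition mf_average ::
    "nat \<Rightarrow> nat \<Rightarrow> (nat \<Rightarrow> (nat \<Rightarrow> real) \<Rightarrow> real) \<Rightarrow> (nat \<Rightarrow> real measure) \<Rightarrow> real" where
  "mf_average p L f Q =
     (\<Sum>i<p. \<integral>z. indicat_real (cube L) z * f i z \<partial>Pi\<^sub>M {..<L} (\<lambda>_. Q i)) / real p"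

end

theory Submission
  imports Defs
begin

text \<open>
  The posterior is a Gibbs measure \<open>e\<^sup>H d\<mu>*\<^sup>p\<close> on the cube, with a quadratic energy \<open>H\<close> whose
  coupling matrix \<open>A\<close> has bounded operator norm and \<open>Tr(A\<^sup>2) = o(p)\<close>. Revealing a suitable set
  \<open>S\<close> of at most \<open>p / \<eta>\<close> coordinates makes the conditional covariances small on average, namely
  \<open>\<Sum>\<^sub>i\<^sub>j Cov(\<beta>\<^sub>i, \<beta>\<^sub>j | \<beta>\<^sub>S)\<^sup>2 \<le> \<eta>p\<close> in mean, and paired with \<open>A\<close> these covariances contribute only
  \<open>\<surd>(Tr(A\<^sup>2) \<eta>p) = o(p)\<close>. So, given \<open>\<beta>\<^sub>S\<close>, the posterior is within relative entropy \<open>o(p)\<close> of the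
  product of the tilts of \<open>\<mu>*\<close> whose means are the conditional means, and these conditional means
  nearly maximise the mean-field objective. By separation they are then close to \<open>u*\<close>, and so is the
  optimizer \<open>u\<close> for \<open>\<mu>\<^sup>(\<^sup>p\<^sup>)\<close>, since tilted means are continuous in the prior. The Donsker--Varadhan
  inequality turns the entropy bound into closeness of \<open>\<Sum>\<^sub>i g\<^sub>i(\<beta>\<^sub>i)\<close> to its mean under the product of
  the tilts of \<open>\<mu>\<^sup>(\<^sup>p\<^sup>)\<close> at \<open>\<tau>\<^sub>i\<close>, for all bounded Lipschitz \<open>g\<^sub>i\<close>. All three claims are instances:
  replicas are exchanged one at a time for (i), \<open>g\<^sub>i\<close> is a trapezoid over the credible interval for
  (ii), and \<open>g\<^sub>i\<close> is the identity up to sign for (iii).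
\<close>

section \<open>Laws on \<open>[-1, 1]\<close> and their tilts\<close>

text \<open>Weak convergence compares the tilts of the two priors only for bounded tilting
  parameters, whereas no parameter is bounded a priori. A competitor is therefore clamped to
  parameters in \<open>[-T, T]\<close>, which moves its means little because the tilted means at
  \<open>T\<close> and \<open>-T\<close> are already near the ends of the support. The optimizer is
  not clamped: stationarity expresses its parameters as \<open>w - A u\<close>, so their squares sum
  to \<open>O(p)\<close> and few exceed \<open>T\<close>. Points pass from one prior to the other
  with their parameters kept, not their means, because the ranges of means differ.

  The constant \<open>\<eta>\<close> in the pinning step is large, not small: few coordinates are
  revealed, the remaining covariances are only of order \<open>\<eta> * p\<close>, and the smallness
  comes from the trace of \<open>A\<close> squared, since \<open>A\<close> tends to 0 per coordinate
  after \<open>\<eta>\<close> is fixed.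

  The estimates are inequalities at fixed \<open>p\<close> and fixed \<open>y\<close>. The limit is
  taken only at the end, where all constants are chosen from one tolerance \<open>b\<close>, which
  bounds both the error per coordinate and the probability of the exceptional event.\<close>

locale interval_law = real_distribution \<mu> for \<mu> +
  assumes mass: "measure \<mu> {-1..1} = 1"

lemma interval_law_iff: "interval_law \<mu> \<longleftrightarrow> \<mu> \<in> prob_on_interval"
  by (auto simp: prob_on_interval_def interval_law_def interval_law_axioms_def)

context interval_law
begin

lemma AE_interval: "AE b in \<mu>. \<bar>b\<bar> \<le> 1"
proof -
  have "AE b in \<mu>. b \<in> {-1..1}"
    using mass prob_eq_1[of "{-1..1}"] by simp
  then show ?thesis by eventually_elim auto
qed

lemma integrable_interval:
  assumes [measurable]: "f \<in> borel_measurable borel" and "\<And>b. \<bar>b\<bar> \<le> 1 \<Longrightarrow> \<bar>f b\<bar> \<le> (B::real)"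
  shows "integrable \<mu> f"
  by (rule integrable_const_bound[where B=B]) (use AE_interval in eventually_elim, use assms in auto)

lemma prob_UNIV [simp]: "measure \<mu> UNIV = 1"
  using prob_space by simp

lemma integral_mono_interval:
  assumes "integrable \<mu> f" "integrable \<mu> g" "\<And>b. \<bar>b\<bar> \<le> 1 \<Longrightarrow> f b \<le> (g b :: real)"
  shows "(\<integral>b. f b \<partial>\<mu>) \<le> (\<integral>b. g b \<partial>\<mu>)"
  using assms AE_interval by (intro integral_mono_AE) auto

lemma integral_ge_const:
  assumes "integrable \<mu> f" "\<And>b. \<bar>b\<bar> \<le> 1 \<Longrightarrow> c \<le> (f b :: real)"
  shows "c \<le> (\<integral>b. f b \<partial>\<mu>)"
  using integral_mono_interval[of "\<lambda>_. c" f] assms by (simp add: prob_space)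

lemma integral_le_const:
  assumes "integrable \<mu> f" "\<And>b. \<bar>b\<bar> \<le> 1 \<Longrightarrow> (f b :: real) \<le> c"
  shows "(\<integral>b. f b \<partial>\<mu>) \<le> c"
  using integral_mono_interval[of f "\<lambda>_. c"] assms by (simp add: prob_space)

lemma abs_integral_le:
  assumes "f \<in> borel_measurable borel" "\<And>b. \<bar>b\<bar> \<le> 1 \<Longrightarrow> \<bar>f b\<bar> \<le> (c::real)"
  shows "\<bar>\<integral>b. f b \<partial>\<mu>\<bar> \<le> c"
proof -
  have i: "integrable \<mu> f" using integrable_interval assms by blast
  have "f b \<le> c \<and> - c \<le> f b" if "\<bar>b\<bar> \<le> 1" for b using assms(2)[OF that] by linarith
  then show ?thesis
    using integral_le_const[OF i, of c] integral_ge_const[OF i, of "-c"] by (simp add: abs_le_iff)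
qed

lemma weight_bounds:
  fixes b :: real
  assumes "\<bar>b\<bar> \<le> 1"
  shows "exp (- \<bar>\<gamma>\<bar> - \<bar>d\<bar>) \<le> exp (\<gamma> * b - d / 2 * b\<^sup>2)"
    "exp (\<gamma> * b - d / 2 * b\<^sup>2) \<le> exp (\<bar>\<gamma>\<bar> + \<bar>d\<bar>)"
proof -
  have "\<bar>\<gamma> * b\<bar> \<le> \<bar>\<gamma>\<bar>" using assms by (simp add: abs_mult mult_left_le)
  moreover have "\<bar>d / 2 * b\<^sup>2\<bar> \<le> \<bar>d\<bar>"
  proof -
    have "b\<^sup>2 \<le> 1" using assms by (simp add: abs_square_le_1)
    then have "\<bar>d\<bar> * b\<^sup>2 \<le> \<bar>d\<bar>" by (simp add: mult_left_le)
    moreover have "0 \<le> \<bar>d\<bar>" by simp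
    ultimately show ?thesis by (simp add: abs_mult)
  qed
  ultimately show "exp (- \<bar>\<gamma>\<bar> - \<bar>d\<bar>) \<le> exp (\<gamma> * b - d / 2 * b\<^sup>2)"
    "exp (\<gamma> * b - d / 2 * b\<^sup>2) \<le> exp (\<bar>\<gamma>\<bar> + \<bar>d\<bar>)" by (auto simp: abs_le_iff)
qed

lemma integrable_weight:
  assumes [measurable]: "f \<in> borel_measurable borel" and B: "\<And>b. \<bar>b\<bar> \<le> 1 \<Longrightarrow> \<bar>f b\<bar> \<le> (B::real)"
  shows "integrable \<mu> (\<lambda>b. f b * exp (\<gamma> * b - d / 2 * b\<^sup>2))"
proof (rule integrable_interval[where B="B * exp (\<bar>\<gamma>\<bar> + \<bar>d\<bar>)"])
  fix b :: real assume b: "\<bar>b\<bar> \<le> 1"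
  show "\<bar>f b * exp (\<gamma> * b - d / 2 * b\<^sup>2)\<bar> \<le> B * exp (\<bar>\<gamma>\<bar> + \<bar>d\<bar>)"
    unfolding abs_mult using B[OF b] weight_bounds(2)[OF b, of \<gamma> d] by (intro mult_mono) auto
qed simp

lemma partition_ge: "exp (- \<bar>\<gamma>\<bar> - \<bar>d\<bar>) \<le> (\<integral>b. exp (\<gamma> * b - d / 2 * b\<^sup>2) \<partial>\<mu>)"
  using integrable_weight[of "\<lambda>_. 1" 1 \<gamma> d] weight_bounds(1) by (intro integral_ge_const) auto

lemma partition_pos: "0 < (\<integral>b. exp (\<gamma> * b - d / 2 * b\<^sup>2) \<partial>\<mu>)"
  using partition_ge[of \<gamma> d] by (meson exp_gt_zero less_le_trans)

lemma exp_log_mgf: "exp (log_mgf \<mu> \<gamma> d) = (\<integral>b. exp (\<gamma> * b - d / 2 * b\<^sup>2) \<partial>\<mu>)"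
  unfolding log_mgf_def using partition_pos by simp

lemma integral_tilt:
  assumes [measurable]: "f \<in> borel_measurable borel"
  shows "(\<integral>b. f b \<partial>tilt \<mu> \<gamma> d) = (\<integral>b. f b * exp (\<gamma> * b - d / 2 * b\<^sup>2 - log_mgf \<mu> \<gamma> d) \<partial>\<mu>)"
  unfolding tilt_def by (subst integral_real_density) (auto simp: mult.commute)

lemma integral_tilt_quotient:
  assumes [measurable]: "f \<in> borel_measurable borel"
  shows "(\<integral>b. f b \<partial>tilt \<mu> \<gamma> d) =
    (\<integral>b. f b * exp (\<gamma> * b - d / 2 * b\<^sup>2) \<partial>\<mu>) / (\<integral>b. exp (\<gamma> * b - d / 2 * b\<^sup>2) \<partial>\<mu>)"
  unfolding integral_tilt[OF assms] exp_diff[of _ "log_mgf \<mu> \<gamma> d"] exp_log_mgf by simp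

text \<open>The tilting density is positive everywhere, so a law and its tilts share their null
  sets. Non-degeneracy and the bounds of the support therefore pass to tilts.\<close>

lemma tilt_AE_iff: "(AE b in tilt \<mu> \<gamma> d. P b) \<longleftrightarrow> (AE b in \<mu>. P b)"
  unfolding tilt_def by (subst AE_density) auto

lemma interval_law_tilt: "interval_law (tilt \<mu> \<gamma> d)"
proof -
  have 1: "(\<integral>b. exp (\<gamma> * b - d / 2 * b\<^sup>2 - log_mgf \<mu> \<gamma> d) \<partial>\<mu>) = 1"
    unfolding exp_diff[of _ "log_mgf \<mu> \<gamma> d"] exp_log_mgf using partition_pos[of \<gamma> d] by simp
  have i: "integrable \<mu> (\<lambda>b. exp (\<gamma> * b - d / 2 * b\<^sup>2 - log_mgf \<mu> \<gamma> d))"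
    unfolding exp_diff[of _ "log_mgf \<mu> \<gamma> d"]
    using integrable_weight[of "\<lambda>_. 1 / exp (log_mgf \<mu> \<gamma> d)" "1 / exp (log_mgf \<mu> \<gamma> d)" \<gamma> d] by simp
  have "emeasure (tilt \<mu> \<gamma> d) (space (tilt \<mu> \<gamma> d)) = 1"
    unfolding tilt_def using nn_integral_eq_integral[OF i] 1 by (simp add: emeasure_density)
  then interpret t: prob_space "tilt \<mu> \<gamma> d" by (rule prob_spaceI)
  interpret t: real_distribution "tilt \<mu> \<gamma> d"
    by standard (auto simp: tilt_def)
  have "AE b in tilt \<mu> \<gamma> d. b \<in> {-1..1}"
    unfolding tilt_AE_iff using AE_interval by eventually_elim auto
  then have "measure (tilt \<mu> \<gamma> d) {-1..1} = 1"
    using t.prob_eq_1[of "{-1..1}"] by simp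
  then show ?thesis by (intro interval_law.intro t.real_distribution_axioms interval_law_axioms.intro)
qed

text \<open>Tilts compose by adding parameters. Statements at an arbitrary parameter thereby reduce
  to statements at the origin for another law on the interval; derivative and convexity are obtained
  this way.\<close>

lemma log_mgf_tilt: "log_mgf (tilt \<mu> \<gamma> d) s e = log_mgf \<mu> (\<gamma> + s) (d + e) - log_mgf \<mu> \<gamma> d"
proof -
  have *: "s * b - e / 2 * b\<^sup>2 + (\<gamma> * b - d / 2 * b\<^sup>2 - c)
      = (\<gamma> + s) * b - (d + e) / 2 * b\<^sup>2 + - c" for b c :: real
    by (simp add: field_simps)
  have "(\<integral>b. exp (s * b - e / 2 * b\<^sup>2) \<partial>tilt \<mu> \<gamma> d) =
    (\<integral>b. exp ((\<gamma> + s) * b - (d + e) / 2 * b\<^sup>2) * exp (- log_mgf \<mu> \<gamma> d) \<partial>\<mu>)"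
    by (subst integral_tilt) (simp_all only: exp_add[symmetric] *, measurable)
  also have "\<dots> = exp (log_mgf \<mu> (\<gamma> + s) (d + e)) * exp (- log_mgf \<mu> \<gamma> d)"
    by (simp only: integral_mult_left_zero exp_log_mgf)
  also have "\<dots> = exp (log_mgf \<mu> (\<gamma> + s) (d + e) - log_mgf \<mu> \<gamma> d)"
    by (simp flip: exp_add)
  finally show ?thesis unfolding log_mgf_def[of "tilt \<mu> \<gamma> d"] by simp
qed

lemma integral_tilt_tilt:
  fixes f :: "real \<Rightarrow> real"
  assumes [measurable]: "f \<in> borel_measurable borel"
  shows "(\<integral>b. f b \<partial>tilt (tilt \<mu> \<gamma> d) s e) = (\<integral>b. f b \<partial>tilt \<mu> (\<gamma> + s) (d + e))"
proof -
  interpret t: interval_law "tilt \<mu> \<gamma> d" by (rule interval_law_tilt)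
  have *: "s * b - e / 2 * b\<^sup>2 - (c' - c) + (\<gamma> * b - d / 2 * b\<^sup>2 - c)
      = (\<gamma> + s) * b - (d + e) / 2 * b\<^sup>2 - c'" for b c c' :: real
    by (simp add: field_simps)
  have "(\<integral>b. f b \<partial>tilt (tilt \<mu> \<gamma> d) s e) = (\<integral>b. f b * exp (s * b - e / 2 * b\<^sup>2 - log_mgf (tilt \<mu> \<gamma> d) s e) \<partial>tilt \<mu> \<gamma> d)"
    by (rule t.integral_tilt) simp
  also have "\<dots> = (\<integral>b. f b * exp (s * b - e / 2 * b\<^sup>2 - log_mgf (tilt \<mu> \<gamma> d) s e)
       * exp (\<gamma> * b - d / 2 * b\<^sup>2 - log_mgf \<mu> \<gamma> d) \<partial>\<mu>)"
    by (rule integral_tilt) simp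
  also have "\<dots> = (\<integral>b. f b \<partial>tilt \<mu> (\<gamma> + s) (d + e))"
    by (simp only: integral_tilt[OF assms] mult.assoc exp_add[symmetric] log_mgf_tilt *)
  finally show ?thesis .
qed

section \<open>Jensen's inequality, derivative and convexity of the log-mgf\<close>

lemma mean_bounds: "\<bar>\<integral>b. b \<partial>\<mu>\<bar> \<le> 1"
  by (rule abs_integral_le) auto

lemma integrable_id: "integrable \<mu> (\<lambda>b. b)"
  by (rule integrable_interval[where B=1]) auto

lemma integrable_exp: "integrable \<mu> (\<lambda>b. exp (s * b))"
  using integrable_weight[of "\<lambda>_. 1" 1 s 0] by simp

text \<open>Jensen's inequality, by integrating the tangent of \<open>exp\<close> at
  \<open>s\<close> times the mean.\<close>

lemma log_mgf_ge_mean: "s * (\<integral>b. b \<partial>\<mu>) \<le> log_mgf \<mu> s 0"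
proof -
  let ?m = "\<integral>b. b \<partial>\<mu>"
  have "exp (s * ?m) * (1 + (s * ?m - s * ?m)) \<le> (\<integral>b. exp (s * b) \<partial>\<mu>)"
  proof -
    have "exp (s * ?m) * (1 + (s * b - s * ?m)) \<le> exp (s * b)" for b
    proof -
      have "exp (s * ?m) * (1 + (s * b - s * ?m)) \<le> exp (s * ?m) * exp (s * b - s * ?m)"
        by (intro mult_left_mono exp_ge_add_one_self) auto
      then show ?thesis by (simp flip: exp_add)
    qed
    then have "(\<integral>b. exp (s * ?m) * (1 + (s * b - s * ?m)) \<partial>\<mu>) \<le> (\<integral>b. exp (s * b) \<partial>\<mu>)"
      using integrable_id integrable_exp by (intro integral_mono_interval) auto
    also have "(\<integral>b. exp (s * ?m) * (1 + (s * b - s * ?m)) \<partial>\<mu>) = exp (s * ?m) * (1 + (s * ?m - s * ?m))"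
      using integrable_id prob_space by simp
    finally show ?thesis .
  qed
  then have "exp (s * ?m) \<le> exp (log_mgf \<mu> s 0)" by (simp add: exp_log_mgf)
  then show ?thesis by simp
qed

lemma return_if_AE: "AE b in \<mu>. b = a \<Longrightarrow> \<mu> = return borel a"
proof (rule measure_eqI)
  fix A assume ae: "AE b in \<mu>. b = a" and A: "A \<in> sets \<mu>"
  then have "emeasure \<mu> A = (\<integral>\<^sup>+b. indicator A a \<partial>\<mu>)"
    unfolding nn_integral_indicator[OF A, symmetric] by (intro nn_integral_cong_AE) auto
  then show "emeasure \<mu> A = emeasure (return borel a) A"
    using A emeasure_space_1 by simp
qed simp

text \<open>Equality would make the nonnegative gap \<open>?g\<close> between \<open>exp\<close> and
  its tangent vanish almost everywhere. It vanishes only at the point of tangency, so the law would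
  be a point mass.\<close>

lemma log_mgf_gt_mean:
  assumes "nondegenerate \<mu>" "s \<noteq> 0"
  shows "s * (\<integral>b. b \<partial>\<mu>) < log_mgf \<mu> s 0"
proof (rule ccontr)
  let ?m = "\<integral>b. b \<partial>\<mu>"
  let ?g = "\<lambda>b. exp (s * b - s * ?m) - 1 - (s * b - s * ?m)"
  assume "\<not> ?thesis"
  then have "log_mgf \<mu> s 0 = s * ?m" using log_mgf_ge_mean[of s] by simp
  then have e: "(\<integral>b. exp (s * b) \<partial>\<mu>) = exp (s * ?m)" using exp_log_mgf[of s 0] by simp
  have gg: "0 \<le> ?g b" for b using exp_ge_add_one_self[of "s * b - s * ?m"] by argo
  have i: "integrable \<mu> ?g" using integrable_id integrable_exp by (simp add: exp_diff)
  have "integral\<^sup>L \<mu> ?g = 0"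
    using integrable_id integrable_exp prob_space by (simp add: exp_diff e)
  then have "AE b in \<mu>. ?g b = 0"
    by (subst (asm) integral_nonneg_eq_0_iff_AE[OF i]) (rule AE_I2, rule gg, simp)
  then have "AE b in \<mu>. b = ?m"
  proof eventually_elim
    fix b assume g: "?g b = 0"
    have "ln (exp (s * b - s * ?m)) = exp (s * b - s * ?m) - 1" using g by simp
    then have "exp (s * b - s * ?m) = 1" by (intro ln_eq_minus_one) auto
    then have "s * b - s * ?m = 0" by (simp only: exp_eq_one_iff)
    then show "b = ?m" using assms(2) by simp
  qed
  then show False using return_if_AE assms(1) unfolding nondegenerate_def by blast
qed

lemma nondegenerate_tilt:
  assumes "nondegenerate \<mu>" shows "nondegenerate (tilt \<mu> \<gamma> d)"
  unfolding nondegenerate_def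
proof (intro allI notI)
  fix a assume t: "tilt \<mu> \<gamma> d = return borel a"
  have "AE b in return borel a. b = a" by (subst AE_return) auto
  then have "AE b in \<mu>. b = a" unfolding t[symmetric] tilt_AE_iff .
  then show False using return_if_AE assms unfolding nondegenerate_def by blast
qed



lemma exp_quadratic_bound:
  assumes "\<bar>x\<bar> \<le> (1::real)"
  shows "\<bar>exp x - 1 - x\<bar> \<le> x\<^sup>2"
proof -
  have "exp x \<le> 1 + x + x\<^sup>2"
  proof (cases "0 \<le> x")
    case True
    then show ?thesis using exp_bound[of x] assms by simp
  next
    case False
    then have "exp x \<le> 1 / (1 - x)"
      using exp_ge_add_one_self[of "-x"] by (simp add: exp_minus field_simps)
    \<comment> \<open>Multiply by \<open>1 - x\<close>: the product
      \<open>(1 + x + x^2) * (1 - x)\<close> is \<open>1 - x^3\<close>, at least 1 for negative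
      \<open>x\<close>.\<close>
    also have "\<dots> \<le> 1 + x + x\<^sup>2"
    proof -
      have "x\<^sup>2 * x \<le> 0" using False by (simp add: mult_nonneg_nonpos)
      then show ?thesis using False by (simp add: field_simps power2_eq_square)
    qed
    finally show ?thesis .
  qed
  moreover have "- (x\<^sup>2) \<le> exp x - 1 - x" using exp_ge_add_one_self[of x] zero_le_power2[of x] by linarith
  ultimately show ?thesis by (simp add: abs_le_iff)
qed

text \<open>The quadratic bound on \<open>exp (s * b) - 1 - s * b\<close>, uniform over the
  interval, takes the place of differentiation under the integral.\<close>

lemma log_mgf_deriv_0: "((\<lambda>s. log_mgf \<mu> s 0) has_real_derivative (\<integral>b. b \<partial>\<mu>)) (at 0)"
proof -
  let ?m = "\<integral>b. b \<partial>\<mu>" and ?F = "\<lambda>s. \<integral>b. exp (s * b) \<partial>\<mu>"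
  have bd: "\<bar>?F s - 1 - s * ?m\<bar> \<le> s\<^sup>2" if s: "\<bar>s\<bar> \<le> 1" for s
  proof -
    have "\<bar>\<integral>b. exp (s * b) - 1 - s * b \<partial>\<mu>\<bar> \<le> s\<^sup>2"
    proof (rule abs_integral_le)
      fix b :: real assume b: "\<bar>b\<bar> \<le> 1"
      have "\<bar>s * b\<bar> \<le> 1 * 1" unfolding abs_mult using s b by (intro mult_mono) auto
      then have "\<bar>exp (s * b) - 1 - s * b\<bar> \<le> (s * b)\<^sup>2"
        using exp_quadratic_bound[of "s * b"] by simp
      also have "\<dots> \<le> s\<^sup>2 * 1" unfolding power_mult_distrib using b
        by (intro mult_left_mono) (auto simp: abs_square_le_1)
      finally show "\<bar>exp (s * b) - 1 - s * b\<bar> \<le> s\<^sup>2" by simp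
    qed simp
    then show ?thesis using integrable_exp integrable_id by simp
  qed
  have "((\<lambda>s. (?F s - 1) / s - ?m) \<longlongrightarrow> 0) (at 0)"
  proof (rule Lim_null_comparison)
    show "eventually (\<lambda>s. norm ((?F s - 1) / s - ?m) \<le> \<bar>s\<bar>) (at 0)"
      unfolding eventually_at
    proof (intro exI[of _ 1] conjI ballI impI)
      fix s :: real assume "s \<noteq> 0 \<and> dist s 0 < 1"
      then have s: "s \<noteq> 0" "\<bar>s\<bar> \<le> 1" by auto
      have "norm ((?F s - 1) / s - ?m) = \<bar>?F s - 1 - s * ?m\<bar> / \<bar>s\<bar>"
        using s by (simp add: diff_divide_distrib flip: abs_divide)
      also have "\<dots> \<le> s\<^sup>2 / \<bar>s\<bar>" using bd[OF s(2)] by (intro divide_right_mono) auto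
      also have "\<dots> = \<bar>s\<bar>" by (simp add: power2_eq_square abs_if)
      finally show "norm ((?F s - 1) / s - ?m) \<le> \<bar>s\<bar>" .
    qed simp
    show "((\<lambda>s. \<bar>s\<bar>) \<longlongrightarrow> (0::real)) (at 0)" by (rule tendsto_eq_intros | simp)+
  qed
  then have "(?F has_real_derivative ?m) (at 0)"
    unfolding has_field_derivative_iff by (subst LIM_zero_iff[symmetric]) simp
  then have "((\<lambda>s. ln (?F s)) has_real_derivative (1 / ?F 0 * ?m)) (at 0)"
    by (intro DERIV_chain2[where f=ln and g="?F"] DERIV_ln_divide) auto
  then show ?thesis by (simp add: log_mgf_def)
qed

text \<open>This is the derivative at 0 for the law already tilted at \<open>\<gamma>\<close>,
  because its log-mgf is a translate.\<close>

lemma log_mgf_deriv: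
  "((\<lambda>\<gamma>'. log_mgf \<mu> \<gamma>' d) has_real_derivative (\<integral>b. b \<partial>tilt \<mu> \<gamma> d)) (at \<gamma>)"
proof -
  interpret t: interval_law "tilt \<mu> \<gamma> d" by (rule interval_law_tilt)
  have "((\<lambda>s. log_mgf \<mu> (\<gamma> + s) d - log_mgf \<mu> \<gamma> d) has_real_derivative (\<integral>b. b \<partial>tilt \<mu> \<gamma> d)) (at 0)"
    using t.log_mgf_deriv_0 by (simp add: log_mgf_tilt)
  from DERIV_add[OF this DERIV_const[of "log_mgf \<mu> \<gamma> d"]]
  have "((\<lambda>s. log_mgf \<mu> (s + \<gamma>) d) has_real_derivative (\<integral>b. b \<partial>tilt \<mu> \<gamma> d)) (at 0)"
    by (simp add: add.commute)
  then show ?thesis using DERIV_shift[of "\<lambda>\<gamma>'. log_mgf \<mu> \<gamma>' d" _ 0 \<gamma>] by simp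
qed

lemma tilt_mean_eq: "tilt_mean \<mu> \<gamma> d = (\<integral>b. b \<partial>tilt \<mu> \<gamma> d)"
  unfolding tilt_mean_def using log_mgf_deriv by (rule DERIV_imp_deriv)

lemma abs_tilt_mean_le: "\<bar>tilt_mean \<mu> \<gamma> d\<bar> \<le> 1"
proof -
  interpret t: interval_law "tilt \<mu> \<gamma> d" by (rule interval_law_tilt)
  show ?thesis using t.mean_bounds by (simp add: tilt_mean_eq)
qed

text \<open>The supporting line at \<open>\<tau>\<close> is Jensen's inequality for the law tilted
  at \<open>\<tau>\<close>.\<close>

lemma log_mgf_convex: "log_mgf \<mu> \<tau> d + (a - \<tau>) * tilt_mean \<mu> \<tau> d \<le> log_mgf \<mu> a d"
proof -
  interpret t: interval_law "tilt \<mu> \<tau> d" by (rule interval_law_tilt)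
  show ?thesis using t.log_mgf_ge_mean[of "a - \<tau>"] by (simp add: tilt_mean_eq log_mgf_tilt)
qed

lemma log_mgf_strictly_convex:
  assumes "nondegenerate \<mu>" "a \<noteq> \<tau>"
  shows "log_mgf \<mu> \<tau> d + (a - \<tau>) * tilt_mean \<mu> \<tau> d < log_mgf \<mu> a d"
proof -
  interpret t: interval_law "tilt \<mu> \<tau> d" by (rule interval_law_tilt)
  show ?thesis using t.log_mgf_gt_mean[of "a - \<tau>"] nondegenerate_tilt assms
    by (simp add: tilt_mean_eq log_mgf_tilt)
qed

text \<open>Adding the supporting lines at the two parameters leaves the product of the increments
  of parameter and mean.\<close>

lemma tilt_mean_mono: "\<tau> \<le> \<tau>' \<Longrightarrow> tilt_mean \<mu> \<tau> d \<le> tilt_mean \<mu> \<tau>' d"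
proof (cases "\<tau> = \<tau>'")
  case False
  assume "\<tau> \<le> \<tau>'"
  have "(\<tau>' - \<tau>) * (tilt_mean \<mu> \<tau> d - tilt_mean \<mu> \<tau>' d) \<le> 0"
    using log_mgf_convex[of \<tau> d \<tau>'] log_mgf_convex[of \<tau>' d \<tau>] by (simp add: algebra_simps)
  then show ?thesis using False \<open>\<tau> \<le> \<tau>'\<close> by (simp add: mult_le_0_iff)
qed simp

lemma tilt_mean_strict_mono:
  assumes "nondegenerate \<mu>" shows "strict_mono (\<lambda>\<tau>. tilt_mean \<mu> \<tau> d)"
proof (rule strict_monoI)
  fix \<tau> \<tau>' :: real assume "\<tau> < \<tau>'"
  have "(\<tau>' - \<tau>) * (tilt_mean \<mu> \<tau> d - tilt_mean \<mu> \<tau>' d) < 0"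
    using log_mgf_strictly_convex[OF assms, of \<tau>' \<tau> d] log_mgf_strictly_convex[OF assms, of \<tau> \<tau>' d] \<open>\<tau> < \<tau>'\<close>
    by (simp add: algebra_simps)
  then show "tilt_mean \<mu> \<tau> d < tilt_mean \<mu> \<tau>' d" using \<open>\<tau> < \<tau>'\<close> by (simp add: mult_less_0_iff)
qed

end

text \<open>The relative entropy of the tilt at \<open>\<tau>\<close> from the tilt at 0 (see
  \<open>KL_tilt\<close>). As a function of the parameter it can be compared for different priors
  and needs no inverse of the mean map.\<close>

definition tilt_div :: "real measure \<Rightarrow> real \<Rightarrow> real \<Rightarrow> real" where
  "tilt_div \<mu> \<tau> d = \<tau> * tilt_mean \<mu> \<tau> d - log_mgf \<mu> \<tau> d + log_mgf \<mu> 0 d"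

section \<open>Support, range of the tilted means, relative entropy of tilts\<close>

context interval_law
begin

text \<open>A point outside the support has a null neighbourhood, hence lies in a null interval with
  rational endpoints, and there are only countably many of these.\<close>

lemma AE_supp: "AE b in \<mu>. b \<in> supp \<mu>"
proof -
  let ?N = "{(q, r). q \<in> \<rat> \<and> r \<in> \<rat> \<and> emeasure \<mu> {q<..<r} = 0}"
  have "countable ?N"
    by (rule countable_subset[of _ "\<rat> \<times> \<rat>"]) (auto simp: countable_rat)
  then have "AE b in \<mu>. \<forall>x\<in>?N. b \<notin> {fst x<..<snd x}"
  proof (subst AE_ball_countable, assumption, intro ballI)
    fix x assume "x \<in> ?N"
    then have "{fst x<..<snd x} \<in> null_sets \<mu>" by auto
    then show "AE b in \<mu>. b \<notin> {fst x<..<snd x}" by (rule AE_not_in)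
  qed
  then show ?thesis
  proof eventually_elim
    fix b assume b: "\<forall>x\<in>?N. b \<notin> {fst x<..<snd x}"
    show "b \<in> supp \<mu>"
      unfolding supp_def
    proof (intro CollectI allI impI, rule ccontr)
      fix U :: "real set" assume U: "open U" "b \<in> U" "\<not> 0 < emeasure \<mu> U"
      then obtain e where e: "e > 0" "ball b e \<subseteq> U" by (meson openE)
      obtain q where q: "q \<in> \<rat>" "b - e < q" "q < b" using Rats_dense_in_real[of "b - e" b] e by auto
      obtain r where r: "r \<in> \<rat>" "b < r" "r < b + e" using Rats_dense_in_real[of b "b + e"] e by auto
      have "{q<..<r} \<subseteq> U" using e(2) q r by (auto simp: subset_iff dist_real_def)
      then have "emeasure \<mu> {q<..<r} \<le> emeasure \<mu> U" using U by (intro emeasure_mono) auto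
      then have "(q, r) \<in> ?N" using U q r by simp
      then show False using b q r by force
    qed
  qed
qed

lemma supp_subset: "supp \<mu> \<subseteq> {-1..1}"
proof (rule ccontr)
  assume "\<not> ?thesis"
  then obtain x where x: "x \<in> supp \<mu>" "x \<in> - {-1..1}" by blast
  have "0 < emeasure \<mu> (- {-1..1})" using x unfolding supp_def by blast
  moreover have "AE b in \<mu>. b \<notin> - {-1..1}" using AE_interval by eventually_elim auto
  ultimately show False by (subst (asm) AE_iff_measurable[OF _ refl]) (auto simp: Compl_eq Int_def)
qed

lemma supp_nonempty: "supp \<mu> \<noteq> {}"
proof
  assume "supp \<mu> = {}"
  then have "AE b in \<mu>. False" using AE_supp by simp
  then show False by simp
qed

lemma bdd_supp: "bdd_above (supp \<mu>)" "bdd_below (supp \<mu>)"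
  using supp_subset by (meson bdd_above_Icc bdd_above_mono, meson supp_subset bdd_below_Icc bdd_below_mono)

lemma AE_supp_bounds: "AE b in \<mu>. Inf (supp \<mu>) \<le> b \<and> b \<le> Sup (supp \<mu>)"
  using AE_supp by eventually_elim (auto intro: cInf_lower cSup_upper bdd_supp)

text \<open>Both tails have the shape \<open>x < s * b\<close> with a sign \<open>s\<close>, so that
  \<open>tilt_mean_tail\<close> treats the two ends at once.\<close>

lemma supp_tails:
  "x < Sup (supp \<mu>) \<Longrightarrow> 0 < measure \<mu> {b. x < 1 * b}"
  "Inf (supp \<mu>) < x \<Longrightarrow> 0 < measure \<mu> {b. - x < (- 1) * b}"
proof -
  assume "x < Sup (supp \<mu>)"
  then obtain y where y: "y \<in> supp \<mu>" "x < y" using less_cSup_iff[OF supp_nonempty bdd_supp(1)] by blast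
  have "open {x<..}" by simp
  then have "0 < emeasure \<mu> {x<..}" using y unfolding supp_def by blast
  then show "0 < measure \<mu> {b. x < 1 * b}" by (simp add: emeasure_eq_measure greaterThan_def)
next
  assume "Inf (supp \<mu>) < x"
  then obtain y where y: "y \<in> supp \<mu>" "y < x" using cInf_less_iff[OF supp_nonempty bdd_supp(2)] by blast
  have "open {..<x}" by simp
  then have "0 < emeasure \<mu> {..<x}" using y unfolding supp_def by blast
  then show "0 < measure \<mu> {b. - x < (- 1) * b}" by (simp add: emeasure_eq_measure lessThan_def)
qed

text \<open>A mean at an end of the interval would make \<open>\<nu>\<close> a point mass, and
  \<open>ac\<close> would pass this on to \<open>\<mu>\<close>. The law \<open>\<nu>\<close> is
  general because it will be a tilt and also the law of one coordinate under a pinned Gibbs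
  measure.\<close>

lemma integral_in_mean_range:
  assumes "nondegenerate \<mu>" "interval_law \<nu>" "AE b in \<nu>. Inf (supp \<mu>) \<le> b \<and> b \<le> Sup (supp \<mu>)"
    and ac: "\<And>k. (AE b in \<nu>. b = k) \<Longrightarrow> AE b in \<mu>. b = k"
  shows "(\<integral>b. b \<partial>\<nu>) \<in> mean_range \<mu>"
proof -
  interpret n: interval_law \<nu> by fact
  let ?a = "Inf (supp \<mu>)" and ?b = "Sup (supp \<mu>)" and ?m = "\<integral>b. b \<partial>\<nu>"
  have i: "integrable \<nu> (\<lambda>b. b)" by (rule n.integrable_id)
  have "(\<integral>b. ?a \<partial>\<nu>) \<le> ?m" "?m \<le> (\<integral>b. ?b \<partial>\<nu>)"
    using assms(3) by (auto intro!: integral_mono_AE i elim: eventually_mono simp del: n.prob_UNIV lebesgue_integral_const)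
  then have "?a \<le> ?m" "?m \<le> ?b" by simp_all
  moreover have False if m: "?m = ?a"
  proof -
    have "(\<integral>b. b - ?a \<partial>\<nu>) = 0" using m i by simp
    then have "AE b in \<nu>. b - ?a = 0"
      using i assms(3) by (subst (asm) integral_nonneg_eq_0_iff_AE) (auto elim: eventually_mono)
    then have "AE b in \<nu>. b = ?a" by eventually_elim simp
    then have "AE b in \<mu>. b = ?a" by (rule ac)
    then show False using return_if_AE assms(1) unfolding nondegenerate_def by blast
  qed
  moreover have False if m: "?m = ?b"
  proof -
    have "(\<integral>b. ?b - b \<partial>\<nu>) = 0" using m i by simp
    then have "AE b in \<nu>. ?b - b = 0"
      using i assms(3) by (subst (asm) integral_nonneg_eq_0_iff_AE) (auto elim: eventually_mono)
    then have "AE b in \<nu>. b = ?b" by eventually_elim simp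
    then have "AE b in \<mu>. b = ?b" by (rule ac)
    then show False using return_if_AE assms(1) unfolding nondegenerate_def by blast
  qed
  ultimately show ?thesis unfolding mean_range_def by (fastforce simp: less_le)
qed

lemma tilt_mean_in_mean_range: "nondegenerate \<mu> \<Longrightarrow> tilt_mean \<mu> \<tau> d \<in> mean_range \<mu>"
  unfolding tilt_mean_eq using AE_supp_bounds
  by (intro integral_in_mean_range interval_law_tilt) (auto simp: tilt_AE_iff)

text \<open>Convexity bounds the tilted mean at \<open>\<plusminus>T\<close> below by the slope \<open>(c(\<plusminus>T) - c(0)) / T\<close>, which
  tends to the extreme point of the support as \<open>T \<rightarrow> \<infinity>\<close>, uniformly for bounded \<open>d\<close>.\<close>

lemma tilt_mean_tail:
  assumes s: "s = 1 \<or> s = (-1::real)" and pos: "0 < measure \<mu> {b. x < s * b}"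
  obtains C where "\<And>T d. 0 < T \<Longrightarrow> 0 \<le> d \<Longrightarrow> d \<le> D \<Longrightarrow> x - C / T \<le> s * tilt_mean \<mu> (s * T) d"
proof
  let ?A = "{b. x < s * b}"
  fix T d :: real assume T: "0 < T" and d: "0 \<le> d" "d \<le> D"
  have [measurable]: "?A \<in> sets borel" by measurable
  \<comment> \<open>Only the half-line \<open>?A\<close> is kept in the partition function; there
    the exponent is at least \<open>T * x - D\<close>. The witness for \<open>C\<close> will be
    \<open>D - ln (measure \<mu> ?A)\<close>.\<close>
  have "exp (T * x - D) * measure \<mu> ?A = (\<integral>b. exp (T * x - D) * indicat_real ?A b \<partial>\<mu>)" by simp
  also have "\<dots> \<le> (\<integral>b. exp (s * T * b - d / 2 * b\<^sup>2) \<partial>\<mu>)"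
  proof (rule integral_mono_interval)
    fix b :: real assume b: "\<bar>b\<bar> \<le> 1"
    show "exp (T * x - D) * indicat_real ?A b \<le> exp (s * T * b - d / 2 * b\<^sup>2)"
    proof (cases "x < s * b")
      case True
      have "T * x \<le> s * T * b" using T True by (simp add: mult.commute mult.left_commute)
      moreover have "d / 2 * b\<^sup>2 \<le> D * 1" using b d by (intro mult_mono) (auto simp: abs_square_le_1)
      ultimately show ?thesis using True by simp
    qed simp
  next
    show "integrable \<mu> (\<lambda>b. exp (T * x - D) * indicat_real ?A b)"
      by (rule integrable_interval[where B="exp (T * x - D)"]) (auto simp: indicator_def)
  qed (use integrable_weight[of "\<lambda>_. 1" 1 "s * T" d] in auto)
  finally have "ln (exp (T * x - D) * measure \<mu> ?A) \<le> log_mgf \<mu> (s * T) d"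
    unfolding log_mgf_def using pos partition_pos by (subst ln_le_cancel_iff) auto
  then have 1: "T * x - D + ln (measure \<mu> ?A) \<le> log_mgf \<mu> (s * T) d"
    using pos by (simp add: ln_mult)
  have "(\<integral>b. exp (0 * b - d / 2 * b\<^sup>2) \<partial>\<mu>) \<le> 1"
    using integrable_weight[of "\<lambda>_. 1" 1 0 d] d by (intro integral_le_const) auto
  then have 2: "log_mgf \<mu> 0 d \<le> 0" unfolding log_mgf_def using partition_pos[of 0 d] by simp
  have "log_mgf \<mu> (s * T) d - T * (s * tilt_mean \<mu> (s * T) d) \<le> log_mgf \<mu> 0 d"
    using log_mgf_convex[of "s * T" d 0] by (simp add: algebra_simps)
  with 1 2 have "T * x - (D - ln (measure \<mu> ?A)) \<le> T * (s * tilt_mean \<mu> (s * T) d)" by linarith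
  then show "x - (D - ln (measure \<mu> ?A)) / T \<le> s * tilt_mean \<mu> (s * T) d"
    using T by (simp add: field_simps)
qed

text \<open>One half of \<open>\<omega>\<close> places the threshold strictly inside the end of the
  support, where the tail has positive mass; the other half absorbs the error
  \<open>C / T\<close>.\<close>

lemma tilt_mean_near_ends:
  assumes "\<omega> > 0"
  shows "eventually (\<lambda>T. \<forall>d. 0 \<le> d \<and> d \<le> D \<longrightarrow>
    Sup (supp \<mu>) - \<omega> \<le> tilt_mean \<mu> T d \<and> tilt_mean \<mu> (- T) d \<le> Inf (supp \<mu>) + \<omega>) at_top"
proof -
  have lim: "eventually (\<lambda>T. C / T \<le> \<omega> / 2) at_top" for C
  proof -
    have "((\<lambda>T. C / T) \<longlongrightarrow> 0) at_top"
      by (intro tendsto_divide_0[OF tendsto_const] filterlim_at_top_imp_at_infinity filterlim_ident)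
    then have "eventually (\<lambda>T. C / T < \<omega> / 2) at_top" using assms by (intro order_tendstoD(2)) auto
    then show ?thesis by eventually_elim auto
  qed
  obtain C1 where C1: "\<And>T d. 0 < T \<Longrightarrow> 0 \<le> d \<Longrightarrow> d \<le> D \<Longrightarrow>
      Sup (supp \<mu>) - \<omega> / 2 - C1 / T \<le> 1 * tilt_mean \<mu> (1 * T) d"
    using tilt_mean_tail[of 1 "Sup (supp \<mu>) - \<omega> / 2" D] supp_tails(1)[of "Sup (supp \<mu>) - \<omega> / 2"] assms by auto
  obtain C2 where C2: "\<And>T d. 0 < T \<Longrightarrow> 0 \<le> d \<Longrightarrow> d \<le> D \<Longrightarrow>
      - (Inf (supp \<mu>) + \<omega> / 2) - C2 / T \<le> (- 1) * tilt_mean \<mu> ((- 1) * T) d"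
    using tilt_mean_tail[of "-1" "- (Inf (supp \<mu>) + \<omega> / 2)" D] supp_tails(2)[of "Inf (supp \<mu>) + \<omega> / 2"] assms by auto
  show ?thesis
    using lim[of C1] lim[of C2] eventually_gt_at_top[of 0]
  proof eventually_elim
    case (elim T)
    then show ?case using C1[of T] C2[of T] by fastforce
  qed
qed

text \<open>The slope is a tilted mean, at most 1 in absolute value; the supporting lines at the two
  points give the two signs.\<close>

lemma log_mgf_increment: "\<bar>log_mgf \<mu> \<tau> d - log_mgf \<mu> a d\<bar> \<le> \<bar>\<tau> - a\<bar>"
proof -
  have *: "\<bar>(\<tau> - a) * tilt_mean \<mu> x d\<bar> \<le> \<bar>\<tau> - a\<bar>" for x
    unfolding abs_mult using abs_tilt_mean_le by (simp add: mult_left_le)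
  show ?thesis
    using *[of a] *[of \<tau>] log_mgf_convex[of a d \<tau>] log_mgf_convex[of \<tau> d a]
    by (simp add: abs_le_iff algebra_simps)
qed

text \<open>A further tilt by \<open>s\<close> has density \<open>exp (s * b - ?c)\<close>, whose
  exponent is at most \<open>2 * \<bar>s\<bar>\<close> because the normaliser \<open>?c\<close> is
  at most \<open>\<bar>s\<bar>\<close>.\<close>

lemma continuous_tilt_mean: "isCont (\<lambda>\<tau>. tilt_mean \<mu> \<tau> d) \<tau>"
proof -
  interpret t: interval_law "tilt \<mu> \<tau> d" by (rule interval_law_tilt)
  have bd: "\<bar>tilt_mean \<mu> (\<tau> + s) d - tilt_mean \<mu> \<tau> d\<bar> \<le> exp (2 * \<bar>s\<bar>) - 1" for s
  proof -
    let ?c = "log_mgf (tilt \<mu> \<tau> d) s 0"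
    have c: "\<bar>?c\<bar> \<le> \<bar>s\<bar>"
      using log_mgf_increment[of "\<tau> + s" d \<tau>] by (simp add: log_mgf_tilt)
    have i: "integrable (tilt \<mu> \<tau> d) (\<lambda>b. b * exp (s * b - 0 / 2 * b\<^sup>2 - ?c))"
      using t.integrable_weight[of "\<lambda>b. b * (1 / exp ?c)" "1 / exp ?c" s 0]
      by (simp add: exp_diff mult_left_le divide_right_mono)
    have "tilt_mean \<mu> (\<tau> + s) d = (\<integral>b. b \<partial>tilt (tilt \<mu> \<tau> d) s 0)"
      unfolding tilt_mean_eq by (subst integral_tilt_tilt) auto
    also have "\<dots> = (\<integral>b. b * exp (s * b - 0 / 2 * b\<^sup>2 - ?c) \<partial>tilt \<mu> \<tau> d)"
      by (rule t.integral_tilt) simp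
    finally have "tilt_mean \<mu> (\<tau> + s) d - tilt_mean \<mu> \<tau> d
        = (\<integral>b. b * exp (s * b - 0 / 2 * b\<^sup>2 - ?c) \<partial>tilt \<mu> \<tau> d) - (\<integral>b. b \<partial>tilt \<mu> \<tau> d)"
      by (simp add: tilt_mean_eq)
    also have "\<dots> = (\<integral>b. b * (exp (s * b - ?c) - 1) \<partial>tilt \<mu> \<tau> d)"
      using i t.integrable_id by (simp add: right_diff_distrib)
    also have "\<bar>\<dots>\<bar> \<le> exp (2 * \<bar>s\<bar>) - 1"
    proof (rule t.abs_integral_le)
      fix b :: real assume b: "\<bar>b\<bar> \<le> 1"
      have "\<bar>s * b\<bar> \<le> \<bar>s\<bar>" using b by (simp add: abs_mult mult_left_le)
      then have x: "\<bar>s * b - ?c\<bar> \<le> 2 * \<bar>s\<bar>" using c by linarith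
      have "exp (s * b - ?c) - 1 \<le> exp (2 * \<bar>s\<bar>) - 1" using x by (simp add: abs_le_iff)
      moreover have "1 - exp (s * b - ?c) \<le> exp (2 * \<bar>s\<bar>) - 1"
        using exp_ge_add_one_self[of "s * b - ?c"] exp_ge_add_one_self[of "2 * \<bar>s\<bar>"] x by linarith
      ultimately have "\<bar>exp (s * b - ?c) - 1\<bar> \<le> exp (2 * \<bar>s\<bar>) - 1" by linarith
      then show "\<bar>b * (exp (s * b - ?c) - 1)\<bar> \<le> exp (2 * \<bar>s\<bar>) - 1"
        unfolding abs_mult using mult_mono[OF b, of "\<bar>exp (s * b - ?c) - 1\<bar>"] by fastforce
    qed simp
    finally show ?thesis .
  qed
  have "((\<lambda>s. tilt_mean \<mu> (\<tau> + s) d - tilt_mean \<mu> \<tau> d) \<longlongrightarrow> 0) (at 0)"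
  proof (rule Lim_null_comparison)
    show "eventually (\<lambda>s. norm (tilt_mean \<mu> (\<tau> + s) d - tilt_mean \<mu> \<tau> d) \<le> exp (2 * \<bar>s\<bar>) - 1) (at 0)"
      using bd by simp
    have "((\<lambda>s. exp (2 * \<bar>s\<bar>) - 1) \<longlongrightarrow> exp (2 * \<bar>0::real\<bar>) - 1) (at 0)" by (intro tendsto_intros)
    then show "((\<lambda>s. exp (2 * \<bar>s\<bar>) - 1) \<longlongrightarrow> (0::real)) (at 0)" by simp
  qed
  then show ?thesis unfolding isCont_iff by (simp add: LIM_zero_iff)
qed

text \<open>Intermediate value theorem on \<open>[-T, T]\<close>. As \<open>?\<omega>\<close> is
  half the distance from \<open>u\<close> to the nearer end, the means at the two endpoints enclose
  \<open>u\<close>.\<close>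

lemma tilt_mean_surj:
  assumes u: "u \<in> mean_range \<mu>" and d: "0 \<le> d"
  shows "\<exists>\<tau>. tilt_mean \<mu> \<tau> d = u"
proof -
  let ?\<omega> = "min (Sup (supp \<mu>) - u) (u - Inf (supp \<mu>)) / 2"
  have \<omega>: "?\<omega> > 0" using u by (simp add: mean_range_def)
  from eventually_conj[OF tilt_mean_near_ends[OF \<omega>, of d] eventually_ge_at_top[of 0]]
  obtain T where T: "0 \<le> T" "Sup (supp \<mu>) - ?\<omega> \<le> tilt_mean \<mu> T d" "tilt_mean \<mu> (- T) d \<le> Inf (supp \<mu>) + ?\<omega>"
    using d unfolding eventually_at_top_linorder by auto
  have "?\<omega> \<le> Sup (supp \<mu>) - u" "?\<omega> \<le> u - Inf (supp \<mu>)" using \<omega> by (auto simp: min_def split: if_splits)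
  then have "tilt_mean \<mu> (- T) d \<le> u" "u \<le> tilt_mean \<mu> T d" using T by linarith+
  then show ?thesis
    using IVT'[of "\<lambda>\<tau>. tilt_mean \<mu> \<tau> d" "- T" u T] T(1) continuous_tilt_mean
    by (auto intro: continuous_at_imp_continuous_on)
qed

lemma tilt_param_mean: "nondegenerate \<mu> \<Longrightarrow> tilt_param \<mu> d (tilt_mean \<mu> \<tau> d) = \<tau>"
  unfolding tilt_param_def
  using the_inv_into_f_f[OF strict_mono_imp_inj_on[OF tilt_mean_strict_mono[of d]], of \<tau>] by simp

lemma mean_tilt_param:
  "nondegenerate \<mu> \<Longrightarrow> 0 \<le> d \<Longrightarrow> u \<in> mean_range \<mu> \<Longrightarrow> tilt_mean \<mu> (tilt_param \<mu> d u) d = u"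
  using tilt_mean_surj[of u d] tilt_param_mean[of d] by auto

text \<open>The quadratic terms cancel in the ratio of the two densities, so its logarithm is affine
  in \<open>b\<close> and only the tilted mean enters.\<close>

lemma KL_tilt: "KL_divergence (exp 1) (tilt \<mu> 0 d) (tilt \<mu> \<tau> d) = tilt_div \<mu> \<tau> d"
proof -
  interpret t: interval_law "tilt \<mu> \<tau> d" by (rule interval_law_tilt)
  let ?q = "\<lambda>\<gamma> b. exp (\<gamma> * b - d / 2 * b\<^sup>2 - log_mgf \<mu> \<gamma> d)"
  have q: "?q \<tau> b / ?q 0 b = exp (\<tau> * b - log_mgf \<mu> \<tau> d + log_mgf \<mu> 0 d)" for b
    by (simp flip: exp_diff)
  have "KL_divergence (exp 1) (tilt \<mu> 0 d) (tilt \<mu> \<tau> d) = (\<integral>b. ?q \<tau> b * log (exp 1) (?q \<tau> b / ?q 0 b) \<partial>\<mu>)"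
    unfolding tilt_def by (rule KL_density_density) auto
  also have "\<dots> = (\<integral>b. \<tau> * b - log_mgf \<mu> \<tau> d + log_mgf \<mu> 0 d \<partial>tilt \<mu> \<tau> d)"
    unfolding q by (subst integral_tilt) (simp_all add: log_def mult.commute)
  also have "\<dots> = tilt_div \<mu> \<tau> d"
    using t.integrable_id by (simp add: tilt_div_def tilt_mean_eq)
  finally show ?thesis .
qed

lemma abs_tilt_div_le: "\<bar>tilt_div \<mu> \<tau> d\<bar> \<le> 2 * \<bar>\<tau>\<bar>"
proof -
  have "\<bar>\<tau> * tilt_mean \<mu> \<tau> d\<bar> \<le> \<bar>\<tau>\<bar>"
    unfolding abs_mult using abs_tilt_mean_le by (simp add: mult_left_le)
  then show ?thesis using log_mgf_increment[of \<tau> d 0] unfolding tilt_div_def by linarith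
qed

lemma tilt_div_nonneg: "0 \<le> tilt_div \<mu> \<tau> d"
  using log_mgf_convex[of \<tau> d 0] by (simp add: tilt_div_def)

lemma tilt_div_zero [simp]: "tilt_div \<mu> 0 d = 0"
  by (simp add: tilt_div_def)

text \<open>The difference is the gap of the supporting line at \<open>\<tau>\<close>, evaluated at
  \<open>s\<close>, plus \<open>s\<close> times the increment of the tilted mean. Both are
  nonnegative when \<open>s\<close> lies between 0 and \<open>\<tau>\<close>. Hence clamping a
  parameter cannot raise the entropy.\<close>

lemma tilt_div_mono:
  assumes "0 \<le> s \<and> s \<le> \<tau> \<or> \<tau> \<le> s \<and> s \<le> 0"
  shows "tilt_div \<mu> s d \<le> tilt_div \<mu> \<tau> d"
proof -
  have "0 \<le> s * (tilt_mean \<mu> \<tau> d - tilt_mean \<mu> s d)"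
    using assms tilt_mean_mono[of s \<tau> d] tilt_mean_mono[of \<tau> s d]
    by (auto simp: zero_le_mult_iff)
  then show ?thesis using log_mgf_convex[of \<tau> d s] by (simp add: tilt_div_def algebra_simps)
qed

text \<open>Tilting by \<open>s \<ge> 0\<close> raises the mean of a nondecreasing \<open>g\<close>: with \<open>b\<^sub>0\<close> a point where \<open>g\<close>
  attains its mean, \<open>g(b) - g(b\<^sub>0)\<close> and \<open>e\<^sup>s\<^sup>b - e\<^sup>s\<^sup>b\<^sup>0\<close> have the same sign.\<close>

lemma integral_tilt_mono:
  assumes [measurable]: "g \<in> borel_measurable borel"
    and mono: "\<And>x y. \<bar>x\<bar> \<le> 1 \<Longrightarrow> \<bar>y\<bar> \<le> 1 \<Longrightarrow> x \<le> y \<Longrightarrow> g x \<le> (g y :: real)"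
    and cont: "continuous_on {-1..1} g" and s: "0 \<le> s"
  shows "(\<integral>b. g b \<partial>\<mu>) \<le> (\<integral>b. g b \<partial>tilt \<mu> s 0)"
proof -
  have b: "g (-1) \<le> g b \<and> g b \<le> g 1" if "\<bar>b\<bar> \<le> 1" for b
    using mono[of "-1" b] mono[of b 1] that by (auto simp: abs_le_iff)
  then have bd: "\<bar>g b\<bar> \<le> max \<bar>g (-1)\<bar> \<bar>g 1\<bar>" if "\<bar>b\<bar> \<le> 1" for b using b[OF that] by linarith
  have i: "integrable \<mu> g" by (rule integrable_interval[OF assms(1) bd])
  have "g (-1) \<le> (\<integral>b. g b \<partial>\<mu>)" "(\<integral>b. g b \<partial>\<mu>) \<le> g 1"
    using integral_ge_const[OF i] integral_le_const[OF i] b by blast+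
  then obtain b0 where b0: "- 1 \<le> b0" "b0 \<le> 1" "g b0 = (\<integral>b. g b \<partial>\<mu>)"
    using IVT'[of g "-1" "\<integral>b. g b \<partial>\<mu>" 1] cont by auto
  let ?c = "g b0" and ?Z = "\<integral>b. exp (s * b - 0 / 2 * b\<^sup>2) \<partial>\<mu>"
  have iw: "integrable \<mu> (\<lambda>b. (g b - ?c) * exp (s * b - 0 / 2 * b\<^sup>2))"
  proof (rule integrable_weight[where B="max \<bar>g (-1)\<bar> \<bar>g 1\<bar> + \<bar>?c\<bar>"])
    show "\<bar>g b - ?c\<bar> \<le> max \<bar>g (-1)\<bar> \<bar>g 1\<bar> + \<bar>?c\<bar>" if "\<bar>b\<bar> \<le> 1" for b
      using bd[OF that] by linarith
  qed simp
  have "0 \<le> (\<integral>b. (g b - ?c) * (exp (s * b) - exp (s * b0)) \<partial>\<mu>)"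
  proof (rule integral_ge_const)
    show "integrable \<mu> (\<lambda>b. (g b - ?c) * (exp (s * b) - exp (s * b0)))"
      using iw i by (simp add: right_diff_distrib)
    fix b :: real assume b: "\<bar>b\<bar> \<le> 1"
    show "0 \<le> (g b - ?c) * (exp (s * b) - exp (s * b0))"
    proof (cases "b0 \<le> b")
      case True
      then show ?thesis using mono[of b0 b] b b0 s
        by (intro mult_nonneg_nonneg) (auto simp: abs_le_iff mult_left_mono)
    next
      case False
      then show ?thesis using mono[of b b0] b b0 s
        by (intro mult_nonpos_nonpos) (auto simp: abs_le_iff mult_left_mono)
    qed
  qed
  also have "\<dots> = (\<integral>b. (g b - ?c) * exp (s * b - 0 / 2 * b\<^sup>2) \<partial>\<mu>)"
    using iw i by (simp add: right_diff_distrib b0)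
  finally have "0 \<le> (\<integral>b. g b - ?c \<partial>tilt \<mu> s 0)"
    using partition_pos[of s 0] by (subst integral_tilt_quotient) auto
  moreover interpret t: interval_law "tilt \<mu> s 0" by (rule interval_law_tilt)
  have "integrable (tilt \<mu> s 0) g" by (rule t.integrable_interval[OF assms(1) bd])
  ultimately show ?thesis by (simp add: b0)
qed

text \<open>For a 1-Lipschitz \<open>f\<close> the function \<open>b - f b\<close> is nondecreasing,
  so a tilt to the right raises its mean.\<close>

lemma integral_tilt_lipschitz_0:
  assumes [measurable]: "f \<in> borel_measurable borel"
    and lip: "\<And>x y. \<bar>x\<bar> \<le> 1 \<Longrightarrow> \<bar>y\<bar> \<le> 1 \<Longrightarrow> \<bar>f x - f y\<bar> \<le> \<bar>x - (y::real)\<bar>" and s: "0 \<le> s"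
  shows "(\<integral>b. f b \<partial>tilt \<mu> s 0) - (\<integral>b. f b \<partial>\<mu>) \<le> (\<integral>b. b \<partial>tilt \<mu> s 0) - (\<integral>b. b \<partial>\<mu>)"
proof -
  interpret t: interval_law "tilt \<mu> s 0" by (rule interval_law_tilt)
  have "1-lipschitz_on {-1..1} f"
    using lip by (intro lipschitz_onI) (auto simp: dist_real_def abs_le_iff)
  then have c: "continuous_on {-1..1} f" by (rule lipschitz_on_continuous_on)
  have bd: "\<bar>f b\<bar> \<le> \<bar>f 0\<bar> + 1" if "\<bar>b\<bar> \<le> 1" for b using lip[of b 0] that by auto
  have i: "integrable \<mu> f" "integrable (tilt \<mu> s 0) f"
    using integrable_interval[OF assms(1)] t.integrable_interval[OF assms(1)] bd by blast+
  have "(\<integral>b. b - f b \<partial>\<mu>) \<le> (\<integral>b. b - f b \<partial>tilt \<mu> s 0)"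
  proof (rule integral_tilt_mono)
    fix x y :: real assume "\<bar>x\<bar> \<le> 1" "\<bar>y\<bar> \<le> 1" "x \<le> y"
    then show "x - f x \<le> y - f y" using lip[of x y] by linarith
  qed (use c s in \<open>auto intro!: continuous_intros\<close>)
  then show ?thesis using i integrable_id t.integrable_id by simp
qed

text \<open>The tilts of one law are stochastically ordered, so their Wasserstein-1 distance is the
  difference of their means. This turns closeness of mean vectors into closeness of integrals of
  Lipschitz functions, uniformly in the parameters.\<close>

lemma integral_tilt_lipschitz:
  assumes [measurable]: "f \<in> borel_measurable borel"
    and lip: "\<And>x y. \<bar>x\<bar> \<le> 1 \<Longrightarrow> \<bar>y\<bar> \<le> 1 \<Longrightarrow> \<bar>f x - f y\<bar> \<le> \<bar>x - (y::real)\<bar>"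
  shows "\<bar>(\<integral>b. f b \<partial>tilt \<mu> \<tau> d) - (\<integral>b. f b \<partial>tilt \<mu> \<tau>' d)\<bar> \<le> \<bar>tilt_mean \<mu> \<tau> d - tilt_mean \<mu> \<tau>' d\<bar>"
proof -
  have *: "(\<integral>b. g b \<partial>tilt \<mu> \<tau>' d) - (\<integral>b. g b \<partial>tilt \<mu> \<tau> d) \<le> tilt_mean \<mu> \<tau>' d - tilt_mean \<mu> \<tau> d"
    if g[measurable]: "g \<in> borel_measurable borel" and "\<tau> \<le> \<tau>'"
      and l: "\<And>x y. \<bar>x\<bar> \<le> 1 \<Longrightarrow> \<bar>y\<bar> \<le> 1 \<Longrightarrow> \<bar>g x - g y\<bar> \<le> \<bar>x - (y::real)\<bar>" for g \<tau> \<tau>'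
  proof -
    interpret t: interval_law "tilt \<mu> \<tau> d" by (rule interval_law_tilt)
    show ?thesis using t.integral_tilt_lipschitz_0[OF g l, of "\<tau>' - \<tau>"] \<open>\<tau> \<le> \<tau>'\<close>
      by (simp add: tilt_mean_eq integral_tilt_tilt)
  qed
  have l': "\<bar>- f x - - f y\<bar> \<le> \<bar>x - y\<bar>" if "\<bar>x\<bar> \<le> 1" "\<bar>y\<bar> \<le> 1" for x y using lip[OF that] by linarith
  have m[measurable]: "(\<lambda>b. - f b) \<in> borel_measurable borel" by simp
  show ?thesis
    using *[OF assms(1) _ lip, of \<tau> \<tau>'] *[OF m _ l', of \<tau> \<tau>'] *[OF assms(1) _ lip, of \<tau>' \<tau>] *[OF m _ l', of \<tau>' \<tau>]
    by (cases "\<tau> \<le> \<tau>'") (simp_all add: abs_le_iff)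
qed

end

section \<open>Comparison of laws\<close>

text \<open>\<open>\<rho>\<close> bounds the Wasserstein-1 distance of the restrictions to \<open>[-1, 1]\<close>.\<close>

definition laws_within :: "real \<Rightarrow> real measure \<Rightarrow> real measure \<Rightarrow> bool" where
  "laws_within \<rho> \<mu> \<nu> \<longleftrightarrow> (\<forall>\<phi> K. \<phi> \<in> borel_measurable borel \<longrightarrow>
     (\<forall>x y. \<bar>x\<bar> \<le> 1 \<longrightarrow> \<bar>y\<bar> \<le> 1 \<longrightarrow> \<bar>\<phi> x - \<phi> y\<bar> \<le> K * \<bar>x - y\<bar>) \<longrightarrow>
     \<bar>(\<integral>b. \<phi> b \<partial>\<mu>) - (\<integral>b. \<phi> b \<partial>\<nu>)\<bar> \<le> K * \<rho>)"

text \<open>Skorohod's representation gives copies that converge pointwise; they are bounded, hence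
  converge in mean. A coupling bounds the difference for all Lipschitz functions simultaneously,
  which testing them one by one would not.\<close>

lemma weak_conv_laws_within:
  assumes law: "\<And>n. interval_law (M n)" "interval_law N" and conv: "weak_conv_m M N" and \<rho>: "\<rho> > 0"
  shows "eventually (\<lambda>n. laws_within \<rho> (M n) N) sequentially"
proof -
  have rd: "real_distribution (M n)" "real_distribution N" for n
    using law by (auto simp: interval_law_def)
  obtain \<Omega> :: "real measure" and Ys Y where \<Omega>: "prob_space \<Omega>"
    and Ys[measurable]: "\<And>n. Ys n \<in> borel_measurable \<Omega>" and Ms: "\<And>n. distr \<Omega> borel (Ys n) = M n"
    and Y: "Y \<in> measurable \<Omega> lborel" and N: "distr \<Omega> borel Y = N"
    and lim: "\<And>x. x \<in> space \<Omega> \<Longrightarrow> (\<lambda>n. Ys n x) \<longlonglongrightarrow> Y x"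
    using Skorohod[OF rd conv] by blast
  have [measurable]: "Y \<in> borel_measurable \<Omega>" using Y by simp
  interpret \<Omega>: prob_space \<Omega> by fact
  have Ys1: "AE x in \<Omega>. \<bar>Ys n x\<bar> \<le> 1" for n
    using interval_law.AE_interval[OF law(1)[of n]] unfolding Ms[symmetric] by (subst (asm) AE_distr_iff) auto
  have Y1: "AE x in \<Omega>. \<bar>Y x\<bar> \<le> 1"
    using interval_law.AE_interval[OF law(2)] unfolding N[symmetric] by (subst (asm) AE_distr_iff) auto
  have "(\<lambda>n. \<integral>x. \<bar>Ys n x - Y x\<bar> \<partial>\<Omega>) \<longlonglongrightarrow> (\<integral>x. 0 \<partial>\<Omega>)"
  proof (rule integral_dominated_convergence[where w="\<lambda>_. 2"])
    show "AE x in \<Omega>. (\<lambda>n. \<bar>Ys n x - Y x\<bar>) \<longlonglongrightarrow> 0"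
    proof (rule AE_I2)
      fix x assume "x \<in> space \<Omega>"
      then have "(\<lambda>n. \<bar>Ys n x - Y x\<bar>) \<longlonglongrightarrow> \<bar>Y x - Y x\<bar>" by (intro tendsto_intros lim)
      then show "(\<lambda>n. \<bar>Ys n x - Y x\<bar>) \<longlonglongrightarrow> 0" by simp
    qed
    show "AE x in \<Omega>. norm \<bar>Ys n x - Y x\<bar> \<le> 2" for n
      using Ys1[of n] Y1 by eventually_elim auto
  qed auto
  then have "eventually (\<lambda>n. (\<integral>x. \<bar>Ys n x - Y x\<bar> \<partial>\<Omega>) < \<rho>) sequentially"
    using \<rho> by (intro order_tendstoD(2)) auto
  then show ?thesis
  proof eventually_elim
    fix n assume n: "(\<integral>x. \<bar>Ys n x - Y x\<bar> \<partial>\<Omega>) < \<rho>"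
    show "laws_within \<rho> (M n) N"
      unfolding laws_within_def
    proof (intro allI impI)
      fix \<phi> :: "real \<Rightarrow> real" and K
      assume [measurable]: "\<phi> \<in> borel_measurable borel"
        and l: "\<forall>x y. \<bar>x\<bar> \<le> 1 \<longrightarrow> \<bar>y\<bar> \<le> 1 \<longrightarrow> \<bar>\<phi> x - \<phi> y\<bar> \<le> K * \<bar>x - y\<bar>"
      have K: "0 \<le> K" using l[rule_format, of 0 1] by simp
      have bd: "\<bar>\<phi> b\<bar> \<le> \<bar>\<phi> 0\<bar> + K" if "\<bar>b\<bar> \<le> 1" for b
        using l[rule_format, of b 0] that mult_left_mono[OF that K] by simp
      have iY: "integrable \<Omega> (\<lambda>x. \<phi> (Y x))"
        by (rule \<Omega>.integrable_const_bound[where B="\<bar>\<phi> 0\<bar> + K"]) (use Y1 bd in \<open>auto elim: eventually_mono\<close>)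
      have iYs: "integrable \<Omega> (\<lambda>x. \<phi> (Ys n x))"
        by (rule \<Omega>.integrable_const_bound[where B="\<bar>\<phi> 0\<bar> + K"]) (use Ys1[of n] bd in \<open>auto elim: eventually_mono\<close>)
      have id: "integrable \<Omega> (\<lambda>x. \<bar>Ys n x - Y x\<bar>)"
        by (rule \<Omega>.integrable_const_bound[where B=2]) (use Ys1[of n] Y1 in eventually_elim, auto)
      have "(\<integral>b. \<phi> b \<partial>M n) - (\<integral>b. \<phi> b \<partial>N) = (\<integral>x. \<phi> (Ys n x) - \<phi> (Y x) \<partial>\<Omega>)"
        unfolding Ms[symmetric] N[symmetric] using iY iYs by (simp add: integral_distr)
      also have "\<bar>\<dots>\<bar> \<le> (\<integral>x. \<bar>\<phi> (Ys n x) - \<phi> (Y x)\<bar> \<partial>\<Omega>)" by (rule integral_abs_bound)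
      also have "\<dots> \<le> (\<integral>x. K * \<bar>Ys n x - Y x\<bar> \<partial>\<Omega>)"
        using iY iYs id Ys1[of n] Y1 l by (intro integral_mono_AE) (auto elim!: eventually_elim2)
      also have "\<dots> \<le> K * \<rho>" using n K by (simp add: mult_left_mono)
      finally show "\<bar>(\<integral>b. \<phi> b \<partial>M n) - (\<integral>b. \<phi> b \<partial>N)\<bar> \<le> K * \<rho>" .
    qed
  qed
qed

text \<open>The variance is positive for \<open>\<mu>\<close>, zero for a point mass, and continuous
  for this distance.\<close>

lemma laws_within_nondegenerate:
  assumes \<mu>: "interval_law \<mu>" "nondegenerate \<mu>"
  obtains \<rho> where "\<rho> > 0" "\<And>\<nu>. interval_law \<nu> \<Longrightarrow> laws_within \<rho> \<nu> \<mu> \<Longrightarrow> nondegenerate \<nu>"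
proof
  interpret m: interval_law \<mu> by fact
  let ?m = "\<integral>b. b \<partial>\<mu>" and ?v = "\<integral>b. b\<^sup>2 \<partial>\<mu>"
  have i2: "integrable \<mu> (\<lambda>b. b\<^sup>2)" by (rule m.integrable_interval[where B=1]) (auto simp: abs_square_le_1)
  have var: "(\<integral>b. (b - ?m)\<^sup>2 \<partial>\<mu>) = ?v - ?m\<^sup>2"
    using m.integrable_id i2 by (simp add: power2_diff power2_eq_square algebra_simps)
  have "(\<integral>b. (b - ?m)\<^sup>2 \<partial>\<mu>) \<noteq> 0"
  proof
    assume "(\<integral>b. (b - ?m)\<^sup>2 \<partial>\<mu>) = 0"
    moreover have "integrable \<mu> (\<lambda>b. (b - ?m)\<^sup>2)" using m.integrable_id i2 by (simp add: power2_diff)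
    ultimately have "AE b in \<mu>. b = ?m" by (subst (asm) integral_nonneg_eq_0_iff_AE) auto
    then show False using m.return_if_AE \<mu>(2) unfolding nondegenerate_def by blast
  qed
  moreover have "0 \<le> (\<integral>b. (b - ?m)\<^sup>2 \<partial>\<mu>)" by (rule Bochner_Integration.integral_nonneg) simp
  ultimately have pos: "0 < ?v - ?m\<^sup>2" using var by simp
  \<comment> \<open>If \<open>\<nu>\<close> were a point mass at \<open>a\<close>, the second moment
    and the squared mean of \<open>\<mu>\<close> would each be within \<open>2 * ?\<rho>\<close> of
    the square of \<open>a\<close>. The variance would be at most \<open>4 * ?\<rho>\<close>, which
    the divisor 5 excludes.\<close>
  let ?\<rho> = "(?v - ?m\<^sup>2) / 5"
  show "?\<rho> > 0" using pos by simp
  fix \<nu> assume \<nu>: "interval_law \<nu>" and w: "laws_within ?\<rho> \<nu> \<mu>"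
  show "nondegenerate \<nu>" unfolding nondegenerate_def
  proof (intro allI notI)
    fix a assume r: "\<nu> = return borel a"
    interpret n: interval_law \<nu> by fact
    have a: "\<bar>a\<bar> \<le> 1" using n.AE_interval unfolding r by (subst (asm) AE_return) auto
    have ia: "(\<integral>b. f b \<partial>\<nu>) = f a" if "f \<in> borel_measurable borel" for f :: "real \<Rightarrow> real"
      unfolding r using that by (subst integral_return) auto
    have "\<bar>x\<^sup>2 - y\<^sup>2\<bar> \<le> 2 * \<bar>x - y\<bar>" if "\<bar>x\<bar> \<le> 1" "\<bar>y\<bar> \<le> 1" for x y :: real
    proof -
      have "\<bar>x\<^sup>2 - y\<^sup>2\<bar> = \<bar>x + y\<bar> * \<bar>x - y\<bar>" by (simp add: power2_eq_square square_diff_square_factored abs_mult)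
      also have "\<dots> \<le> 2 * \<bar>x - y\<bar>" using that by (intro mult_right_mono) auto
      finally show ?thesis .
    qed
    then have 2: "\<bar>a\<^sup>2 - ?v\<bar> \<le> 2 * ?\<rho>"
      using w[unfolded laws_within_def, rule_format, of "\<lambda>b. b\<^sup>2" 2] by (simp add: ia)
    have 1: "\<bar>a - ?m\<bar> \<le> 1 * ?\<rho>"
      using w[unfolded laws_within_def, rule_format, of "\<lambda>b. b" 1] by (simp add: ia)
    have "\<bar>a\<^sup>2 - ?m\<^sup>2\<bar> = \<bar>a + ?m\<bar> * \<bar>a - ?m\<bar>" by (simp add: power2_eq_square square_diff_square_factored abs_mult)
    also have "\<dots> \<le> 2 * ?\<rho>" using 1 a m.mean_bounds by (intro mult_mono) (auto simp: abs_le_iff)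
    finally have 3: "\<bar>a\<^sup>2 - ?m\<^sup>2\<bar> \<le> 2 * ?\<rho>" .
    have "v \<le> m" if "\<bar>x - m\<bar> \<le> 2 * ((v - m) / 5)" "\<bar>x - v\<bar> \<le> 2 * ((v - m) / 5)" for x v m :: real
      using that abs_ge_self[of "x - m"] abs_ge_minus_self[of "x - v"] by argo
    from this[OF 3 2] show False using pos by simp
  qed
qed

text \<open>A tilted integral is a quotient. Its numerator and its denominator each move by at most
  \<open>exp T * (T + D + 1) * \<rho>\<close>, whence the factor 2, and the denominator is at least
  \<open>exp (- (T + D))\<close>.\<close>

definition tilt_lip :: "real \<Rightarrow> real \<Rightarrow> real" where
  "tilt_lip T D = 2 * exp (2 * T + D) * (T + D + 1)"

section \<open>Lipschitz dependence of the tilts on the prior\<close>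

context
  fixes \<mu> \<nu> T D \<rho> \<gamma> d :: real and M N
  assumes M: "interval_law M" and N: "interval_law N" and within: "laws_within \<rho> M N"
    and g: "\<bar>\<gamma>\<bar> \<le> T" and d: "0 \<le> d" "d \<le> D"
begin

interpretation M: interval_law M by (rule M)
interpretation N: interval_law N by (rule N)

private definition W where "W b = exp (\<gamma> * b - d / 2 * b\<^sup>2)" for b :: real

private lemma W_meas [measurable]: "W \<in> borel_measurable borel"
  unfolding W_def by measurable

private lemma W_bounds: "\<bar>b\<bar> \<le> 1 \<Longrightarrow> exp (- (T + D)) \<le> W b" "\<bar>b\<bar> \<le> 1 \<Longrightarrow> W b \<le> exp T"
proof -
  assume b: "\<bar>b\<bar> \<le> 1"
  show "exp (- (T + D)) \<le> W b"
    using M.weight_bounds(1)[OF b, of \<gamma> d] g d unfolding W_def by (auto elim!: order_trans[rotated])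
  have "\<gamma> * b \<le> T" using b g mult_mono[of "\<bar>\<gamma>\<bar>" T "\<bar>b\<bar>" 1] abs_ge_self[of "\<gamma> * b"] by (simp add: abs_mult) linarith
  moreover have "0 \<le> d / 2 * b\<^sup>2" using d by simp
  ultimately show "W b \<le> exp T" unfolding W_def by (intro exp_mono) linarith
qed

private lemma W_lip: 
  assumes x: "\<bar>x\<bar> \<le> 1" and y: "\<bar>y\<bar> \<le> 1"
  shows "\<bar>W x - W y\<bar> \<le> exp T * (T + D) * \<bar>x - y\<bar>"
proof -
  have *: "W u - W v \<le> exp T * (T + D) * \<bar>u - v\<bar>" if u: "\<bar>u\<bar> \<le> 1" and v: "\<bar>v\<bar> \<le> 1" for u v
  proof -
    \<comment> \<open>The tangent of \<open>exp\<close> at \<open>?a\<close> bounds the increment by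
      \<open>W u\<close> times the difference of the exponents, which has \<open>u - v\<close> as a
      factor.\<close>
    let ?a = "\<gamma> * u - d / 2 * u\<^sup>2" and ?b = "\<gamma> * v - d / 2 * v\<^sup>2"
    have "exp ?a * (1 + (?b - ?a)) \<le> exp ?a * exp (?b - ?a)" by (intro mult_left_mono exp_ge_add_one_self) auto
    then have "W u - W v \<le> W u * (?a - ?b)" by (simp add: W_def algebra_simps flip: exp_add)
    also have "?a - ?b = (\<gamma> - d / 2 * (u + v)) * (u - v)" by (simp add: power2_eq_square field_simps)
    also have "W u * \<dots> \<le> W u * ((T + D) * \<bar>u - v\<bar>)"
    proof (rule mult_left_mono)
      have "\<bar>d / 2 * (u + v)\<bar> \<le> D / 2 * 2" unfolding abs_mult using d u v by (intro mult_mono) auto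
      then have "\<bar>\<gamma> - d / 2 * (u + v)\<bar> \<le> T + D" using g by linarith
      then show "(\<gamma> - d / 2 * (u + v)) * (u - v) \<le> (T + D) * \<bar>u - v\<bar>"
        using mult_right_mono[of "\<bar>\<gamma> - d / 2 * (u + v)\<bar>" "T + D" "\<bar>u - v\<bar>"]
          abs_ge_self[of "(\<gamma> - d / 2 * (u + v)) * (u - v)"] by (simp add: abs_mult)
    qed (simp add: W_def)
    also have "\<dots> \<le> exp T * ((T + D) * \<bar>u - v\<bar>)"
      using W_bounds[OF u] g d by (intro mult_right_mono) auto
    finally show ?thesis by (simp add: mult.assoc)
  qed
  show ?thesis using *[OF x y] *[OF y x] by (simp add: abs_le_iff abs_minus_commute)
qed

private lemma Z_ge: "exp (- (T + D)) \<le> (\<integral>b. W b \<partial>M)" "exp (- (T + D)) \<le> (\<integral>b. W b \<partial>N)"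
  using M.integral_ge_const[of W] N.integral_ge_const[of W] W_bounds
    M.integrable_interval[OF W_meas, of "exp T"] N.integrable_interval[OF W_meas, of "exp T"]
  by (simp_all add: W_def)

private lemma TD: "0 \<le> T" "0 \<le> D"
  using g d by linarith+

private lemma Z_diff: "\<bar>(\<integral>b. W b \<partial>M) - (\<integral>b. W b \<partial>N)\<bar> \<le> exp T * (T + D) * \<rho>"
  using within W_lip unfolding laws_within_def by simp

private lemma rho_nonneg: "0 \<le> \<rho>"
  using within[unfolded laws_within_def, rule_format, of "\<lambda>b. b" 1] by simp

private lemma tilt_lip_eq: "tilt_lip T D = 2 * (exp T * (T + D + 1)) * exp (T + D)"
proof -
  have "exp (2 * T + D) = exp T * exp (T + D)" by (simp flip: exp_add)
  then show ?thesis by (simp add: tilt_lip_def)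
qed

private lemma divide_exp: "x / exp (- (T + D)) = x * exp (T + D)"
  by (simp only: exp_minus divide_inverse inverse_inverse_eq)

lemma laws_within_tilt:
  assumes f[measurable]: "f \<in> borel_measurable borel"
    and lip: "\<And>x y. \<bar>x\<bar> \<le> 1 \<Longrightarrow> \<bar>y\<bar> \<le> 1 \<Longrightarrow> \<bar>f x - f y\<bar> \<le> \<bar>x - (y::real)\<bar>"
    and bd: "\<And>x. \<bar>x\<bar> \<le> 1 \<Longrightarrow> \<bar>f x\<bar> \<le> 1"
  shows "\<bar>(\<integral>b. f b \<partial>tilt M \<gamma> d) - (\<integral>b. f b \<partial>tilt N \<gamma> d)\<bar> \<le> tilt_lip T D * \<rho>"
proof -
  let ?F = "\<lambda>L. \<integral>b. f b * W b \<partial>L" and ?Z = "\<lambda>L. \<integral>b. W b \<partial>L"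
  have l: "\<bar>f x * W x - f y * W y\<bar> \<le> exp T * (T + D + 1) * \<bar>x - y\<bar>" if x: "\<bar>x\<bar> \<le> 1" and y: "\<bar>y\<bar> \<le> 1" for x y
  proof -
    have "\<bar>f x * W x - f y * W y\<bar> \<le> \<bar>f x\<bar> * \<bar>W x - W y\<bar> + \<bar>f x - f y\<bar> * \<bar>W y\<bar>"
      by (simp flip: abs_mult add: algebra_simps)
    also have "\<dots> \<le> 1 * (exp T * (T + D) * \<bar>x - y\<bar>) + \<bar>x - y\<bar> * exp T"
      using bd[OF x] W_lip[OF x y] lip[OF x y] W_bounds[OF y] by (intro add_mono mult_mono) (auto simp: W_def)
    finally show ?thesis by (simp add: algebra_simps)
  qed
  have Fd: "\<bar>?F M - ?F N\<bar> \<le> exp T * (T + D + 1) * \<rho>"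
    using within l unfolding laws_within_def by simp
  have Zd: "\<bar>?Z M - ?Z N\<bar> \<le> exp T * (T + D + 1) * \<rho>"
    using Z_diff rho_nonneg TD by (smt (verit) exp_gt_zero mult_left_mono mult_right_mono)
  have Z: "0 < ?Z M" "0 < ?Z N" using Z_ge exp_gt_zero[of "- (T + D)"] by linarith+
  interpret n: interval_law "tilt N \<gamma> d" by (rule N.interval_law_tilt)
  let ?q = "\<integral>b. f b \<partial>tilt N \<gamma> d"
  have tM: "(\<integral>b. f b \<partial>tilt M \<gamma> d) = ?F M / ?Z M" and tN: "?q = ?F N / ?Z N"
    unfolding W_def by (rule M.integral_tilt_quotient[OF f], rule N.integral_tilt_quotient[OF f])
  have q: "\<bar>?q\<bar> \<le> 1" by (rule n.abs_integral_le[OF f bd])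
  \<comment> \<open>Arranged so that only one denominator remains: \<open>?q\<close> is itself a
    tilted mean of \<open>f\<close>, hence at most 1, and multiplies the difference of the partition
    functions.\<close>
  have "(\<integral>b. f b \<partial>tilt M \<gamma> d) - ?q = ((?F M - ?F N) + ?q * (?Z N - ?Z M)) / ?Z M"
    using Z by (simp add: tM tN field_simps)
  also have "\<bar>\<dots>\<bar> \<le> (exp T * (T + D + 1) * \<rho> + 1 * (exp T * (T + D + 1) * \<rho>)) / exp (- (T + D))"
    unfolding abs_divide
  proof (rule frac_le)
    show "\<bar>?F M - ?F N + ?q * (?Z N - ?Z M)\<bar> \<le> exp T * (T + D + 1) * \<rho> + 1 * (exp T * (T + D + 1) * \<rho>)"
    proof -
      have "\<bar>?q * (?Z N - ?Z M)\<bar> \<le> 1 * (exp T * (T + D + 1) * \<rho>)"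
        unfolding abs_mult using q Zd by (intro mult_mono) (auto simp: abs_minus_commute)
      then show ?thesis using Fd abs_triangle_ineq[of "?F M - ?F N" "?q * (?Z N - ?Z M)"] by linarith
    qed
    then show "0 \<le> exp T * (T + D + 1) * \<rho> + 1 * (exp T * (T + D + 1) * \<rho>)" by linarith
  qed (use Z Z_ge in auto)
  also have "\<dots> = tilt_lip T D * \<rho>" unfolding tilt_lip_eq divide_exp by (simp add: algebra_simps)
  finally show ?thesis .
qed

lemma laws_within_tilt_mean: "\<bar>tilt_mean M \<gamma> d - tilt_mean N \<gamma> d\<bar> \<le> tilt_lip T D * \<rho>"
  unfolding M.tilt_mean_eq N.tilt_mean_eq by (rule laws_within_tilt) auto

lemma laws_within_log_mgf: "\<bar>log_mgf M \<gamma> d - log_mgf N \<gamma> d\<bar> \<le> tilt_lip T D * \<rho>"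
proof -
  have *: "ln x - ln y \<le> tilt_lip T D * \<rho>"
    if "\<bar>x - y\<bar> \<le> exp T * (T + D) * \<rho>" "exp (- (T + D)) \<le> y" "0 < x" for x y
  proof -
    have y: "0 < y" using that exp_gt_zero[of "- (T + D)"] by linarith
    have "ln x - ln y = ln (x / y)" using y that by (simp add: ln_div)
    also have "\<dots> \<le> x / y - 1" using y that by (intro ln_le_minus_one) auto
    also have "\<dots> = (x - y) / y" using y by (simp add: field_simps)
    also have "\<dots> \<le> (exp T * (T + D) * \<rho>) / exp (- (T + D))"
      using that y rho_nonneg TD by (intro frac_le) auto
    also have "\<dots> \<le> tilt_lip T D * \<rho>"
    proof -
      have "exp T * (T + D) \<le> 2 * (exp T * (T + D + 1))" using TD by (simp add: algebra_simps add_nonneg_nonneg)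
      then have "exp T * (T + D) * (\<rho> * exp (T + D)) \<le> 2 * (exp T * (T + D + 1)) * (\<rho> * exp (T + D))"
        using rho_nonneg by (intro mult_right_mono) auto
      then show ?thesis unfolding tilt_lip_eq divide_exp by (simp add: mult_ac)
    qed
    finally show ?thesis .
  qed
  have Z: "0 < (\<integral>b. W b \<partial>M)" "0 < (\<integral>b. W b \<partial>N)" using Z_ge exp_gt_zero[of "- (T + D)"] by linarith+
  have "log_mgf M \<gamma> d = ln (\<integral>b. W b \<partial>M)" "log_mgf N \<gamma> d = ln (\<integral>b. W b \<partial>N)"
    by (simp_all add: log_mgf_def W_def)
  then show ?thesis
    using *[OF Z_diff Z_ge(2) Z(1)] *[OF _ Z_ge(1) Z(2)] Z_diff by (simp add: abs_le_iff abs_minus_commute)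
qed

end

text \<open>The factor \<open>T + 2\<close> counts the tilted mean with weight
  \<open>\<gamma>\<close> and the log-mgf twice, at \<open>\<gamma>\<close> and at 0.\<close>

lemma laws_within_tilt_div:
  assumes M: "interval_law M" and N: "interval_law N" and within: "laws_within \<rho> M N"
    and g: "\<bar>\<gamma>\<bar> \<le> T" and d: "0 \<le> d" "d \<le> D"
  shows "\<bar>tilt_div M \<gamma> d - tilt_div N \<gamma> d\<bar> \<le> (T + 2) * (tilt_lip T D * \<rho>)"
proof -
  have "\<bar>\<gamma> * (tilt_mean M \<gamma> d - tilt_mean N \<gamma> d)\<bar> \<le> T * (tilt_lip T D * \<rho>)"
    unfolding abs_mult using laws_within_tilt_mean[OF assms] g by (intro mult_mono) auto
  moreover have "\<bar>0::real\<bar> \<le> T" using g by simp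
  ultimately show ?thesis
    using laws_within_log_mgf[OF assms] laws_within_log_mgf[OF M N within _ d, of 0 T]
    unfolding tilt_div_def by (simp add: abs_le_iff algebra_simps)
qed

section \<open>Gibbs measures and pinning\<close>

abbreviation Cube :: "nat set \<Rightarrow> (nat \<Rightarrow> real) set" where
  "Cube I \<equiv> PiE I (\<lambda>_. {-1..1})"

text \<open>Boundedness is asked only on the cube, which carries all the laws considered, because
  polynomials in the coordinates are unbounded off it.\<close>

definition obs :: "nat \<Rightarrow> ((nat \<Rightarrow> real) \<Rightarrow> real) \<Rightarrow> bool" where
  "obs p F \<longleftrightarrow> F \<in> borel_measurable (vec_space p) \<and> (\<exists>C. \<forall>\<beta>\<in>cube p. \<bar>F \<beta>\<bar> \<le> C)"

named_theorems obs_intros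

lemma obs_measurable [measurable_dest]: "obs p F \<Longrightarrow> F \<in> borel_measurable (vec_space p)"
  by (simp add: obs_def)

lemma obs_const [obs_intros]: "obs p (\<lambda>_. c)"
  by (auto simp: obs_def)

lemma obs_coord [obs_intros]: "i < p \<Longrightarrow> obs p (\<lambda>\<beta>. \<beta> i)"
  unfolding obs_def by (intro conjI exI[of _ 1]) (measurable, auto simp: PiE_iff abs_le_iff)

lemma obs_add [obs_intros]: "obs p F \<Longrightarrow> obs p G \<Longrightarrow> obs p (\<lambda>\<beta>. F \<beta> + G \<beta>)"
proof -
  assume *: "obs p F" "obs p G"
  then obtain C D where "\<forall>\<beta>\<in>cube p. \<bar>F \<beta>\<bar> \<le> C" "\<forall>\<beta>\<in>cube p. \<bar>G \<beta>\<bar> \<le> D" unfolding obs_def by blast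
  then have "\<forall>\<beta>\<in>cube p. \<bar>F \<beta> + G \<beta>\<bar> \<le> C + D" by (smt (verit))
  then show ?thesis using * unfolding obs_def by (blast intro: borel_measurable_add)
qed

lemma obs_mult [obs_intros]: "obs p F \<Longrightarrow> obs p G \<Longrightarrow> obs p (\<lambda>\<beta>. F \<beta> * G \<beta>)"
proof -
  assume *: "obs p F" "obs p G"
  then obtain C D where b: "\<forall>\<beta>\<in>cube p. \<bar>F \<beta>\<bar> \<le> C" "\<forall>\<beta>\<in>cube p. \<bar>G \<beta>\<bar> \<le> D" unfolding obs_def by blast
  have "\<bar>F \<beta> * G \<beta>\<bar> \<le> C * D" if "\<beta> \<in> cube p" for \<beta>
    unfolding abs_mult using b that abs_ge_zero[of "F \<beta>"] by (intro mult_mono) (auto intro: order_trans)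
  then show ?thesis using * unfolding obs_def by (blast intro: borel_measurable_times)
qed

lemma obs_cmult [obs_intros]: "obs p F \<Longrightarrow> obs p (\<lambda>\<beta>. c * F \<beta>)"
  by (intro obs_intros)

lemma obs_uminus [obs_intros]: "obs p F \<Longrightarrow> obs p (\<lambda>\<beta>. - F \<beta>)"
  by (simp add: obs_def)

lemma obs_diff [obs_intros]: "obs p F \<Longrightarrow> obs p G \<Longrightarrow> obs p (\<lambda>\<beta>. F \<beta> - G \<beta>)"
  using obs_add[OF _ obs_uminus, of p F G] by simp

lemma obs_power [obs_intros]: "obs p F \<Longrightarrow> obs p (\<lambda>\<beta>. F \<beta> ^ k)"
  by (induction k) (auto intro!: obs_intros)

lemma obs_sum [obs_intros]: "(\<And>i. i \<in> I \<Longrightarrow> obs p (F i)) \<Longrightarrow> obs p (\<lambda>\<beta>. \<Sum>i\<in>I. F i \<beta>)"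
  by (induction I rule: infinite_finite_induct) (auto intro!: obs_intros)

lemma obs_abs [obs_intros]: "obs p F \<Longrightarrow> obs p (\<lambda>\<beta>. \<bar>F \<beta>\<bar>)"
  by (auto simp: obs_def)

lemma obs_exp [obs_intros]: "obs p F \<Longrightarrow> obs p (\<lambda>\<beta>. exp (F \<beta>))"
proof -
  assume *: "obs p F"
  then obtain C where "\<forall>\<beta>\<in>cube p. \<bar>F \<beta>\<bar> \<le> C" unfolding obs_def by blast
  then have "\<forall>\<beta>\<in>cube p. \<bar>exp (F \<beta>)\<bar> \<le> exp C" by auto
  then show ?thesis using * unfolding obs_def by (blast intro: borel_measurable_exp measurable_compose)
qed

lemma obs_compose:
  assumes "g \<in> borel_measurable borel" "\<And>b. \<bar>b\<bar> \<le> 1 \<Longrightarrow> \<bar>g b\<bar> \<le> (B::real)" "i < p"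
  shows "obs p (\<lambda>\<beta>. g (\<beta> i))"
  unfolding obs_def
proof (intro conjI exI[of _ B] ballI)
  show "(\<lambda>\<beta>. g (\<beta> i)) \<in> borel_measurable (vec_space p)"
    using assms(3) by (intro measurable_compose[OF _ assms(1)] measurable_component_singleton) simp
  show "\<bar>g (\<beta> i)\<bar> \<le> B" if "\<beta> \<in> cube p" for \<beta>
    using that assms(3) by (intro assms(2)) (auto simp: PiE_iff abs_le_iff)
qed

lemma obs_bound:
  assumes "obs p F" obtains C where "0 \<le> C" "\<And>\<beta>. \<beta> \<in> cube p \<Longrightarrow> \<bar>F \<beta>\<bar> \<le> C"
proof -
  obtain C where "\<forall>\<beta>\<in>cube p. \<bar>F \<beta>\<bar> \<le> C" using assms unfolding obs_def by blast
  then show ?thesis by (intro that[of "max 0 C"]) (auto simp: le_max_iff_disj)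
qed

locale cube_law = prob_space P for P :: "(nat \<Rightarrow> real) measure" + fixes p :: nat
  assumes sets_P [measurable_cong]: "sets P = sets (vec_space p)"
    and AE_cube: "AE \<beta> in P. \<beta> \<in> cube p"
begin

lemma integrable_obs:
  assumes "obs p F" shows "integrable P F"
proof -
  obtain C where "\<And>\<beta>. \<beta> \<in> cube p \<Longrightarrow> \<bar>F \<beta>\<bar> \<le> C" using obs_bound[OF assms] by blast
  then show ?thesis
    using AE_cube obs_measurable[OF assms]
    by (intro integrable_const_bound[where B=C]) (auto elim: eventually_mono simp: measurable_cong_sets[OF sets_P refl])
qed

lemma integral_obs_mono:
  assumes "obs p F" "obs p G" "\<And>\<beta>. \<beta> \<in> cube p \<Longrightarrow> F \<beta> \<le> G \<beta>"
  shows "(\<integral>\<beta>. F \<beta> \<partial>P) \<le> (\<integral>\<beta>. G \<beta> \<partial>P)"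
  using assms AE_cube by (intro integral_mono_AE integrable_obs) (auto elim: eventually_mono)

declare prob_space [simp]

lemma integral_obs_nonneg:
  assumes "obs p F" "\<And>\<beta>. \<beta> \<in> cube p \<Longrightarrow> 0 \<le> F \<beta>"
  shows "0 \<le> (\<integral>\<beta>. F \<beta> \<partial>P)"
  using integral_obs_mono[of "\<lambda>_. 0" F] assms by (simp add: obs_const)

lemma abs_integral_obs:
  assumes "obs p F" shows "\<bar>\<integral>\<beta>. F \<beta> \<partial>P\<bar> \<le> (\<integral>\<beta>. \<bar>F \<beta>\<bar> \<partial>P)"
  by (rule integral_abs_bound)

lemma integral_obs_bound:
  assumes "obs p F" "\<And>\<beta>. \<beta> \<in> cube p \<Longrightarrow> \<bar>F \<beta>\<bar> \<le> C"
  shows "\<bar>\<integral>\<beta>. F \<beta> \<partial>P\<bar> \<le> C"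
proof -
  have "(\<integral>\<beta>. \<bar>F \<beta>\<bar> \<partial>P) \<le> (\<integral>\<beta>. C \<partial>P)" using assms by (intro integral_obs_mono obs_intros) auto
  then have "(\<integral>\<beta>. \<bar>F \<beta>\<bar> \<partial>P) \<le> C" by simp
  with abs_integral_obs[OF assms(1)] show ?thesis by linarith
qed

lemma exp_integral_le:
  assumes F: "obs p F" shows "exp (\<integral>\<beta>. F \<beta> \<partial>P) \<le> (\<integral>\<beta>. exp (F \<beta>) \<partial>P)"
proof -
  let ?a = "\<integral>\<beta>. F \<beta> \<partial>P"
  have i: "integrable P F" by (rule integrable_obs[OF F])
  have "exp ?a = (\<integral>\<beta>. exp ?a * (1 + (F \<beta> - ?a)) \<partial>P)" using i by simp
  also have "\<dots> \<le> (\<integral>\<beta>. exp (F \<beta>) \<partial>P)"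
  proof (intro integral_obs_mono obs_intros F)
    fix \<beta>
    have "exp ?a * (1 + (F \<beta> - ?a)) \<le> exp ?a * exp (F \<beta> - ?a)" by (intro mult_left_mono exp_ge_add_one_self) auto
    then show "exp ?a * (1 + (F \<beta> - ?a)) \<le> exp (F \<beta>)" by (simp flip: exp_add)
  qed
  finally show ?thesis .
qed

lemma square_integral_le:
  assumes F: "obs p F" shows "(\<integral>\<beta>. F \<beta> \<partial>P)\<^sup>2 \<le> (\<integral>\<beta>. (F \<beta>)\<^sup>2 \<partial>P)"
proof -
  let ?a = "\<integral>\<beta>. F \<beta> \<partial>P"
  have "0 \<le> (\<integral>\<beta>. (F \<beta> - ?a)\<^sup>2 \<partial>P)" by (intro integral_obs_nonneg obs_intros F) simp
  also have "\<dots> = (\<integral>\<beta>. (F \<beta>)\<^sup>2 - 2 * ?a * F \<beta> + ?a\<^sup>2 \<partial>P)" by (simp add: power2_diff algebra_simps)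
  also have "\<dots> = (\<integral>\<beta>. (F \<beta>)\<^sup>2 \<partial>P) - ?a\<^sup>2"
    using integrable_obs[OF F] integrable_obs[OF obs_power[OF F, of 2]] by (simp add: power2_eq_square)
  finally show ?thesis by simp
qed

lemma markov:
  assumes F: "obs p F" and nn: "\<And>\<beta>. \<beta> \<in> cube p \<Longrightarrow> 0 \<le> F \<beta>" and c: "0 < c"
  shows "measure P {\<beta> \<in> space P. c < F \<beta>} \<le> (\<integral>\<beta>. F \<beta> \<partial>P) / c"
proof -
  have [measurable]: "F \<in> borel_measurable P" using obs_measurable[OF F] by (simp add: measurable_cong_sets[OF sets_P refl])
  have "measure P {\<beta> \<in> space P. c < F \<beta>} \<le> measure P {\<beta> \<in> space P. c \<le> F \<beta>}"
    by (intro finite_measure_mono) auto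
  also have "\<dots> \<le> (\<integral>\<beta>. F \<beta> \<partial>P) / c"
    using AE_cube nn c by (intro integral_Markov_inequality_measure[where A="{}"] integrable_obs[OF F]) (auto elim: eventually_mono)
  finally show ?thesis .
qed

end

locale gibbs = interval_law \<mu> for \<mu> + fixes p :: nat and H :: "(nat \<Rightarrow> real) \<Rightarrow> real"
  assumes obs_H: "obs p H"
begin

abbreviation N :: "nat set \<Rightarrow> (nat \<Rightarrow> real) measure" where
  "N I \<equiv> Pi\<^sub>M I (\<lambda>_. \<mu>)"

lemma sets_N [measurable_cong]: "sets (N I) = sets (Pi\<^sub>M I (\<lambda>_. borel))"
  by (intro sets_PiM_cong) auto

sublocale prod: product_prob_space "\<lambda>_::nat. \<mu>" I for I
  by unfold_locales

lemma sigma_finite_N: "sigma_finite_measure (N I)"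
  by unfold_locales

lemma AE_Cube: "finite I \<Longrightarrow> AE x in N I. x \<in> Cube I"
proof -
  assume "finite I"
  then have "AE x in N I. \<forall>i\<in>I. \<bar>x i\<bar> \<le> 1"
    by (intro AE_finite_allI AE_PiM_component[where P="\<lambda>b. \<bar>b\<bar> \<le> 1"] AE_interval prob_space_axioms) auto
  moreover have "AE x in N I. x \<in> space (N I)" by simp
  ultimately show ?thesis by eventually_elim (auto simp: space_PiM PiE_iff abs_le_iff)
qed

definition mix :: "nat set \<Rightarrow> (nat \<Rightarrow> real) \<Rightarrow> (nat \<Rightarrow> real) \<Rightarrow> nat \<Rightarrow> real" where
  "mix S \<beta> x = (\<lambda>i\<in>{..<p}. if i \<in> S then \<beta> i else x i)"

definition pin_part :: "nat set \<Rightarrow> (nat \<Rightarrow> real) \<Rightarrow> real" where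
  "pin_part S \<beta> = (\<integral>x. exp (H (mix S \<beta> x)) \<partial>N ({..<p} - S))"

text \<open>A version of the conditional law of the Gibbs measure given the coordinates in
  \<open>S\<close>, usable at every \<open>\<beta>\<close> of the cube rather than almost
  everywhere. It lives on all \<open>p\<close> coordinates, those in \<open>S\<close> frozen at
  \<open>\<beta>\<close>.\<close>

definition pin :: "nat set \<Rightarrow> (nat \<Rightarrow> real) \<Rightarrow> (nat \<Rightarrow> real) measure" where
  "pin S \<beta> = distr (density (N ({..<p} - S)) (\<lambda>x. ennreal (exp (H (mix S \<beta> x)) / pin_part S \<beta>)))
     (vec_space p) (mix S \<beta>)"

lemma mix_measurable_pair [measurable]:
  "(\<lambda>(\<beta>, x). mix S \<beta> x) \<in> vec_space p \<Otimes>\<^sub>M Pi\<^sub>M ({..<p} - S) (\<lambda>_. borel) \<rightarrow>\<^sub>M vec_space p"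
proof -
  have "(\<lambda>w. \<lambda>i\<in>{..<p}. if i \<in> S then fst w i else snd w i)
      \<in> vec_space p \<Otimes>\<^sub>M Pi\<^sub>M ({..<p} - S) (\<lambda>_. borel) \<rightarrow>\<^sub>M vec_space p"
  proof (rule measurable_restrict)
    fix i assume "i \<in> {..<p}"
    then show "(\<lambda>w. if i \<in> S then fst w i else snd w i) \<in> borel_measurable (vec_space p \<Otimes>\<^sub>M Pi\<^sub>M ({..<p} - S) (\<lambda>_. borel))"
      by (cases "i \<in> S") (auto intro!: measurable_compose[OF measurable_fst] measurable_compose[OF measurable_snd] measurable_component_singleton)
  qed
  then show ?thesis by (simp add: mix_def case_prod_beta')
qed

lemma mix_measurable [measurable]:
  "mix S \<beta> \<in> Pi\<^sub>M ({..<p} - S) (\<lambda>_. borel) \<rightarrow>\<^sub>M vec_space p"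
  unfolding mix_def
proof (rule measurable_restrict)
  fix i assume "i \<in> {..<p}"
  then show "(\<lambda>x. if i \<in> S then \<beta> i else x i) \<in> borel_measurable (Pi\<^sub>M ({..<p} - S) (\<lambda>_. borel))"
    by (cases "i \<in> S") (auto intro!: measurable_component_singleton)
qed

lemma mix_Cube: "\<beta> \<in> cube p \<Longrightarrow> x \<in> Cube ({..<p} - S) \<Longrightarrow> mix S \<beta> x \<in> cube p"
  by (auto simp: mix_def PiE_iff)

lemma integrable_mix:
  assumes F: "obs p F" and \<beta>: "\<beta> \<in> cube p"
  shows "integrable (N ({..<p} - S)) (\<lambda>x. F (mix S \<beta> x))"
proof -
  obtain C where C: "\<And>\<beta>. \<beta> \<in> cube p \<Longrightarrow> \<bar>F \<beta>\<bar> \<le> C" using obs_bound[OF F] by blast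
  have [measurable]: "F \<in> borel_measurable (vec_space p)" by (rule obs_measurable[OF F])
  show ?thesis
    using AE_Cube[of "{..<p} - S"] C mix_Cube[OF \<beta>]
    by (intro prod.integrable_const_bound[where B=C]) (auto elim: eventually_mono)
qed

lemma pin_part_pos: "\<beta> \<in> cube p \<Longrightarrow> 0 < pin_part S \<beta>"
proof -
  assume \<beta>: "\<beta> \<in> cube p"
  obtain C where C: "\<And>\<beta>. \<beta> \<in> cube p \<Longrightarrow> \<bar>H \<beta>\<bar> \<le> C" using obs_bound[OF obs_H] by blast
  have "(\<integral>x. exp (- C) \<partial>N ({..<p} - S)) \<le> pin_part S \<beta>"
    unfolding pin_part_def
  proof (intro integral_mono_AE integrable_mix[OF obs_exp[OF obs_H] \<beta>])
    have "exp (- C) \<le> exp (H (mix S \<beta> x))" if "x \<in> Cube ({..<p} - S)" for x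
      using C[OF mix_Cube[OF \<beta> that]] by (simp add: abs_le_iff)
    then show "AE x in N ({..<p} - S). exp (- C) \<le> exp (H (mix S \<beta> x))"
      using AE_Cube[of "{..<p} - S"] by (auto elim: eventually_mono)
  qed simp
  then have "exp (- C) \<le> pin_part S \<beta>" by (simp add: prod.P.prob_space)
  then show ?thesis by (meson exp_gt_zero less_le_trans)
qed

lemma integral_pin:
  assumes F: "obs p F" and \<beta>: "\<beta> \<in> cube p"
  shows "(\<integral>\<beta>'. F \<beta>' \<partial>pin S \<beta>) = (\<integral>x. F (mix S \<beta> x) * exp (H (mix S \<beta> x)) \<partial>N ({..<p} - S)) / pin_part S \<beta>"
proof -
  have [measurable]: "F \<in> borel_measurable (vec_space p)" "H \<in> borel_measurable (vec_space p)"
    using obs_measurable F obs_H by auto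
  have "(\<integral>\<beta>'. F \<beta>' \<partial>pin S \<beta>) = (\<integral>x. exp (H (mix S \<beta> x)) / pin_part S \<beta> * F (mix S \<beta> x) \<partial>N ({..<p} - S))"
    unfolding pin_def using pin_part_pos[OF \<beta>, of S]
    by (subst integral_distr) (auto simp: integral_real_density)
  then show ?thesis by (simp add: mult.commute)
qed

lemma cube_law_pin:
  assumes \<beta>: "\<beta> \<in> cube p" shows "cube_law (pin S \<beta>) p"
proof -
  have [measurable]: "H \<in> borel_measurable (vec_space p)" using obs_measurable obs_H by auto
  let ?D = "density (N ({..<p} - S)) (\<lambda>x. ennreal (exp (H (mix S \<beta> x)) / pin_part S \<beta>))"
  have i: "integrable (N ({..<p} - S)) (\<lambda>x. exp (H (mix S \<beta> x)) / pin_part S \<beta>)"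
    using integrable_mix[OF obs_exp[OF obs_H] \<beta>] by simp
  have "(\<integral>x. exp (H (mix S \<beta> x)) / pin_part S \<beta> \<partial>N ({..<p} - S)) = 1"
    using pin_part_pos[OF \<beta>, of S] by (simp add: pin_part_def)
  then have "emeasure ?D (space ?D) = 1"
    using nn_integral_eq_integral[OF i] pin_part_pos[OF \<beta>, of S] by (simp add: emeasure_density cong: nn_integral_cong)
  then interpret D: prob_space ?D by (rule prob_spaceI)
  interpret P: prob_space "pin S \<beta>" unfolding pin_def by (rule D.prob_space_distr) simp
  show ?thesis
  proof
    show "sets (pin S \<beta>) = sets (vec_space p)" by (simp add: pin_def)
    have "AE x in N ({..<p} - S). mix S \<beta> x \<in> cube p"
      using AE_Cube[of "{..<p} - S"] mix_Cube[OF \<beta>] by (auto elim: eventually_mono)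
    then show "AE \<beta>' in pin S \<beta>. \<beta>' \<in> cube p"
      unfolding pin_def by (subst AE_distr_iff) (auto simp: AE_density)
  qed
qed

lemma AE_pin_agree: "\<beta> \<in> cube p \<Longrightarrow> S \<subseteq> {..<p} \<Longrightarrow> AE \<beta>' in pin S \<beta>. \<forall>i\<in>S. \<beta>' i = \<beta> i"
proof -
  assume \<beta>: "\<beta> \<in> cube p" and S: "S \<subseteq> {..<p}"
  have [measurable]: "H \<in> borel_measurable (vec_space p)" using obs_measurable obs_H by auto
  have f: "finite S" using S finite_subset by blast
  have "{x \<in> space (vec_space p). \<forall>i\<in>S. x i = \<beta> i} \<in> sets (vec_space p)"
    using f
  proof (intro sets.sets_Collect_finite_All)
    fix i assume "i \<in> S"
    then have "(\<lambda>x. x i) \<in> borel_measurable (vec_space p)" using S by (intro measurable_component_singleton) auto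
    from measurable_sets[OF this, of "{\<beta> i}"]
    show "{x \<in> space (vec_space p). x i = \<beta> i} \<in> sets (vec_space p)" by (simp add: vimage_def Int_def conj_commute)
  qed
  then show ?thesis
    unfolding pin_def using S by (subst AE_distr_iff) (auto simp: mix_def)
qed

lemma integral_pin_cong:
  assumes \<beta>: "\<beta> \<in> cube p" and S: "S \<subseteq> {..<p}" and F: "obs p F" and G: "obs p G"
    and eq: "\<And>\<beta>'. \<beta>' \<in> cube p \<Longrightarrow> (\<And>i. i \<in> S \<Longrightarrow> \<beta>' i = \<beta> i) \<Longrightarrow> F \<beta>' = G \<beta>'"
  shows "(\<integral>\<beta>'. F \<beta>' \<partial>pin S \<beta>) = (\<integral>\<beta>'. G \<beta>' \<partial>pin S \<beta>)"
proof -
  interpret P: cube_law "pin S \<beta>" p by (rule cube_law_pin[OF \<beta>])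
  show ?thesis
    using P.AE_cube AE_pin_agree[OF \<beta> S] eq P.integrable_obs[OF F] P.integrable_obs[OF G]
    by (intro integral_cong_AE) (auto elim!: eventually_elim2)
qed


text \<open>The Gibbs measure itself, of density proportional to \<open>e\<^sup>H\<close>.\<close>

abbreviation G :: "(nat \<Rightarrow> real) measure" where
  "G \<equiv> pin {} (\<lambda>i\<in>{..<p}. 0)"

lemma zero_cube: "(\<lambda>i\<in>{..<p}. 0) \<in> cube p" by auto

sublocale G: cube_law G p by (rule cube_law_pin[OF zero_cube])

lemma mix_empty: "x \<in> space (N {..<p}) \<Longrightarrow> mix {} \<beta> x = x"
  by (simp add: mix_def space_PiM PiE_restrict)

lemma integral_G:
  assumes F: "obs p F"
  shows "(\<integral>\<beta>. F \<beta> \<partial>G) = (\<integral>\<beta>. F \<beta> * exp (H \<beta>) \<partial>N {..<p}) / (\<integral>\<beta>. exp (H \<beta>) \<partial>N {..<p})"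
proof -
  have "(\<integral>x. f (mix {} (\<lambda>i\<in>{..<p}. 0) x) \<partial>N {..<p}) = (\<integral>x. f x \<partial>N {..<p})" for f :: "_ \<Rightarrow> real"
    by (rule Bochner_Integration.integral_cong) (simp_all add: mix_empty)
  from this[of "\<lambda>x. F x * exp (H x)"] this[of "\<lambda>x. exp (H x)"] show ?thesis
    unfolding integral_pin[OF F zero_cube] pin_part_def by simp
qed

text \<open>The conditional expectation given the coordinates in \<open>S\<close>. It is written as a quotient because
  \<open>pin S \<beta>\<close> is not a probability measure, and need not depend measurably on \<open>\<beta>\<close>, off the cube.\<close>

definition cexp :: "nat set \<Rightarrow> ((nat \<Rightarrow> real) \<Rightarrow> real) \<Rightarrow> (nat \<Rightarrow> real) \<Rightarrow> real" where
  "cexp S F \<beta> = (\<integral>x. F (mix S \<beta> x) * exp (H (mix S \<beta> x)) \<partial>N ({..<p} - S)) / pin_part S \<beta>"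

lemma cexp_eq: "obs p F \<Longrightarrow> \<beta> \<in> cube p \<Longrightarrow> cexp S F \<beta> = (\<integral>\<beta>'. F \<beta>' \<partial>pin S \<beta>)"
  by (simp add: cexp_def integral_pin)

lemma mix_cong: "(\<And>i. i \<in> S \<Longrightarrow> \<beta> i = \<beta>' i) \<Longrightarrow> mix S \<beta> = mix S \<beta>'"
  by (auto simp: mix_def fun_eq_iff)

lemma cexp_cong: "(\<And>i. i \<in> S \<Longrightarrow> \<beta> i = \<beta>' i) \<Longrightarrow> cexp S F \<beta> = cexp S F \<beta>'"
  unfolding cexp_def pin_part_def using mix_cong[of S \<beta> \<beta>'] by simp

lemma obs_cexp [obs_intros]:
  assumes F: "obs p F" shows "obs p (cexp S F)"
proof -
  have [measurable]: "F \<in> borel_measurable (vec_space p)" "H \<in> borel_measurable (vec_space p)"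
    using obs_measurable F obs_H by auto
  let ?R = "{..<p} - S"
  obtain C where C: "\<And>\<beta>. \<beta> \<in> cube p \<Longrightarrow> \<bar>F \<beta>\<bar> \<le> C" using obs_bound[OF F] by blast
  have m[measurable]: "(\<lambda>w. mix S (fst w) (snd w)) \<in> vec_space p \<Otimes>\<^sub>M N ?R \<rightarrow>\<^sub>M vec_space p"
    using mix_measurable_pair[of S] unfolding case_prod_beta'
    by (subst measurable_cong_sets[OF sets_pair_measure_cong[OF refl sets_N] refl])
  have 1: "(\<lambda>\<beta>. \<integral>x. F (mix S \<beta> x) * exp (H (mix S \<beta> x)) \<partial>N ?R) \<in> borel_measurable (vec_space p)"
    by (rule sigma_finite_measure.borel_measurable_lebesgue_integral[OF sigma_finite_N]) (simp add: case_prod_beta')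
  have 2: "pin_part S \<in> borel_measurable (vec_space p)"
    unfolding pin_part_def[abs_def] by (rule sigma_finite_measure.borel_measurable_lebesgue_integral[OF sigma_finite_N]) (simp add: case_prod_beta')
  have "\<bar>cexp S F \<beta>\<bar> \<le> C" if \<beta>: "\<beta> \<in> cube p" for \<beta>
  proof -
    interpret P: cube_law "pin S \<beta>" p by (rule cube_law_pin[OF \<beta>])
    show ?thesis unfolding cexp_eq[OF F \<beta>] by (rule P.integral_obs_bound[OF F C])
  qed
  then show ?thesis unfolding obs_def using borel_measurable_divide[OF 1 2] unfolding cexp_def[abs_def] by blast
qed

text \<open>Fubini's theorem splits the product into \<open>S\<close> and the rest. As
  \<open>cexp\<close> depends only on the coordinates in \<open>S\<close>, integrating the weight
  over the rest gives \<open>pin_part\<close>, which cancels the denominator.\<close>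

lemma tower:
  assumes F: "obs p F" and S: "S \<subseteq> {..<p}"
  shows "(\<integral>\<beta>. cexp S F \<beta> \<partial>G) = (\<integral>\<beta>. F \<beta> \<partial>G)"
proof -
  let ?R = "{..<p} - S" and ?m = "\<lambda>z x. merge S ({..<p} - S) (z, x)"
  have fin: "finite S" using S finite_subset by blast
  have un: "S \<union> ?R = {..<p}" using S by auto
  have mix_eq: "mix S z x = ?m z x" for z x
    using S by (auto simp: mix_def merge_def fun_eq_iff)
  have int: "integrable (N {..<p}) E" if E: "obs p E" for E
    using integrable_mix[OF E zero_cube, of "{}"] by (simp add: mix_empty cong: Bochner_Integration.integrable_cong)
  have fold: "(\<integral>\<beta>. E \<beta> \<partial>N {..<p}) = (\<integral>z. \<integral>x. E (?m z x) \<partial>N ?R \<partial>N S)" if E: "obs p E" for E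
    using prod.product_integral_fold[of S ?R E] int[OF E] fin un by simp
  have meas: "(\<lambda>z. \<integral>x. E (?m z x) \<partial>N ?R) \<in> borel_measurable (N S)" if E: "obs p E" for E
  proof -
    have e[measurable]: "E \<in> borel_measurable (N {..<p})"
      using obs_measurable[OF E] by (simp add: measurable_cong_sets[OF sets_N refl])
    have "merge S ?R \<in> N S \<Otimes>\<^sub>M N ?R \<rightarrow>\<^sub>M N {..<p}" using measurable_merge[of S ?R "\<lambda>_. \<mu>"] un by simp
    then have "(\<lambda>w. E (merge S ?R w)) \<in> borel_measurable (N S \<Otimes>\<^sub>M N ?R)" using e by (rule measurable_compose)
    then show ?thesis by (intro sigma_finite_measure.borel_measurable_lebesgue_integral[OF sigma_finite_N]) (simp add: case_prod_beta')
  qed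
  have oF: "obs p (\<lambda>\<beta>. F \<beta> * exp (H \<beta>))" and oC: "obs p (\<lambda>\<beta>. cexp S F \<beta> * exp (H \<beta>))"
    by (intro obs_intros F obs_H)+
  have pt: "(\<integral>x. cexp S F (?m z x) * exp (H (?m z x)) \<partial>N ?R) = (\<integral>x. F (?m z x) * exp (H (?m z x)) \<partial>N ?R)"
    if z: "z \<in> Cube S" for z
  proof -
    \<comment> \<open>Any cube point with the coordinates \<open>z\<close> on \<open>S\<close> would
      serve; it supplies the positivity of \<open>pin_part\<close>.\<close>
    let ?b = "?m z (\<lambda>i\<in>?R. 0)"
    have b: "?b \<in> cube p" using z S by (auto simp: merge_def PiE_iff extensional_def)
    have m: "?m (?m z x) y = ?m z y" for x y by (auto simp: merge_def fun_eq_iff)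
    have c: "cexp S F (?m z x) = cexp S F ?b" for x by (rule cexp_cong) (auto simp: merge_def)
    show ?thesis
      using pin_part_pos[OF b, of S] unfolding c cexp_def pin_part_def mix_eq m by simp
  qed
  have "(\<integral>\<beta>. cexp S F \<beta> * exp (H \<beta>) \<partial>N {..<p}) = (\<integral>\<beta>. F \<beta> * exp (H \<beta>) \<partial>N {..<p})"
    unfolding fold[OF oF] fold[OF oC]
  proof (rule integral_cong_AE[OF meas[OF oC] meas[OF oF]])
    show "AE z in N S. (\<integral>x. cexp S F (?m z x) * exp (H (?m z x)) \<partial>N ?R) = (\<integral>x. F (?m z x) * exp (H (?m z x)) \<partial>N ?R)"
      using AE_Cube[OF fin] pt by (auto elim: eventually_mono)
  qed
  then show ?thesis by (simp add: integral_G[OF F] integral_G[OF obs_cexp[OF F]])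
qed

section \<open>Conditional means and covariances, and the pinning argument\<close>

definition pmean :: "nat set \<Rightarrow> (nat \<Rightarrow> real) \<Rightarrow> nat \<Rightarrow> real" where
  "pmean S \<beta> i = cexp S (\<lambda>\<beta>. \<beta> i) \<beta>"

definition pcov :: "nat set \<Rightarrow> (nat \<Rightarrow> real) \<Rightarrow> nat \<Rightarrow> nat \<Rightarrow> real" where
  "pcov S \<beta> i j = cexp S (\<lambda>\<beta>. \<beta> i * \<beta> j) \<beta> - pmean S \<beta> i * pmean S \<beta> j"

text \<open>The potential of the pinning argument: it starts at most at \<open>p\<close>, is never
  negative, and drops with each revealed coordinate by the squared covariances with it.\<close>

definition pvar_sum :: "nat set \<Rightarrow> real" where
  "pvar_sum S = (\<integral>\<beta>. (\<Sum>i<p. (\<beta> i - pmean S \<beta> i)\<^sup>2) \<partial>G)"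

lemma obs_pmean [obs_intros]: "i < p \<Longrightarrow> obs p (\<lambda>\<beta>. pmean S \<beta> i)"
  unfolding pmean_def by (intro obs_intros)

lemma obs_pcov [obs_intros]: "i < p \<Longrightarrow> j < p \<Longrightarrow> obs p (\<lambda>\<beta>. pcov S \<beta> i j)"
  unfolding pcov_def by (intro obs_intros)

lemma pmean_cong: "(\<And>i. i \<in> S \<Longrightarrow> \<beta> i = \<beta>' i) \<Longrightarrow> pmean S \<beta> = pmean S \<beta>'"
  unfolding pmean_def by (intro ext cexp_cong) auto

lemma pcov_cong: "(\<And>i. i \<in> S \<Longrightarrow> \<beta> i = \<beta>' i) \<Longrightarrow> pcov S \<beta> = pcov S \<beta>'"
  unfolding pcov_def using pmean_cong[of S \<beta> \<beta>'] cexp_cong[of S \<beta> \<beta>'] by (intro ext) auto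

lemma pin_moments:
  assumes \<beta>: "\<beta> \<in> cube p" and i: "i < p" and j: "j < p"
  shows "(\<integral>b. b i \<partial>pin S \<beta>) = pmean S \<beta> i"
    "(\<integral>b. b i * b j \<partial>pin S \<beta>) = pcov S \<beta> i j + pmean S \<beta> i * pmean S \<beta> j"
    "(\<integral>b. (b i - pmean S \<beta> i) * (b j - pmean S \<beta> j) \<partial>pin S \<beta>) = pcov S \<beta> i j"
proof -
  interpret P: cube_law "pin S \<beta>" p by (rule cube_law_pin[OF \<beta>])
  have ob: "obs p (\<lambda>b. b i)" "obs p (\<lambda>b. b j)" "obs p (\<lambda>b. b i * b j)" using i j by (intro obs_intros; simp)+
  show 1: "(\<integral>b. b i \<partial>pin S \<beta>) = pmean S \<beta> i" unfolding pmean_def by (rule cexp_eq[symmetric, OF ob(1) \<beta>])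
  have m1: "(\<integral>b. b j \<partial>pin S \<beta>) = pmean S \<beta> j" unfolding pmean_def by (rule cexp_eq[symmetric, OF ob(2) \<beta>])
  show 2: "(\<integral>b. b i * b j \<partial>pin S \<beta>) = pcov S \<beta> i j + pmean S \<beta> i * pmean S \<beta> j"
    unfolding pcov_def using cexp_eq[OF ob(3) \<beta>, of S] by simp
  have "(\<integral>b. (b i - pmean S \<beta> i) * (b j - pmean S \<beta> j) \<partial>pin S \<beta>)
      = (\<integral>b. b i * b j - pmean S \<beta> j * b i - pmean S \<beta> i * b j + pmean S \<beta> i * pmean S \<beta> j \<partial>pin S \<beta>)"
    by (simp add: algebra_simps)
  also have "\<dots> = pcov S \<beta> i j"
    using P.integrable_obs[OF ob(1)] P.integrable_obs[OF ob(2)] P.integrable_obs[OF ob(3)] by (simp add: 1 m1 2)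
  finally show "(\<integral>b. (b i - pmean S \<beta> i) * (b j - pmean S \<beta> j) \<partial>pin S \<beta>) = pcov S \<beta> i j" .
qed

lemma pmean_bound: "\<beta> \<in> cube p \<Longrightarrow> i < p \<Longrightarrow> \<bar>pmean S \<beta> i\<bar> \<le> 1"
proof -
  assume \<beta>: "\<beta> \<in> cube p" and i: "i < p"
  interpret P: cube_law "pin S \<beta>" p by (rule cube_law_pin[OF \<beta>])
  show ?thesis
    unfolding pin_moments(1)[OF \<beta> i i, symmetric]
    using i by (intro P.integral_obs_bound obs_intros) (auto simp: PiE_iff abs_le_iff)
qed

lemma pvar_le: "\<beta> \<in> cube p \<Longrightarrow> i < p \<Longrightarrow> pcov S \<beta> i i \<le> 1"
proof -
  assume \<beta>: "\<beta> \<in> cube p" and i: "i < p"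
  interpret P: cube_law "pin S \<beta>" p by (rule cube_law_pin[OF \<beta>])
  have "(\<integral>b. b i * b i \<partial>pin S \<beta>) \<le> (\<integral>b. 1 \<partial>pin S \<beta>)"
    using i by (intro P.integral_obs_mono obs_intros)
      (auto simp: PiE_iff abs_le_iff abs_square_le_1 simp flip: power2_eq_square)
  then show ?thesis using pin_moments(2)[OF \<beta> i i, of S] zero_le_square[of "pmean S \<beta> i"]
    by (simp del: zero_le_square)
qed

text \<open>Given the coordinates in \<open>S\<close>, functions of these coordinates behave as
  constants. The two arguments of \<open>F\<close> separate the occurrences that may be frozen from
  those that are integrated.\<close>

lemma cexp_freeze:
  assumes \<beta>: "\<beta> \<in> cube p" and S: "S \<subseteq> {..<p}" and F: "obs p (\<lambda>b. F b b)" and F': "obs p (F \<beta>)"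
    and dep: "\<And>b. (\<And>i. i \<in> S \<Longrightarrow> b i = \<beta> i) \<Longrightarrow> F b b = F \<beta> b"
  shows "cexp S (\<lambda>b. F b b) \<beta> = (\<integral>b. F \<beta> b \<partial>pin S \<beta>)"
  unfolding cexp_eq[OF F \<beta>] by (rule integral_pin_cong[OF \<beta> S F F']) (rule dep)

lemma cexp_var:
  assumes \<beta>: "\<beta> \<in> cube p" and S: "S \<subseteq> {..<p}" and i: "i < p"
  shows "cexp S (\<lambda>b. (b i - pmean S b i)\<^sup>2) \<beta> = pcov S \<beta> i i"
proof -
  have "cexp S (\<lambda>b. (b i - pmean S b i)\<^sup>2) \<beta> = (\<integral>b. (b i - pmean S \<beta> i)\<^sup>2 \<partial>pin S \<beta>)"
  proof (rule cexp_freeze[OF \<beta> S, where F="\<lambda>b' b. (b i - pmean S b' i)\<^sup>2"])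
    fix b assume "\<And>i. i \<in> S \<Longrightarrow> b i = \<beta> i"
    then show "(b i - pmean S b i)\<^sup>2 = (b i - pmean S \<beta> i)\<^sup>2" using pmean_cong[of S b \<beta>] by simp
  qed (use i in \<open>intro obs_intros; simp\<close>)+
  then show ?thesis by (simp add: power2_eq_square pin_moments(3)[OF \<beta> i i])
qed

text \<open>Conditionally on \<open>S\<close>, the mean squared error of a constant is the variance
  plus the squared bias; then average with \<open>tower\<close>.\<close>

lemma best_predictor:
  assumes S: "S \<subseteq> {..<p}" and i: "i < p" and g: "obs p g"
    and dep: "\<And>\<beta> \<beta>'. (\<And>i. i \<in> S \<Longrightarrow> \<beta> i = \<beta>' i) \<Longrightarrow> g \<beta> = g \<beta>'"
  shows "(\<integral>\<beta>. (\<beta> i - pmean S \<beta> i)\<^sup>2 \<partial>G) \<le> (\<integral>\<beta>. (\<beta> i - g \<beta>)\<^sup>2 \<partial>G)"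
proof -
  have o1: "obs p (\<lambda>b. (b i - pmean S b i)\<^sup>2)" and o2: "obs p (\<lambda>b. (b i - g b)\<^sup>2)"
    using i g by (intro obs_intros; simp)+
  have "cexp S (\<lambda>b. (b i - pmean S b i)\<^sup>2) \<beta> \<le> cexp S (\<lambda>b. (b i - g b)\<^sup>2) \<beta>" if \<beta>: "\<beta> \<in> cube p" for \<beta>
  proof -
    interpret P: cube_law "pin S \<beta>" p by (rule cube_law_pin[OF \<beta>])
    let ?m = "pmean S \<beta> i" and ?g = "g \<beta>"
    have i1: "integrable (pin S \<beta>) (\<lambda>b. b i)" "integrable (pin S \<beta>) (\<lambda>b. b i * b i)"
      using i by (intro P.integrable_obs obs_intros; simp)+
    have e: "(\<integral>b. (b i - c)\<^sup>2 \<partial>pin S \<beta>) = pcov S \<beta> i i + (?m - c)\<^sup>2" for c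
    proof -
      have "(\<integral>b. (b i - c)\<^sup>2 \<partial>pin S \<beta>) = (\<integral>b. b i * b i - 2 * c * b i + c * c \<partial>pin S \<beta>)"
        by (simp add: power2_eq_square algebra_simps)
      also have "\<dots> = pcov S \<beta> i i + ?m * ?m - 2 * c * ?m + c * c"
        using i1 by (simp add: pin_moments[OF \<beta> i i])
      finally show ?thesis by (simp add: power2_eq_square algebra_simps)
    qed
    have "cexp S (\<lambda>b. (b i - g b)\<^sup>2) \<beta> = (\<integral>b. (b i - ?g)\<^sup>2 \<partial>pin S \<beta>)"
    proof (rule cexp_freeze[OF \<beta> S, where F="\<lambda>b' b. (b i - g b')\<^sup>2"])
      fix b assume "\<And>i. i \<in> S \<Longrightarrow> b i = \<beta> i"
      then show "(b i - g b)\<^sup>2 = (b i - g \<beta>)\<^sup>2" using dep[of b \<beta>] by simp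
    qed (use i g in \<open>intro obs_intros; simp\<close>)+
    then show ?thesis by (simp add: e cexp_var[OF \<beta> S i])
  qed
  then have "(\<integral>\<beta>. cexp S (\<lambda>b. (b i - pmean S b i)\<^sup>2) \<beta> \<partial>G) \<le> (\<integral>\<beta>. cexp S (\<lambda>b. (b i - g b)\<^sup>2) \<beta> \<partial>G)"
    by (intro G.integral_obs_mono obs_cexp o1 o2) auto
  then show ?thesis by (simp add: tower[OF o1 S] tower[OF o2 S])
qed

text \<open>Revealing \<open>\<beta>\<^sub>j\<close> lowers the residual variances by at least what linear regression on \<open>\<beta>\<^sub>j\<close> achieves.\<close>

lemma pvar_sum_insert:
  assumes S: "S \<subseteq> {..<p}" and j: "j < p"
  shows "pvar_sum (insert j S) \<le> pvar_sum S - (\<integral>\<beta>. (\<Sum>i<p. (pcov S \<beta> i j)\<^sup>2) \<partial>G)"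
proof -
  have S': "insert j S \<subseteq> {..<p}" using S j by auto
  have one: "(\<integral>\<beta>. (\<beta> i - pmean (insert j S) \<beta> i)\<^sup>2 \<partial>G) \<le> (\<integral>\<beta>. (\<beta> i - pmean S \<beta> i)\<^sup>2 \<partial>G) - (\<integral>\<beta>. (pcov S \<beta> i j)\<^sup>2 \<partial>G)"
    if i: "i < p" for i
  proof -
    \<comment> \<open>The slope is the covariance itself rather than covariance over variance. The
      variance of \<open>\<beta> j\<close> is at most 1, so the error still falls by the squared
      covariance, and no possibly vanishing variance is divided by.\<close>
    let ?g = "\<lambda>\<beta>. pmean S \<beta> i + pcov S \<beta> i j * (\<beta> j - pmean S \<beta> j)"
    have og: "obs p ?g" using i j by (intro obs_intros; simp)
    have dep: "?g \<beta> = ?g \<beta>'" if "\<And>i. i \<in> insert j S \<Longrightarrow> \<beta> i = \<beta>' i" for \<beta> \<beta>'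
      using pmean_cong[of S \<beta> \<beta>'] pcov_cong[of S \<beta> \<beta>'] that by simp
    have o1: "obs p (\<lambda>b. (b i - pmean S b i)\<^sup>2)" and o2: "obs p (\<lambda>b. (b i - ?g b)\<^sup>2)"
      using i j og by (intro obs_intros; simp)+
    have "(\<integral>\<beta>. (\<beta> i - ?g \<beta>)\<^sup>2 \<partial>G) = (\<integral>\<beta>. cexp S (\<lambda>b. (b i - ?g b)\<^sup>2) \<beta> \<partial>G)"
      by (simp add: tower[OF o2 S])
    also have "\<dots> \<le> (\<integral>\<beta>. cexp S (\<lambda>b. (b i - pmean S b i)\<^sup>2) \<beta> - (pcov S \<beta> i j)\<^sup>2 \<partial>G)"
    proof (intro G.integral_obs_mono)
      show "obs p (cexp S (\<lambda>b. (b i - ?g b)\<^sup>2))" by (rule obs_cexp[OF o2])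
      show "obs p (\<lambda>\<beta>. cexp S (\<lambda>b. (b i - pmean S b i)\<^sup>2) \<beta> - (pcov S \<beta> i j)\<^sup>2)"
        using obs_cexp[OF o1] i j by (intro obs_intros)
      fix \<beta> assume \<beta>: "\<beta> \<in> cube p"
      interpret P: cube_law "pin S \<beta>" p by (rule cube_law_pin[OF \<beta>])
      let ?mi = "pmean S \<beta> i" and ?mj = "pmean S \<beta> j" and ?c = "pcov S \<beta> i j"
      have o3: "obs p (\<lambda>b. (b i - (?mi + ?c * (b j - ?mj)))\<^sup>2)" using i j by (intro obs_intros; simp)
      have ij: "integrable (pin S \<beta>) (\<lambda>b. (b i - ?mi) * (b i - ?mi))" "integrable (pin S \<beta>) (\<lambda>b. (b i - ?mi) * (b j - ?mj))"
        "integrable (pin S \<beta>) (\<lambda>b. (b j - ?mj) * (b j - ?mj))"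
        using i j by (intro P.integrable_obs obs_intros; simp)+
      have "cexp S (\<lambda>b. (b i - ?g b)\<^sup>2) \<beta> = (\<integral>b. (b i - (?mi + ?c * (b j - ?mj)))\<^sup>2 \<partial>pin S \<beta>)"
      proof (rule cexp_freeze[OF \<beta> S, where F="\<lambda>b' b. (b i - (pmean S b' i + pcov S b' i j * (b j - pmean S b' j)))\<^sup>2"])
        fix b assume "\<And>i. i \<in> S \<Longrightarrow> b i = \<beta> i"
        then show "(b i - (pmean S b i + pcov S b i j * (b j - pmean S b j)))\<^sup>2
            = (b i - (?mi + ?c * (b j - ?mj)))\<^sup>2"
          using pmean_cong[of S b \<beta>] pcov_cong[of S b \<beta>] by simp
      qed (use o2 o3 in auto)
      also have "\<dots> = (\<integral>b. (b i - ?mi) * (b i - ?mi) - 2 * ?c * ((b i - ?mi) * (b j - ?mj)) + ?c\<^sup>2 * ((b j - ?mj) * (b j - ?mj)) \<partial>pin S \<beta>)"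
        by (rule Bochner_Integration.integral_cong) (simp_all add: power2_eq_square algebra_simps)
      also have "\<dots> = pcov S \<beta> i i - 2 * ?c * ?c + ?c\<^sup>2 * pcov S \<beta> j j"
        using ij by (simp add: pin_moments(3)[OF \<beta>] i j)
      also have "\<dots> \<le> pcov S \<beta> i i - ?c\<^sup>2"
        using mult_left_mono[OF pvar_le[OF \<beta> j, of S] zero_le_power2[of ?c]] by (simp add: power2_eq_square)
      also have "pcov S \<beta> i i = cexp S (\<lambda>b. (b i - pmean S b i)\<^sup>2) \<beta>"
        by (rule cexp_var[OF \<beta> S i, symmetric])
      finally show "cexp S (\<lambda>b. (b i - ?g b)\<^sup>2) \<beta> \<le> cexp S (\<lambda>b. (b i - pmean S b i)\<^sup>2) \<beta> - ?c\<^sup>2" .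
    qed
    also have "\<dots> = (\<integral>\<beta>. (\<beta> i - pmean S \<beta> i)\<^sup>2 \<partial>G) - (\<integral>\<beta>. (pcov S \<beta> i j)\<^sup>2 \<partial>G)"
      using G.integrable_obs[OF obs_cexp[OF o1, of S]] G.integrable_obs[OF obs_power[OF obs_pcov[OF i j, of S], of 2]]
      by (simp add: tower[OF o1 S])
    finally show ?thesis
      by (rule order_trans[rotated]) (rule best_predictor[OF S' i og], rule dep)
  qed
  have sum: "(\<integral>\<beta>. (\<Sum>i<p. F i \<beta>) \<partial>G) = (\<Sum>i<p. \<integral>\<beta>. F i \<beta> \<partial>G)" if "\<And>i. i < p \<Longrightarrow> obs p (F i)" for F
    using that by (intro Bochner_Integration.integral_sum G.integrable_obs) auto
  have "pvar_sum (insert j S) = (\<Sum>i<p. \<integral>\<beta>. (\<beta> i - pmean (insert j S) \<beta> i)\<^sup>2 \<partial>G)"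
    unfolding pvar_sum_def by (intro sum obs_intros)
  also have "\<dots> \<le> (\<Sum>i<p. (\<integral>\<beta>. (\<beta> i - pmean S \<beta> i)\<^sup>2 \<partial>G) - (\<integral>\<beta>. (pcov S \<beta> i j)\<^sup>2 \<partial>G))"
    using one by (intro sum_mono) simp
  also have "\<dots> = pvar_sum S - (\<integral>\<beta>. (\<Sum>i<p. (pcov S \<beta> i j)\<^sup>2) \<partial>G)"
    unfolding pvar_sum_def sum_subtractf using j by (subst (1 2) sum) (auto intro!: obs_intros)
  finally show ?thesis .
qed

lemma pvar_sum_empty: "pvar_sum {} \<le> real p"
proof -
  have "pvar_sum {} = (\<Sum>i<p. \<integral>\<beta>. (\<beta> i - pmean {} \<beta> i)\<^sup>2 \<partial>G)"
    unfolding pvar_sum_def by (intro Bochner_Integration.integral_sum G.integrable_obs obs_intros) auto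
  also have "\<dots> \<le> (\<Sum>i<p. 1)"
  proof (rule sum_mono)
    fix i assume "i \<in> {..<p}"
    then have i: "i < p" by simp
    have "(\<integral>\<beta>. (\<beta> i - pmean {} \<beta> i)\<^sup>2 \<partial>G) \<le> (\<integral>\<beta>. (\<beta> i - 0)\<^sup>2 \<partial>G)"
      using i by (intro best_predictor obs_intros) auto
    also have "\<dots> \<le> (\<integral>\<beta>. 1 \<partial>G)"
      using i by (intro G.integral_obs_mono obs_intros) (auto simp: PiE_iff abs_square_le_1 abs_le_iff)
    finally show "(\<integral>\<beta>. (\<beta> i - pmean {} \<beta> i)\<^sup>2 \<partial>G) \<le> 1" by simp
  qed
  finally show ?thesis by simp
qed

text \<open>Minimising \<open>pvar_sum S + \<eta> |S|\<close>, no further coordinate is worth revealing.\<close>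

lemma pinning:
  fixes \<eta> :: real
  assumes l: "0 < \<eta>"
  obtains S where "S \<subseteq> {..<p}" "\<eta> * card S \<le> real p"
    "(\<integral>\<beta>. (\<Sum>i<p. \<Sum>j<p. (pcov S \<beta> i j)\<^sup>2) \<partial>G) \<le> \<eta> * p"
proof -
  define \<Phi> where "\<Phi> S = pvar_sum S + \<eta> * card S" for S
  have "Min (\<Phi> ` Pow {..<p}) \<in> \<Phi> ` Pow {..<p}" by (rule Min_in) auto
  then obtain S where S: "S \<in> Pow {..<p}" "Min (\<Phi> ` Pow {..<p}) = \<Phi> S" by (rule imageE)
  have min: "\<Phi> S \<le> \<Phi> S'" if "S' \<in> Pow {..<p}" for S'
    unfolding S(2)[symmetric] using that by (intro Min_le) auto
  have S': "S \<subseteq> {..<p}" using S by simp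
  then have fin: "finite S" by (rule finite_subset) simp
  have "0 \<le> pvar_sum S"
    unfolding pvar_sum_def by (intro G.integral_obs_nonneg obs_intros sum_nonneg) auto
  \<comment> \<open>Comparison with revealing nothing, which costs at most \<open>p\<close>.\<close>
  then have c: "\<eta> * card S \<le> real p" using min[of "{}"] pvar_sum_empty by (simp add: \<Phi>_def)
  have col: "(\<integral>\<beta>. (\<Sum>i<p. (pcov S \<beta> i j)\<^sup>2) \<partial>G) \<le> \<eta>" if j: "j < p" for j
  proof -
    \<comment> \<open>One more coordinate costs at most \<open>\<eta>\<close>, so by minimality it
      cannot lower the residual variance by more; if \<open>j\<close> is already in
      \<open>S\<close>, the same comparison is with \<open>S\<close> itself.\<close>
    have "card (insert j S) \<le> card S + 1" using fin by (simp add: card_insert_if)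
    then have "\<eta> * card (insert j S) \<le> \<eta> * (card S + 1)" using l by (intro mult_left_mono) auto
    then show ?thesis using min[of "insert j S"] pvar_sum_insert[OF S' j] S' j by (simp add: \<Phi>_def algebra_simps)
  qed
  have "(\<integral>\<beta>. (\<Sum>i<p. \<Sum>j<p. (pcov S \<beta> i j)\<^sup>2) \<partial>G) = (\<integral>\<beta>. (\<Sum>j<p. \<Sum>i<p. (pcov S \<beta> i j)\<^sup>2) \<partial>G)"
    by (subst sum.swap) simp
  also have "\<dots> = (\<Sum>j<p. \<integral>\<beta>. (\<Sum>i<p. (pcov S \<beta> i j)\<^sup>2) \<partial>G)"
    by (intro Bochner_Integration.integral_sum G.integrable_obs obs_intros) auto
  also have "\<dots> \<le> (\<Sum>j<p. \<eta>)" using col by (intro sum_mono) simp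
  finally show ?thesis using c S' by (intro that[of S]) (simp_all add: mult.commute)
qed

text \<open>Used in two ways: under a product of tilts it is the variational lower bound for the
  partition function of the energy, and under the pinned posterior it is the Donsker--Varadhan
  inequality.\<close>

lemma gibbs_jensen:
  assumes Y: "obs p Y" and \<beta>: "\<beta> \<in> cube p"
  shows "(\<integral>b. Y b \<partial>pin S \<beta>) \<le> ln (\<integral>x. exp (Y (mix S \<beta> x) + H (mix S \<beta> x)) \<partial>N ({..<p} - S)) - ln (pin_part S \<beta>)"
proof -
  interpret P: cube_law "pin S \<beta>" p by (rule cube_law_pin[OF \<beta>])
  let ?I = "\<integral>x. exp (Y (mix S \<beta> x) + H (mix S \<beta> x)) \<partial>N ({..<p} - S)"
  have Z: "0 < pin_part S \<beta>" by (rule pin_part_pos[OF \<beta>])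
  have e: "exp (\<integral>b. Y b \<partial>pin S \<beta>) \<le> ?I / pin_part S \<beta>"
    using P.exp_integral_le[OF Y] unfolding integral_pin[OF obs_exp[OF Y] \<beta>] by (simp add: exp_add)
  then have "0 < ?I / pin_part S \<beta>" by (meson exp_gt_zero less_le_trans)
  then have I: "0 < ?I" using Z by (simp add: zero_less_divide_iff)
  have "(\<integral>b. Y b \<partial>pin S \<beta>) \<le> ln (?I / pin_part S \<beta>)"
    using e I Z by (subst ln_ge_iff) auto
  then show ?thesis using I Z by (simp add: ln_div)
qed

end

section \<open>Products of tilts, the energy and the objective\<close>

context interval_law
begin

text \<open>The log-density, with respect to the product of \<open>\<mu>\<close>, of the product of
  the tilts on the coordinates in \<open>R\<close>. It is normalised, so as a Gibbs energy it has
  partition function 1.\<close>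

definition log_tilt :: "(nat \<Rightarrow> real) \<Rightarrow> (nat \<Rightarrow> real) \<Rightarrow> nat set \<Rightarrow> (nat \<Rightarrow> real) \<Rightarrow> real" where
  "log_tilt t d R \<beta> = (\<Sum>i\<in>R. t i * \<beta> i - d i / 2 * (\<beta> i)\<^sup>2 - log_mgf \<mu> (t i) (d i))"

lemma integral_prod_log_tilt:
  assumes R: "finite R" and \<phi>: "\<And>i. i \<in> R \<Longrightarrow> \<phi> i \<in> borel_measurable borel"
    and bd: "\<And>i b. i \<in> R \<Longrightarrow> \<bar>b\<bar> \<le> 1 \<Longrightarrow> \<bar>\<phi> i b\<bar> \<le> (B :: real)"
  shows "(\<integral>x. (\<Prod>i\<in>R. \<phi> i (x i)) * exp (log_tilt t d R x) \<partial>Pi\<^sub>M R (\<lambda>_. \<mu>))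
    = (\<Prod>i\<in>R. \<integral>b. \<phi> i b \<partial>tilt \<mu> (t i) (d i))"
proof -
  interpret product_prob_space "\<lambda>_::nat. \<mu>" R by unfold_locales
  let ?f = "\<lambda>i b. \<phi> i b * exp (t i * b - d i / 2 * b\<^sup>2 - log_mgf \<mu> (t i) (d i))"
  have "(\<integral>x. (\<Prod>i\<in>R. \<phi> i (x i)) * exp (log_tilt t d R x) \<partial>Pi\<^sub>M R (\<lambda>_. \<mu>))
      = (\<integral>x. (\<Prod>i\<in>R. ?f i (x i)) \<partial>Pi\<^sub>M R (\<lambda>_. \<mu>))"
    unfolding log_tilt_def exp_sum[OF R] prod.distrib ..
  also have "\<dots> = (\<Prod>i\<in>R. \<integral>b. ?f i b \<partial>\<mu>)"
  proof (rule product_integral_prod[OF R])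
    fix i assume i: "i \<in> R"
    have [measurable]: "\<phi> i \<in> borel_measurable borel" by (rule \<phi>[OF i])
    have "integrable \<mu> (\<lambda>b. \<phi> i b * exp (t i * b - d i / 2 * b\<^sup>2) * exp (- log_mgf \<mu> (t i) (d i)))"
      by (intro integrable_mult_left integrable_weight[OF \<phi>[OF i] bd[OF i]])
    then show "integrable \<mu> (?f i)" by (simp only: mult.assoc exp_add[symmetric] diff_conv_add_uminus)
  qed
  also have "\<dots> = (\<Prod>i\<in>R. \<integral>b. \<phi> i b \<partial>tilt \<mu> (t i) (d i))"
    by (intro prod.cong refl integral_tilt[symmetric] \<phi>)
  finally show ?thesis .
qed

lemma measure_space_tilt [simp]: "measure (tilt \<mu> s e) (space (tilt \<mu> s e)) = 1"
proof -
  interpret t: interval_law "tilt \<mu> s e" by (rule interval_law_tilt)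
  show ?thesis by (rule t.prob_space)
qed

text \<open>The exponent is at most \<open>2 * \<bar>\<theta>\<bar>\<close>, which the bound on
  \<open>\<theta>\<close> keeps in the range of \<open>exp_quadratic_bound\<close>; the linear term
  is centred and integrates to 0.\<close>

lemma integral_exp_centered_tilt:
  fixes g :: "real \<Rightarrow> real" and \<theta> :: real
  assumes g[measurable]: "g \<in> borel_measurable borel" and bd: "\<And>b. \<bar>b\<bar> \<le> 1 \<Longrightarrow> \<bar>g b\<bar> \<le> 1" and \<theta>: "\<bar>\<theta>\<bar> \<le> 1 / 2"
  shows "(\<integral>b. exp (\<theta> * (g b - (\<integral>b. g b \<partial>tilt \<mu> t e))) \<partial>tilt \<mu> t e) \<le> exp (4 * \<theta>\<^sup>2)"
proof -
  interpret q: interval_law "tilt \<mu> t e" by (rule interval_law_tilt)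
  let ?e = "\<integral>b. g b \<partial>tilt \<mu> t e" and ?Q = "tilt \<mu> t e"
  have e: "\<bar>?e\<bar> \<le> 1" by (rule q.abs_integral_le[OF g bd])
  have ig: "integrable ?Q g" by (rule q.integrable_interval[OF g bd])
  have x: "\<bar>\<theta> * (g b - ?e)\<bar> \<le> \<bar>\<theta>\<bar> * 2" if "\<bar>b\<bar> \<le> 1" for b
    unfolding abs_mult using bd[OF that] e by (intro mult_left_mono) auto
  have "(\<integral>b. exp (\<theta> * (g b - ?e)) \<partial>?Q) \<le> (\<integral>b. 1 + \<theta> * (g b - ?e) + 4 * \<theta>\<^sup>2 \<partial>?Q)"
  proof (rule q.integral_mono_interval)
    show "integrable ?Q (\<lambda>b. exp (\<theta> * (g b - ?e)))"
    proof (rule q.integrable_interval[where B="exp 1"])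
      fix b :: real assume "\<bar>b\<bar> \<le> 1"
      then show "\<bar>exp (\<theta> * (g b - ?e))\<bar> \<le> exp 1" using x[of b] \<theta> by simp
    qed simp
    fix b :: real assume b: "\<bar>b\<bar> \<le> 1"
    have "\<bar>\<theta> * (g b - ?e)\<bar> \<le> 1" using x[OF b] \<theta> by linarith
    then have "exp (\<theta> * (g b - ?e)) \<le> 1 + \<theta> * (g b - ?e) + (\<theta> * (g b - ?e))\<^sup>2"
      using exp_quadratic_bound[of "\<theta> * (g b - ?e)"] by linarith
    also have "(\<theta> * (g b - ?e))\<^sup>2 \<le> (\<bar>\<theta>\<bar> * 2)\<^sup>2" using x[OF b] by (rule abs_le_square_iff[THEN iffD1, OF order_trans]) simp
    finally show "exp (\<theta> * (g b - ?e)) \<le> 1 + \<theta> * (g b - ?e) + 4 * \<theta>\<^sup>2" by (simp add: power_mult_distrib)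
  qed (use ig in simp)
  also have "\<dots> = 1 + 4 * \<theta>\<^sup>2" using ig by simp
  also have "\<dots> \<le> exp (4 * \<theta>\<^sup>2)" by (rule exp_ge_add_one_self)
  finally show ?thesis .
qed

end

definition bil :: "nat \<Rightarrow> (nat \<Rightarrow> nat \<Rightarrow> real) \<Rightarrow> (nat \<Rightarrow> real) \<Rightarrow> (nat \<Rightarrow> real) \<Rightarrow> real" where
  "bil p a x y = (\<Sum>i<p. \<Sum>j<p. x i * a i j * y j)"

definition lin :: "nat \<Rightarrow> (nat \<Rightarrow> real) \<Rightarrow> (nat \<Rightarrow> real) \<Rightarrow> real" where
  "lin p w x = (\<Sum>i<p. x i * w i)"

text \<open>The diagonal of the quadratic form is kept apart because it acts on single coordinates
  and is absorbed into the tilts; only the off-diagonal part couples coordinates.\<close>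

definition energy :: "nat \<Rightarrow> (nat \<Rightarrow> nat \<Rightarrow> real) \<Rightarrow> (nat \<Rightarrow> real) \<Rightarrow> (nat \<Rightarrow> real) \<Rightarrow> (nat \<Rightarrow> real) \<Rightarrow> real" where
  "energy p a d w \<beta> = - (1 / 2) * bil p a \<beta> \<beta> + lin p w \<beta> - (\<Sum>i<p. d i / 2 * (\<beta> i)\<^sup>2)"

definition mf_obj :: "nat \<Rightarrow> (nat \<Rightarrow> nat \<Rightarrow> real) \<Rightarrow> (nat \<Rightarrow> real) \<Rightarrow> (nat \<Rightarrow> real) \<Rightarrow> real measure \<Rightarrow> (nat \<Rightarrow> real) \<Rightarrow> real" where
  "mf_obj p a d w \<mu> u = - (1 / 2) * bil p a u u + lin p w u - (\<Sum>i<p. tilt_div \<mu> (tilt_param \<mu> (d i) (u i)) (d i))"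

abbreviation nrm :: "nat \<Rightarrow> (nat \<Rightarrow> real) \<Rightarrow> real" where
  "nrm p x \<equiv> L2_set x {..<p}"

section \<open>The mean-field approximation\<close>

text \<open>The deterministic problem for one observation: \<open>a\<close> is the off-diagonal
  matrix, \<open>w\<close> the score, and \<open>\<kappa>\<close> bounds the operator norm of
  \<open>a\<close>. The score is only bounded in mean square, which holds with high
  probability.\<close>

locale mf_system =
  fixes p :: nat and a :: "nat \<Rightarrow> nat \<Rightarrow> real" and d w :: "nat \<Rightarrow> real" and \<kappa> W D :: real
  assumes sym: "\<And>i j. i < p \<Longrightarrow> j < p \<Longrightarrow> a i j = a j i"
    and diag: "\<And>i. i < p \<Longrightarrow> a i i = 0"
    and d_nonneg: "\<And>i. i < p \<Longrightarrow> 0 \<le> d i" and d_le: "\<And>i. i < p \<Longrightarrow> d i \<le> D"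
    and op_bound: "\<And>x y. \<bar>bil p a x y\<bar> \<le> \<kappa> * nrm p x * nrm p y"
    and \<kappa>_nonneg: "0 \<le> \<kappa>" and W_nonneg: "0 \<le> W"
    and w_bound: "nrm p w \<le> W * sqrt (real p)"
begin

text \<open>Factored as a difference of squares, so that a change of the quadratic form is linear in
  the Euclidean distance of the arguments.\<close>

lemma bil_diff: "bil p a x x - bil p a y y = bil p a (\<lambda>i. x i - y i) (\<lambda>i. x i + y i)"
proof -
  have s: "bil p a x y = bil p a y x"
    unfolding bil_def by (subst sum.swap) (auto intro!: sum.cong simp: sym mult_ac)
  have "bil p a (\<lambda>i. x i - y i) (\<lambda>i. x i + y i) = bil p a x x + bil p a x y - bil p a y x - bil p a y y"
    unfolding bil_def by (simp add: algebra_simps sum.distrib sum_subtractf)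
  then show ?thesis by (simp add: s)
qed

lemma nrm_le_sqrt: "(\<And>i. i < p \<Longrightarrow> \<bar>x i\<bar> \<le> c) \<Longrightarrow> 0 \<le> c \<Longrightarrow> nrm p x \<le> c * sqrt p"
proof -
  assume x: "\<And>i. i < p \<Longrightarrow> \<bar>x i\<bar> \<le> c" and c: "0 \<le> c"
  have "nrm p x = L2_set (\<lambda>i. \<bar>x i\<bar>) {..<p}" by (simp add: L2_set_def)
  also have "\<dots> \<le> L2_set (\<lambda>_. c) {..<p}" using x by (intro L2_set_mono) auto
  also have "\<dots> = c * sqrt p" using c by (simp add: L2_set_constant)
  finally show ?thesis .
qed

lemma bil_change:
  assumes "\<And>i. i < p \<Longrightarrow> \<bar>x i\<bar> \<le> 1" "\<And>i. i < p \<Longrightarrow> \<bar>y i\<bar> \<le> 1"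
  shows "\<bar>bil p a x x - bil p a y y\<bar> \<le> 2 * \<kappa> * sqrt p * nrm p (\<lambda>i. x i - y i)"
proof -
  have "\<bar>x i + y i\<bar> \<le> 2" if "i < p" for i using assms(1)[OF that] assms(2)[OF that] by linarith
  then have n: "nrm p (\<lambda>i. x i + y i) \<le> 2 * sqrt p" by (intro nrm_le_sqrt) auto
  have "\<bar>bil p a x x - bil p a y y\<bar> \<le> \<kappa> * nrm p (\<lambda>i. x i - y i) * nrm p (\<lambda>i. x i + y i)"
    unfolding bil_diff by (rule op_bound)
  also have "\<dots> \<le> \<kappa> * nrm p (\<lambda>i. x i - y i) * (2 * sqrt p)"
    using n \<kappa>_nonneg by (intro mult_left_mono) auto
  finally show ?thesis by (simp add: mult_ac)
qed

lemma lin_change: "\<bar>lin p w x - lin p w y\<bar> \<le> W * sqrt p * nrm p (\<lambda>i. x i - y i)"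
proof -
  have "lin p w x - lin p w y = (\<Sum>i<p. (x i - y i) * w i)"
    by (simp add: lin_def sum_subtractf algebra_simps)
  also have "\<bar>\<dots>\<bar> \<le> (\<Sum>i<p. \<bar>x i - y i\<bar> * \<bar>w i\<bar>)"
    by (rule order_trans[OF sum_abs]) (simp add: abs_mult)
  also have "\<dots> \<le> nrm p (\<lambda>i. x i - y i) * nrm p w" by (rule L2_set_mult_ineq)
  also have "\<dots> \<le> nrm p (\<lambda>i. x i - y i) * (W * sqrt p)" using w_bound by (intro mult_left_mono) auto
  finally show ?thesis by (simp add: mult_ac)
qed

definition quad_err :: "real \<Rightarrow> real" where
  "quad_err e = (\<kappa> + W) * sqrt p * e"

lemma quad_change:
  assumes "\<And>i. i < p \<Longrightarrow> \<bar>x i\<bar> \<le> 1" "\<And>i. i < p \<Longrightarrow> \<bar>y i\<bar> \<le> 1" "nrm p (\<lambda>i. x i - y i) \<le> e"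
  shows "\<bar>(- (1 / 2) * bil p a x x + lin p w x) - (- (1 / 2) * bil p a y y + lin p w y)\<bar> \<le> quad_err e"
proof -
  have "\<bar>(- (1 / 2) * bil p a x x + lin p w x) - (- (1 / 2) * bil p a y y + lin p w y)\<bar>
      \<le> 1 / 2 * \<bar>bil p a x x - bil p a y y\<bar> + \<bar>lin p w x - lin p w y\<bar>"
    by (simp add: abs_if field_simps)
  also have "\<dots> \<le> (\<kappa> + W) * sqrt p * nrm p (\<lambda>i. x i - y i)"
    using bil_change[of x y] lin_change[of x y] assms by (simp add: algebra_simps)
  also have "\<dots> \<le> quad_err e"
    unfolding quad_err_def using assms(3) \<kappa>_nonneg W_nonneg by (intro mult_left_mono) auto
  finally show ?thesis .
qed

lemma obs_bil: "obs p (\<lambda>\<beta>. bil p a \<beta> \<beta>)"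
  unfolding bil_def by (intro obs_intros) auto

lemma obs_lin: "obs p (lin p w)"
  unfolding lin_def[abs_def] by (intro obs_intros) auto

lemma obs_energy: "obs p (energy p a d w)"
  unfolding energy_def[abs_def] by (intro obs_intros obs_bil obs_lin) auto

end

locale mf_law = mf_system + interval_law \<mu> for \<mu> +
  assumes nondeg: "nondegenerate \<mu>"
begin

sublocale gibbs \<mu> p "energy p a d w"
  by unfold_locales (rule obs_energy)

abbreviation "M \<equiv> mf_obj p a d w \<mu>"

abbreviation "c i t \<equiv> log_mgf \<mu> t (d i)"
abbreviation "m i t \<equiv> tilt_mean \<mu> t (d i)"
abbreviation "h i u \<equiv> tilt_param \<mu> (d i) u"

lemma obs_log_tilt: "R \<subseteq> {..<p} \<Longrightarrow> obs p (log_tilt t d R)"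
  unfolding log_tilt_def[abs_def] by (intro obs_intros) auto

lemma log_tilt_mix: "log_tilt t d ({..<p} - S) (mix S \<beta> x) = log_tilt t d ({..<p} - S) x"
  unfolding log_tilt_def by (rule sum.cong) (auto simp: mix_def)

lemma integral_exp_log_tilt: "(\<integral>x. exp (log_tilt t d ({..<p} - S) x) \<partial>N ({..<p} - S)) = 1"
proof -
  show ?thesis
    using integral_prod_log_tilt[of "{..<p} - S" "\<lambda>_ _. 1" 1 t d] by simp
qed

text \<open>Jensen's inequality for the product of tilts on the coordinates outside \<open>S\<close>; the off-diagonal
  form \<open>a\<close> only sees products of distinct, hence independent, coordinates.\<close>

lemma pin_part_lower:
  fixes t :: "nat \<Rightarrow> real"
  assumes \<beta>: "\<beta> \<in> cube p" and S: "S \<subseteq> {..<p}"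
  defines "x \<equiv> \<lambda>i. if i \<in> S then \<beta> i else m i (t i)"
  shows "- (1 / 2) * bil p a x x + lin p w x - (\<Sum>i\<in>S. d i / 2 * (\<beta> i)\<^sup>2)
      - (\<Sum>i\<in>{..<p} - S. t i * m i (t i) - c i (t i)) \<le> ln (pin_part S \<beta>)"
proof -
  let ?R = "{..<p} - S" and ?q = "log_tilt t d ({..<p} - S)"
  have fin: "finite ?R" by simp
  have oq: "obs p ?q" by (rule obs_log_tilt) auto
  interpret q: gibbs \<mu> p ?q by unfold_locales (rule oq)
  interpret Q: cube_law "q.pin S \<beta>" p by (rule q.cube_law_pin[OF \<beta>])
  have qZ: "q.pin_part S \<beta> = 1" unfolding q.pin_part_def log_tilt_mix by (rule integral_exp_log_tilt)
  have qE: "(\<integral>b. F b \<partial>q.pin S \<beta>) = (\<integral>x. F (mix S \<beta> x) * exp (?q x) \<partial>N ?R)" if "obs p F" for F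
    using q.integral_pin[OF that \<beta>] by (simp add: qZ log_tilt_mix)
  have E1: "(\<integral>b. b i \<partial>q.pin S \<beta>) = x i" if i: "i < p" for i
  proof (cases "i \<in> S")
    case True
    then show ?thesis
      using q.integral_pin_cong[OF \<beta> S obs_coord[OF i] obs_const[of p "\<beta> i"]] by (simp add: x_def)
  next
    case False
    then have iR: "i \<in> ?R" using i by simp
    \<comment> \<open>A coordinate is written as a product with trivial factors elsewhere, so that
      the product formula for the tilts applies; a pair of coordinates is treated likewise
      below.\<close>
    have "(\<integral>b. b i \<partial>q.pin S \<beta>) = (\<integral>x. (\<Prod>k\<in>?R. if k = i then x k else 1) * exp (?q x) \<partial>N ?R)"
      unfolding qE[OF obs_coord[OF i]] using iR by (simp add: mix_def prod.delta)
    also have "\<dots> = (\<Prod>k\<in>?R. \<integral>b. (if k = i then b else 1) \<partial>tilt \<mu> (t k) (d k))"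
      by (rule integral_prod_log_tilt[where B=1 and \<phi>="\<lambda>k b. if k = i then b else 1"]) auto
    also have "\<dots> = (\<Prod>k\<in>?R. if k = i then m i (t i) else 1)"
      by (intro prod.cong refl) (auto simp: tilt_mean_eq)
    also have "\<dots> = x i" using iR by (simp add: prod.delta x_def)
    finally show ?thesis .
  qed
  have E2: "(\<integral>b. b i * b j \<partial>q.pin S \<beta>) = x i * x j" if i: "i < p" and j: "j < p" and ij: "i \<noteq> j" for i j
  proof -
    have o2: "obs p (\<lambda>b. b i * b j)" using i j by (intro obs_intros)
    have oc: "obs p (\<lambda>b. s * b k)" if "k < p" for s k using that by (intro obs_intros)
    consider "i \<in> S" | "j \<in> S" | "i \<in> ?R" "j \<in> ?R" using i j by auto
    then show ?thesis
    proof cases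
      case 1
      have "(\<integral>b. b i * b j \<partial>q.pin S \<beta>) = (\<integral>b. \<beta> i * b j \<partial>q.pin S \<beta>)"
        using 1 by (intro q.integral_pin_cong[OF \<beta> S o2 oc[OF j]]) simp
      then show ?thesis using 1 E1[OF j] by (simp add: x_def)
    next
      case 2
      have "(\<integral>b. b i * b j \<partial>q.pin S \<beta>) = (\<integral>b. \<beta> j * b i \<partial>q.pin S \<beta>)"
        using 2 by (intro q.integral_pin_cong[OF \<beta> S o2 oc[OF i]]) simp
      then show ?thesis using 2 E1[OF i] by (simp add: x_def)
    next
      case 3
      have "(\<integral>b. b i * b j \<partial>q.pin S \<beta>)
          = (\<integral>x. (\<Prod>k\<in>?R. (if k = i then x k else 1) * (if k = j then x k else 1)) * exp (?q x) \<partial>N ?R)"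
        unfolding qE[OF o2] prod.distrib using 3 i j by (simp add: mix_def prod.delta)
      also have "\<dots> = (\<Prod>k\<in>?R. \<integral>b. (if k = i then b else 1) * (if k = j then b else 1) \<partial>tilt \<mu> (t k) (d k))"
        using ij by (intro integral_prod_log_tilt[where B=1 and \<phi>="\<lambda>k b. (if k = i then b else 1) * (if k = j then b else 1)"]) auto
      also have "\<dots> = (\<Prod>k\<in>?R. (if k = i then m i (t i) else 1) * (if k = j then m j (t j) else 1))"
        using ij by (intro prod.cong refl) (auto simp: tilt_mean_eq)
      also have "\<dots> = x i * x j" unfolding prod.distrib using 3 by (simp add: prod.delta x_def)
      finally show ?thesis .
    qed
  qed
  have Ebil: "(\<integral>b. bil p a b b \<partial>q.pin S \<beta>) = bil p a x x"
  proof -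
    have "(\<integral>b. bil p a b b \<partial>q.pin S \<beta>) = (\<Sum>i<p. \<Sum>j<p. \<integral>b. b i * a i j * b j \<partial>q.pin S \<beta>)"
      unfolding bil_def by (subst Bochner_Integration.integral_sum Bochner_Integration.integral_sum[OF Q.integrable_obs];
          auto intro!: Q.integrable_obs obs_intros Bochner_Integration.integral_sum sum.cong)+
    also have "\<dots> = (\<Sum>i<p. \<Sum>j<p. x i * a i j * x j)"
    proof (intro sum.cong refl)
      fix i j assume "i \<in> {..<p}" "j \<in> {..<p}"
      then show "(\<integral>b. b i * a i j * b j \<partial>q.pin S \<beta>) = x i * a i j * x j"
        using E2[of i j] by (cases "i = j") (simp_all add: diag mult.commute[of _ "a i j"] mult.assoc)
    qed
    finally show ?thesis by (simp add: bil_def)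
  qed
  have Elin: "(\<integral>b. lin p w b \<partial>q.pin S \<beta>) = lin p w x"
    unfolding lin_def by (subst Bochner_Integration.integral_sum) (auto intro!: Q.integrable_obs obs_intros simp: E1)
  \<comment> \<open>Outside \<open>S\<close> the quadratic terms of the energy and of the tilts
    cancel. What remains is affine there, so the first moments suffice.\<close>
  let ?rest = "\<lambda>b. (\<Sum>i<p. d i / 2 * (b i)\<^sup>2) + ?q b"
  have rest: "?rest b = (\<Sum>i\<in>S. d i / 2 * (b i)\<^sup>2) + (\<Sum>i\<in>?R. t i * b i - c i (t i))" for b
  proof -
    have "(\<Sum>i<p. d i / 2 * (b i)\<^sup>2) = (\<Sum>i\<in>S. d i / 2 * (b i)\<^sup>2) + (\<Sum>i\<in>?R. d i / 2 * (b i)\<^sup>2)"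
      using S by (simp add: sum.subset_diff)
    then show ?thesis unfolding log_tilt_def by (simp add: sum.distrib sum_subtractf)
  qed
  have Erest: "(\<integral>b. ?rest b \<partial>q.pin S \<beta>) = (\<Sum>i\<in>S. d i / 2 * (\<beta> i)\<^sup>2) + (\<Sum>i\<in>?R. t i * m i (t i) - c i (t i))"
  proof -
    have "(\<integral>b. ?rest b \<partial>q.pin S \<beta>) = (\<integral>b. (\<Sum>i\<in>S. d i / 2 * (\<beta> i)\<^sup>2) + (\<Sum>i\<in>?R. t i * b i - c i (t i)) \<partial>q.pin S \<beta>)"
      unfolding rest using S by (intro q.integral_pin_cong[OF \<beta> S] obs_intros) auto
    also have "\<dots> = (\<Sum>i\<in>S. d i / 2 * (\<beta> i)\<^sup>2) + (\<integral>b. (\<Sum>i\<in>?R. t i * b i - c i (t i)) \<partial>q.pin S \<beta>)"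
    proof -
      have "integrable (q.pin S \<beta>) (\<lambda>b. \<Sum>i\<in>?R. t i * b i - c i (t i))"
        by (intro Q.integrable_obs obs_intros) auto
      then show ?thesis by simp
    qed
    also have "(\<integral>b. (\<Sum>i\<in>?R. t i * b i - c i (t i)) \<partial>q.pin S \<beta>) = (\<Sum>i\<in>?R. \<integral>b. t i * b i - c i (t i) \<partial>q.pin S \<beta>)"
      by (intro Bochner_Integration.integral_sum Q.integrable_obs obs_intros) auto
    also have "\<dots> = (\<Sum>i\<in>?R. t i * (\<integral>b. b i \<partial>q.pin S \<beta>) - c i (t i))"
      using Q.integrable_obs[OF obs_coord] by (intro sum.cong) simp_all
    also have "\<dots> = (\<Sum>i\<in>?R. t i * m i (t i) - c i (t i))"
      by (rule sum.cong) (auto simp: E1 x_def)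
    finally show ?thesis .
  qed
  have oY: "obs p (\<lambda>b. energy p a d w b - ?q b)" by (intro obs_intros obs_energy oq)
  have "(\<integral>b. energy p a d w b - ?q b \<partial>q.pin S \<beta>) \<le> ln (pin_part S \<beta>)"
    using q.gibbs_jensen[OF oY \<beta>, of S] by (simp add: qZ pin_part_def)
  moreover have "(\<integral>b. energy p a d w b - ?q b \<partial>q.pin S \<beta>) = (\<integral>b. - (1 / 2) * bil p a b b + lin p w b - ?rest b \<partial>q.pin S \<beta>)"
    unfolding energy_def by (intro Bochner_Integration.integral_cong) auto
  moreover have "\<dots> = - (1 / 2) * bil p a x x + lin p w x - ((\<Sum>i\<in>S. d i / 2 * (\<beta> i)\<^sup>2) + (\<Sum>i\<in>?R. t i * m i (t i) - c i (t i)))"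
  proof -
    have "integrable (q.pin S \<beta>) ?rest" using oq by (intro Q.integrable_obs obs_intros) auto
    then show ?thesis using Q.integrable_obs[OF obs_bil] Q.integrable_obs[OF obs_lin] Erest Ebil Elin by simp
  qed
  ultimately show ?thesis by linarith
qed

lemma integral_pin_coord: "\<beta> \<in> cube p \<Longrightarrow> i < p \<Longrightarrow> (\<integral>b. b i \<partial>pin S \<beta>) = pmean S \<beta> i"
  by (rule pin_moments(1))

text \<open>\<open>tilt_param\<close> is meaningful only on the open range. The Gibbs density is
  positive, so a free coordinate has the same null sets as under \<open>\<mu>\<close>, and
  \<open>integral_in_mean_range\<close> applies.\<close>

lemma pmean_in_range:
  assumes \<beta>: "\<beta> \<in> cube p" and i: "i < p" "i \<notin> S"
  shows "pmean S \<beta> i \<in> mean_range \<mu>"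
proof -
  interpret P: cube_law "pin S \<beta>" p by (rule cube_law_pin[OF \<beta>])
  let ?R = "{..<p} - S"
  have iR: "i \<in> ?R" using i by simp
  have [measurable]: "energy p a d w \<in> borel_measurable (vec_space p)" by (rule obs_measurable[OF obs_energy])
  have [measurable]: "(\<lambda>b. b i) \<in> borel_measurable (pin S \<beta>)"
    using i by (subst measurable_cong_sets[OF P.sets_P refl]) (intro measurable_component_singleton, simp)
  let ?\<nu> = "distr (pin S \<beta>) borel (\<lambda>b. b i)"
  interpret \<nu>: prob_space ?\<nu> by (rule P.prob_space_distr) simp
  have AEpin: "(AE b in pin S \<beta>. Q (b i)) \<longleftrightarrow> (AE x in N ?R. Q (x i))" if Q: "{b. Q b} \<in> sets borel" for Q
  proof -
    have "(\<lambda>b. b i) \<in> borel_measurable (vec_space p)" using i by (intro measurable_component_singleton) simp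
    from measurable_sets[OF this Q] have "{b \<in> space (vec_space p). Q (b i)} \<in> sets (vec_space p)"
      by (simp add: vimage_def Int_def conj_commute)
    then have "(AE b in pin S \<beta>. Q (b i)) \<longleftrightarrow> (AE x in N ?R. Q (mix S \<beta> x i))"
      unfolding pin_def using pin_part_pos[OF \<beta>, of S]
      by (subst AE_distr_iff) (auto simp: AE_density)
    then show ?thesis using i by (simp add: mix_def)
  qed
  have "AE b in ?\<nu>. b \<in> {-1..1}"
    using P.AE_cube i by (subst AE_distr_iff) (auto elim!: eventually_mono simp: PiE_iff)
  then have "measure ?\<nu> {-1..1} = 1" using \<nu>.prob_eq_1[of "{-1..1}"] by simp
  then have law: "interval_law ?\<nu>"
    by (intro interval_law.intro interval_law_axioms.intro real_distribution.intro real_distribution_axioms.intro \<nu>.prob_space_axioms) auto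
  have "AE x in N ?R. Inf (supp \<mu>) \<le> x i \<and> x i \<le> Sup (supp \<mu>)"
    using iR by (intro AE_PiM_component[where P="\<lambda>b. Inf (supp \<mu>) \<le> b \<and> b \<le> Sup (supp \<mu>)"] AE_supp_bounds prob_space_axioms)
  moreover have "{b. Inf (supp \<mu>) \<le> b \<and> b \<le> Sup (supp \<mu>)} \<in> sets borel" by measurable
  ultimately have "AE b in pin S \<beta>. Inf (supp \<mu>) \<le> b i \<and> b i \<le> Sup (supp \<mu>)"
    using AEpin[of "\<lambda>b. Inf (supp \<mu>) \<le> b \<and> b \<le> Sup (supp \<mu>)"] by blast
  then have b: "AE b in ?\<nu>. Inf (supp \<mu>) \<le> b \<and> b \<le> Sup (supp \<mu>)"
    by (subst AE_distr_iff) auto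
  have ac: "AE b in \<mu>. b = k" if "AE b in ?\<nu>. b = k" for k
  proof -
    have "AE b in pin S \<beta>. b i = k" using that by (subst (asm) AE_distr_iff) auto
    then have *: "AE x in N ?R. x i = k" using AEpin[of "\<lambda>b. b = k"] by simp
    have distr: "distr (N ?R) \<mu> (\<lambda>x. x i) = \<mu>" by (rule prod.PiM_component[OF iR])
    have "(AE b in \<mu>. b = k) \<longleftrightarrow> (AE b in distr (N ?R) \<mu> (\<lambda>x. x i). b = k)" unfolding distr ..
    also have "\<dots> \<longleftrightarrow> (AE x in N ?R. x i = k)"
      using iR by (subst AE_distr_iff) (auto intro!: measurable_component_singleton)
    finally show ?thesis using * by simp
  qed
  have "pmean S \<beta> i = (\<integral>b. b \<partial>?\<nu>)"
    using pin_moments(1)[OF \<beta> i(1) i(1), of S] by (subst integral_distr) auto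
  then show ?thesis using integral_in_mean_range[OF nondeg law b ac] by simp
qed

lemma mean_range_bound: "u \<in> mean_range \<mu> \<Longrightarrow> \<bar>u\<bar> \<le> 1"
  using tilt_mean_surj[of u 0] abs_tilt_mean_le by auto

lemma mean_h: "i < p \<Longrightarrow> u \<in> mean_range \<mu> \<Longrightarrow> m i (h i u) = u"
  using mean_tilt_param[OF nondeg d_nonneg] .

text \<open>The relative entropy of the pinned posterior from the product of tilts with the
  conditional means, written as the mean difference of energies minus the log partition function.
  The tilts contribute no normaliser.\<close>

definition kl :: "nat set \<Rightarrow> (nat \<Rightarrow> real) \<Rightarrow> real" where
  "kl S \<beta> = (\<integral>b. energy p a d w b - log_tilt (\<lambda>i. h i (pmean S \<beta> i)) d ({..<p} - S) b \<partial>pin S \<beta>) - ln (pin_part S \<beta>)"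

text \<open>The conditional means, kept in the open box. A revealed value may be an end of the
  support, so a pinned coordinate takes the mean at parameter 0 instead, where the entropy
  vanishes.\<close>

definition vfill :: "nat set \<Rightarrow> (nat \<Rightarrow> real) \<Rightarrow> nat \<Rightarrow> real" where
  "vfill S \<beta> = (\<lambda>i\<in>{..<p}. if i \<in> S then m i 0 else pmean S \<beta> i)"

lemma donsker_varadhan:
  assumes F: "obs p F" and \<beta>: "\<beta> \<in> cube p"
  shows "(\<integral>b. F b \<partial>pin S \<beta>) \<le> kl S \<beta>
    + ln (\<integral>x. exp (F (mix S \<beta> x)) * exp (log_tilt (\<lambda>i. h i (pmean S \<beta> i)) d ({..<p} - S) x) \<partial>N ({..<p} - S))"
proof -
  let ?R = "{..<p} - S" and ?t = "\<lambda>i. h i (pmean S \<beta> i)"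
  interpret P: cube_law "pin S \<beta>" p by (rule cube_law_pin[OF \<beta>])
  have oq: "obs p (log_tilt ?t d ?R)" by (rule obs_log_tilt) auto
  have oE: "obs p (\<lambda>b. energy p a d w b - log_tilt ?t d ?R b)" by (intro obs_intros obs_energy oq)
  have "(\<integral>b. F b - (energy p a d w b - log_tilt ?t d ?R b) \<partial>pin S \<beta>)
      \<le> ln (\<integral>x. exp (F (mix S \<beta> x)) * exp (log_tilt ?t d ?R x) \<partial>N ?R) - ln (pin_part S \<beta>)"
    using gibbs_jensen[OF obs_diff[OF F oE] \<beta>, of S] by (simp add: log_tilt_mix exp_add)
  then show ?thesis
    unfolding kl_def using P.integrable_obs[OF F] P.integrable_obs[OF oE] by simp
qed

lemma kl_nonneg: "\<beta> \<in> cube p \<Longrightarrow> 0 \<le> kl S \<beta>"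
  using donsker_varadhan[of "\<lambda>_. 0" \<beta> S] by (simp add: obs_const integral_exp_log_tilt)

text \<open>Donsker--Varadhan for \<open>\<theta>\<close> times the absolute deviation. Splitting
  the exponential of an absolute value into both signs costs \<open>ln 2\<close>; independence and
  \<open>integral_exp_centered_tilt\<close> give \<open>4 * \<theta>\<^sup>2\<close> per
  coordinate.\<close>

lemma concentration:
  assumes \<beta>: "\<beta> \<in> cube p" and g: "\<And>i. i < p \<Longrightarrow> g i \<in> borel_measurable borel"
    and bd: "\<And>i b. i < p \<Longrightarrow> \<bar>b\<bar> \<le> 1 \<Longrightarrow> \<bar>g i b\<bar> \<le> (1::real)" and \<theta>: "0 < \<theta>" "\<theta> \<le> 1 / 2"
  shows "\<theta> * (\<integral>b. \<bar>\<Sum>i\<in>{..<p} - S. g i (b i) - (\<integral>s. g i s \<partial>tilt \<mu> (h i (pmean S \<beta> i)) (d i))\<bar> \<partial>pin S \<beta>)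
    \<le> kl S \<beta> + ln 2 + 4 * \<theta>\<^sup>2 * p"
proof -
  let ?R = "{..<p} - S" and ?t = "\<lambda>i. h i (pmean S \<beta> i)"
  let ?e = "\<lambda>i. \<integral>s. g i s \<partial>tilt \<mu> (?t i) (d i)"
  let ?X = "\<lambda>b. \<Sum>i\<in>?R. g i (b i) - ?e i" and ?q = "log_tilt ?t d ?R"
  have oX: "obs p ?X" using g bd by (intro obs_intros obs_compose) auto
  have oq: "obs p ?q" by (rule obs_log_tilt) auto
  have Xmix: "?X (mix S \<beta> x) = ?X x" for x by (rule sum.cong) (auto simp: mix_def)
  have side: "(\<integral>x. exp (s * ?X x) * exp (?q x) \<partial>N ?R) \<le> exp (4 * \<theta>\<^sup>2 * p)" if s: "s = \<theta> \<or> s = - \<theta>" for s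
  proof -
    have "(\<integral>x. exp (s * ?X x) * exp (?q x) \<partial>N ?R) = (\<integral>x. (\<Prod>i\<in>?R. exp (s * (g i (x i) - ?e i))) * exp (?q x) \<partial>N ?R)"
      by (simp add: sum_distrib_left exp_sum)
    also have "\<dots> = (\<Prod>i\<in>?R. \<integral>b. exp (s * (g i b - ?e i)) \<partial>tilt \<mu> (?t i) (d i))"
    proof (rule integral_prod_log_tilt[where B="exp (\<theta> * 2)" and \<phi>="\<lambda>i b. exp (s * (g i b - ?e i))"])
      fix i assume i: "i \<in> ?R"
      then have [measurable]: "g i \<in> borel_measurable borel" using g by simp
      show "(\<lambda>b. exp (s * (g i b - ?e i))) \<in> borel_measurable borel" by measurable
      fix b :: real assume b: "\<bar>b\<bar> \<le> 1"
      interpret q: interval_law "tilt \<mu> (?t i) (d i)" by (rule interval_law_tilt)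
      have "\<bar>?e i\<bar> \<le> 1" using i by (intro q.abs_integral_le bd) auto
      then have "\<bar>g i b - ?e i\<bar> \<le> 2" using bd[of i b] b i by auto
      then have "\<bar>s * (g i b - ?e i)\<bar> \<le> \<theta> * 2" unfolding abs_mult using s \<theta> by (intro mult_mono) auto
      then show "\<bar>exp (s * (g i b - ?e i))\<bar> \<le> exp (\<theta> * 2)" by simp
    qed simp
    also have "\<dots> \<le> (\<Prod>i\<in>?R. exp (4 * \<theta>\<^sup>2))"
    proof (rule prod_mono, intro conjI)
      fix i assume i: "i \<in> ?R"
      show "0 \<le> (\<integral>b. exp (s * (g i b - ?e i)) \<partial>tilt \<mu> (?t i) (d i))"
        by (rule Bochner_Integration.integral_nonneg) simp
      have "(\<integral>b. exp (s * (g i b - ?e i)) \<partial>tilt \<mu> (?t i) (d i)) \<le> exp (4 * s\<^sup>2)"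
        using i s \<theta> by (intro integral_exp_centered_tilt g bd) auto
      then show "(\<integral>b. exp (s * (g i b - ?e i)) \<partial>tilt \<mu> (?t i) (d i)) \<le> exp (4 * \<theta>\<^sup>2)" using s by auto
    qed
    also have "\<dots> = exp (card ?R * (4 * \<theta>\<^sup>2))" by (simp add: exp_of_nat_mult)
    also have "\<dots> \<le> exp (4 * \<theta>\<^sup>2 * p)"
    proof -
      have "card ?R \<le> p" using card_mono[of "{..<p}" ?R] by simp
      then have "real (card ?R) * (4 * \<theta>\<^sup>2) \<le> real p * (4 * \<theta>\<^sup>2)" by (intro mult_right_mono) auto
      then show ?thesis by (simp add: mult.commute)
    qed
    finally show ?thesis .
  qed
  have int: "integrable (N ?R) (\<lambda>x. exp (s * ?X x) * exp (?q x))" for s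
    using integrable_mix[OF obs_mult[OF obs_exp[OF obs_cmult[OF oX]] obs_exp[OF oq]] \<beta>, of S s] unfolding Xmix log_tilt_mix .
  have intabs: "integrable (N ?R) (\<lambda>x. exp (\<theta> * \<bar>?X x\<bar>) * exp (?q x))"
    using integrable_mix[OF obs_mult[OF obs_exp[OF obs_cmult[OF obs_abs[OF oX]]] obs_exp[OF oq]] \<beta>, of S \<theta>] unfolding Xmix log_tilt_mix .
  have ub: "(\<integral>x. exp (\<theta> * \<bar>?X x\<bar>) * exp (?q x) \<partial>N ?R) \<le> 2 * exp (4 * \<theta>\<^sup>2 * p)"
  proof -
    have "(\<integral>x. exp (\<theta> * \<bar>?X x\<bar>) * exp (?q x) \<partial>N ?R) \<le> (\<integral>x. exp (\<theta> * ?X x) * exp (?q x) + exp (- \<theta> * ?X x) * exp (?q x) \<partial>N ?R)"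
    proof (rule integral_mono[OF intabs Bochner_Integration.integrable_add[OF int int]])
      fix x
      have "exp (\<theta> * \<bar>?X x\<bar>) \<le> exp (\<theta> * ?X x) + exp (- \<theta> * ?X x)" by (cases "0 \<le> ?X x") (auto simp: abs_if)
      then have "exp (\<theta> * \<bar>?X x\<bar>) * exp (?q x) \<le> (exp (\<theta> * ?X x) + exp (- \<theta> * ?X x)) * exp (?q x)"
        by (rule mult_right_mono) simp
      then show "exp (\<theta> * \<bar>?X x\<bar>) * exp (?q x) \<le> exp (\<theta> * ?X x) * exp (?q x) + exp (- \<theta> * ?X x) * exp (?q x)"
        by (simp add: distrib_right)
    qed
    also have "\<dots> = (\<integral>x. exp (\<theta> * ?X x) * exp (?q x) \<partial>N ?R) + (\<integral>x. exp (- \<theta> * ?X x) * exp (?q x) \<partial>N ?R)"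
      by (rule Bochner_Integration.integral_add[OF int int])
    also have "\<dots> \<le> exp (4 * \<theta>\<^sup>2 * p) + exp (4 * \<theta>\<^sup>2 * p)" by (intro add_mono side) auto
    finally show ?thesis by simp
  qed
  have "1 \<le> (\<integral>x. exp (\<theta> * \<bar>?X x\<bar>) * exp (?q x) \<partial>N ?R)"
  proof -
    have "(\<integral>x. exp (?q x) \<partial>N ?R) \<le> (\<integral>x. exp (\<theta> * \<bar>?X x\<bar>) * exp (?q x) \<partial>N ?R)"
      using int[of 0] \<theta> by (intro integral_mono intabs) auto
    then show ?thesis by (simp add: integral_exp_log_tilt)
  qed
  then have "ln (\<integral>x. exp (\<theta> * \<bar>?X x\<bar>) * exp (?q x) \<partial>N ?R) \<le> ln (2 * exp (4 * \<theta>\<^sup>2 * p))"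
    using ub by (subst ln_le_cancel_iff) auto
  also have "\<dots> = ln 2 + 4 * \<theta>\<^sup>2 * p" by (simp add: ln_mult)
  finally have L: "ln (\<integral>x. exp (\<theta> * \<bar>?X x\<bar>) * exp (?q x) \<partial>N ?R) \<le> ln 2 + 4 * \<theta>\<^sup>2 * p" .
  have "(\<integral>b. \<theta> * \<bar>?X b\<bar> \<partial>pin S \<beta>) \<le> kl S \<beta> + ln (\<integral>x. exp (\<theta> * \<bar>?X x\<bar>) * exp (?q x) \<partial>N ?R)"
    using donsker_varadhan[OF obs_cmult[OF obs_abs[OF oX], of \<theta>] \<beta>, of S] unfolding Xmix .
  then show ?thesis using L by simp
qed

lemma integral_bil_pin:
  assumes \<beta>: "\<beta> \<in> cube p"
  shows "(\<integral>b. bil p a b b \<partial>pin S \<beta>) = bil p a (pmean S \<beta>) (pmean S \<beta>) + (\<Sum>i<p. \<Sum>j<p. a i j * pcov S \<beta> i j)"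
proof -
  interpret P: cube_law "pin S \<beta>" p by (rule cube_law_pin[OF \<beta>])
  have "(\<integral>b. bil p a b b \<partial>pin S \<beta>) = (\<Sum>i<p. \<integral>b. (\<Sum>j<p. b i * a i j * b j) \<partial>pin S \<beta>)"
    unfolding bil_def by (intro Bochner_Integration.integral_sum P.integrable_obs obs_intros) auto
  also have "\<dots> = (\<Sum>i<p. \<Sum>j<p. \<integral>b. b i * a i j * b j \<partial>pin S \<beta>)"
    by (intro sum.cong refl Bochner_Integration.integral_sum P.integrable_obs obs_intros) auto
  also have "\<dots> = (\<Sum>i<p. \<Sum>j<p. pmean S \<beta> i * a i j * pmean S \<beta> j + a i j * pcov S \<beta> i j)"
  proof (intro sum.cong refl)
    fix i j assume ij: "i \<in> {..<p}" "j \<in> {..<p}"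
    have "(\<integral>b. b i * a i j * b j \<partial>pin S \<beta>) = a i j * (\<integral>b. b i * b j \<partial>pin S \<beta>)"
      by (simp add: mult.commute[of _ "a i j"] mult.assoc)
    then show "(\<integral>b. b i * a i j * b j \<partial>pin S \<beta>) = pmean S \<beta> i * a i j * pmean S \<beta> j + a i j * pcov S \<beta> i j"
      using ij by (simp add: pin_moments(2)[OF \<beta>] algebra_simps)
  qed
  finally show ?thesis by (simp add: bil_def sum.distrib)
qed

lemma integral_energy_pin:
  assumes \<beta>: "\<beta> \<in> cube p" and S: "S \<subseteq> {..<p}"
  defines "v \<equiv> pmean S \<beta>"
  shows "(\<integral>b. energy p a d w b - log_tilt t d ({..<p} - S) b \<partial>pin S \<beta>)
    = - (1 / 2) * (bil p a v v + (\<Sum>i<p. \<Sum>j<p. a i j * pcov S \<beta> i j)) + lin p w v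
      - (\<Sum>i\<in>S. d i / 2 * (\<beta> i)\<^sup>2) - (\<Sum>i\<in>{..<p} - S. t i * v i - c i (t i))"
proof -
  let ?R = "{..<p} - S" and ?q = "log_tilt t d ({..<p} - S)"
  interpret P: cube_law "pin S \<beta>" p by (rule cube_law_pin[OF \<beta>])
  have oq: "obs p ?q" by (rule obs_log_tilt) auto
  have Elin: "(\<integral>b. lin p w b \<partial>pin S \<beta>) = lin p w v"
    unfolding lin_def v_def
    by (subst Bochner_Integration.integral_sum) (auto intro!: P.integrable_obs obs_intros sum.cong simp: pin_moments(1)[OF \<beta>])
  let ?rest = "\<lambda>b. (\<Sum>i<p. d i / 2 * (b i)\<^sup>2) + ?q b"
  have rest: "?rest b = (\<Sum>i\<in>S. d i / 2 * (b i)\<^sup>2) + (\<Sum>i\<in>?R. t i * b i - c i (t i))" for b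
  proof -
    have "(\<Sum>i<p. d i / 2 * (b i)\<^sup>2) = (\<Sum>i\<in>S. d i / 2 * (b i)\<^sup>2) + (\<Sum>i\<in>?R. d i / 2 * (b i)\<^sup>2)"
      using S by (simp add: sum.subset_diff)
    then show ?thesis unfolding log_tilt_def by (simp add: sum.distrib sum_subtractf)
  qed
  have Erest: "(\<integral>b. ?rest b \<partial>pin S \<beta>) = (\<Sum>i\<in>S. d i / 2 * (\<beta> i)\<^sup>2) + (\<Sum>i\<in>?R. t i * v i - c i (t i))"
  proof -
    have "(\<integral>b. ?rest b \<partial>pin S \<beta>) = (\<integral>b. (\<Sum>i\<in>S. d i / 2 * (\<beta> i)\<^sup>2) + (\<Sum>i\<in>?R. t i * b i - c i (t i)) \<partial>pin S \<beta>)"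
      unfolding rest using S by (intro integral_pin_cong[OF \<beta> S] obs_intros) auto
    also have "\<dots> = (\<Sum>i\<in>S. d i / 2 * (\<beta> i)\<^sup>2) + (\<integral>b. (\<Sum>i\<in>?R. t i * b i - c i (t i)) \<partial>pin S \<beta>)"
    proof -
      have "integrable (pin S \<beta>) (\<lambda>b. \<Sum>i\<in>?R. t i * b i - c i (t i))"
        by (intro P.integrable_obs obs_intros) auto
      then show ?thesis by simp
    qed
    also have "(\<integral>b. (\<Sum>i\<in>?R. t i * b i - c i (t i)) \<partial>pin S \<beta>) = (\<Sum>i\<in>?R. \<integral>b. t i * b i - c i (t i) \<partial>pin S \<beta>)"
      by (intro Bochner_Integration.integral_sum P.integrable_obs obs_intros) auto
    also have "\<dots> = (\<Sum>i\<in>?R. t i * v i - c i (t i))"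
      using P.integrable_obs[OF obs_coord] by (intro sum.cong) (auto simp: integral_pin_coord[OF \<beta>] v_def)
    finally show ?thesis .
  qed
  have "(\<integral>b. energy p a d w b - ?q b \<partial>pin S \<beta>) = (\<integral>b. - (1 / 2) * bil p a b b + lin p w b - ?rest b \<partial>pin S \<beta>)"
    unfolding energy_def by (intro Bochner_Integration.integral_cong) auto
  also have "\<dots> = - (1 / 2) * (\<integral>b. bil p a b b \<partial>pin S \<beta>) + lin p w v - (\<integral>b. ?rest b \<partial>pin S \<beta>)"
  proof -
    have "integrable (pin S \<beta>) ?rest" using oq by (intro P.integrable_obs obs_intros) auto
    then show ?thesis using P.integrable_obs[OF obs_bil] P.integrable_obs[OF obs_lin] Elin by simp
  qed
  finally show ?thesis unfolding integral_bil_pin[OF \<beta>] Erest v_def by linarith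
qed

lemma vfill_mean_box:
  assumes "\<beta> \<in> cube p" shows "vfill S \<beta> \<in> mean_box \<mu> p"
  using assms tilt_mean_in_mean_range[OF nondeg] pmean_in_range by (auto simp: vfill_def)

lemma nrm_differ_on:
  assumes S: "S \<subseteq> {..<p}" and "\<And>i. i < p \<Longrightarrow> \<bar>x i\<bar> \<le> 1" "\<And>i. i < p \<Longrightarrow> \<bar>y i\<bar> \<le> 1"
    and eq: "\<And>i. i < p \<Longrightarrow> i \<notin> S \<Longrightarrow> x i = y i"
  shows "nrm p (\<lambda>i. x i - y i) \<le> 2 * sqrt (card S)"
proof -
  have "(\<Sum>i<p. (x i - y i)\<^sup>2) = (\<Sum>i\<in>S. (x i - y i)\<^sup>2)"
    using S eq by (intro sum.mono_neutral_right) auto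
  also have "\<dots> \<le> (\<Sum>i\<in>S. 4)"
  proof (rule sum_mono)
    fix i assume "i \<in> S"
    then have "i < p" using S by auto
    then have "\<bar>x i - y i\<bar> \<le> 2" using assms(2)[of i] assms(3)[of i] by linarith
    then show "(x i - y i)\<^sup>2 \<le> 4" using abs_le_square_iff[of "x i - y i" 2] by simp
  qed
  finally have "sqrt (\<Sum>i<p. (x i - y i)\<^sup>2) \<le> sqrt (4 * card S)" by (intro real_sqrt_le_mono) (simp add: mult.commute)
  then show ?thesis unfolding L2_set_def by (simp add: real_sqrt_mult)
qed

text \<open>The mean energy under the pinned law is the objective at the conditional means up to the
  covariance term, and the variational bound puts \<open>ln (pin_part S \<beta>)\<close> above the
  objective at \<open>u\<close>. Replacing the coordinates in \<open>S\<close> costs one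
  \<open>quad_err\<close> on each side. Since \<open>kl\<close> is nonnegative, the same bound shows
  that \<open>vfill\<close> nearly maximises \<open>M\<close>.\<close>

lemma kl_le:
  assumes \<beta>: "\<beta> \<in> cube p" and S: "S \<subseteq> {..<p}" and u: "u \<in> mean_box \<mu> p"
  shows "kl S \<beta> \<le> M (vfill S \<beta>) - M u + 1 / 2 * \<bar>\<Sum>i<p. \<Sum>j<p. a i j * pcov S \<beta> i j\<bar> + 2 * quad_err (2 * sqrt (card S))"
proof -
  let ?R = "{..<p} - S" and ?v = "pmean S \<beta>" and ?v' = "vfill S \<beta>"
  let ?t = "\<lambda>i. h i (u i)" and ?s = "\<lambda>i. h i (pmean S \<beta> i)"
  define x where "x = (\<lambda>i. if i \<in> S then \<beta> i else m i (?t i))"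
  define Q where "Q z = - (1 / 2) * bil p a z z + lin p w z" for z
  have mu: "m i (?t i) = u i" if "i < p" for i using u that by (intro mean_h) auto
  have u1: "\<bar>u i\<bar> \<le> 1" if "i < p" for i using u that mean_range_bound by auto
  have b1: "\<bar>\<beta> i\<bar> \<le> 1" if "i < p" for i using \<beta> that by (auto simp: PiE_iff abs_le_iff)
  have v1: "\<bar>?v i\<bar> \<le> 1" if "i < p" for i using pmean_bound[OF \<beta> that] .
  have v'1: "\<bar>?v' i\<bar> \<le> 1" if "i < p" for i using v1 that abs_tilt_mean_le by (auto simp: vfill_def)
  have x1: "\<bar>x i\<bar> \<le> 1" if "i < p" for i using b1 u1 mu that by (auto simp: x_def)
  have 1: "\<bar>Q ?v - Q ?v'\<bar> \<le> quad_err (2 * sqrt (card S))"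
    unfolding Q_def using v1 v'1 by (intro quad_change nrm_differ_on[OF S]) (auto simp: vfill_def)
  have 2: "\<bar>Q x - Q u\<bar> \<le> quad_err (2 * sqrt (card S))"
    unfolding Q_def using x1 u1 by (intro quad_change nrm_differ_on[OF S]) (auto simp: x_def mu)
  have split: "(\<Sum>i<p. f i) = (\<Sum>i\<in>S. f i) + (\<Sum>i\<in>?R. f i)" for f :: "nat \<Rightarrow> real"
    using S by (simp add: sum.subset_diff)
  have M': "M ?v' = Q ?v' - (\<Sum>i\<in>?R. tilt_div \<mu> (?s i) (d i))"
  proof -
    have "(\<Sum>i\<in>S. tilt_div \<mu> (h i (?v' i)) (d i)) = 0"
      using S by (intro sum.neutral) (auto simp: vfill_def tilt_param_mean[OF nondeg])
    moreover have "(\<Sum>i\<in>?R. tilt_div \<mu> (h i (?v' i)) (d i)) = (\<Sum>i\<in>?R. tilt_div \<mu> (?s i) (d i))"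
      by (rule sum.cong) (auto simp: vfill_def)
    ultimately show ?thesis unfolding mf_obj_def Q_def split by simp
  qed
  \<comment> \<open>The entropies of the coordinates in \<open>S\<close> are dropped; they are
    nonnegative and the variational bound contains only the free coordinates.\<close>
  have Mu: "M u \<le> Q u - (\<Sum>i\<in>?R. tilt_div \<mu> (?t i) (d i))"
    unfolding mf_obj_def Q_def split[of "\<lambda>i. tilt_div \<mu> (?t i) (d i)"]
    using sum_nonneg[of S "\<lambda>i. tilt_div \<mu> (?t i) (d i)"] tilt_div_nonneg by simp
  have Ds: "(\<Sum>i\<in>?R. tilt_div \<mu> (?s i) (d i)) = (\<Sum>i\<in>?R. ?s i * ?v i - c i (?s i)) + (\<Sum>i\<in>?R. c i 0)"
    unfolding sum.distrib[symmetric] using pmean_in_range[OF \<beta>]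
    by (intro sum.cong) (auto simp: tilt_div_def mean_h)
  have Dt: "(\<Sum>i\<in>?R. tilt_div \<mu> (?t i) (d i)) = (\<Sum>i\<in>?R. ?t i * m i (?t i) - c i (?t i)) + (\<Sum>i\<in>?R. c i 0)"
    unfolding sum.distrib[symmetric] by (intro sum.cong) (auto simp: tilt_div_def)
  have up: "kl S \<beta> = Q ?v - 1 / 2 * (\<Sum>i<p. \<Sum>j<p. a i j * pcov S \<beta> i j) - (\<Sum>i\<in>S. d i / 2 * (\<beta> i)\<^sup>2)
      - (\<Sum>i\<in>?R. ?s i * ?v i - c i (?s i)) - ln (pin_part S \<beta>)"
    unfolding kl_def integral_energy_pin[OF \<beta> S] Q_def by (simp add: algebra_simps)
  have lo: "Q x - (\<Sum>i\<in>S. d i / 2 * (\<beta> i)\<^sup>2) - (\<Sum>i\<in>?R. ?t i * m i (?t i) - c i (?t i)) \<le> ln (pin_part S \<beta>)"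
    using pin_part_lower[OF \<beta> S, of ?t] unfolding Q_def x_def .
  let ?C = "\<Sum>i<p. \<Sum>j<p. a i j * pcov S \<beta> i j"
  have "- ?C \<le> \<bar>?C\<bar>" by (rule abs_ge_minus_self)
  then show ?thesis using 1 2 M' Mu Ds Dt up lo by linarith
qed

lemma frobenius_cauchy_schwarz:
  assumes A: "(\<Sum>i<p. \<Sum>j<p. (a i j)\<^sup>2) \<le> A"
  shows "\<bar>\<Sum>i<p. \<Sum>j<p. a i j * e i j\<bar> \<le> sqrt A * sqrt (\<Sum>i<p. \<Sum>j<p. (e i j)\<^sup>2)"
proof -
  let ?I = "{..<p} \<times> {..<p}"
  have "0 \<le> (\<Sum>i<p. \<Sum>j<p. (a i j)\<^sup>2)" by (intro sum_nonneg) simp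
  then have A0: "0 \<le> A" using A by linarith
  have "\<bar>\<Sum>i<p. \<Sum>j<p. a i j * e i j\<bar> = \<bar>\<Sum>(i, j)\<in>?I. a i j * e i j\<bar>" by (simp add: sum.cartesian_product)
  also have "\<dots> \<le> (\<Sum>z\<in>?I. \<bar>a (fst z) (snd z)\<bar> * \<bar>e (fst z) (snd z)\<bar>)"
    by (rule order_trans[OF sum_abs]) (simp add: abs_mult case_prod_beta')
  also have "\<dots> \<le> L2_set (\<lambda>z. a (fst z) (snd z)) ?I * L2_set (\<lambda>z. e (fst z) (snd z)) ?I"
    by (rule L2_set_mult_ineq)
  also have "\<dots> \<le> sqrt A * sqrt (\<Sum>i<p. \<Sum>j<p. (e i j)\<^sup>2)"
    using A A0 unfolding L2_set_def by (intro mult_mono) (simp_all add: sum.cartesian_product case_prod_beta' sum_nonneg)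
  finally show ?thesis .
qed

end

lemma obs_sqrt [obs_intros]: "obs p F \<Longrightarrow> obs p (\<lambda>\<beta>. sqrt (F \<beta>))"
proof -
  assume *: "obs p F"
  then obtain C where C: "\<forall>\<beta>\<in>cube p. \<bar>F \<beta>\<bar> \<le> C" unfolding obs_def by blast
  have "\<bar>sqrt (F \<beta>)\<bar> \<le> sqrt C" if "\<beta> \<in> cube p" for \<beta>
  proof -
    have "F \<beta> \<le> C" "- C \<le> F \<beta>" using C that by (auto simp: abs_le_iff)
    then show ?thesis using real_sqrt_le_mono[of "F \<beta>" C] real_sqrt_le_mono[of "- C" "F \<beta>"]
      by (simp add: real_sqrt_minus abs_le_iff)
  qed
  moreover have [measurable]: "F \<in> borel_measurable (vec_space p)" by (rule obs_measurable[OF *])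
  have "(\<lambda>\<beta>. sqrt (F \<beta>)) \<in> borel_measurable (vec_space p)" by measurable
  ultimately show ?thesis unfolding obs_def by blast
qed

section \<open>Stationarity, and comparison of the objectives of two priors\<close>

context mf_system
begin

abbreviation V where "V \<equiv> \<kappa> + W"

lemma V_nonneg: "0 \<le> V" using \<kappa>_nonneg W_nonneg by simp

lemma quad_err_sqrt: "quad_err (sqrt p * e) = V * real p * e"
  by (simp add: quad_err_def)

text \<open>Testing the bilinear bound against \<open>z = a u\<close> itself turns it into a bound
  on the norm of \<open>a u\<close>.\<close>

lemma stationary_bound:
  assumes u: "\<And>i. i < p \<Longrightarrow> \<bar>u i\<bar> \<le> 1"
    and \<tau>: "\<And>i. i < p \<Longrightarrow> \<tau> i = w i - (\<Sum>j<p. a i j * u j)"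
  shows "(\<Sum>i<p. (\<tau> i)\<^sup>2) \<le> V\<^sup>2 * p"
proof -
  define z where "z i = (\<Sum>j<p. a i j * u j)" for i
  have "bil p a z u = (\<Sum>i<p. z i * (\<Sum>j<p. a i j * u j))"
    by (simp add: bil_def sum_distrib_left mult.assoc)
  then have "(nrm p z)\<^sup>2 = bil p a z u"
    by (simp add: L2_set_def sum_nonneg power2_eq_square flip: z_def)
  also have "\<dots> \<le> \<kappa> * nrm p z * nrm p u" using op_bound[of z u] by simp
  also have "\<dots> \<le> \<kappa> * nrm p z * sqrt p"
    using nrm_le_sqrt[of u 1] u \<kappa>_nonneg by (intro mult_left_mono) auto
  finally have "nrm p z * nrm p z \<le> (\<kappa> * sqrt p) * nrm p z" by (simp add: power2_eq_square mult_ac)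
  then have z: "nrm p z \<le> \<kappa> * sqrt p"
    using \<kappa>_nonneg by (cases "nrm p z = 0") (auto simp: less_le)
  have "nrm p \<tau> = nrm p (\<lambda>i. w i + - z i)" using \<tau> by (intro L2_set_cong) (auto simp: z_def)
  also have "\<dots> \<le> nrm p w + nrm p (\<lambda>i. - z i)" by (rule L2_set_triangle_ineq)
  also have "nrm p (\<lambda>i. - z i) = nrm p z" by (simp add: L2_set_def)
  finally have "nrm p \<tau> \<le> V * sqrt p" using z w_bound by (simp add: distrib_right)
  then have "(nrm p \<tau>)\<^sup>2 \<le> (V * sqrt p)\<^sup>2" by (intro power_mono) auto
  then show ?thesis by (simp add: L2_set_def sum_nonneg power_mult_distrib)
qed

end

context mf_law
begin

lemma bil_update:
  assumes i: "i < p"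
  shows "bil p a (u(i := s)) (u(i := s)) - bil p a u u = 2 * (s - u i) * (\<Sum>j<p. a i j * u j)"
proof -
  let ?e = "\<lambda>k. if k = i then s - u i else 0"
  have "bil p a (u(i := s)) (u(i := s)) - bil p a u u = bil p a (\<lambda>k. (u(i := s)) k - u k) (\<lambda>k. (u(i := s)) k + u k)"
    by (rule bil_diff)
  also have "\<dots> = (\<Sum>k<p. if k = i then (\<Sum>j<p. (s - u i) * a i j * ((u(i := s)) j + u j)) else 0)"
    unfolding bil_def by (intro sum.cong) auto
  also have "\<dots> = (\<Sum>j<p. (s - u i) * a i j * ((u(i := s)) j + u j))" using i by (simp add: sum.delta)
  also have "\<dots> = (\<Sum>j<p. 2 * (s - u i) * (a i j * u j))"
  proof (rule sum.cong)
    fix j assume "j \<in> {..<p}"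
    then show "(s - u i) * a i j * ((u(i := s)) j + u j) = 2 * (s - u i) * (a i j * u j)"
      using i by (cases "j = i") (auto simp: diag algebra_simps)
  qed simp
  finally show ?thesis by (simp add: sum_distrib_left)
qed

text \<open>As \<open>a\<close> has zero diagonal, the objective is linear minus \<open>tilt_div\<close> in each coordinate, and
  strict convexity of the log-mgf identifies the coordinatewise maximiser.\<close>

lemma maximizer_stationary:
  assumes opt: "is_arg_max M (\<lambda>v. v \<in> mean_box \<mu> p) u" and i: "i < p"
  shows "h i (u i) = w i - (\<Sum>j<p. a i j * u j)"
proof (rule ccontr)
  let ?\<alpha> = "w i - (\<Sum>j<p. a i j * u j)" and ?\<tau> = "h i (u i)"
  assume ne: "?\<tau> \<noteq> ?\<alpha>"
  have u: "u \<in> mean_box \<mu> p" and max: "\<And>v. v \<in> mean_box \<mu> p \<Longrightarrow> M v \<le> M u"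
    using opt unfolding is_arg_max_def by (auto simp: not_less)
  have ui: "u i \<in> mean_range \<mu>" using u i by auto
  let ?s = "m i ?\<alpha>"
  let ?u = "u(i := ?s)"
  have u': "?u \<in> mean_box \<mu> p"
    using u i tilt_mean_in_mean_range[OF nondeg] by (auto simp: PiE_iff extensional_def)
  have l: "lin p w ?u - lin p w u = (?s - u i) * w i"
  proof -
    have "lin p w ?u - lin p w u = (\<Sum>k<p. if k = i then (?s - u i) * w i else 0)"
      unfolding lin_def sum_subtractf[symmetric] by (intro sum.cong) (auto simp: algebra_simps)
    then show ?thesis using i by (simp add: sum.delta)
  qed
  have D: "(\<Sum>k<p. tilt_div \<mu> (h k (?u k)) (d k)) - (\<Sum>k<p. tilt_div \<mu> (h k (u k)) (d k))
      = tilt_div \<mu> ?\<alpha> (d i) - tilt_div \<mu> ?\<tau> (d i)"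
  proof -
    have "(\<Sum>k<p. tilt_div \<mu> (h k (?u k)) (d k)) - (\<Sum>k<p. tilt_div \<mu> (h k (u k)) (d k))
        = (\<Sum>k<p. if k = i then tilt_div \<mu> ?\<alpha> (d i) - tilt_div \<mu> ?\<tau> (d i) else 0)"
      unfolding sum_subtractf[symmetric] by (intro sum.cong) (auto simp: tilt_param_mean[OF nondeg])
    then show ?thesis using i by (simp add: sum.delta)
  qed
  have mt: "m i ?\<tau> = u i" by (rule mean_h[OF i ui])
  have "M ?u - M u = (?s - u i) * ?\<alpha> - (tilt_div \<mu> ?\<alpha> (d i) - tilt_div \<mu> ?\<tau> (d i))"
    using bil_update[OF i, of u ?s] l D unfolding mf_obj_def by (simp add: algebra_simps)
  also have "\<dots> = c i ?\<alpha> - c i ?\<tau> - (?\<alpha> - ?\<tau>) * u i"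
    by (simp add: tilt_div_def mt algebra_simps)
  also have "\<dots> > 0"
    using log_mgf_strictly_convex[OF nondeg, of ?\<alpha> ?\<tau> "d i"] ne by (simp add: mt)
  finally show False using max[OF u'] by simp
qed

lemma M_tilt: "M (\<lambda>i\<in>{..<p}. m i (t i))
  = - (1 / 2) * bil p a (\<lambda>i\<in>{..<p}. m i (t i)) (\<lambda>i\<in>{..<p}. m i (t i)) + lin p w (\<lambda>i\<in>{..<p}. m i (t i))
    - (\<Sum>i<p. tilt_div \<mu> (t i) (d i))"
  unfolding mf_obj_def by (simp add: tilt_param_mean[OF nondeg])

lemma tilt_in_box: "(\<lambda>i\<in>{..<p}. m i (t i)) \<in> mean_box \<mu> p"
  using tilt_mean_in_mean_range[OF nondeg] by auto

lemma box_tilt: "u \<in> mean_box \<mu> p \<Longrightarrow> (\<lambda>i\<in>{..<p}. m i (h i (u i))) = u"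
proof (rule ext)
  fix i assume u: "u \<in> mean_box \<mu> p"
  show "(\<lambda>i\<in>{..<p}. m i (h i (u i))) i = u i"
  proof (cases "i < p")
    case True
    then have "u i \<in> mean_range \<mu>" using u by auto
    then show ?thesis using True by (simp add: mean_h)
  next
    case False
    then show ?thesis using PiE_arb[OF u, of i] by simp
  qed
qed

lemma nrm_le_uniform: "(\<And>i. i < p \<Longrightarrow> \<bar>x i\<bar> \<le> e) \<Longrightarrow> 0 \<le> e \<Longrightarrow> nrm p x \<le> sqrt p * e"
  using nrm_le_sqrt[of x e] by (simp add: mult.commute)

text \<open>Clamping lowers every entropy (\<open>tilt_div_mono\<close>) and moves each mean by at
  most \<open>\<omega>\<close>, because beyond \<open>T\<close> the tilted mean is within
  \<open>\<omega>\<close> of the end of the support.\<close>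

lemma M_clamp:
  assumes T: "0 \<le> T" and \<omega>: "0 \<le> \<omega>"
    and tail: "\<And>e. 0 \<le> e \<Longrightarrow> e \<le> D \<Longrightarrow>
      Sup (supp \<mu>) - \<omega> \<le> tilt_mean \<mu> T e \<and> tilt_mean \<mu> (- T) e \<le> Inf (supp \<mu>) + \<omega>"
    and x: "x \<in> mean_box \<mu> p"
  defines "t \<equiv> \<lambda>i. max (- T) (min T (h i (x i)))"
  shows "M x \<le> M (\<lambda>i\<in>{..<p}. m i (t i)) + V * p * \<omega>"
proof -
  let ?y = "\<lambda>i\<in>{..<p}. m i (t i)" and ?s = "\<lambda>i. h i (x i)"
  have near: "\<bar>x i - ?y i\<bar> \<le> \<omega>" if i: "i < p" for i
  proof -
    have xi: "m i (?s i) = x i" and r: "x i \<in> mean_range \<mu>" using mean_h[OF i] x i by auto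
    have t1: "Sup (supp \<mu>) - \<omega> \<le> m i T" "m i (- T) \<le> Inf (supp \<mu>) + \<omega>" using tail[OF d_nonneg d_le] i by auto
    have b: "Inf (supp \<mu>) < x i" "x i < Sup (supp \<mu>)" using r by (auto simp: mean_range_def)
    consider "?s i < - T" | "T < ?s i" | "- T \<le> ?s i" "?s i \<le> T" by linarith
    then show ?thesis
    proof cases
      case 1
      then have "t i = - T" using T by (simp add: t_def)
      moreover have "m i (?s i) \<le> m i (- T)" using 1 by (intro tilt_mean_mono) simp
      ultimately show ?thesis using xi t1 b i by simp
    next
      case 2
      then have "t i = T" using T by (simp add: t_def)
      moreover have "m i T \<le> m i (?s i)" using 2 by (intro tilt_mean_mono) simp
      ultimately show ?thesis using xi t1 b i by simp
    next
      case 3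
      then have "t i = ?s i" using T by (simp add: t_def)
      then show ?thesis using xi \<omega> i by simp
    qed
  qed
  have "nrm p (\<lambda>i. x i - ?y i) \<le> sqrt p * \<omega>" using near \<omega> by (intro nrm_le_uniform)
  then have q: "\<bar>(- (1 / 2) * bil p a x x + lin p w x) - (- (1 / 2) * bil p a ?y ?y + lin p w ?y)\<bar> \<le> V * p * \<omega>"
    unfolding quad_err_sqrt[symmetric] using x abs_tilt_mean_le mean_range_bound
    by (intro quad_change) auto
  have "(\<Sum>i<p. tilt_div \<mu> (t i) (d i)) \<le> (\<Sum>i<p. tilt_div \<mu> (?s i) (d i))"
    using T by (intro sum_mono tilt_div_mono) (auto simp: t_def)
  then show ?thesis using q unfolding M_tilt unfolding mf_obj_def by linarith
qed

end

context mf_system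
begin

text \<open>The parameters \<open>t\<close> are kept and the prior is exchanged. Where
  \<open>\<bar>t i\<bar> \<le> T\<close> the laws are close. Elsewhere the trivial bounds 2 for the
  means and \<open>4 * \<bar>t i\<bar>\<close> for the entropies are at most
  \<open>2 * \<bar>t i\<bar> / T\<close> and \<open>4 * (t i)\<^sup>2 / T\<close>, so a bound
  \<open>K\<close> on the large parameters in mean square suffices.\<close>

lemma transfer:
  fixes t :: "nat \<Rightarrow> real" and T L K :: real
  assumes \<mu>: "interval_law \<mu>" "nondegenerate \<mu>" and \<nu>: "interval_law \<nu>" "nondegenerate \<nu>"
    and L: "\<And>s e. \<bar>s\<bar> \<le> T \<Longrightarrow> 0 \<le> e \<Longrightarrow> e \<le> D \<Longrightarrow> \<bar>tilt_mean \<mu> s e - tilt_mean \<nu> s e\<bar> \<le> L"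
      "\<And>s e. \<bar>s\<bar> \<le> T \<Longrightarrow> 0 \<le> e \<Longrightarrow> e \<le> D \<Longrightarrow> \<bar>tilt_div \<mu> s e - tilt_div \<nu> s e\<bar> \<le> (T + 2) * L"
    and L0: "0 \<le> L" and T: "0 < T" and t: "(\<Sum>i<p. (if \<bar>t i\<bar> \<le> T then 0 else t i)\<^sup>2) \<le> K\<^sup>2 * p" and K: "0 \<le> K"
  shows "mf_obj p a d w \<nu> (\<lambda>i\<in>{..<p}. tilt_mean \<nu> (t i) (d i))
    \<le> mf_obj p a d w \<mu> (\<lambda>i\<in>{..<p}. tilt_mean \<mu> (t i) (d i)) + p * (V * (L + 2 * K / T) + (T + 2) * L + 4 * K\<^sup>2 / T)"
proof -
  interpret m: mf_law p a d w \<kappa> W D \<mu> using \<mu> by (intro mf_law.intro mf_system_axioms mf_law_axioms.intro)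
  interpret n: mf_law p a d w \<kappa> W D \<nu> using \<nu> by (intro mf_law.intro mf_system_axioms mf_law_axioms.intro)
  let ?x = "\<lambda>i\<in>{..<p}. tilt_mean \<mu> (t i) (d i)" and ?y = "\<lambda>i\<in>{..<p}. tilt_mean \<nu> (t i) (d i)"
  define r where "r i = (if \<bar>t i\<bar> \<le> T then 0 else t i)" for i
  have pw: "\<bar>?y i - ?x i\<bar> \<le> L + 2 * (\<bar>r i\<bar> / T)" if i: "i < p" for i
  proof (cases "\<bar>t i\<bar> \<le> T")
    case True
    then show ?thesis using L(1)[OF True d_nonneg d_le] i by (simp add: abs_minus_commute r_def)
  next
    case False
    then have "1 \<le> \<bar>r i\<bar> / T" using T by (simp add: r_def)
    moreover have "\<bar>?y i - ?x i\<bar> \<le> 2" using n.abs_tilt_mean_le[of "t i" "d i"] m.abs_tilt_mean_le[of "t i" "d i"] i by simp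
    ultimately show ?thesis using L0 by linarith
  qed
  have Dw: "\<bar>tilt_div \<nu> (t i) (d i) - tilt_div \<mu> (t i) (d i)\<bar> \<le> (T + 2) * L + 4 * ((r i)\<^sup>2 / T)" if i: "i < p" for i
  proof (cases "\<bar>t i\<bar> \<le> T")
    case True
    then show ?thesis using L(2)[OF True d_nonneg d_le] i by (simp add: abs_minus_commute r_def)
  next
    case False
    then have r: "r i = t i" by (simp add: r_def)
    have "\<bar>t i\<bar> * T \<le> \<bar>t i\<bar> * \<bar>t i\<bar>" using False by (intro mult_left_mono) auto
    then have "\<bar>t i\<bar> \<le> (r i)\<^sup>2 / T" using T by (simp add: r pos_le_divide_eq power2_eq_square)
    moreover have "\<bar>tilt_div \<nu> (t i) (d i) - tilt_div \<mu> (t i) (d i)\<bar> \<le> 4 * \<bar>t i\<bar>"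
      using n.abs_tilt_div_le[of "t i" "d i"] m.abs_tilt_div_le[of "t i" "d i"] by linarith
    moreover have "0 \<le> (T + 2) * L" using T L0 by simp
    ultimately show ?thesis by linarith
  qed
  have nt: "nrm p r \<le> sqrt p * K"
  proof -
    have "nrm p r \<le> sqrt (K\<^sup>2 * p)" unfolding L2_set_def using t unfolding r_def by (rule real_sqrt_le_mono)
    then show ?thesis using K by (simp add: real_sqrt_mult mult.commute)
  qed
  have "nrm p (\<lambda>i. ?y i - ?x i) = nrm p (\<lambda>i. \<bar>?y i - ?x i\<bar>)" by (simp add: L2_set_def)
  also have "\<dots> \<le> nrm p (\<lambda>i. L + 2 * (\<bar>r i\<bar> / T))" using pw by (intro L2_set_mono) auto
  also have "\<dots> \<le> nrm p (\<lambda>i. L) + nrm p (\<lambda>i. 2 * (\<bar>r i\<bar> / T))" by (rule L2_set_triangle_ineq)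
  also have "nrm p (\<lambda>i. 2 * (\<bar>r i\<bar> / T)) = 2 / T * nrm p r"
    using T L2_set_right_distrib[of "2 / T" "\<lambda>i. \<bar>r i\<bar>" "{..<p}"] by (simp add: L2_set_def)
  also have "nrm p (\<lambda>i. L) + 2 / T * nrm p r \<le> sqrt p * L + 2 / T * (sqrt p * K)"
  proof (rule add_mono)
    show "nrm p (\<lambda>i. L) \<le> sqrt p * L" using L0 by (intro m.nrm_le_uniform) auto
    show "2 / T * nrm p r \<le> 2 / T * (sqrt p * K)" using nt T by (intro mult_left_mono) auto
  qed
  finally have "nrm p (\<lambda>i. ?y i - ?x i) \<le> sqrt p * (L + 2 * K / T)" by (simp add: algebra_simps)
  then have q: "\<bar>(- (1 / 2) * bil p a ?y ?y + lin p w ?y) - (- (1 / 2) * bil p a ?x ?x + lin p w ?x)\<bar> \<le> V * p * (L + 2 * K / T)"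
    unfolding quad_err_sqrt[symmetric] using n.abs_tilt_mean_le m.abs_tilt_mean_le by (intro quad_change) auto
  have "(\<Sum>i<p. tilt_div \<mu> (t i) (d i)) - (\<Sum>i<p. tilt_div \<nu> (t i) (d i)) \<le> (\<Sum>i<p. (T + 2) * L + 4 * ((r i)\<^sup>2 / T))"
    unfolding sum_subtractf[symmetric] using Dw by (intro sum_mono) (force simp: abs_le_iff)
  also have "\<dots> = p * ((T + 2) * L) + 4 / T * (\<Sum>i<p. (r i)\<^sup>2)"
    by (simp add: sum.distrib sum_distrib_left)
  also have "\<dots> \<le> p * ((T + 2) * L) + 4 / T * (K\<^sup>2 * p)" using t T unfolding r_def by (intro add_mono mult_left_mono) auto
  finally have "(\<Sum>i<p. tilt_div \<mu> (t i) (d i)) - (\<Sum>i<p. tilt_div \<nu> (t i) (d i)) \<le> p * ((T + 2) * L + 4 * K\<^sup>2 / T)"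
    by (simp add: algebra_simps)
  moreover have "q * (v * x + y + z) = v * q * x + q * (y + z)" for q v x y z :: real
    by (simp add: algebra_simps)
  from this[of "real p" V "L + 2 * K / T" "(T + 2) * L" "4 * K\<^sup>2 / T"]
  have "p * (V * (L + 2 * K / T) + (T + 2) * L + 4 * K\<^sup>2 / T)
      = V * p * (L + 2 * K / T) + p * ((T + 2) * L + 4 * K\<^sup>2 / T)" .
  ultimately show ?thesis using q unfolding m.M_tilt n.M_tilt by linarith
qed

end

context mf_law
begin

text \<open>Four comparisons: clamp \<open>x\<close>, pass to \<open>\<nu>\<close> at the same
  parameters, use the optimality of \<open>u\<close>, pass back. The two passages together cost
  \<open>2 * (V + T + 2) * L\<close>; the way back adds \<open>2 * V\<^sup>2 / T\<close> and
  \<open>4 * V\<^sup>2 / T\<close> for the parameters of \<open>u\<close> beyond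
  \<open>T\<close>.\<close>

lemma near_optimal:
  fixes T \<omega> \<rho> :: real
  assumes \<nu>: "interval_law \<nu>" "nondegenerate \<nu>" and within: "laws_within \<rho> \<nu> \<mu>"
    and T: "0 < T" and \<omega>: "0 \<le> \<omega>"
    and tail: "\<And>e. 0 \<le> e \<Longrightarrow> e \<le> D \<Longrightarrow>
      Sup (supp \<mu>) - \<omega> \<le> tilt_mean \<mu> T e \<and> tilt_mean \<mu> (- T) e \<le> Inf (supp \<mu>) + \<omega>"
    and opt: "is_arg_max (mf_obj p a d w \<nu>) (\<lambda>v. v \<in> mean_box \<nu> p) u"
    and x: "x \<in> mean_box \<mu> p" and p: "0 < p"
  defines "L \<equiv> tilt_lip T D * \<rho>" and "\<tau> \<equiv> \<lambda>i. tilt_param \<nu> (d i) (u i)"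
  shows "M x \<le> M (\<lambda>i\<in>{..<p}. m i (\<tau> i)) + p * (V * \<omega> + 2 * (V + T + 2) * L + 6 * V\<^sup>2 / T)"
    and "(\<Sum>i<p. (\<tau> i)\<^sup>2) \<le> V\<^sup>2 * p"
proof -
  interpret n: mf_law p a d w \<kappa> W D \<nu> using \<nu> by (intro mf_law.intro mf_system_axioms mf_law_axioms.intro)
  have D0: "0 \<le> D" using d_nonneg[OF p] d_le[OF p] by linarith
  have "0 \<le> \<rho>" using within[unfolded laws_within_def, rule_format, of "\<lambda>b. b" 1] by simp
  then have L0: "0 \<le> L" using T D0 by (simp add: L_def tilt_lip_def)
  have mdiff: "\<bar>tilt_mean \<nu> s e - tilt_mean \<mu> s e\<bar> \<le> L" if "\<bar>s\<bar> \<le> T" "0 \<le> e" "e \<le> D" for s e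
    unfolding L_def by (rule laws_within_tilt_mean[OF \<nu>(1) interval_law_axioms within that])
  have ddiff: "\<bar>tilt_div \<nu> s e - tilt_div \<mu> s e\<bar> \<le> (T + 2) * L" if "\<bar>s\<bar> \<le> T" "0 \<le> e" "e \<le> D" for s e
    unfolding L_def by (rule laws_within_tilt_div[OF \<nu>(1) interval_law_axioms within that])
  have u: "u \<in> mean_box \<nu> p" and max: "\<And>v. v \<in> mean_box \<nu> p \<Longrightarrow> n.M v \<le> n.M u"
    using opt unfolding is_arg_max_def by (auto simp: not_less)
  have u1: "\<bar>u i\<bar> \<le> 1" if "i < p" for i using u that n.mean_range_bound by auto
  show \<tau>: "(\<Sum>i<p. (\<tau> i)\<^sup>2) \<le> V\<^sup>2 * p"
    unfolding \<tau>_def by (rule stationary_bound[OF u1]) (auto intro: n.maximizer_stationary[OF opt])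
  have uy: "(\<lambda>i\<in>{..<p}. tilt_mean \<nu> (\<tau> i) (d i)) = u" unfolding \<tau>_def by (rule n.box_tilt[OF u])
  have "(\<Sum>i<p. (if \<bar>\<tau> i\<bar> \<le> T then 0 else \<tau> i)\<^sup>2) \<le> (\<Sum>i<p. (\<tau> i)\<^sup>2)" by (intro sum_mono) simp
  then have big: "(\<Sum>i<p. (if \<bar>\<tau> i\<bar> \<le> T then 0 else \<tau> i)\<^sup>2) \<le> V\<^sup>2 * p" using \<tau> by linarith
  have 2: "n.M u \<le> M (\<lambda>i\<in>{..<p}. m i (\<tau> i)) + p * (V * (L + 2 * V / T) + (T + 2) * L + 4 * V\<^sup>2 / T)"
  proof -
    have "n.M (\<lambda>i\<in>{..<p}. tilt_mean \<nu> (\<tau> i) (d i)) \<le> M (\<lambda>i\<in>{..<p}. m i (\<tau> i)) + p * (V * (L + 2 * V / T) + (T + 2) * L + 4 * V\<^sup>2 / T)"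
    proof (rule transfer[OF interval_law_axioms nondeg \<nu> _ _ L0 T big V_nonneg])
      fix s e assume "\<bar>s\<bar> \<le> T" "0 \<le> e" "e \<le> D"
      then show "\<bar>tilt_mean \<mu> s e - tilt_mean \<nu> s e\<bar> \<le> L" "\<bar>tilt_div \<mu> s e - tilt_div \<nu> s e\<bar> \<le> (T + 2) * L"
        using mdiff[of s e] ddiff[of s e] by (simp_all add: abs_minus_commute)
    qed
    then show ?thesis unfolding uy .
  qed
  define t where "t i = max (- T) (min T (h i (x i)))" for i
  have 0: "M x \<le> M (\<lambda>i\<in>{..<p}. m i (t i)) + V * p * \<omega>"
    unfolding t_def using T by (intro M_clamp[OF _ \<omega> tail x]) auto
  have "\<bar>t i\<bar> \<le> T" for i using T by (auto simp: t_def)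
  \<comment> \<open>Clamped parameters never exceed \<open>T\<close>, so \<open>transfer\<close> is
    used with \<open>K = 0\<close> on the way out and with \<open>K = V\<close> on the way
    back.\<close>
  then have small: "(\<Sum>i<p. (if \<bar>t i\<bar> \<le> T then 0 else t i)\<^sup>2) \<le> (0::real)\<^sup>2 * p" by simp
  have 1: "M (\<lambda>i\<in>{..<p}. m i (t i)) \<le> n.M (\<lambda>i\<in>{..<p}. tilt_mean \<nu> (t i) (d i)) + p * (V * (L + 2 * 0 / T) + (T + 2) * L + 4 * 0\<^sup>2 / T)"
    by (rule transfer[OF \<nu> interval_law_axioms nondeg mdiff ddiff L0 T small order_refl]; assumption)
  have 3: "n.M (\<lambda>i\<in>{..<p}. tilt_mean \<nu> (t i) (d i)) \<le> n.M u" by (rule max[OF n.tilt_in_box])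
  show "M x \<le> M (\<lambda>i\<in>{..<p}. m i (\<tau> i)) + p * (V * \<omega> + 2 * (V + T + 2) * L + 6 * V\<^sup>2 / T)"
  proof -
    have "v * p * \<omega> + p * (v * (L + 2 * 0 / T) + (T + 2) * L + 4 * 0\<^sup>2 / T) + p * (v * (L + 2 * v / T) + (T + 2) * L + 4 * v\<^sup>2 / T)
        = p * (v * \<omega> + 2 * (v + T + 2) * L + 6 * v\<^sup>2 / T)" for v :: real
      using T by (simp add: field_simps power2_eq_square)
    from this[of V] show ?thesis using 0 1 2 3 by linarith
  qed
qed

text \<open>Separation speaks of squared distances, whereas Lipschitz test functions need sums of
  absolute differences; Cauchy--Schwarz bridges the two.\<close>

lemma dist_triangle_sq:
  fixes x y z :: "nat \<Rightarrow> real" and \<delta> :: real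
  assumes "(\<Sum>i<p. (x i - z i)\<^sup>2) \<le> p * \<delta>" "(\<Sum>i<p. (y i - z i)\<^sup>2) \<le> p * (\<delta>::real)"
  shows "(\<Sum>i<p. \<bar>x i - y i\<bar>) \<le> 2 * p * sqrt \<delta>"
proof -
  have n: "nrm p (\<lambda>i. x i - z i) \<le> sqrt p * sqrt \<delta>" "nrm p (\<lambda>i. y i - z i) \<le> sqrt p * sqrt \<delta>"
    using real_sqrt_le_mono[OF assms(1)] real_sqrt_le_mono[OF assms(2)] by (simp_all add: L2_set_def real_sqrt_mult)
  have "nrm p (\<lambda>i. x i - y i) = nrm p (\<lambda>i. (x i - z i) + - (y i - z i))" by simp
  also have "\<dots> \<le> nrm p (\<lambda>i. x i - z i) + nrm p (\<lambda>i. - (y i - z i))" by (rule L2_set_triangle_ineq)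
  also have "nrm p (\<lambda>i. - (y i - z i)) = nrm p (\<lambda>i. y i - z i)" unfolding L2_set_def power2_minus ..
  finally have d: "nrm p (\<lambda>i. x i - y i) \<le> 2 * (sqrt p * sqrt \<delta>)" using n by linarith
  have "(\<Sum>i<p. \<bar>x i - y i\<bar>) = (\<Sum>i<p. \<bar>x i - y i\<bar> * \<bar>1\<bar>)" by simp
  also have "\<dots> \<le> nrm p (\<lambda>i. x i - y i) * nrm p (\<lambda>i. 1)" by (rule L2_set_mult_ineq)
  also have "\<dots> \<le> 2 * (sqrt p * sqrt \<delta>) * sqrt p" using d by (simp add: L2_set_constant mult_right_mono)
  also have "\<dots> = 2 * (sqrt p * sqrt p) * sqrt \<delta>" by (simp only: mult_ac)
  finally show ?thesis by simp
qed

text \<open>The error of the mean-field approximation, averaged over the pinned coordinates. \<open>\<Gamma>\<close> collects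
  the correlations left after pinning (\<open>\<surd>(A\<eta>)\<close>) and the cost of pinning \<open>p / \<eta>\<close> coordinates;
  \<open>\<theta>\<close> is the exponent in the Donsker--Varadhan inequality.\<close>

lemma mean_field_core:
  fixes T \<omega> \<rho> A \<epsilon> \<delta> \<theta> \<eta> :: real and us :: "nat \<Rightarrow> real" and g :: "nat \<Rightarrow> real \<Rightarrow> real"
  assumes \<nu>: "interval_law \<nu>" "nondegenerate \<nu>" and within: "laws_within \<rho> \<nu> \<mu>"
    and T: "0 < T" and \<omega>: "0 \<le> \<omega>"
    and tail: "\<And>e. 0 \<le> e \<Longrightarrow> e \<le> D \<Longrightarrow>
      Sup (supp \<mu>) - \<omega> \<le> tilt_mean \<mu> T e \<and> tilt_mean \<mu> (- T) e \<le> Inf (supp \<mu>) + \<omega>"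
    and opt: "is_arg_max (mf_obj p a d w \<nu>) (\<lambda>v. v \<in> mean_box \<nu> p) u"
    and p: "0 < p"
  defines "L \<equiv> tilt_lip T D * \<rho>" and "\<tau> \<equiv> \<lambda>i. tilt_param \<nu> (d i) (u i)"
  assumes A: "(\<Sum>i<p. \<Sum>j<p. (a i j)\<^sup>2) \<le> A * p"
    and \<epsilon>: "0 < \<epsilon>" "V * \<omega> + 2 * (V + T + 2) * L + 6 * V\<^sup>2 / T \<le> \<epsilon>"
    and sep: "\<And>x. x \<in> mean_box \<mu> p \<Longrightarrow> (\<And>y. y \<in> mean_box \<mu> p \<Longrightarrow> M y \<le> M x + p * \<epsilon>) \<Longrightarrow>
      (\<Sum>i<p. (x i - us i)\<^sup>2) \<le> p * \<delta>"
    and \<theta>: "0 < \<theta>" "\<theta> \<le> 1 / 2" and \<eta>: "0 < \<eta>" and \<delta>: "0 \<le> \<delta>"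
    and g: "\<And>i. i < p \<Longrightarrow> g i \<in> borel_measurable borel"
    and lip: "\<And>i x y. i < p \<Longrightarrow> \<bar>x\<bar> \<le> 1 \<Longrightarrow> \<bar>y\<bar> \<le> 1 \<Longrightarrow> \<bar>g i x - g i y\<bar> \<le> \<bar>x - (y::real)\<bar>"
    and bd: "\<And>i x. i < p \<Longrightarrow> \<bar>x\<bar> \<le> 1 \<Longrightarrow> \<bar>g i x\<bar> \<le> 1"
  defines "\<Gamma> \<equiv> sqrt (A * \<eta>) / 2 + 4 * V / sqrt \<eta>"
  shows "(\<integral>b. \<bar>\<Sum>i<p. g i (b i) - (\<integral>s. g i s \<partial>tilt \<nu> (\<tau> i) (d i))\<bar> \<partial>G)
    \<le> p * (\<Gamma> / \<theta> + ln 2 / (p * \<theta>) + 4 * \<theta> + 2 * sqrt \<delta> + L + 2 * V\<^sup>2 / T\<^sup>2 + 2 / \<eta> + 2 * \<Gamma> / \<epsilon>)"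
proof -
  obtain S where S: "S \<subseteq> {..<p}" and card: "\<eta> * card S \<le> real p"
    and cov: "(\<integral>\<beta>. (\<Sum>i<p. \<Sum>j<p. (pcov S \<beta> i j)\<^sup>2) \<partial>G) \<le> \<eta> * p"
    by (rule pinning[OF \<eta>])
  let ?R = "{..<p} - S"
  let ?xu = "\<lambda>i\<in>{..<p}. m i (\<tau> i)"
  let ?e = "\<lambda>i. \<integral>s. g i s \<partial>tilt \<nu> (\<tau> i) (d i)" and ?em = "\<lambda>i. \<integral>s. g i s \<partial>tilt \<mu> (\<tau> i) (d i)"
  let ?X = "\<lambda>b. \<Sum>i<p. g i (b i) - ?e i"
  have no: "M x \<le> M ?xu + p * (V * \<omega> + 2 * (V + T + 2) * L + 6 * V\<^sup>2 / T)" if "x \<in> mean_box \<mu> p" for x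
    unfolding L_def \<tau>_def by (rule near_optimal(1)[OF \<nu> within T \<omega> tail opt that p])
  have \<tau>2: "(\<Sum>i<p. (\<tau> i)\<^sup>2) \<le> V\<^sup>2 * p"
    unfolding \<tau>_def by (rule near_optimal(2)[OF \<nu> within T \<omega> tail opt tilt_in_box[of "\<lambda>_. 0"] p])
  have D0: "0 \<le> D" using d_nonneg[OF p] d_le[OF p] by linarith
  have A0: "0 \<le> A"
  proof -
    have "0 \<le> (\<Sum>i<p. \<Sum>j<p. (a i j)\<^sup>2)" by (intro sum_nonneg) simp
    then have "0 \<le> A * p" using A by linarith
    then show ?thesis using p by (simp add: zero_le_mult_iff)
  qed
  have pR: "0 < real p" using p by simp
  \<comment> \<open>The optimizer for \<open>\<nu>\<close>, re-read for \<open>\<mu>\<close> at the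
    same parameters, is near-optimal, so separation applies to it.\<close>
  have us_u: "(\<Sum>i<p. (?xu i - us i)\<^sup>2) \<le> p * \<delta>"
  proof (rule sep[OF tilt_in_box])
    fix y assume y: "y \<in> mean_box \<mu> p"
    have "p * (V * \<omega> + 2 * (V + T + 2) * L + 6 * V\<^sup>2 / T) \<le> p * \<epsilon>" using \<epsilon> by (intro mult_left_mono) auto
    then show "M y \<le> M ?xu + p * \<epsilon>" using no[OF y] by linarith
  qed
  \<comment> \<open>One error serves twice: it bounds the entropy \<open>kl\<close> and the
    optimality gap of \<open>vfill\<close>.\<close>
  define r where "r \<beta> = 1 / 2 * (sqrt (A * p) * sqrt (\<Sum>i<p. \<Sum>j<p. (pcov S \<beta> i j)\<^sup>2)) + 2 * quad_err (2 * sqrt (card S))" for \<beta>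
  have o_cov: "obs p (\<lambda>\<beta>. sqrt (\<Sum>i<p. \<Sum>j<p. (pcov S \<beta> i j)\<^sup>2))" by (intro obs_intros) auto
  have o_r: "obs p r" unfolding r_def[abs_def] by (intro obs_intros) auto
  have klr: "kl S \<beta> \<le> M (vfill S \<beta>) - M y + r \<beta>" if \<beta>: "\<beta> \<in> cube p" and y: "y \<in> mean_box \<mu> p" for \<beta> y
    using kl_le[OF \<beta> S y] frobenius_cauchy_schwarz[OF A, of "pcov S \<beta>"] by (simp add: r_def)
  have kl_r: "kl S \<beta> \<le> r \<beta>" if \<beta>: "\<beta> \<in> cube p" for \<beta> using klr[OF \<beta> vfill_mean_box[OF \<beta>, of S]] by simp
  have r0: "0 \<le> r \<beta>" if "\<beta> \<in> cube p" for \<beta> using kl_r[OF that] kl_nonneg[OF that, of S] by linarith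
  \<comment> \<open>Jensen for the square root turns the pinning bound into
    \<open>sqrt (\<eta> * p)\<close>, paired with \<open>sqrt (A * p)\<close>. At most
    \<open>p / \<eta>\<close> pinned coordinates make each \<open>quad_err\<close> at most
    \<open>p * (2 * V / sqrt \<eta>)\<close>.\<close>
  have Er: "(\<integral>\<beta>. r \<beta> \<partial>G) \<le> p * \<Gamma>"
  proof -
    have "(\<integral>\<beta>. sqrt (\<Sum>i<p. \<Sum>j<p. (pcov S \<beta> i j)\<^sup>2) \<partial>G)\<^sup>2 \<le> (\<integral>\<beta>. (sqrt (\<Sum>i<p. \<Sum>j<p. (pcov S \<beta> i j)\<^sup>2))\<^sup>2 \<partial>G)"
      by (rule G.square_integral_le[OF o_cov])
    also have "\<dots> \<le> \<eta> * p" using cov by (simp add: sum_nonneg)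
    finally have 1: "(\<integral>\<beta>. sqrt (\<Sum>i<p. \<Sum>j<p. (pcov S \<beta> i j)\<^sup>2) \<partial>G) \<le> sqrt (\<eta> * p)"
      by (rule real_le_rsqrt)
    have "sqrt (card S) \<le> sqrt (p / \<eta>)" using card \<eta> by (intro real_sqrt_le_mono) (simp add: field_simps)
    then have "quad_err (2 * sqrt (card S)) \<le> V * sqrt p * (2 * sqrt (p / \<eta>))"
      unfolding quad_err_def using V_nonneg by (intro mult_left_mono) auto
    also have "\<dots> = (sqrt p * sqrt p) * (2 * V / sqrt \<eta>)"
      unfolding real_sqrt_divide by (simp only: times_divide_eq_right times_divide_eq_left mult_ac)
    also have "\<dots> = p * (2 * V / sqrt \<eta>)" by simp
    finally have 2: "quad_err (2 * sqrt (card S)) \<le> p * (2 * V / sqrt \<eta>)" .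
    have "(\<integral>\<beta>. r \<beta> \<partial>G) = 1 / 2 * (sqrt (A * p) * (\<integral>\<beta>. sqrt (\<Sum>i<p. \<Sum>j<p. (pcov S \<beta> i j)\<^sup>2) \<partial>G)) + 2 * quad_err (2 * sqrt (card S))"
      unfolding r_def using G.integrable_obs[OF o_cov] by simp
    also have "\<dots> \<le> 1 / 2 * (sqrt (A * p) * sqrt (\<eta> * p)) + 2 * (p * (2 * V / sqrt \<eta>))"
      using 1 2 A0 by (intro add_mono mult_left_mono) auto
    also have "sqrt (A * p) * sqrt (\<eta> * p) = p * sqrt (A * \<eta>)" by (simp add: real_sqrt_mult mult_ac)
    also have "1 / 2 * (p * sqrt (A * \<eta>)) + 2 * (p * (2 * V / sqrt \<eta>)) = p * \<Gamma>"
    proof -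
      have "1 / 2 * (q * x) + 2 * (q * (2 * v / e)) = q * (x / 2 + 4 * v / e)" for q x v e :: real
        by (simp add: algebra_simps)
      then show ?thesis unfolding \<Gamma>_def .
    qed
    finally show ?thesis .
  qed
  have dev_\<mu>\<nu>: "(\<Sum>i\<in>?R. \<bar>?em i - ?e i\<bar>) \<le> p * (L + 2 * V\<^sup>2 / T\<^sup>2)"
  proof -
    have "(\<Sum>i\<in>?R. \<bar>?em i - ?e i\<bar>) \<le> (\<Sum>i<p. \<bar>?em i - ?e i\<bar>)" by (rule sum_mono2) auto
    also have "\<dots> \<le> (\<Sum>i<p. L + 2 * ((\<tau> i)\<^sup>2 / T\<^sup>2))"
    proof (rule sum_mono)
      fix i assume "i \<in> {..<p}"
      then have i: "i < p" by simp
      interpret tm: interval_law "tilt \<mu> (\<tau> i) (d i)" by (rule interval_law_tilt)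
      interpret tn: interval_law "tilt \<nu> (\<tau> i) (d i)" by (rule interval_law.interval_law_tilt[OF \<nu>(1)])
      show "\<bar>?em i - ?e i\<bar> \<le> L + 2 * ((\<tau> i)\<^sup>2 / T\<^sup>2)"
      proof (cases "\<bar>\<tau> i\<bar> \<le> T")
        case True
        have "\<bar>?e i - ?em i\<bar> \<le> L"
          unfolding L_def
          by (rule laws_within_tilt[OF \<nu>(1) interval_law_axioms within True d_nonneg[OF i] d_le[OF i] g[OF i] lip[OF i] bd[OF i]])
        moreover have "0 \<le> 2 * ((\<tau> i)\<^sup>2 / T\<^sup>2)" by simp
        ultimately show ?thesis unfolding abs_minus_commute[of "?em i"] by linarith
      next
        case False
        \<comment> \<open>Chebyshev: a coordinate beyond \<open>T\<close> contributes at most 2,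
          hence at most twice its squared parameter over \<open>T\<^sup>2\<close>.\<close>
        then have "T\<^sup>2 \<le> (\<tau> i)\<^sup>2" using T abs_le_square_iff[of T "\<tau> i"] by simp
        then have "1 \<le> (\<tau> i)\<^sup>2 / T\<^sup>2" using T by simp
        moreover have "\<bar>?em i\<bar> \<le> 1" by (rule tm.abs_integral_le[OF g[OF i] bd[OF i]])
        moreover have "\<bar>?e i\<bar> \<le> 1" by (rule tn.abs_integral_le[OF g[OF i] bd[OF i]])
        moreover have "0 \<le> \<rho>" using within[unfolded laws_within_def, rule_format, of "\<lambda>b. b" 1] by simp
        then have "0 \<le> L" using T D0 by (simp add: L_def tilt_lip_def)
        ultimately show ?thesis by linarith
      qed
    qed
    also have "\<dots> = p * L + 2 / T\<^sup>2 * (\<Sum>i<p. (\<tau> i)\<^sup>2)" by (simp add: sum.distrib sum_distrib_left)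
    also have "\<dots> \<le> p * L + 2 / T\<^sup>2 * (V\<^sup>2 * p)"
      using \<tau>2 by (intro add_mono mult_left_mono) auto
    finally show ?thesis by (simp add: algebra_simps)
  qed
  have oX: "obs p (\<lambda>b. \<bar>?X b\<bar>)" using g bd by (intro obs_intros obs_compose) auto
  \<comment> \<open>The part of the final bound that does not depend on the revealed values.\<close>
  define K where "K = ln 2 / \<theta> + 4 * \<theta> * p + 2 * p * sqrt \<delta> + p * (L + 2 * V\<^sup>2 / T\<^sup>2) + 2 * p / \<eta>"
  have e1: "\<bar>?e i\<bar> \<le> 1" if "i < p" for i
  proof -
    interpret tn: interval_law "tilt \<nu> (\<tau> i) (d i)" by (rule interval_law.interval_law_tilt[OF \<nu>(1)])
    show ?thesis using that by (intro tn.abs_integral_le g bd)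
  qed
  have term2: "\<bar>g i (b i) - ?e i\<bar> \<le> 2" if "i < p" "b \<in> cube p" for i b
  proof -
    have "\<bar>g i (b i)\<bar> \<le> 1" using that by (intro bd) (auto simp: PiE_iff abs_le_iff)
    then show ?thesis using e1[OF that(1)] by linarith
  qed
  have local: "cexp S (\<lambda>b. \<bar>?X b\<bar>) \<beta> \<le> r \<beta> * (1 / \<theta> + 2 / \<epsilon>) + K" if \<beta>: "\<beta> \<in> cube p" for \<beta>
  proof -
    interpret P: cube_law "pin S \<beta>" p by (rule cube_law_pin[OF \<beta>])
    let ?eh = "\<lambda>i. \<integral>s. g i s \<partial>tilt \<mu> (h i (pmean S \<beta> i)) (d i)"
    let ?Y = "\<lambda>b. \<Sum>i\<in>?R. g i (b i) - ?eh i"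
    have oY: "obs p (\<lambda>b. \<bar>?Y b\<bar>)" using g bd by (intro obs_intros obs_compose) auto
    have cX: "cexp S (\<lambda>b. \<bar>?X b\<bar>) \<beta> = (\<integral>b. \<bar>?X b\<bar> \<partial>pin S \<beta>)" by (rule cexp_eq[OF oX \<beta>])
    have K0: "0 \<le> K - 2 * p * sqrt \<delta>" "0 \<le> K"
    proof -
      have "0 \<le> p * (L + 2 * V\<^sup>2 / T\<^sup>2)" using dev_\<mu>\<nu> sum_nonneg[of ?R "\<lambda>i. \<bar>?em i - ?e i\<bar>"] by linarith
      moreover have "0 \<le> ln 2 / \<theta>" "0 \<le> 4 * \<theta> * p" "0 \<le> 2 * p / \<eta>" "0 \<le> 2 * p * sqrt \<delta>" using \<theta> \<eta> \<delta> by auto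
      ultimately show "0 \<le> K - 2 * p * sqrt \<delta>" "0 \<le> K" unfolding K_def by linarith+
    qed
    show ?thesis
    \<comment> \<open>Markov's inequality in pointwise form: when the error is too large for
      separation, the trivial bound \<open>2 * p\<close> is at most
      \<open>r \<beta> * (2 / \<epsilon>)\<close>.\<close>
    proof (cases "r \<beta> \<le> p * \<epsilon>")
      case False
      have "\<bar>?X b\<bar> \<le> 2 * p" if "b \<in> cube p" for b
      proof -
        have "\<bar>?X b\<bar> \<le> (\<Sum>i<p. \<bar>g i (b i) - ?e i\<bar>)" by (rule sum_abs)
        also have "\<dots> \<le> (\<Sum>i<p. 2)" using term2 that by (intro sum_mono) simp
        finally show ?thesis by simp
      qed
      then have "(\<integral>b. \<bar>?X b\<bar> \<partial>pin S \<beta>) \<le> (\<integral>b. 2 * p \<partial>pin S \<beta>)" by (intro P.integral_obs_mono oX obs_intros)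
      then have "(\<integral>b. \<bar>?X b\<bar> \<partial>pin S \<beta>) \<le> 2 * p" by simp
      also have "\<dots> \<le> r \<beta> * (2 / \<epsilon>)" using False \<epsilon> by (simp add: field_simps)
      also have "\<dots> \<le> r \<beta> * (1 / \<theta> + 2 / \<epsilon>)" using r0[OF \<beta>] \<theta> by (intro mult_left_mono) auto
      finally show ?thesis unfolding cX using K0 by linarith
    next
      case True
      have "(\<Sum>i<p. (vfill S \<beta> i - us i)\<^sup>2) \<le> p * \<delta>"
      proof (rule sep[OF vfill_mean_box[OF \<beta>]])
        fix y assume y: "y \<in> mean_box \<mu> p"
        show "M y \<le> M (vfill S \<beta>) + p * \<epsilon>" using klr[OF \<beta> y] kl_nonneg[OF \<beta>, of S] True by linarith
      qed
      from dist_triangle_sq[OF this us_u]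
      have vu: "(\<Sum>i<p. \<bar>vfill S \<beta> i - ?xu i\<bar>) \<le> 2 * p * sqrt \<delta>" .
      have "(\<Sum>i\<in>?R. \<bar>?eh i - ?em i\<bar>) \<le> (\<Sum>i\<in>?R. \<bar>vfill S \<beta> i - ?xu i\<bar>)"
      proof (rule sum_mono)
        fix i assume i: "i \<in> ?R"
        then have "\<bar>?eh i - ?em i\<bar> \<le> \<bar>m i (h i (pmean S \<beta> i)) - m i (\<tau> i)\<bar>"
          by (intro integral_tilt_lipschitz g lip) auto
        also have "m i (h i (pmean S \<beta> i)) = pmean S \<beta> i" using i pmean_in_range[OF \<beta>] by (intro mean_h) auto
        finally show "\<bar>?eh i - ?em i\<bar> \<le> \<bar>vfill S \<beta> i - ?xu i\<bar>" using i by (simp add: vfill_def)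
      qed
      also have "\<dots> \<le> (\<Sum>i<p. \<bar>vfill S \<beta> i - ?xu i\<bar>)" by (rule sum_mono2) auto
      finally have dev_h: "(\<Sum>i\<in>?R. \<bar>?eh i - ?em i\<bar>) \<le> 2 * p * sqrt \<delta>" using vu by linarith
      have cardS: "2 * real (card S) \<le> 2 * p / \<eta>" using card \<eta> by (simp add: field_simps)
      \<comment> \<open>Three corrections to \<open>?Y\<close>: the tilts of \<open>\<mu>\<close>
        change from the conditional means to the parameters \<open>\<tau>\<close> (via separation),
        the prior changes from \<open>\<mu>\<close> to \<open>\<nu>\<close>, and the pinned
        coordinates are estimated by 2 each.\<close>
      have ptw: "\<bar>?X b\<bar> \<le> \<bar>?Y b\<bar> + (2 * p * sqrt \<delta> + p * (L + 2 * V\<^sup>2 / T\<^sup>2) + 2 * p / \<eta>)" if b: "b \<in> cube p" for b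
      proof -
        have "?X b = (\<Sum>i\<in>S. g i (b i) - ?e i) + (\<Sum>i\<in>?R. g i (b i) - ?e i)"
          using S by (simp add: sum.subset_diff[of S "{..<p}"])
        moreover have "(\<Sum>i\<in>?R. g i (b i) - ?e i) = ?Y b + (\<Sum>i\<in>?R. ?eh i - ?em i) + (\<Sum>i\<in>?R. ?em i - ?e i)"
          by (simp flip: sum.distrib)
        moreover have "\<bar>\<Sum>i\<in>?R. ?eh i - ?em i\<bar> \<le> 2 * p * sqrt \<delta>" using dev_h sum_abs[of "\<lambda>i. ?eh i - ?em i" ?R] by linarith
        moreover have "\<bar>\<Sum>i\<in>?R. ?em i - ?e i\<bar> \<le> p * (L + 2 * V\<^sup>2 / T\<^sup>2)" using dev_\<mu>\<nu> sum_abs[of "\<lambda>i. ?em i - ?e i" ?R] by linarith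
        moreover have "\<bar>\<Sum>i\<in>S. g i (b i) - ?e i\<bar> \<le> 2 * p / \<eta>"
        proof -
          have "\<bar>\<Sum>i\<in>S. g i (b i) - ?e i\<bar> \<le> (\<Sum>i\<in>S. \<bar>g i (b i) - ?e i\<bar>)" by (rule sum_abs)
          also have "\<dots> \<le> (\<Sum>i\<in>S. 2)" using term2[OF _ b] S by (intro sum_mono) auto
          finally show ?thesis using cardS by simp
        qed
        ultimately show ?thesis by linarith
      qed
      have "(\<integral>b. \<bar>?X b\<bar> \<partial>pin S \<beta>) \<le> (\<integral>b. \<bar>?Y b\<bar> + (2 * p * sqrt \<delta> + p * (L + 2 * V\<^sup>2 / T\<^sup>2) + 2 * p / \<eta>) \<partial>pin S \<beta>)"
        using ptw by (intro P.integral_obs_mono oX obs_add[OF oY obs_const])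
      also have "\<dots> = (\<integral>b. \<bar>?Y b\<bar> \<partial>pin S \<beta>) + (2 * p * sqrt \<delta> + p * (L + 2 * V\<^sup>2 / T\<^sup>2) + 2 * p / \<eta>)"
        using P.integrable_obs[OF oY] by simp
      also have "(\<integral>b. \<bar>?Y b\<bar> \<partial>pin S \<beta>) \<le> (r \<beta> + ln 2 + 4 * \<theta>\<^sup>2 * p) / \<theta>"
      proof -
        have "\<theta> * (\<integral>b. \<bar>?Y b\<bar> \<partial>pin S \<beta>) \<le> kl S \<beta> + ln 2 + 4 * \<theta>\<^sup>2 * p"
          by (rule concentration[OF \<beta> _ _ \<theta>]) (simp_all add: g bd)
        then show ?thesis using kl_r[OF \<beta>] \<theta> by (simp add: pos_le_divide_eq mult.commute)
      qed
      also have "(r \<beta> + ln 2 + 4 * \<theta>\<^sup>2 * p) / \<theta> = r \<beta> * (1 / \<theta>) + ln 2 / \<theta> + 4 * \<theta> * p"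
        using \<theta> by (simp add: field_simps power2_eq_square)
      finally have "(\<integral>b. \<bar>?X b\<bar> \<partial>pin S \<beta>) \<le> r \<beta> * (1 / \<theta>) + K" unfolding K_def by linarith
      moreover have "r \<beta> * (1 / \<theta>) \<le> r \<beta> * (1 / \<theta> + 2 / \<epsilon>)" using r0[OF \<beta>] \<epsilon> by (intro mult_left_mono) auto
      ultimately show ?thesis unfolding cX by linarith
    qed
  qed
  have "(\<integral>b. \<bar>?X b\<bar> \<partial>G) = (\<integral>\<beta>. cexp S (\<lambda>b. \<bar>?X b\<bar>) \<beta> \<partial>G)" by (rule tower[OF oX S, symmetric])
  also have "\<dots> \<le> (\<integral>\<beta>. r \<beta> * (1 / \<theta> + 2 / \<epsilon>) + K \<partial>G)"
    using local o_r by (intro G.integral_obs_mono obs_cexp oX obs_intros)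
  also have "\<dots> = (\<integral>\<beta>. r \<beta> \<partial>G) * (1 / \<theta> + 2 / \<epsilon>) + K" using G.integrable_obs[OF o_r] by simp
  also have "\<dots> \<le> p * \<Gamma> * (1 / \<theta> + 2 / \<epsilon>) + K" using Er \<theta> \<epsilon> by (intro add_mono mult_right_mono) auto
  also have "\<dots> = p * (\<Gamma> / \<theta> + ln 2 / (p * \<theta>) + 4 * \<theta> + 2 * sqrt \<delta> + L + 2 * V\<^sup>2 / T\<^sup>2 + 2 / \<eta> + 2 * \<Gamma> / \<epsilon>)"
    using pR \<theta> \<epsilon> \<eta> T unfolding K_def by (simp add: field_simps)
  finally show ?thesis .
qed

end

section \<open>The largest eigenvalue as the maximum of the Rayleigh quotient\<close>

lemma compact_coordinate_sphere:
  "compact {x :: nat \<Rightarrow> real. (\<forall>i. x i \<in> (if i < p then {-1..1} else {0})) \<and> (\<Sum>i<p. (x i)\<^sup>2) = 1}"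
proof -
  define B where "B i = (if i < p then {-1..1} else {0::real})" for i :: nat
  \<comment> \<open>Vectors are functions on all naturals with the product topology. Fixing the
    coordinates beyond \<open>p\<close> at 0 leaves a product of compact sets, to which Tychonoff's
    theorem applies.\<close>
  have "compactin (product_topology (\<lambda>_::nat. euclidean) UNIV) (PiE UNIV B)"
    unfolding compactin_PiE by (auto simp: B_def)
  then have "compact (PiE UNIV B)" by (simp add: euclidean_product_topology)
  moreover have "closed {x :: nat \<Rightarrow> real. (\<Sum>i<p. (x i)\<^sup>2) = 1}"
    by (intro closed_Collect_eq continuous_intros continuous_on_product_coordinates)
  ultimately have "compact (PiE UNIV B \<inter> {x. (\<Sum>i<p. (x i)\<^sup>2) = 1})" by (rule compact_Int_closed)
  also have "PiE UNIV B \<inter> {x. (\<Sum>i<p. (x i)\<^sup>2) = 1} = {x. (\<forall>i. x i \<in> B i) \<and> (\<Sum>i<p. (x i)\<^sup>2) = 1}"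
    by (auto simp: PiE_iff)
  finally show ?thesis unfolding B_def .
qed

lemma bil_scale: "bil p a (\<lambda>i. s * x i) (\<lambda>i. t * y i) = s * t * bil p a x y"
  unfolding bil_def by (simp add: sum_distrib_left mult_ac)

lemma bil_cong: "(\<And>i. i < p \<Longrightarrow> x i = x' i) \<Longrightarrow> (\<And>i. i < p \<Longrightarrow> y i = y' i) \<Longrightarrow> bil p a x y = bil p a x' y'"
  unfolding bil_def by (intro sum.cong) auto

lemma bil_sym: "(\<And>i j. i < p \<Longrightarrow> j < p \<Longrightarrow> a i j = a j i) \<Longrightarrow> bil p a x y = bil p a y x"
  unfolding bil_def by (subst sum.swap) (auto intro!: sum.cong simp: mult_ac)

lemma bil_add: "bil p a (\<lambda>i. x i + t * y i) (\<lambda>i. x i + t * y i)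
  = bil p a x x + t * (bil p a x y + bil p a y x) + t\<^sup>2 * bil p a y y"
  unfolding bil_def by (simp add: algebra_simps sum.distrib sum_distrib_left power2_eq_square)

lemma bil_add_sym:
  assumes "\<And>i j. i < p \<Longrightarrow> j < p \<Longrightarrow> a i j = a j i"
  shows "bil p a (\<lambda>i. x i + t * y i) (\<lambda>i. x i + t * y i) = bil p a x x + 2 * t * bil p a x y + t\<^sup>2 * bil p a y y"
proof -
  have "B = A \<Longrightarrow> c + t * (A + B) + e = c + 2 * t * A + e" for A B c e :: real by simp
  from this[OF bil_sym[where p=p and a=a and x=y and y=x, OF assms]] show ?thesis unfolding bil_add by blast
qed

text \<open>For \<open>t\<close> a small multiple of \<open>b\<close> the linear term dominates and
  is positive; dividing by \<open>\<bar>c\<bar> + 1\<close> makes it small enough.\<close>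

lemma linear_coeff_zero:
  assumes "\<And>t :: real. 2 * t * b + t\<^sup>2 * c \<le> 0" shows "b = 0"
proof (rule ccontr)
  assume b: "b \<noteq> 0"
  let ?t = "b / (\<bar>c\<bar> + 1)"
  have pos: "0 < \<bar>c\<bar> + 1" by simp
  have "2 * (b / s) * b + (b / s)\<^sup>2 * c = b\<^sup>2 / s * (2 + c / s)" for s
    by (simp add: power2_eq_square distrib_left)
  then have "2 * ?t * b + ?t\<^sup>2 * c = b\<^sup>2 / (\<bar>c\<bar> + 1) * (2 + c / (\<bar>c\<bar> + 1))" .
  moreover have "- 1 < c / (\<bar>c\<bar> + 1)" using pos by (simp add: less_divide_eq)
  then have "0 < b\<^sup>2 / (\<bar>c\<bar> + 1) * (2 + c / (\<bar>c\<bar> + 1))" using b pos by (intro mult_pos_pos divide_pos_pos) auto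
  ultimately show False using assms[of ?t] by simp
qed

text \<open>\<open>lambda_max\<close> is a maximum over eigenvalues, so to bound the quadratic form
  by it the supremum of the Rayleigh quotient must be exhibited as an eigenvalue. The maximiser on
  the sphere exists by compactness and is an eigenvector by its first-order condition.\<close>

lemma rayleigh_maximizer:
  assumes sym: "\<And>i j. i < p \<Longrightarrow> j < p \<Longrightarrow> a i j = a j i" and p: "0 < p"
  obtains v l where "\<exists>i<p. v i \<noteq> 0" "\<And>i. i < p \<Longrightarrow> (\<Sum>j<p. a i j * v j) = l * v i"
    "\<And>x. bil p a x x \<le> l * (\<Sum>i<p. (x i)\<^sup>2)"
proof -
  define S where "S = {x :: nat \<Rightarrow> real. (\<forall>i. x i \<in> (if i < p then {-1..1} else {0})) \<and> (\<Sum>i<p. (x i)\<^sup>2) = 1}"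
  have "continuous_on UNIV (\<lambda>x. bil p a x x)"
    unfolding bil_def by (intro continuous_intros continuous_on_product_coordinates)
  then have cont: "continuous_on S (\<lambda>x. bil p a x x)" by (rule continuous_on_subset) simp
  have "(\<lambda>i. if i = 0 then 1 else 0) \<in> S" unfolding S_def using p by (auto simp: if_distrib[of "\<lambda>x. x\<^sup>2"] sum.delta cong: if_cong)
  then have "S \<noteq> {}" by auto
  then obtain v where v: "v \<in> S" and max: "\<And>x. x \<in> S \<Longrightarrow> bil p a x x \<le> bil p a v v"
    using continuous_attains_sup[OF compact_coordinate_sphere[of p, folded S_def] _ cont] by blast
  let ?l = "bil p a v v"
  have v1: "(\<Sum>i<p. (v i)\<^sup>2) = 1" using v by (simp add: S_def)
  have ray: "bil p a x x \<le> ?l * (\<Sum>i<p. (x i)\<^sup>2)" for x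
  proof (cases "(\<Sum>i<p. (x i)\<^sup>2) = 0")
    case True
    then have "x i = 0" if "i < p" for i using that by (subst (asm) sum_nonneg_eq_0_iff) auto
    then have "bil p a x x = bil p a (\<lambda>_. 0) (\<lambda>_. 0)" by (intro bil_cong) auto
    then show ?thesis using True by (simp add: bil_def)
  next
    case False
    let ?n = "\<Sum>i<p. (x i)\<^sup>2"
    have n: "0 < ?n" using False by (simp add: sum_nonneg less_le)
    let ?y = "\<lambda>i. if i < p then 1 / sqrt ?n * x i else 0"
    have sum1: "(\<Sum>i<p. (?y i)\<^sup>2) = 1"
    proof -
      have "(\<Sum>i<p. (?y i)\<^sup>2) = (\<Sum>i<p. (x i)\<^sup>2 / ?n)" using n by (intro sum.cong) (auto simp: power_divide)
      also have "\<dots> = 1" unfolding sum_divide_distrib[symmetric] using False by simp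
      finally show ?thesis .
    qed
    have "?y \<in> S"
      unfolding S_def
    proof (intro CollectI conjI allI sum1)
      fix i
      have "(?y i)\<^sup>2 \<le> (\<Sum>i<p. (?y i)\<^sup>2)" if "i < p"
        using that by (intro member_le_sum) auto
      then have "(?y i)\<^sup>2 \<le> 1" if "i < p" using that unfolding sum1 .
      moreover have "z \<in> {-1..1}" if "z\<^sup>2 \<le> 1" for z :: real
        using that by (simp add: abs_square_le_1 abs_le_iff)
      ultimately have "?y i \<in> {-1..1}" if "i < p" using that by blast
      then show "?y i \<in> (if i < p then {-1..1} else {0})" by simp
    qed
    then have "bil p a ?y ?y \<le> ?l" by (rule max)
    also have "bil p a ?y ?y = bil p a (\<lambda>i. 1 / sqrt ?n * x i) (\<lambda>i. 1 / sqrt ?n * x i)" by (rule bil_cong) auto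
    also have "\<dots> = bil p a x x / ?n" unfolding bil_scale using n by simp
    finally show ?thesis using n by (simp add: pos_divide_le_eq)
  qed
  have add: "bil p a (\<lambda>i. x i + t * y i) (\<lambda>i. x i + t * y i) = bil p a x x + 2 * t * bil p a x y + t\<^sup>2 * bil p a y y" for x y t
    by (rule bil_add_sym[OF sym])
  \<comment> \<open>The form minus \<open>?l\<close> times the squared length is nonpositive and
    vanishes at \<open>v\<close>, so along each line through \<open>v\<close> its linear coefficient
    is 0.\<close>
  have orth: "bil p a v y - ?l * (\<Sum>i<p. v i * y i) = 0" for y
  proof (rule linear_coeff_zero)
    fix t :: real
    have "bil p a (\<lambda>i. v i + t * y i) (\<lambda>i. v i + t * y i) \<le> ?l * (\<Sum>i<p. (v i + t * y i)\<^sup>2)" by (rule ray)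
    also have "(\<Sum>i<p. (v i + t * y i)\<^sup>2) = 1 + 2 * t * (\<Sum>i<p. v i * y i) + t\<^sup>2 * (\<Sum>i<p. (y i)\<^sup>2)"
      unfolding v1[symmetric] by (simp add: power2_sum sum.distrib sum_distrib_left power_mult_distrib algebra_simps)
    finally show "2 * t * (bil p a v y - ?l * (\<Sum>i<p. v i * y i)) + t\<^sup>2 * (bil p a y y - ?l * (\<Sum>i<p. (y i)\<^sup>2)) \<le> 0"
      unfolding add by (simp add: algebra_simps)
  qed
  show ?thesis
  proof (rule that[OF _ _ ray])
    show "\<exists>i<p. v i \<noteq> 0"
    proof (rule ccontr)
      assume "\<not> ?thesis"
      then have "(\<Sum>i<p. (v i)\<^sup>2) = 0" by simp
      then show False using v1 by simp
    qed
    fix i assume i: "i < p"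
    let ?d = "\<lambda>k. if k = i then 1 else (0::real)"
    have "bil p a v ?d = (\<Sum>k<p. v k * a k i)"
      unfolding bil_def using i by (simp add: if_distrib[of "\<lambda>x. _ * x"] sum.delta cong: if_cong)
    also have "\<dots> = (\<Sum>j<p. a i j * v j)" using sym[OF i] by (intro sum.cong) auto
    finally show "(\<Sum>j<p. a i j * v j) = ?l * v i"
      using orth[of ?d] i by (simp add: if_distrib[of "\<lambda>x. _ * x"] sum.delta cong: if_cong)
  qed
qed

text \<open>Positivity at \<open>x + y\<close> and \<open>x - y\<close> bounds the form by a sum of
  squared norms. Reciprocal rescaling of the arguments by \<open>?s\<close>, which equalises their
  norms, turns the sum into a product.\<close>

lemma psd_cauchy_schwarz:
  assumes sym: "\<And>i j. i < p \<Longrightarrow> j < p \<Longrightarrow> a i j = a j i"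
    and psd: "\<And>x. 0 \<le> bil p a x x" and ub: "\<And>x. bil p a x x \<le> l * (\<Sum>i<p. (x i)\<^sup>2)" and l: "0 \<le> l"
  shows "\<bar>bil p a x y\<bar> \<le> l * nrm p x * nrm p y"
proof -
  have add: "bil p a (\<lambda>i. x i + t * y i) (\<lambda>i. x i + t * y i) = bil p a x x + 2 * t * bil p a x y + t\<^sup>2 * bil p a y y" for x y t
    by (rule bil_add_sym[OF sym])
  have two: "2 * \<bar>bil p a x y\<bar> \<le> l * ((nrm p x)\<^sup>2 + (nrm p y)\<^sup>2)" for x y
  proof -
    have "0 \<le> bil p a (\<lambda>i. x i + t * y i) (\<lambda>i. x i + t * y i)" for t by (rule psd)
    then have "0 \<le> bil p a x x + 2 * t * bil p a x y + t\<^sup>2 * bil p a y y" for t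
      unfolding add .
    from this[of 1] this[of "-1"] have "2 * \<bar>bil p a x y\<bar> \<le> bil p a x x + bil p a y y"
      by (simp add: abs_if)
    also have "\<dots> \<le> l * (\<Sum>i<p. (x i)\<^sup>2) + l * (\<Sum>i<p. (y i)\<^sup>2)" using ub by (intro add_mono)
    finally show ?thesis by (simp add: L2_set_def sum_nonneg distrib_left)
  qed
  show ?thesis
  proof (cases "nrm p x = 0 \<or> nrm p y = 0")
    case True
    then have "(\<forall>i<p. x i = 0) \<or> (\<forall>i<p. y i = 0)" by (auto simp: L2_set_eq_0_iff)
    then have "bil p a x y = 0" by (auto simp: bil_def)
    then show ?thesis using l by simp
  next
    case False
    then have pos: "0 < nrm p x" "0 < nrm p y" by (auto simp: less_le)
    let ?s = "sqrt (nrm p y / nrm p x)"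
    have s: "0 < ?s" "?s\<^sup>2 = nrm p y / nrm p x" using pos by auto
    have n: "(nrm p (\<lambda>i. r * z i))\<^sup>2 = r\<^sup>2 * (nrm p z)\<^sup>2" for r z
      by (simp add: L2_set_def sum_nonneg power_mult_distrib sum_distrib_left)
    have "2 * \<bar>bil p a (\<lambda>i. ?s * x i) (\<lambda>i. 1 / ?s * y i)\<bar> \<le> l * (?s\<^sup>2 * (nrm p x)\<^sup>2 + (1 / ?s)\<^sup>2 * (nrm p y)\<^sup>2)"
      using two[of "\<lambda>i. ?s * x i" "\<lambda>i. 1 / ?s * y i"] unfolding n .
    also have "bil p a (\<lambda>i. ?s * x i) (\<lambda>i. 1 / ?s * y i) = bil p a x y"
      unfolding bil_scale using less_imp_neq[OF s(1)] by (simp del: real_sqrt_eq_0_iff real_sqrt_eq_zero_cancel_iff)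
    also have "?s\<^sup>2 * (nrm p x)\<^sup>2 + (1 / ?s)\<^sup>2 * (nrm p y)\<^sup>2 = 2 * (nrm p x * nrm p y)"
      unfolding power_divide s(2) using pos by (simp add: power2_eq_square)
    finally show ?thesis by simp
  qed
qed

section \<open>The design\<close>

lemma gram_entry:
  assumes X: "X \<in> carrier_mat n p" and "i < p" "j < p"
  shows "gram X $$ (i, j) = (\<Sum>k<n. X $$ (k, i) * X $$ (k, j))"
  using assms by (simp add: gram_def scalar_prod_def atLeast0LessThan)

lemma gram_carrier: "X \<in> carrier_mat n p \<Longrightarrow> gram X \<in> carrier_mat p p"
  by (auto simp: gram_def)

lemma bil_gram:
  assumes X: "X \<in> carrier_mat n p"
  shows "bil p (\<lambda>i j. gram X $$ (i, j)) x y = (\<Sum>k<n. (\<Sum>i<p. X $$ (k, i) * x i) * (\<Sum>j<p. X $$ (k, j) * y j))"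
proof -
  have "bil p (\<lambda>i j. gram X $$ (i, j)) x y = (\<Sum>i<p. \<Sum>j<p. \<Sum>k<n. X $$ (k, i) * x i * (X $$ (k, j) * y j))"
    unfolding bil_def by (intro sum.cong refl) (simp add: gram_entry[OF X] sum_distrib_left sum_distrib_right mult_ac)
  also have "\<dots> = (\<Sum>k<n. \<Sum>i<p. \<Sum>j<p. X $$ (k, i) * x i * (X $$ (k, j) * y j))"
    by (subst sum.swap[of _ "{..<n}"], subst sum.swap[of _ "{..<n}" "{..<p}"]) (intro sum.cong refl sum.swap)
  finally show ?thesis by (simp add: sum_product)
qed

lemma gram_sym: "X \<in> carrier_mat n p \<Longrightarrow> i < p \<Longrightarrow> j < p \<Longrightarrow> gram X $$ (i, j) = gram X $$ (j, i)"
  by (simp add: gram_entry mult.commute)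

lemma gram_rayleigh:
  assumes X: "X \<in> carrier_mat n p" and p: "0 < p"
  shows "bil p (\<lambda>i j. gram X $$ (i, j)) x x \<le> lambda_max (gram X) * (\<Sum>i<p. (x i)\<^sup>2)"
proof -
  have G: "gram X \<in> carrier_mat p p" by (rule gram_carrier[OF X])
  obtain v l where v0: "\<exists>i<p. v i \<noteq> 0" and ev: "\<And>i. i < p \<Longrightarrow> (\<Sum>j<p. gram X $$ (i, j) * v j) = l * v i"
    and ray: "\<And>x. bil p (\<lambda>i j. gram X $$ (i, j)) x x \<le> l * (\<Sum>i<p. (x i)\<^sup>2)"
    using rayleigh_maximizer[of p "\<lambda>i j. gram X $$ (i, j)", OF gram_sym[OF X] p] by blast
  have "eigenvector (gram X) (vec p v) l"
    unfolding eigenvector_def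
  proof (intro conjI)
    show "vec p v \<in> carrier_vec (dim_row (gram X))" using G by auto
    show "vec p v \<noteq> 0\<^sub>v (dim_row (gram X))"
    proof
      assume "vec p v = 0\<^sub>v (dim_row (gram X))"
      then have "vec p v = 0\<^sub>v p" using G by auto
      moreover obtain i where "i < p" "v i \<noteq> 0" using v0 by blast
      ultimately show False by (metis index_vec index_zero_vec(1))
    qed
    show "gram X *\<^sub>v vec p v = l \<cdot>\<^sub>v vec p v"
      using G ev by (intro eq_vecI) (auto simp: scalar_prod_def atLeast0LessThan)
  qed
  then have "l \<in> spectrum (gram X)" by (auto simp: spectrum_def eigenvalue_def)
  then have "l \<le> lambda_max (gram X)" unfolding lambda_max_def using card_finite_spectrum(1)[OF G] by (intro Max_ge)
  then have "l * (\<Sum>i<p. (x i)\<^sup>2) \<le> lambda_max (gram X) * (\<Sum>i<p. (x i)\<^sup>2)"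
    by (intro mult_right_mono sum_nonneg) auto
  then show ?thesis using ray[of x] by linarith
qed

locale design =
  fixes X :: "real mat" and n p :: nat and \<sigma> C :: real
  assumes carrier: "X \<in> carrier_mat n p" and p_pos: "0 < p" and sigma_pos: "0 < \<sigma>"
    and eig: "lambda_max (gram X) / \<sigma>\<^sup>2 \<le> C" and C_nonneg: "0 \<le> C"
begin

abbreviation "gs i j \<equiv> gram X $$ (i, j) / \<sigma>\<^sup>2"
abbreviation "amat i j \<equiv> offdiag \<sigma> X $$ (i, j)"
abbreviation "dvec \<equiv> diag_coeff \<sigma> X"

lemma dims [simp]: "dim_row X = n" "dim_col X = p"
  using carrier by auto

lemma amat: "i < p \<Longrightarrow> j < p \<Longrightarrow> amat i j = (if i = j then 0 else gs i j)"
  by (simp add: offdiag_def)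

lemma gs_sym: "i < p \<Longrightarrow> j < p \<Longrightarrow> gs i j = gs j i"
  using gram_sym[OF carrier] by simp

lemma bil_gs: "bil p gs x y = bil p (\<lambda>i j. gram X $$ (i, j)) x y / \<sigma>\<^sup>2"
  by (simp add: bil_def sum_divide_distrib)

lemma gs_psd: "0 \<le> bil p gs x x"
  unfolding bil_gs bil_gram[OF carrier] by (intro divide_nonneg_nonneg sum_nonneg) auto

lemma gs_upper: "bil p gs x x \<le> C * (\<Sum>i<p. (x i)\<^sup>2)"
proof -
  have "bil p gs x x \<le> lambda_max (gram X) * (\<Sum>i<p. (x i)\<^sup>2) / \<sigma>\<^sup>2"
    unfolding bil_gs using gram_rayleigh[OF carrier p_pos] by (intro divide_right_mono) auto
  also have "\<dots> = lambda_max (gram X) / \<sigma>\<^sup>2 * (\<Sum>i<p. (x i)\<^sup>2)" by simp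
  also have "\<dots> \<le> C * (\<Sum>i<p. (x i)\<^sup>2)" using eig by (intro mult_right_mono sum_nonneg) auto
  finally show ?thesis .
qed

lemma gs_bil: "\<bar>bil p gs x y\<bar> \<le> C * nrm p x * nrm p y"
  by (rule psd_cauchy_schwarz[OF gs_sym gs_psd gs_upper C_nonneg])

lemma gs_bound: "i < p \<Longrightarrow> j < p \<Longrightarrow> \<bar>gs i j\<bar> \<le> C"
proof -
  assume i: "i < p" and j: "j < p"
  let ?e = "\<lambda>i k. if k = i then 1 else (0::real)"
  have n: "nrm p (?e i) = 1" if "i < p" for i
    using that by (simp add: L2_set_def if_distrib[of "\<lambda>x. x\<^sup>2"] sum.delta cong: if_cong)
  have "bil p gs (?e i) (?e j) = gs i j"
    unfolding bil_def using i j
    by (simp add: if_distrib[of "\<lambda>x. _ * x"] if_distrib[of "\<lambda>x. x * _"] if_distrib[of "\<lambda>x. x / _"] sum.delta cong: if_cong)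
  then show ?thesis using gs_bil[of "?e i" "?e j"] n i j by simp
qed

lemma dvec: "i < p \<Longrightarrow> dvec i = gs i i"
  by (simp add: diag_coeff_def)

lemma dvec_bounds: "i < p \<Longrightarrow> 0 \<le> dvec i" "i < p \<Longrightarrow> dvec i \<le> C"
proof -
  assume i: "i < p"
  show "0 \<le> dvec i" using i by (simp add: dvec gram_entry[OF carrier] sum_nonneg)
  show "dvec i \<le> C" using gs_bound[OF i i] abs_ge_self[of "gs i i"] unfolding dvec[OF i] by linarith
qed

lemma bil_amat: "bil p amat x y = bil p gs x y - (\<Sum>i<p. dvec i * (x i * y i))"
proof -
  have "bil p amat x y = (\<Sum>i<p. (\<Sum>j<p. x i * gs i j * y j) - dvec i * (x i * y i))"
    unfolding bil_def
  proof (rule sum.cong)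
    fix i assume "i \<in> {..<p}"
    then have i: "i < p" by simp
    have "(\<Sum>j<p. x i * amat i j * y j) = (\<Sum>j<p. x i * gs i j * y j - (if j = i then dvec i * (x i * y i) else 0))"
      using i by (intro sum.cong) (auto simp: amat dvec)
    then show "(\<Sum>j<p. x i * amat i j * y j) = (\<Sum>j<p. x i * gs i j * y j) - dvec i * (x i * y i)"
      using i by (simp add: sum_subtractf sum.delta)
  qed simp
  then show ?thesis by (simp add: sum_subtractf bil_def)
qed

text \<open>The scaled Gram form and the diagonal removed from it contribute \<open>C\<close> each,
  whence the factor 2.\<close>

lemma amat_bil: "\<bar>bil p amat x y\<bar> \<le> 2 * C * nrm p x * nrm p y"
proof -
  have "\<bar>\<Sum>i<p. dvec i * (x i * y i)\<bar> \<le> (\<Sum>i<p. C * (\<bar>x i\<bar> * \<bar>y i\<bar>))"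
  proof (rule order_trans[OF sum_abs], rule sum_mono)
    fix i assume "i \<in> {..<p}"
    then show "\<bar>dvec i * (x i * y i)\<bar> \<le> C * (\<bar>x i\<bar> * \<bar>y i\<bar>)"
      using dvec_bounds[of i] unfolding abs_mult by (intro mult_right_mono) auto
  qed
  also have "\<dots> \<le> C * (nrm p x * nrm p y)"
    unfolding sum_distrib_left[symmetric] using C_nonneg by (intro mult_left_mono L2_set_mult_ineq)
  finally show ?thesis using gs_bil[of x y] unfolding bil_amat by (simp add: mult.assoc)
qed

lemma trace_amat: "mat_trace (offdiag \<sigma> X * offdiag \<sigma> X) = (\<Sum>i<p. \<Sum>j<p. (amat i j)\<^sup>2)"
proof -
  have c: "offdiag \<sigma> X \<in> carrier_mat p p" by (simp add: offdiag_def)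
  have "mat_trace (offdiag \<sigma> X * offdiag \<sigma> X) = (\<Sum>i<p. \<Sum>j<p. amat i j * amat j i)"
    unfolding mat_trace_def using c by (auto intro!: sum.cong simp: scalar_prod_def atLeast0LessThan)
  also have "\<dots> = (\<Sum>i<p. \<Sum>j<p. (amat i j)\<^sup>2)"
    using gs_sym by (intro sum.cong refl) (auto simp: amat power2_eq_square)
  finally show ?thesis .
qed

lemma mf_system_design:
  assumes "nrm p w \<le> W * sqrt p" "0 \<le> W"
  shows "mf_system p amat dvec w (2 * C) W C"
proof
  show "amat i j = amat j i" if "i < p" "j < p" for i j using gs_sym that by (simp add: amat)
qed (use assms C_nonneg amat_bil dvec_bounds in \<open>auto simp: amat\<close>)

lemma mf_objective_eq: "interval_law \<mu> \<Longrightarrow> mf_objective \<sigma> X \<mu> v u = mf_obj p amat dvec v \<mu> u"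
  unfolding mf_objective_def mf_obj_def bil_def lin_def
  by (simp add: interval_law.KL_tilt)

lemma score_expand:
  assumes "\<And>j. j < n \<Longrightarrow> y j = (\<Sum>i<p. X $$ (j, i) * \<beta> i) + e j" and i: "i < p"
  shows "score \<sigma> X y i = (\<Sum>j<p. gs i j * \<beta> j) + (\<Sum>k<n. X $$ (k, i) * e k) / \<sigma>\<^sup>2"
proof -
  have "(\<Sum>k<n. X $$ (k, i) * y k) = (\<Sum>k<n. X $$ (k, i) * (\<Sum>j<p. X $$ (k, j) * \<beta> j) + X $$ (k, i) * e k)"
    using assms(1) by (intro sum.cong) (auto simp: distrib_left)
  also have "\<dots> = (\<Sum>j<p. gram X $$ (i, j) * \<beta> j) + (\<Sum>k<n. X $$ (k, i) * e k)"
  proof -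
    have "(\<Sum>k<n. X $$ (k, i) * (\<Sum>j<p. X $$ (k, j) * \<beta> j)) = (\<Sum>k<n. \<Sum>j<p. X $$ (k, i) * X $$ (k, j) * \<beta> j)"
      by (simp add: sum_distrib_left mult.assoc)
    also have "\<dots> = (\<Sum>j<p. \<Sum>k<n. X $$ (k, i) * X $$ (k, j) * \<beta> j)" by (rule sum.swap)
    also have "\<dots> = (\<Sum>j<p. gram X $$ (i, j) * \<beta> j)"
      using i by (intro sum.cong) (auto simp: gram_entry[OF carrier] sum_distrib_right)
    finally show ?thesis by (simp add: sum.distrib)
  qed
  finally show ?thesis by (simp add: score_def add_divide_distrib sum_divide_distrib)
qed

text \<open>As in \<open>stationary_bound\<close>, the bilinear bound is tested against the image
  vector itself.\<close>

lemma nrm_gs: "nrm p (\<lambda>i. \<Sum>j<p. gs i j * \<beta> j) \<le> C * nrm p \<beta>"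
proof -
  define z where "z i = (\<Sum>j<p. gs i j * \<beta> j)" for i
  have "bil p gs z \<beta> = (\<Sum>i<p. z i * (\<Sum>j<p. gs i j * \<beta> j))"
    unfolding bil_def by (simp only: sum_distrib_left mult.assoc)
  then have "(nrm p z)\<^sup>2 = bil p gs z \<beta>"
    by (simp only: L2_set_def z_def[symmetric] power2_eq_square[symmetric]) (simp add: sum_nonneg)
  also have "\<dots> \<le> C * nrm p z * nrm p \<beta>" using gs_bil[of z \<beta>] by simp
  finally have "nrm p z * nrm p z \<le> (C * nrm p \<beta>) * nrm p z" by (simp add: power2_eq_square mult_ac)
  then have "nrm p z \<le> C * nrm p \<beta>" using C_nonneg by (cases "nrm p z = 0") (auto simp: less_le)
  then show ?thesis by (simp add: z_def[abs_def])
qed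

end

section \<open>A countable generator of the Borel sets\<close>

lemma borel_rational_halflines: "borel = sigma UNIV ((\<lambda>q. {..q::real}) ` \<rat>)"
proof (rule borel_eq_sigmaI1[OF borel_eq_atMost])
  fix x :: "real set" assume "x \<in> range (\<lambda>a. {..a})"
  then obtain a where x: "x = {..a}" by blast
  have "{..a} = (\<Inter>q\<in>{q \<in> \<rat>. a \<le> q}. {..q})"
  proof (intro equalityI subsetI)
    fix z assume z: "z \<in> (\<Inter>q\<in>{q \<in> \<rat>. a \<le> q}. {..q})"
    show "z \<in> {..a}"
    proof (rule ccontr)
      assume "z \<notin> {..a}"
      then obtain q where "q \<in> \<rat>" "a < q" "q < z" using Rats_dense_in_real[of a z] by auto
      then show False using z by force
    qed
  qed auto
  moreover have "(\<Inter>q\<in>{q \<in> \<rat>. a \<le> q}. {..q}) \<in> sets (sigma UNIV ((\<lambda>q. {..q::real}) ` \<rat>))"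
  proof (rule sets.countable_INT')
    show "countable {q \<in> \<rat>. a \<le> q}" using countable_rat by (rule countable_subset[rotated]) auto
    obtain q where "q \<in> \<rat>" "a < q" using Rats_dense_in_real[of a "a + 1"] by auto
    then show "{q \<in> \<rat>. a \<le> q} \<noteq> {}" by force
  qed (auto simp: image_subset_iff)
  ultimately show "x \<in> sets (sigma UNIV ((\<lambda>q. {..q::real}) ` \<rat>))" by (simp add: x)
qed auto

text \<open>Lower boxes with rational corners form a countable intersection-stable generator.
  Countability is the point: equalities that hold almost everywhere for each box can be
  combined.\<close>

lemma prob_eq_on_rational_boxes:
  assumes P: "prob_space P" "sets P = sets (vec_space p)" and Q: "prob_space Q" "sets Q = sets (vec_space p)"
    and eq: "\<And>r. r \<in> PiE {..<p} (\<lambda>_. \<rat>) \<Longrightarrow> emeasure P (PiE {..<p} (\<lambda>i. {..r i})) = emeasure Q (PiE {..<p} (\<lambda>i. {..r i}))"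
  shows "P = Q"
proof -
  let ?E = "(\<lambda>q. {..q::real}) ` \<rat>"
  let ?B = "\<lambda>r. PiE {..<p} (\<lambda>i. {..r i :: real})"
  let ?G = "{{f \<in> PiE {..<p} (\<lambda>_. UNIV). \<forall>i\<in>j. f i \<in> A i} | A j. j \<in> {{..<p}} \<and> A \<in> Pi j (\<lambda>_. ?E)}"
  have "sets (vec_space p) = sets (Pi\<^sub>M {..<p} (\<lambda>_. sigma UNIV ?E))"
    by (subst borel_rational_halflines) simp
  also have "\<dots> = sets (sigma (PiE {..<p} (\<lambda>_. UNIV)) ?G)"
  proof (rule sets_PiM_sigma)
    show "\<exists>S\<subseteq>?E. countable S \<and> UNIV = \<Union>S" if "i \<in> {..<p}" for i
    proof (intro exI[of _ ?E] conjI)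
      show "UNIV = \<Union>?E"
      proof (intro equalityI subsetI)
        fix x :: real
        obtain q where "q \<in> \<rat>" "x < q" using Rats_dense_in_real[of x "x + 1"] by auto
        then show "x \<in> \<Union>?E" by (intro UnionI[of "{..q}"]) auto
      qed simp
    qed (use countable_rat in auto)
  qed auto
  also have "\<dots> = sigma_sets (PiE {..<p} (\<lambda>_. UNIV)) ?G" by (rule sets_measure_of) auto
  also have G: "?G = ?B ` PiE {..<p} (\<lambda>_. \<rat>)"
  proof (intro equalityI subsetI)
    fix X assume "X \<in> ?G"
    then obtain A where A: "A \<in> Pi {..<p} (\<lambda>_. ?E)" and X: "X = {f \<in> PiE {..<p} (\<lambda>_. UNIV). \<forall>i\<in>{..<p}. f i \<in> A i}" by blast
    have "\<forall>i\<in>{..<p}. \<exists>q\<in>\<rat>. A i = {..q}" using A by (auto simp: Pi_iff image_iff)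
    then obtain r where r: "\<And>i. i < p \<Longrightarrow> r i \<in> \<rat> \<and> A i = {..r i}" by (metis lessThan_iff)
    have "X = ?B r"
    proof (rule Set.set_eqI)
      fix f show "f \<in> X \<longleftrightarrow> f \<in> ?B r" unfolding X using r by (simp add: PiE_iff) blast
    qed
    also have "?B r = ?B (restrict r {..<p})" by (rule PiE_cong) simp
    finally have "X = ?B (restrict r {..<p})" .
    moreover have "restrict r {..<p} \<in> PiE {..<p} (\<lambda>_. \<rat>)" using r by auto
    ultimately show "X \<in> ?B ` PiE {..<p} (\<lambda>_. \<rat>)" by blast
  next
    fix X assume "X \<in> ?B ` PiE {..<p} (\<lambda>_. \<rat>)"
    then obtain r where r: "r \<in> PiE {..<p} (\<lambda>_. \<rat>)" and X: "X = ?B r" by blast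
    have "X = {f \<in> PiE {..<p} (\<lambda>_. UNIV). \<forall>i\<in>{..<p}. f i \<in> {..r i}}"
    proof (rule Set.set_eqI)
      fix f show "f \<in> X \<longleftrightarrow> f \<in> {f \<in> PiE {..<p} (\<lambda>_. UNIV). \<forall>i\<in>{..<p}. f i \<in> {..r i}}"
        unfolding X by (simp add: PiE_iff) blast
    qed
    moreover have "(\<lambda>i. {..r i}) \<in> Pi {..<p} (\<lambda>_. ?E)" using r by auto
    ultimately show "X \<in> ?G" unfolding mem_Collect_eq
      by (intro exI[of _ "\<lambda>i. {..r i}"] exI[of _ "{..<p}"] conjI) simp_all
  qed
  finally have gen: "sets (vec_space p) = sigma_sets (PiE {..<p} (\<lambda>_. UNIV)) (?B ` PiE {..<p} (\<lambda>_. \<rat>))" .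
  show ?thesis
  proof (rule measure_eqI_generator_eq_countable[where E="?B ` PiE {..<p} (\<lambda>_. \<rat>)" and \<Omega>="PiE {..<p} (\<lambda>_. UNIV)" and A="?B ` PiE {..<p} (\<lambda>_. \<rat>)"])
    show "Int_stable (?B ` PiE {..<p} (\<lambda>_. \<rat>))"
    proof (rule Int_stableI)
      fix X Y assume "X \<in> ?B ` PiE {..<p} (\<lambda>_. \<rat>)" "Y \<in> ?B ` PiE {..<p} (\<lambda>_. \<rat>)"
      then obtain r s where rs: "r \<in> PiE {..<p} (\<lambda>_. \<rat>)" "s \<in> PiE {..<p} (\<lambda>_. \<rat>)" "X = ?B r" "Y = ?B s" by blast
      let ?t = "\<lambda>i\<in>{..<p}. min (r i) (s i)"
      have "X \<inter> Y = PiE {..<p} (\<lambda>i. {..r i} \<inter> {..s i})" unfolding rs(3,4) by (rule PiE_Int)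
      also have "\<dots> = ?B ?t" by (rule PiE_cong) simp
      finally have "X \<inter> Y = ?B ?t" .
      moreover have "?t \<in> PiE {..<p} (\<lambda>_. \<rat>)"
      proof (rule restrict_PiE_iff[THEN iffD2], rule ballI)
        fix i assume "i \<in> {..<p}"
        then show "min (r i) (s i) \<in> \<rat>" using PiE_mem[OF rs(1)] PiE_mem[OF rs(2)] by (simp add: min_def)
      qed
      ultimately show "X \<inter> Y \<in> ?B ` PiE {..<p} (\<lambda>_. \<rat>)" by (rule image_eqI)
    qed
    show "\<Union> (?B ` PiE {..<p} (\<lambda>_. \<rat>)) = PiE {..<p} (\<lambda>_. UNIV)"
    proof (rule equalityI)
      show "PiE {..<p} (\<lambda>_. UNIV) \<subseteq> \<Union> (?B ` PiE {..<p} (\<lambda>_. \<rat>))"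
      proof (rule subsetI)
        fix f :: "nat \<Rightarrow> real" assume f: "f \<in> PiE {..<p} (\<lambda>_. UNIV)"
        have "\<exists>q\<in>\<rat>. x < q" for x :: real using Rats_dense_in_real[of x "x + 1"] by auto
        then obtain q where q: "\<And>x::real. q x \<in> \<rat> \<and> x < q x" by metis
        have 1: "f \<in> ?B (\<lambda>i\<in>{..<p}. q (f i))"
        proof (rule PiE_I)
          fix i assume "i \<in> {..<p}"
          then show "f i \<in> {..(\<lambda>i\<in>{..<p}. q (f i)) i}" using q[of "f i"] by simp
        next
          fix i assume "i \<notin> {..<p}"
          then show "f i = undefined" by (rule PiE_arb[OF f])
        qed
        have 2: "(\<lambda>i\<in>{..<p}. q (f i)) \<in> PiE {..<p} (\<lambda>_. \<rat>)"
          using q by (intro restrict_PiE_iff[THEN iffD2]) simp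
        show "f \<in> \<Union> (?B ` PiE {..<p} (\<lambda>_. \<rat>))" using 1 2 by (meson UN_I)
      qed
      show "\<Union> (?B ` PiE {..<p} (\<lambda>_. \<rat>)) \<subseteq> PiE {..<p} (\<lambda>_. UNIV)"
        by (intro Union_least) (erule imageE, simp only:, rule PiE_mono, simp)
    qed
    show "countable (?B ` PiE {..<p} (\<lambda>_. \<rat>))" by (intro countable_image countable_PiE countable_rat) auto
    show "emeasure P a \<noteq> \<infinity>" for a
      using prob_space.emeasure_le_1[OF P(1), of a] by (auto simp: top_unique)
  qed (use eq P Q gen in \<open>auto simp: PiE_iff\<close>)
qed

section \<open>The noise\<close>

abbreviation noise1 :: "real \<Rightarrow> real measure" where
  "noise1 \<sigma> \<equiv> density lborel (\<lambda>x. ennreal (normal_density 0 \<sigma> x))"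

abbreviation noise :: "real \<Rightarrow> nat \<Rightarrow> (nat \<Rightarrow> real) measure" where
  "noise \<sigma> n \<equiv> Pi\<^sub>M {..<n} (\<lambda>_. noise1 \<sigma>)"

context
  fixes \<sigma> :: real assumes \<sigma>: "0 < \<sigma>"
begin

interpretation Q1: prob_space "noise1 \<sigma>"
  using prob_space_normal_density[OF \<sigma>, of 0] by simp

interpretation Q: product_prob_space "\<lambda>_::nat. noise1 \<sigma>" I for I
  by unfold_locales

lemma noise1_moments:
  "integrable (noise1 \<sigma>) (\<lambda>x. x)" "(\<integral>x. x \<partial>noise1 \<sigma>) = 0"
  "integrable (noise1 \<sigma>) (\<lambda>x. x * x)" "(\<integral>x. x * x \<partial>noise1 \<sigma>) = \<sigma>\<^sup>2"
proof -
  have 1: "has_bochner_integral lborel (\<lambda>x. normal_density 0 \<sigma> x * x) 0"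
    using normal_moment_odd[OF \<sigma>, of 0 0] by simp
  have 2: "has_bochner_integral lborel (\<lambda>x. normal_density 0 \<sigma> x * (x * x)) (\<sigma>\<^sup>2)"
    using normal_moment_even[OF \<sigma>, of 0 1] by (simp add: power2_eq_square numeral_2_eq_2)
  show "integrable (noise1 \<sigma>) (\<lambda>x. x)" "(\<integral>x. x \<partial>noise1 \<sigma>) = 0"
    using 1 by (auto simp: integrable_density integral_density has_bochner_integral_iff)
  show "integrable (noise1 \<sigma>) (\<lambda>x. x * x)" "(\<integral>x. x * x \<partial>noise1 \<sigma>) = \<sigma>\<^sup>2"
    using 2 by (auto simp: integrable_density integral_density has_bochner_integral_iff)
qed

lemma noise_covariance:
  assumes j: "j < n" and k: "k < n"
  shows "integrable (noise \<sigma> n) (\<lambda>e. e j * e k)" "(\<integral>e. e j * e k \<partial>noise \<sigma> n) = (if j = k then \<sigma>\<^sup>2 else 0)"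
proof -
  let ?f = "\<lambda>i x :: real. (if i = j then x else 1) * (if i = k then x else 1)"
  have prod: "(\<Prod>i<n. ?f i (e i)) = e j * e k" for e
    unfolding prod.distrib using j k by (simp add: prod.delta)
  have i: "integrable (noise1 \<sigma>) (?f i)" for i
    using noise1_moments(1,3) by (cases "i = j"; cases "i = k") auto
  show "integrable (noise \<sigma> n) (\<lambda>e. e j * e k)"
    using Q.product_integrable_prod[of "{..<n}" ?f] i unfolding prod by simp
  have "(\<integral>e. e j * e k \<partial>noise \<sigma> n) = (\<Prod>i<n. \<integral>x. ?f i x \<partial>noise1 \<sigma>)"
    using Q.product_integral_prod[of "{..<n}" ?f] i unfolding prod by simp
  also have "\<dots> = (if j = k then \<sigma>\<^sup>2 else 0)"
  proof (cases "j = k")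
    case True
    have "(\<Prod>i<n. \<integral>x. ?f i x \<partial>noise1 \<sigma>) = (\<Prod>i<n. if i = j then \<sigma>\<^sup>2 else 1)"
      using True noise1_moments(4) Q1.prob_space by (intro prod.cong) auto
    then show ?thesis using True j by (simp add: prod.delta)
  next
    case False
    have "(\<integral>x. ?f j x \<partial>noise1 \<sigma>) = 0" using False noise1_moments(2) by simp
    then have "\<exists>i\<in>{..<n}. (\<integral>x. ?f i x \<partial>noise1 \<sigma>) = 0" using j by (intro bexI[of _ j]) auto
    then have "(\<Prod>i<n. \<integral>x. ?f i x \<partial>noise1 \<sigma>) = 0" by (intro prod_zero) auto
    then show ?thesis using False by simp
  qed
  finally show "(\<integral>e. e j * e k \<partial>noise \<sigma> n) = (if j = k then \<sigma>\<^sup>2 else 0)" .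
qed

lemma noise_linear_second_moment:
  "integrable (noise \<sigma> n) (\<lambda>e. (\<Sum>k<n. b k * e k)\<^sup>2)"
  "(\<integral>e. (\<Sum>k<n. b k * e k)\<^sup>2 \<partial>noise \<sigma> n) = \<sigma>\<^sup>2 * (\<Sum>k<n. (b k)\<^sup>2)"
proof -
  have e: "(\<Sum>k<n. b k * e k)\<^sup>2 = (\<Sum>j<n. \<Sum>k<n. b j * b k * (e j * e k))" for e
    by (simp add: power2_eq_square sum_product mult_ac)
  show "integrable (noise \<sigma> n) (\<lambda>e. (\<Sum>k<n. b k * e k)\<^sup>2)"
    unfolding e using noise_covariance(1)
    by (intro Bochner_Integration.integrable_sum integrable_mult_right) auto
  have "(\<integral>e. (\<Sum>k<n. b k * e k)\<^sup>2 \<partial>noise \<sigma> n) = (\<Sum>j<n. \<Sum>k<n. b j * b k * (\<integral>e. e j * e k \<partial>noise \<sigma> n))"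
    unfolding e using noise_covariance(1)
    by (subst Bochner_Integration.integral_sum, force intro!: Bochner_Integration.integrable_sum)
      (intro sum.cong refl, subst Bochner_Integration.integral_sum, auto)
  also have "\<dots> = (\<Sum>j<n. \<Sum>k<n. if k = j then b j * b j * \<sigma>\<^sup>2 else 0)"
    using noise_covariance(2) by (intro sum.cong refl) auto
  also have "\<dots> = \<sigma>\<^sup>2 * (\<Sum>k<n. (b k)\<^sup>2)"
    by (simp add: sum.delta sum_distrib_left power2_eq_square mult_ac)
  finally show "(\<integral>e. (\<Sum>k<n. b k * e k)\<^sup>2 \<partial>noise \<sigma> n) = \<sigma>\<^sup>2 * (\<Sum>k<n. (b k)\<^sup>2)" .
qed

text \<open>The Cameron--Martin formula. It replaces the Lebesgue density of \<open>y\<close> by its density with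
  respect to pure noise, which is \<open>e\<^sup>H\<close> for the energy \<open>H\<close> of the posterior.\<close>

lemma noise1_shift:
  assumes A: "A \<in> sets borel"
  shows "emeasure (noise1 \<sigma>) {x. m + x \<in> A}
    = (\<integral>\<^sup>+x. ennreal (exp (m * x / \<sigma>\<^sup>2 - m\<^sup>2 / (2 * \<sigma>\<^sup>2))) * indicator A x \<partial>noise1 \<sigma>)"
proof -
  note [measurable] = A
  have [measurable]: "{x. m + x \<in> A} \<in> sets borel"
    using measurable_sets_borel[of "\<lambda>x. m + x" borel A] A by (simp add: vimage_def)
  have d: "normal_density 0 \<sigma> x * exp (m * x / \<sigma>\<^sup>2 - m\<^sup>2 / (2 * \<sigma>\<^sup>2)) = normal_density 0 \<sigma> (x - m)" for x
  proof -
    have "- x\<^sup>2 / (2 * \<sigma>\<^sup>2) + (m * x / \<sigma>\<^sup>2 - m\<^sup>2 / (2 * \<sigma>\<^sup>2)) = - (x - m)\<^sup>2 / (2 * \<sigma>\<^sup>2)"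
      using \<sigma> by (simp add: power2_diff field_simps)
    then show ?thesis by (simp add: normal_density_def flip: exp_add)
  qed
  have "(\<integral>\<^sup>+x. ennreal (exp (m * x / \<sigma>\<^sup>2 - m\<^sup>2 / (2 * \<sigma>\<^sup>2))) * indicator A x \<partial>noise1 \<sigma>)
      = (\<integral>\<^sup>+x. ennreal (normal_density 0 \<sigma> (x - m)) * indicator A x \<partial>lborel)"
    by (subst nn_integral_density) (auto intro!: nn_integral_cong simp: d[symmetric] ennreal_mult mult.assoc)
  also have "\<dots> = (\<integral>\<^sup>+x. ennreal (normal_density 0 \<sigma> x) * indicator {x. m + x \<in> A} x \<partial>lborel)"
    by (subst nn_integral_real_affine[where c=1 and t=m]) (auto intro!: nn_integral_cong simp: indicator_def)
  also have "\<dots> = emeasure (noise1 \<sigma>) {x. m + x \<in> A}" by (subst emeasure_density) auto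
  finally show ?thesis by simp
qed

text \<open>Both sides are the product of the shifted one-dimensional laws, checked on boxes; the
  product density factorises over the coordinates.\<close>

lemma noise_shift:
  "distr (noise \<sigma> n) (vec_space n) (\<lambda>e. \<lambda>j\<in>{..<n}. m j + e j)
    = density (noise \<sigma> n) (\<lambda>y. \<Prod>j<n. ennreal (exp (m j * y j / \<sigma>\<^sup>2 - (m j)\<^sup>2 / (2 * \<sigma>\<^sup>2))))"
proof -
  let ?w = "\<lambda>j x. ennreal (exp (m j * x / \<sigma>\<^sup>2 - (m j)\<^sup>2 / (2 * \<sigma>\<^sup>2)))"
  let ?D = "density (noise \<sigma> n) (\<lambda>y. \<Prod>j<n. ?w j (y j))"
  have sN: "sets (noise \<sigma> n) = sets (vec_space n)" by (intro sets_PiM_cong) auto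
  have s1: "(\<lambda>x. m j + x) \<in> noise1 \<sigma> \<rightarrow>\<^sub>M borel" for j by simp
  interpret S: product_prob_space "\<lambda>j. distr (noise1 \<sigma>) borel (\<lambda>x. m j + x)" "{..<n}"
    by (intro product_prob_spaceI Q1.prob_space_distr s1)
  have "?D = Pi\<^sub>M {..<n} (\<lambda>j. distr (noise1 \<sigma>) borel (\<lambda>x. m j + x))"
  proof (rule S.PiM_eqI)
    show "sets ?D = sets (Pi\<^sub>M {..<n} (\<lambda>j. distr (noise1 \<sigma>) borel (\<lambda>x. m j + x)))"
      by (simp, intro sets_PiM_cong) auto
    fix A assume A: "\<And>j. j \<in> {..<n} \<Longrightarrow> A j \<in> sets (distr (noise1 \<sigma>) borel (\<lambda>x. m j + x))"
    have bA: "PiE {..<n} A \<in> sets (noise \<sigma> n)" using A by (intro sets_PiM_I_finite) auto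
    have "emeasure ?D (PiE {..<n} A) = (\<integral>\<^sup>+y. (\<Prod>j<n. ?w j (y j)) * indicator (PiE {..<n} A) y \<partial>noise \<sigma> n)"
      using bA by (subst emeasure_density) (auto simp: measurable_cong_sets[OF sN refl])
    also have "\<dots> = (\<integral>\<^sup>+y. (\<Prod>j<n. ?w j (y j) * indicator (A j) (y j)) \<partial>noise \<sigma> n)"
    proof (rule nn_integral_cong)
      fix y assume "y \<in> space (noise \<sigma> n)"
      then have "indicator (PiE {..<n} A) y = (\<Prod>j<n. indicator (A j) (y j) :: ennreal)"
        by (auto simp: indicator_def space_PiM PiE_iff prod_eq_1_iff intro!: prod_zero)
      then show "(\<Prod>j<n. ?w j (y j)) * indicator (PiE {..<n} A) y = (\<Prod>j<n. ?w j (y j) * indicator (A j) (y j))"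
        by (simp add: prod.distrib)
    qed
    also have "\<dots> = (\<Prod>j<n. \<integral>\<^sup>+x. ?w j x * indicator (A j) x \<partial>noise1 \<sigma>)"
      using A by (intro Q.product_nn_integral_prod[of "{..<n}" "\<lambda>j x. ?w j x * indicator (A j) x"]) auto
    also have "\<dots> = (\<Prod>j<n. emeasure (distr (noise1 \<sigma>) borel (\<lambda>x. m j + x)) (A j))"
      using A by (intro prod.cong refl) (auto simp: emeasure_distr noise1_shift[symmetric] vimage_def)
    finally show "emeasure ?D (PiE {..<n} A) = (\<Prod>j\<in>{..<n}. emeasure (distr (noise1 \<sigma>) borel (\<lambda>x. m j + x)) (A j))" .
  qed simp
  moreover have "distr (noise \<sigma> n) (vec_space n) (\<lambda>e. \<lambda>j\<in>{..<n}. m j + e j) = Pi\<^sub>M {..<n} (\<lambda>j. distr (noise1 \<sigma>) borel (\<lambda>x. m j + x))"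
  proof (rule S.PiM_eqI)
    show "sets (distr (noise \<sigma> n) (vec_space n) (\<lambda>e. \<lambda>j\<in>{..<n}. m j + e j)) = sets (Pi\<^sub>M {..<n} (\<lambda>j. distr (noise1 \<sigma>) borel (\<lambda>x. m j + x)))"
      by (simp, intro sets_PiM_cong) auto
    fix A assume A: "\<And>j. j \<in> {..<n} \<Longrightarrow> A j \<in> sets (distr (noise1 \<sigma>) borel (\<lambda>x. m j + x))"
    have shift: "(\<lambda>e. \<lambda>j\<in>{..<n}. m j + e j) \<in> noise \<sigma> n \<rightarrow>\<^sub>M vec_space n"
      by (intro measurable_restrict) (auto intro!: borel_measurable_add measurable_component_singleton simp: measurable_cong_sets[OF sN refl])
    have "emeasure (distr (noise \<sigma> n) (vec_space n) (\<lambda>e. \<lambda>j\<in>{..<n}. m j + e j)) (PiE {..<n} A)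
        = emeasure (noise \<sigma> n) (PiE {..<n} (\<lambda>j. {x. m j + x \<in> A j}))"
      using A by (subst emeasure_distr[OF shift]) (auto intro!: sets_PiM_I_finite arg_cong[where f="emeasure _"] simp: space_PiM PiE_iff)
    also have "\<dots> = (\<Prod>j<n. emeasure (noise1 \<sigma>) {x. m j + x \<in> A j})"
    proof (rule Q.emeasure_PiM)
      fix j assume "j \<in> {..<n}"
      then show "{x. m j + x \<in> A j} \<in> sets (noise1 \<sigma>)"
        using measurable_sets_borel[of "\<lambda>x. m j + x" borel "A j"] A by (simp add: vimage_def)
    qed simp
    also have "\<dots> = (\<Prod>j<n. emeasure (distr (noise1 \<sigma>) borel (\<lambda>x. m j + x)) (A j))"
      using A by (intro prod.cong refl) (auto simp: emeasure_distr vimage_def)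
    finally show "emeasure (distr (noise \<sigma> n) (vec_space n) (\<lambda>e. \<lambda>j\<in>{..<n}. m j + e j)) (PiE {..<n} A)
      = (\<Prod>j\<in>{..<n}. emeasure (distr (noise1 \<sigma>) borel (\<lambda>x. m j + x)) (A j))" .
  qed simp
  ultimately show ?thesis by simp
qed

end

section \<open>The posterior\<close>

locale model = design + interval_law \<mu> for \<mu> +
  assumes nondeg: "nondegenerate \<mu>"
begin

abbreviation H :: "(nat \<Rightarrow> real) \<Rightarrow> (nat \<Rightarrow> real) \<Rightarrow> real" where
  "H y \<equiv> energy p amat dvec (score \<sigma> X y)"

abbreviation prior :: "(nat \<Rightarrow> real) measure" where
  "prior \<equiv> Pi\<^sub>M {..<p} (\<lambda>_. \<mu>)"

abbreviation joint :: "((nat \<Rightarrow> real) \<times> (nat \<Rightarrow> real)) measure" where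
  "joint \<equiv> joint_law \<sigma> X \<mu>"

lemma mf_system_any: "mf_system p amat dvec w (2 * C) (nrm p w / sqrt p) C"
  using p_pos by (intro mf_system_design) auto

lemma gibbs_H: "gibbs \<mu> p (H y)"
  by (intro gibbs.intro interval_law_axioms gibbs_axioms.intro mf_system.obs_energy[OF mf_system_any])

text \<open>The explicit posterior, the Gibbs measure with nothing pinned. Every kernel satisfying
  \<open>is_posterior\<close> agrees with it almost surely, by
  \<open>posterior_unique\<close>.\<close>

definition post :: "(nat \<Rightarrow> real) \<Rightarrow> (nat \<Rightarrow> real) measure" where
  "post y = gibbs.pin \<mu> p (H y) {} (\<lambda>i\<in>{..<p}. 0)"

lemma cube_law_post: "cube_law (post y) p"
  unfolding post_def by (rule gibbs.cube_law_pin[OF gibbs_H]) auto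

lemma sets_prior: "sets prior = sets (vec_space p)"
  by (intro sets_PiM_cong) auto

lemma sets_noise: "sets (noise \<sigma> n) = sets (vec_space n)"
  by (intro sets_PiM_cong) auto

lemma prob_space_noise1: "prob_space (noise1 \<sigma>)"
  using prob_space_normal_density[OF sigma_pos, of 0] by simp

lemma prob_space_noise: "prob_space (noise \<sigma> n)"
  by (intro prob_space_PiM prob_space_noise1)

lemma prob_space_prior: "prob_space prior"
  by (intro prob_space_PiM prob_space_axioms)

lemma score_measurable [measurable]: "i < p \<Longrightarrow> (\<lambda>y. score \<sigma> X y i) \<in> borel_measurable (vec_space n)"
  unfolding score_def by (intro borel_measurable_divide borel_measurable_sum borel_measurable_times) auto

lemma H_measurable_pair: "(\<lambda>z. H (fst z) (snd z)) \<in> borel_measurable (vec_space n \<Otimes>\<^sub>M vec_space p)"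
proof -
  have c: "(\<lambda>z. snd z i) \<in> borel_measurable (vec_space n \<Otimes>\<^sub>M vec_space p)" if "i < p" for i
    using that by (intro measurable_compose[OF measurable_snd] measurable_component_singleton) simp
  have s: "(\<lambda>z. score \<sigma> X (fst z) i) \<in> borel_measurable (vec_space n \<Otimes>\<^sub>M vec_space p)" if "i < p" for i
    using that by (intro measurable_compose[OF measurable_fst] score_measurable)
  show ?thesis
    unfolding energy_def bil_def lin_def
    by (intro borel_measurable_diff borel_measurable_add borel_measurable_times borel_measurable_sum
        borel_measurable_const borel_measurable_power) (auto intro!: c s)
qed

text \<open>Off-diagonal and diagonal parts recombine to the Gram form, and the energy becomes the
  Cameron--Martin exponent for the shift by \<open>X\<close> applied to
  \<open>\<beta>\<close>.\<close>

lemma H_eq: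
  "H y \<beta> = (\<Sum>j<n. (\<Sum>i<p. X $$ (j, i) * \<beta> i) * y j / \<sigma>\<^sup>2 - (\<Sum>i<p. X $$ (j, i) * \<beta> i)\<^sup>2 / (2 * \<sigma>\<^sup>2))"
proof -
  let ?m = "\<lambda>j. \<Sum>i<p. X $$ (j, i) * \<beta> i"
  have "H y \<beta> = lin p (score \<sigma> X y) \<beta> - 1 / 2 * bil p gs \<beta> \<beta>"
    unfolding energy_def bil_amat by (simp add: sum_divide_distrib sum_distrib_left power2_eq_square field_simps)
  also have "lin p (score \<sigma> X y) \<beta> = (\<Sum>j<n. ?m j * y j / \<sigma>\<^sup>2)"
  proof -
    have "lin p (score \<sigma> X y) \<beta> = (\<Sum>i<p. \<Sum>j<n. X $$ (j, i) * \<beta> i * y j / \<sigma>\<^sup>2)"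
      by (simp add: lin_def score_def sum_distrib_left sum_divide_distrib mult_ac)
    also have "\<dots> = (\<Sum>j<n. \<Sum>i<p. X $$ (j, i) * \<beta> i * y j / \<sigma>\<^sup>2)" by (rule sum.swap)
    finally show ?thesis by (simp add: sum_distrib_right sum_divide_distrib)
  qed
  also have "1 / 2 * bil p gs \<beta> \<beta> = (\<Sum>j<n. (?m j)\<^sup>2 / (2 * \<sigma>\<^sup>2))"
    unfolding bil_gs bil_gram[OF carrier] by (simp add: sum_divide_distrib power2_eq_square mult_ac)
  finally show ?thesis by (simp add: sum_subtractf)
qed

lemma nn_integral_joint_noise:
  assumes F[measurable]: "F \<in> borel_measurable (vec_space n \<Otimes>\<^sub>M vec_space p)"
  shows "(\<integral>\<^sup>+z. F z \<partial>joint) =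
    (\<integral>\<^sup>+\<beta>. \<integral>\<^sup>+e. F (\<lambda>j\<in>{..<n}. (\<Sum>i<p. X $$ (j, i) * \<beta> i) + e j, \<beta>) \<partial>noise \<sigma> n \<partial>prior)"
proof -
  interpret pr: prob_space prior by (rule prob_space_prior)
  interpret no: prob_space "noise \<sigma> n" by (rule prob_space_noise)
  interpret pn: pair_sigma_finite "noise \<sigma> n" prior by unfold_locales
  note sp[measurable_cong] = sets_prior and sn[measurable_cong] = sets_noise
  let ?s = "\<lambda>\<beta> e. \<lambda>j\<in>{..<n}. (\<Sum>i<p. X $$ (j, i) * \<beta> i) + e j"
  have sh: "(\<lambda>z. ?s (fst z) (snd z)) \<in> prior \<Otimes>\<^sub>M noise \<sigma> n \<rightarrow>\<^sub>M vec_space n"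
  proof (rule measurable_restrict)
    fix j assume j: "j \<in> {..<n}"
    have "(\<lambda>z. fst z i) \<in> borel_measurable (prior \<Otimes>\<^sub>M noise \<sigma> n)" if "i < p" for i
      using that by (intro measurable_compose[OF measurable_fst]) (auto intro!: measurable_component_singleton simp: measurable_cong_sets[OF sp refl])
    moreover have "(\<lambda>z. snd z j) \<in> borel_measurable (prior \<Otimes>\<^sub>M noise \<sigma> n)"
      using j by (intro measurable_compose[OF measurable_snd]) (auto intro!: measurable_component_singleton simp: measurable_cong_sets[OF sn refl])
    ultimately show "(\<lambda>z. (\<Sum>i<p. X $$ (j, i) * fst z i) + snd z j) \<in> borel_measurable (prior \<Otimes>\<^sub>M noise \<sigma> n)"
      by (intro borel_measurable_add borel_measurable_sum borel_measurable_times) auto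
  qed
  have T: "(\<lambda>(\<beta>, e). (?s \<beta> e, \<beta>)) \<in> prior \<Otimes>\<^sub>M noise \<sigma> n \<rightarrow>\<^sub>M vec_space n \<Otimes>\<^sub>M vec_space p"
  proof -
    have "(\<lambda>z. (?s (fst z) (snd z), fst z)) \<in> prior \<Otimes>\<^sub>M noise \<sigma> n \<rightarrow>\<^sub>M vec_space n \<Otimes>\<^sub>M vec_space p"
      by (intro measurable_Pair sh) (auto simp: measurable_cong_sets[OF refl sp[symmetric]])
    then show ?thesis by (simp add: case_prod_beta')
  qed
  have "(\<integral>\<^sup>+z. F z \<partial>joint) = (\<integral>\<^sup>+z. F (?s (fst z) (snd z), fst z) \<partial>(prior \<Otimes>\<^sub>M noise \<sigma> n))"
    unfolding joint_law_def dims using F by (subst nn_integral_distr[OF T]) (simp_all add: case_prod_beta')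
  also have "\<dots> = (\<integral>\<^sup>+\<beta>. \<integral>\<^sup>+e. F (?s \<beta> e, \<beta>) \<partial>noise \<sigma> n \<partial>prior)"
    using measurable_compose[OF T F] by (subst no.nn_integral_fst[symmetric]) (auto simp: case_prod_beta')
  finally show ?thesis .
qed

text \<open>Bayes' formula before normalisation: with respect to independent pure noise and prior,
  the joint law has density \<open>exp (H y \<beta>)\<close>. Shift the noise for fixed
  \<open>\<beta>\<close>, then exchange the integrals.\<close>

lemma nn_integral_joint:
  assumes F[measurable]: "F \<in> borel_measurable (vec_space n \<Otimes>\<^sub>M vec_space p)"
  shows "(\<integral>\<^sup>+z. F z \<partial>joint) = (\<integral>\<^sup>+y. \<integral>\<^sup>+\<beta>. F (y, \<beta>) * ennreal (exp (H y \<beta>)) \<partial>prior \<partial>noise \<sigma> n)"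
proof -
  interpret pr: prob_space prior by (rule prob_space_prior)
  interpret no: prob_space "noise \<sigma> n" by (rule prob_space_noise)
  interpret pn: pair_sigma_finite "noise \<sigma> n" prior by unfold_locales
  note sp[measurable_cong] = sets_prior and sn[measurable_cong] = sets_noise
  note [measurable] = H_measurable_pair
  let ?s = "\<lambda>\<beta> e. \<lambda>j\<in>{..<n}. (\<Sum>i<p. X $$ (j, i) * \<beta> i) + e j"
  have "(\<integral>\<^sup>+z. F z \<partial>joint) = (\<integral>\<^sup>+\<beta>. \<integral>\<^sup>+e. F (?s \<beta> e, \<beta>) \<partial>noise \<sigma> n \<partial>prior)"
    by (rule nn_integral_joint_noise[OF F])
  also have "\<dots> = (\<integral>\<^sup>+\<beta>. \<integral>\<^sup>+y. F (y, \<beta>) * ennreal (exp (H y \<beta>)) \<partial>noise \<sigma> n \<partial>prior)"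
  proof (rule nn_integral_cong)
    fix \<beta> assume "\<beta> \<in> space prior"
    then have \<beta>: "\<beta> \<in> space (vec_space p)" using sets_eq_imp_space_eq[OF sp] by simp
    let ?m = "\<lambda>j. \<Sum>i<p. X $$ (j, i) * \<beta> i"
    have Fb: "(\<lambda>y. F (y, \<beta>)) \<in> borel_measurable (vec_space n)" using \<beta> by (intro measurable_compose[OF measurable_Pair2' F])
    have s1: "?s \<beta> \<in> noise \<sigma> n \<rightarrow>\<^sub>M vec_space n"
      by (intro measurable_restrict borel_measurable_add borel_measurable_const)
        (auto intro!: measurable_component_singleton simp: measurable_cong_sets[OF sn refl])
    have w: "(\<Prod>j<n. ennreal (exp (?m j * y j / \<sigma>\<^sup>2 - (?m j)\<^sup>2 / (2 * \<sigma>\<^sup>2)))) = ennreal (exp (H y \<beta>))" for y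
      unfolding H_eq exp_sum[OF finite_lessThan] by (rule prod_ennreal) simp
    have "(\<integral>\<^sup>+e. F (?s \<beta> e, \<beta>) \<partial>noise \<sigma> n) = (\<integral>\<^sup>+y. F (y, \<beta>) \<partial>distr (noise \<sigma> n) (vec_space n) (?s \<beta>))"
      using Fb by (subst nn_integral_distr[OF s1]) simp_all
    also have "\<dots> = (\<integral>\<^sup>+y. F (y, \<beta>) \<partial>density (noise \<sigma> n) (\<lambda>y. ennreal (exp (H y \<beta>))))"
      unfolding noise_shift[OF sigma_pos, of n ?m] w ..
    also have "\<dots> = (\<integral>\<^sup>+y. ennreal (exp (H y \<beta>)) * F (y, \<beta>) \<partial>noise \<sigma> n)"
    proof (rule nn_integral_density)
      have "(\<lambda>y. H y \<beta>) \<in> borel_measurable (vec_space n)"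
        using measurable_compose[OF measurable_Pair2'[OF \<beta>] H_measurable_pair] by simp
      then show "(\<lambda>y. ennreal (exp (H y \<beta>))) \<in> borel_measurable (noise \<sigma> n)"
        by (simp add: measurable_cong_sets[OF sn refl])
      show "(\<lambda>y. F (y, \<beta>)) \<in> borel_measurable (noise \<sigma> n)" using Fb by (simp add: measurable_cong_sets[OF sn refl])
    qed
    finally show "(\<integral>\<^sup>+e. F (?s \<beta> e, \<beta>) \<partial>noise \<sigma> n) = (\<integral>\<^sup>+y. F (y, \<beta>) * ennreal (exp (H y \<beta>)) \<partial>noise \<sigma> n)"
      by (simp add: mult.commute)
  qed
  also have "\<dots> = (\<integral>\<^sup>+y. \<integral>\<^sup>+\<beta>. F (y, \<beta>) * ennreal (exp (H y \<beta>)) \<partial>prior \<partial>noise \<sigma> n)"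
  proof -
    have "(\<lambda>z. F z * ennreal (exp (H (fst z) (snd z)))) \<in> borel_measurable (noise \<sigma> n \<Otimes>\<^sub>M prior)"
      by (subst measurable_cong_sets[OF sets_pair_measure_cong[OF sn sp] refl]) simp
    then show ?thesis by (subst pn.Fubini') (auto simp: case_prod_beta')
  qed
  finally show ?thesis .
qed

lemma sets_joint [measurable_cong]: "sets joint = sets (vec_space n \<Otimes>\<^sub>M vec_space p)"
  unfolding joint_law_def by simp

text \<open>The density of the marginal law of \<open>y\<close> with respect to pure noise, which is
  also the normaliser of the posterior.\<close>

definition Z :: "(nat \<Rightarrow> real) \<Rightarrow> real" where
  "Z y = (\<integral>\<beta>. exp (H y \<beta>) \<partial>prior)"

lemma integrable_exp_H: "integrable prior (\<lambda>\<beta>. exp (H y \<beta>))"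
  and Z_pos: "0 < Z y"
  and integral_post: "obs p F \<Longrightarrow> (\<integral>\<beta>. F \<beta> \<partial>post y) = (\<integral>\<beta>. F \<beta> * exp (H y \<beta>) \<partial>prior) / Z y"
proof -
  interpret g: gibbs \<mu> p "H y" by (rule gibbs_H)
  have mix: "(\<integral>x. f (g.mix {} (\<lambda>i\<in>{..<p}. 0) x) \<partial>prior) = (\<integral>x. f x \<partial>prior)" for f :: "_ \<Rightarrow> real"
    by (rule Bochner_Integration.integral_cong) (simp_all add: g.mix_empty)
  show "integrable prior (\<lambda>\<beta>. exp (H y \<beta>))"
    using g.integrable_mix[OF obs_exp[OF g.obs_H] g.zero_cube, of "{}"]
    by (simp add: g.mix_empty cong: Bochner_Integration.integrable_cong)
  show "0 < Z y" using g.pin_part_pos[OF g.zero_cube, of "{}"] mix[of "\<lambda>x. exp (H y x)"] by (simp add: g.pin_part_def Z_def)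
  show "obs p F \<Longrightarrow> (\<integral>\<beta>. F \<beta> \<partial>post y) = (\<integral>\<beta>. F \<beta> * exp (H y \<beta>) \<partial>prior) / Z y"
    unfolding post_def Z_def by (rule g.integral_G)
qed

lemma nn_Z: "(\<integral>\<^sup>+\<beta>. ennreal (exp (H y \<beta>)) \<partial>prior) = ennreal (Z y)"
  unfolding Z_def by (rule nn_integral_eq_integral[OF integrable_exp_H]) simp

lemma emeasure_post:
  assumes T: "T \<in> sets (vec_space p)"
  shows "emeasure (post y) T * ennreal (Z y) = (\<integral>\<^sup>+\<beta>. indicator T \<beta> * ennreal (exp (H y \<beta>)) \<partial>prior)"
proof -
  interpret P: cube_law "post y" p by (rule cube_law_post)
  have T': "T \<in> sets (post y)" using T P.sets_P by simp
  have o: "obs p (indicat_real T)"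
    unfolding obs_def using T by (intro conjI exI[of _ 1]) (auto simp: indicator_def)
  have "measure (post y) T = (\<integral>\<beta>. indicat_real T \<beta> \<partial>post y)" using T' by simp
  also have "\<dots> = (\<integral>\<beta>. indicat_real T \<beta> * exp (H y \<beta>) \<partial>prior) / Z y" by (rule integral_post[OF o])
  finally have m: "measure (post y) T * Z y = (\<integral>\<beta>. indicat_real T \<beta> * exp (H y \<beta>) \<partial>prior)"
    using Z_pos[of y] by (simp add: field_simps)
  have i: "integrable prior (\<lambda>\<beta>. indicat_real T \<beta> * exp (H y \<beta>))"
    using integrable_real_mult_indicator[OF _ integrable_exp_H] T sets_prior by (simp add: mult.commute)
  have "emeasure (post y) T * ennreal (Z y) = ennreal (measure (post y) T * Z y)"
    using Z_pos[of y] by (simp add: P.emeasure_eq_measure ennreal_mult)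
  also have "\<dots> = (\<integral>\<^sup>+\<beta>. ennreal (indicat_real T \<beta> * exp (H y \<beta>)) \<partial>prior)"
    unfolding m by (rule nn_integral_eq_integral[OF i, symmetric]) simp
  also have "\<dots> = (\<integral>\<^sup>+\<beta>. indicator T \<beta> * ennreal (exp (H y \<beta>)) \<partial>prior)"
    by (rule nn_integral_cong) (auto simp: indicator_def)
  finally show ?thesis .
qed

lemma Z_measurable: "(\<lambda>y. ennreal (Z y)) \<in> borel_measurable (noise \<sigma> n)"
proof -
  interpret pr: prob_space prior by (rule prob_space_prior)
  have "(\<lambda>z. ennreal (exp (H (fst z) (snd z)))) \<in> borel_measurable (noise \<sigma> n \<Otimes>\<^sub>M prior)"
    using H_measurable_pair by (subst measurable_cong_sets[OF sets_pair_measure_cong[OF sets_noise sets_prior] refl]) simp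
  from pr.borel_measurable_nn_integral_fst[OF this] show ?thesis by (simp add: nn_Z)
qed

lemma nn_integral_marginal:
  assumes F: "F \<in> borel_measurable (vec_space n)"
  shows "(\<integral>\<^sup>+z. F (fst z) \<partial>joint) = (\<integral>\<^sup>+y. F y * ennreal (Z y) \<partial>noise \<sigma> n)"
proof -
  have m: "(\<lambda>z. F (fst z)) \<in> borel_measurable (vec_space n \<Otimes>\<^sub>M vec_space p)"
    by (intro measurable_compose[OF measurable_fst F])
  show ?thesis
    unfolding nn_integral_joint[OF m]
  proof (rule nn_integral_cong)
    fix y assume "y \<in> space (noise \<sigma> n)"
    then have y: "y \<in> space (vec_space n)" using sets_eq_imp_space_eq[OF sets_noise] by simp
    have "(\<lambda>\<beta>. ennreal (exp (H y \<beta>))) \<in> borel_measurable prior"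
      using integrable_exp_H[of y] by (intro measurable_compose[OF borel_measurable_integrable measurable_ennreal])
    then show "(\<integral>\<^sup>+\<beta>. F (fst (y, \<beta>)) * ennreal (exp (H y \<beta>)) \<partial>prior) = F y * ennreal (Z y)"
      by (simp add: nn_integral_cmult nn_Z)
  qed
qed

lemma prob_space_joint: "prob_space joint"
proof -
  interpret pr: prob_space prior by (rule prob_space_prior)
  interpret no: prob_space "noise \<sigma> n" by (rule prob_space_noise)
  interpret pp: pair_prob_space prior "noise \<sigma> n" by unfold_locales
  note sp[measurable_cong] = sets_prior and sn[measurable_cong] = sets_noise
  have c: "(\<lambda>z. fst z i) \<in> borel_measurable (prior \<Otimes>\<^sub>M noise \<sigma> n)" if "i < p" for i
    using that by (intro measurable_compose[OF measurable_fst]) (auto intro!: measurable_component_singleton simp: measurable_cong_sets[OF sp refl])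
  have e: "(\<lambda>z. snd z j) \<in> borel_measurable (prior \<Otimes>\<^sub>M noise \<sigma> n)" if "j < n" for j
    using that by (intro measurable_compose[OF measurable_snd]) (auto intro!: measurable_component_singleton simp: measurable_cong_sets[OF sn refl])
  have "(\<lambda>z. (\<lambda>j\<in>{..<n}. (\<Sum>i<p. X $$ (j, i) * fst z i) + snd z j, fst z))
      \<in> prior \<Otimes>\<^sub>M noise \<sigma> n \<rightarrow>\<^sub>M vec_space n \<Otimes>\<^sub>M vec_space p"
    by (intro measurable_Pair measurable_restrict borel_measurable_add borel_measurable_sum borel_measurable_times)
      (auto intro!: c e simp: measurable_cong_sets[OF refl sp[symmetric]])
  then show ?thesis unfolding joint_law_def dims by (intro pp.prob_space_distr) (simp add: case_prod_beta')
qed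

text \<open>For a fixed event \<open>T\<close>, both kernels times \<open>Z\<close> have the same
  integral over every set of observations, so they agree almost everywhere, and \<open>Z\<close> is
  positive. The exceptional set depends on \<open>T\<close>, hence the countably many rational
  boxes.\<close>

lemma posterior_unique:
  assumes K: "is_posterior \<sigma> X \<mu> K"
  shows "AE z in joint. K (fst z) = post (fst z)"
proof -
  interpret pr: prob_space prior by (rule prob_space_prior)
  interpret no: prob_space "noise \<sigma> n" by (rule prob_space_noise)
  interpret J: prob_space joint by (rule prob_space_joint)
  have Km: "K \<in> vec_space n \<rightarrow>\<^sub>M prob_algebra (vec_space p)"
    and Keq: "\<And>S T. S \<in> sets (vec_space n) \<Longrightarrow> T \<in> sets (vec_space p) \<Longrightarrow> emeasure joint (S \<times> T) =
        (\<integral>\<^sup>+y\<in>S. emeasure (K y) T \<partial>distr joint (vec_space n) fst)"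
    using K unfolding is_posterior_def by auto
  have fstm: "fst \<in> joint \<rightarrow>\<^sub>M vec_space n" by (simp add: measurable_cong_sets[OF sets_joint refl])
  have KT: "(\<lambda>y. emeasure (K y) T) \<in> borel_measurable (vec_space n)" if T: "T \<in> sets (vec_space p)" for T
    using measurable_compose[OF measurable_prob_algebraD[OF Km] measurable_emeasure_subprob_algebra[OF T]] .
  have one: "AE y in noise \<sigma> n. emeasure (K y) T = emeasure (post y) T" if T: "T \<in> sets (vec_space p)" for T
  proof -
    let ?k = "\<lambda>y. emeasure (K y) T * ennreal (Z y)" and ?q = "\<lambda>y. \<integral>\<^sup>+\<beta>. indicator T \<beta> * ennreal (exp (H y \<beta>)) \<partial>prior"
    have km: "?k \<in> borel_measurable (noise \<sigma> n)"
      using KT[OF T] Z_measurable by (intro borel_measurable_times_ennreal) (auto simp: measurable_cong_sets[OF sets_noise refl])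
    have "(\<lambda>z. indicator T (snd z) * ennreal (exp (H (fst z) (snd z)))) \<in> borel_measurable (noise \<sigma> n \<Otimes>\<^sub>M prior)"
      using H_measurable_pair T
      by (subst measurable_cong_sets[OF sets_pair_measure_cong[OF sets_noise sets_prior] refl],
          intro borel_measurable_times_ennreal measurable_compose[OF measurable_snd borel_measurable_indicator]) auto
    from pr.borel_measurable_nn_integral_fst[OF this] have qm: "?q \<in> borel_measurable (noise \<sigma> n)" by simp
    have "density (noise \<sigma> n) ?k = density (noise \<sigma> n) ?q"
    proof (rule measure_eqI)
      fix S assume "S \<in> sets (density (noise \<sigma> n) ?k)"
      then have S: "S \<in> sets (noise \<sigma> n)" "S \<in> sets (vec_space n)" using sets_noise by auto
      have "emeasure (density (noise \<sigma> n) ?k) S = (\<integral>\<^sup>+y. emeasure (K y) T * indicator S y * ennreal (Z y) \<partial>noise \<sigma> n)"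
        by (subst emeasure_density[OF km S(1)]) (auto intro!: nn_integral_cong simp: mult_ac)
      also have "\<dots> = (\<integral>\<^sup>+z. emeasure (K (fst z)) T * indicator S (fst z) \<partial>joint)"
        using KT[OF T] S by (subst nn_integral_marginal[symmetric]) auto
      also have "\<dots> = (\<integral>\<^sup>+y\<in>S. emeasure (K y) T \<partial>distr joint (vec_space n) fst)"
        using KT[OF T] S by (subst nn_integral_distr[OF fstm]) auto
      also have "\<dots> = emeasure joint (S \<times> T)" using Keq[OF S(2) T] by simp
      also have "\<dots> = (\<integral>\<^sup>+z. indicator (S \<times> T) z \<partial>joint)"
        using S T by (subst nn_integral_indicator) (auto simp: sets_joint)
      also have "\<dots> = (\<integral>\<^sup>+y. \<integral>\<^sup>+\<beta>. indicator (S \<times> T) (y, \<beta>) * ennreal (exp (H y \<beta>)) \<partial>prior \<partial>noise \<sigma> n)"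
        using S T by (intro nn_integral_joint) auto
      also have "\<dots> = (\<integral>\<^sup>+y. ?q y * indicator S y \<partial>noise \<sigma> n)"
        by (rule nn_integral_cong) (auto simp: indicator_def intro!: nn_integral_cong)
      also have "\<dots> = emeasure (density (noise \<sigma> n) ?q) S" by (rule emeasure_density[OF qm S(1), symmetric])
      finally show "emeasure (density (noise \<sigma> n) ?k) S = emeasure (density (noise \<sigma> n) ?q) S" .
    qed simp
    then have "AE y in noise \<sigma> n. ?k y = ?q y" by (rule no.density_unique[OF km qm])
    then show ?thesis
    proof eventually_elim
      fix y assume "?k y = ?q y"
      then have eq: "emeasure (K y) T * ennreal (Z y) = emeasure (post y) T * ennreal (Z y)" by (simp add: emeasure_post[OF T])
      show "emeasure (K y) T = emeasure (post y) T"
        using eq Z_pos[of y] ennreal_mult_cancel_left[of "ennreal (Z y)" "emeasure (K y) T" "emeasure (post y) T"]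
          by (auto simp: mult.commute)
    qed
  qed
  let ?B = "\<lambda>r. PiE {..<p} (\<lambda>i. {..r i :: real})"
  have "AE y in noise \<sigma> n. \<forall>r\<in>PiE {..<p} (\<lambda>_. \<rat>). emeasure (K y) (?B r) = emeasure (post y) (?B r)"
  proof (subst AE_ball_countable)
    show "countable (PiE {..<p} (\<lambda>_. \<rat> :: real set))" by (intro countable_PiE countable_rat) auto
    show "\<forall>r\<in>PiE {..<p} (\<lambda>_. \<rat>). AE y in noise \<sigma> n. emeasure (K y) (?B r) = emeasure (post y) (?B r)"
      by (intro ballI one sets_PiM_I_finite) auto
  qed
  moreover have "AE y in noise \<sigma> n. y \<in> space (vec_space n)" using sets_eq_imp_space_eq[OF sets_noise] AE_space[of "noise \<sigma> n"] by simp
  ultimately have ae: "AE y in noise \<sigma> n. K y = post y"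
  proof eventually_elim
    fix y assume eq: "\<forall>r\<in>PiE {..<p} (\<lambda>_. \<rat>). emeasure (K y) (?B r) = emeasure (post y) (?B r)"
      and y: "y \<in> space (vec_space n)"
    interpret P: cube_law "post y" p by (rule cube_law_post)
    have "K y \<in> space (prob_algebra (vec_space p))" using measurable_space[OF Km y] .
    then show "K y = post y"
      using eq P.prob_space_axioms P.sets_P by (intro prob_eq_on_rational_boxes[where p=p]) (auto simp: space_prob_algebra)
  qed
  have marg: "distr joint (vec_space n) fst = density (noise \<sigma> n) (\<lambda>y. ennreal (Z y))"
  proof (rule measure_eqI)
    fix S assume "S \<in> sets (distr joint (vec_space n) fst)"
    then have S: "S \<in> sets (vec_space n)" "S \<in> sets (noise \<sigma> n)" using sets_noise by auto
    have "emeasure (distr joint (vec_space n) fst) S = (\<integral>\<^sup>+y. indicator S y \<partial>distr joint (vec_space n) fst)" using S by simp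
    also have "\<dots> = (\<integral>\<^sup>+z. indicator S (fst z) \<partial>joint)" using S by (subst nn_integral_distr[OF fstm]) auto
    also have "\<dots> = (\<integral>\<^sup>+y. indicator S y * ennreal (Z y) \<partial>noise \<sigma> n)" using S by (intro nn_integral_marginal) auto
    also have "\<dots> = emeasure (density (noise \<sigma> n) (\<lambda>y. ennreal (Z y))) S"
      by (subst emeasure_density[OF Z_measurable S(2)]) (simp add: mult.commute)
    finally show "emeasure (distr joint (vec_space n) fst) S = emeasure (density (noise \<sigma> n) (\<lambda>y. ennreal (Z y))) S" .
  qed (simp add: sets_noise)
  have "AE y in distr joint (vec_space n) fst. K y = post y"
    unfolding marg using ae by (subst AE_density[OF Z_measurable]) (auto elim: eventually_mono)
  then show ?thesis by (rule AE_distrD[OF fstm])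
qed

end

section \<open>Consequences of closeness to a product measure\<close>

text \<open>The family \<open>g\<close> is quantified for a fixed law \<open>P\<close>, so it may
  depend on the observation, on the signs of errors, or on replicas already drawn.\<close>

definition close_to_product :: "nat \<Rightarrow> real \<Rightarrow> (nat \<Rightarrow> real) measure \<Rightarrow> (nat \<Rightarrow> real measure) \<Rightarrow> bool" where
  "close_to_product p b P Q \<longleftrightarrow> (\<forall>g. (\<forall>i<p. g i \<in> borel_measurable borel \<and>
      (\<forall>x y. \<bar>x\<bar> \<le> 1 \<longrightarrow> \<bar>y\<bar> \<le> 1 \<longrightarrow> \<bar>g i x - g i y\<bar> \<le> \<bar>x - y\<bar>) \<and> (\<forall>x. \<bar>x\<bar> \<le> 1 \<longrightarrow> \<bar>g i x\<bar> \<le> 1)) \<longrightarrow>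
    (\<integral>\<beta>. \<bar>\<Sum>i<p. g i (\<beta> i) - (\<integral>s. g i s \<partial>Q i)\<bar> \<partial>P) \<le> real p * b)"

text \<open>The left limit of the distribution function at the lower quantile is at most
  \<open>\<alpha> / 2\<close>, and right-continuity gives at least \<open>1 - \<alpha> / 2\<close>
  at the upper one. The interval is closed so that atoms at the quantiles count.\<close>

lemma quantile_mass:
  assumes Q: "interval_law Q" and \<alpha>: "0 < \<alpha>" "\<alpha> < 1"
  shows "1 - \<alpha> \<le> measure Q {quantile Q (\<alpha> / 2)..quantile Q (1 - \<alpha> / 2)}"
proof -
  interpret interval_law Q by (rule Q)
  have ub: "a \<le> cdf Q 1" if "a < 1" for a
  proof -
    have "measure Q {-1..1} \<le> measure Q {..1}" by (intro finite_measure_mono) auto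
    then show ?thesis using mass that by (simp add: cdf_def)
  qed
  have lb: "cdf Q x = 0" if "x < -1" for x
  proof -
    have "measure Q {..x} + measure Q {-1..1} = measure Q ({..x} \<union> {-1..1})"
      using that by (intro finite_measure_Union[symmetric]) auto
    also have "\<dots> \<le> 1" by simp
    finally show ?thesis using mass measure_nonneg[of Q "{..x}"] by (simp add: cdf_def)
  qed
  have bdd: "bdd_below {x. a \<le> cdf Q x}" if "0 < a" for a
    using lb that by (intro bdd_belowI[of _ "-1"]) (metis mem_Collect_eq not_le)
  have lower: "measure Q {..<quantile Q a} \<le> a" if a: "0 < a" for a
  proof (rule tendsto_upperbound[OF cdf_at_left])
    have "cdf Q x < a" if "x < quantile Q a" for x
      using that cInf_lower[OF _ bdd[OF a], of x] unfolding quantile_def by force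
    then show "\<forall>\<^sub>F x in at_left (quantile Q a). cdf Q x \<le> a"
      by (auto simp: eventually_at_filter less_imp_le)
  qed simp
  have upper: "a \<le> cdf Q (quantile Q a)" if a: "0 < a" "a < 1" for a
  proof (rule tendsto_lowerbound)
    show "(cdf Q \<longlongrightarrow> cdf Q (quantile Q a)) (at_right (quantile Q a))"
      using cdf_is_right_cont by (simp add: continuous_within)
    have "a \<le> cdf Q x" if x: "quantile Q a < x" for x
    proof -
      have "{x. a \<le> cdf Q x} \<noteq> {}" using ub[OF a(2)] by blast
      then obtain z where "a \<le> cdf Q z" "z < x" using cInf_lessD[of "{x. a \<le> cdf Q x}" x] x unfolding quantile_def by auto
      then show ?thesis using cdf_nondecreasing[of z x] by linarith
    qed
    then show "\<forall>\<^sub>F x in at_right (quantile Q a). a \<le> cdf Q x" by (auto simp: eventually_at_filter)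
  qed simp
  let ?lo = "quantile Q (\<alpha> / 2)" and ?hi = "quantile Q (1 - \<alpha> / 2)"
  have "measure Q {..?hi} \<le> measure Q ({..<?lo} \<union> {?lo..?hi})" by (intro finite_measure_mono) auto
  also have "\<dots> \<le> measure Q {..<?lo} + measure Q {?lo..?hi}" by (intro measure_Un_le) auto
  finally show ?thesis using lower[of "\<alpha> / 2"] upper[of "1 - \<alpha> / 2"] \<alpha> by (simp add: cdf_def)
qed

text \<open>McShane's extension formula; test functions are arbitrary off the cube.\<close>

lemma test_function_measurable:
  assumes f: "test_function L f"
  shows "(\<lambda>z. indicat_real (cube L) z * f z) \<in> borel_measurable (vec_space L)"
proof -
  \<comment> \<open>Rational points make the infimum countable, hence measurable.\<close>
  define D where "D = PiE {..<L} (\<lambda>_. \<rat> \<inter> {-1..1 :: real})"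
  have D: "D \<subseteq> cube L" unfolding D_def by (rule PiE_mono) simp
  have cD: "countable D" unfolding D_def by (intro countable_PiE countable_subset[OF _ countable_rat]) auto
  have zero: "(\<lambda>l\<in>{..<L}. 0) \<in> D" unfolding D_def by (rule restrict_PiE_iff[THEN iffD2]) simp
  define F where "F s = (INF t\<in>D. f t + (\<Sum>l<L. \<bar>s l - t l\<bar>))" for s
  have lip: "\<bar>f s - f t\<bar> \<le> (\<Sum>l<L. \<bar>s l - t l\<bar>)" if "s \<in> cube L" "t \<in> cube L" for s t
    using f that unfolding test_function_def by blast
  have bd: "\<bar>f s\<bar> \<le> 1" if "s \<in> cube L" for s using f that unfolding test_function_def by blast
  have bdd: "bdd_below ((\<lambda>t. f t + (\<Sum>l<L. \<bar>s l - t l\<bar>)) ` D)" for s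
  proof (rule bdd_belowI2[of _ "-1"])
    fix t assume "t \<in> D"
    then have "\<bar>f t\<bar> \<le> 1" using bd D by blast
    moreover have "0 \<le> (\<Sum>l<L. \<bar>s l - t l\<bar>)" by (intro sum_nonneg) simp
    ultimately show "-1 \<le> f t + (\<Sum>l<L. \<bar>s l - t l\<bar>)" by linarith
  qed
  have Fm: "F \<in> borel_measurable (vec_space L)"
    unfolding F_def
  proof (rule borel_measurable_cINF_real[OF cD])
    fix t
    have "(\<lambda>s. s l) \<in> borel_measurable (vec_space L)" if "l \<in> {..<L}" for l
      by (rule measurable_component_singleton[OF that])
    then show "(\<lambda>s. f t + (\<Sum>l<L. \<bar>s l - t l\<bar>)) \<in> borel_measurable (vec_space L)"
      by (intro borel_measurable_add borel_measurable_const borel_measurable_sum borel_measurable_abs borel_measurable_diff)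
  qed
  have Ff: "F s = f s" if s: "s \<in> cube L" for s
  proof (rule antisym)
    show "f s \<le> F s"
      unfolding F_def
    proof (rule cINF_greatest)
      show "D \<noteq> {}" using zero by blast
      fix t assume "t \<in> D"
      then have "t \<in> cube L" using D by blast
      from lip[OF s this] show "f s \<le> f t + (\<Sum>l<L. \<bar>s l - t l\<bar>)" by linarith
    qed
    show "F s \<le> f s"
    proof (rule field_le_epsilon)
      fix e :: real assume e: "0 < e"
      \<comment> \<open>The tolerance is shared among \<open>L\<close> coordinates, half of
        \<open>e\<close> in all; the summand 1 covers \<open>L = 0\<close>.\<close>
      define h where "h = e / (2 * (real L + 1))"
      have h: "0 < h" using e by (simp add: h_def)
      \<comment> \<open>Approximation from below stays in the interval except at \<open>-1\<close>,
        which is rational itself.\<close>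
      have "\<exists>q. q \<in> \<rat> \<inter> {-1..1} \<and> \<bar>x - q\<bar> \<le> h" if x: "x \<in> {-1..1}" for x :: real
      proof (cases "x = -1")
        case True
        then show ?thesis using h by (intro exI[of _ "-1"]) auto
      next
        case False
        then have "max (-1) (x - h) < x" using x h by auto
        then obtain q where "q \<in> \<rat>" "max (-1) (x - h) < q" "q < x" using Rats_dense_in_real by blast
        then show ?thesis using x by (intro exI[of _ q]) auto
      qed
      then obtain q where q: "\<And>x. x \<in> {-1..1} \<Longrightarrow> q x \<in> \<rat> \<inter> {-1..1} \<and> \<bar>x - q x\<bar> \<le> h" by metis
      let ?t = "\<lambda>l\<in>{..<L}. q (s l)"
      have sl: "s l \<in> {-1..1}" if "l < L" for l using PiE_mem[OF s] that by simp
      have t: "?t \<in> D" unfolding D_def by (rule restrict_PiE_iff[THEN iffD2]) (use q sl in auto)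
      have "(\<Sum>l<L. \<bar>s l - ?t l\<bar>) \<le> (\<Sum>l<L. h)" using q sl by (intro sum_mono) simp
      also have "\<dots> = real L * h" by simp
      also have "\<dots> \<le> e / 2" using e by (simp add: h_def field_simps)
      finally have d: "(\<Sum>l<L. \<bar>s l - ?t l\<bar>) \<le> e / 2" .
      have "F s \<le> f ?t + (\<Sum>l<L. \<bar>s l - ?t l\<bar>)" unfolding F_def by (rule cINF_lower[OF bdd t])
      moreover have "\<bar>f s - f ?t\<bar> \<le> (\<Sum>l<L. \<bar>s l - ?t l\<bar>)" using t D by (intro lip[OF s]) blast
      ultimately show "F s \<le> f s + e" using d by linarith
    qed
  qed
  have "(\<lambda>z. indicat_real (cube L) z * F z) \<in> borel_measurable (vec_space L)"
    using Fm by (intro borel_measurable_times borel_measurable_indicator sets_PiM_I_finite) auto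
  moreover have "indicat_real (cube L) z * F z = indicat_real (cube L) z * f z" for z
    by (simp add: indicator_def Ff)
  ultimately show ?thesis by simp
qed

context cube_law
begin

text \<open>The trapezoid \<open>g i\<close> has height \<open>e = min \<epsilon> 1\<close> and
  slope 1, so it is an admissible test function. It lies above \<open>e\<close> times the indicator
  of the closed quantile interval and below \<open>e\<close> times that of the enlarged one.
  Undercoverage therefore moves the sum by more than \<open>p * (e * \<epsilon>)\<close>, and
  Markov's inequality applies.\<close>

lemma close_count:
  assumes close: "close_to_product p b P Q" and Q: "\<And>i. i < p \<Longrightarrow> interval_law (Q i)"
    and p: "0 < p" and \<alpha>: "0 < \<alpha>" "\<alpha> < 1" and \<epsilon>: "0 < \<epsilon>"
  shows "measure P {\<beta> \<in> space P. \<not> 1 - \<alpha> - \<epsilon> \<le> (\<Sum>i<p. indicat_real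
      {quantile (Q i) (\<alpha> / 2) - \<epsilon> <..< quantile (Q i) (1 - \<alpha> / 2) + \<epsilon>} (\<beta> i)) / real p}
    \<le> b / (min \<epsilon> 1 * \<epsilon>)"
proof -
  define lo hi e where "lo i = quantile (Q i) (\<alpha> / 2)" and "hi i = quantile (Q i) (1 - \<alpha> / 2)" and "e = min \<epsilon> 1" for i
  define g where "g i s = max 0 (min e (min (s - lo i + e) (hi i + e - s)))" for i s
  have e: "0 < e" "e \<le> \<epsilon>" "e \<le> 1" using \<epsilon> by (auto simp: e_def)
  have gm[measurable]: "g i \<in> borel_measurable borel" for i unfolding g_def[abs_def] by measurable
  have glip: "\<bar>g i x - g i y\<bar> \<le> \<bar>x - y\<bar>" for i x y unfolding g_def by (auto simp: max_def min_def)
  have g0: "0 \<le> g i s" and ge: "g i s \<le> e" for i s unfolding g_def using e by auto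
  have gind: "g i s \<le> e * indicat_real {lo i - \<epsilon> <..< hi i + \<epsilon>} s" for i s
    using e ge[of i s] by (auto simp: g_def indicator_def)
  have gtop: "e * indicat_real {lo i..hi i} s \<le> g i s" for i s
    using e by (auto simp: g_def indicator_def)
  have int: "e * (1 - \<alpha>) \<le> (\<integral>s. g i s \<partial>Q i)" if i: "i < p" for i
  proof -
    interpret Qi: interval_law "Q i" by (rule Q[OF i])
    have "e * (1 - \<alpha>) \<le> e * measure (Q i) {lo i..hi i}"
      using quantile_mass[OF Q[OF i] \<alpha>] e by (intro mult_left_mono) (auto simp: lo_def hi_def)
    also have "\<dots> = (\<integral>s. e * indicat_real {lo i..hi i} s \<partial>Q i)" by simp
    also have "\<dots> \<le> (\<integral>s. g i s \<partial>Q i)"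
    proof (rule integral_mono[OF _ _ gtop])
      show "integrable (Q i) (\<lambda>s. g i s)"
        using g0 ge by (intro Qi.integrable_const_bound[where B=e]) auto
      show "integrable (Q i) (\<lambda>s. e * indicat_real {lo i..hi i} s)"
        using e by (intro Qi.integrable_const_bound[where B=e]) (auto simp: indicator_def)
    qed
    finally show ?thesis .
  qed
  let ?F = "\<lambda>\<beta>. \<bar>\<Sum>i<p. g i (\<beta> i) - (\<integral>s. g i s \<partial>Q i)\<bar>"
  have og: "obs p (\<lambda>\<beta>. g i (\<beta> i))" if "i < p" for i
    using g0[of i] order_trans[OF ge e(3), of i] that by (intro obs_compose[OF gm, where B=1]) auto
  have oF: "obs p ?F" by (intro obs_intros og) simp
  have "measure P {\<beta> \<in> space P. \<not> 1 - \<alpha> - \<epsilon> \<le> (\<Sum>i<p. indicat_real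
      {quantile (Q i) (\<alpha> / 2) - \<epsilon> <..< quantile (Q i) (1 - \<alpha> / 2) + \<epsilon>} (\<beta> i)) / real p}
    \<le> measure P {\<beta> \<in> space P. real p * (e * \<epsilon>) < ?F \<beta>}"
  proof (rule finite_measure_mono)
    have [measurable]: "?F \<in> borel_measurable P" using oF by (simp add: measurable_cong_sets[OF sets_P refl] obs_measurable)
    show "{\<beta> \<in> space P. real p * (e * \<epsilon>) < ?F \<beta>} \<in> sets P" by measurable
    show "{\<beta> \<in> space P. \<not> 1 - \<alpha> - \<epsilon> \<le> (\<Sum>i<p. indicat_real
        {quantile (Q i) (\<alpha> / 2) - \<epsilon> <..< quantile (Q i) (1 - \<alpha> / 2) + \<epsilon>} (\<beta> i)) / real p}
      \<subseteq> {\<beta> \<in> space P. real p * (e * \<epsilon>) < ?F \<beta>}"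
    proof (intro subsetI CollectI conjI)
      fix \<beta> assume "\<beta> \<in> {\<beta> \<in> space P. \<not> 1 - \<alpha> - \<epsilon> \<le> (\<Sum>i<p. indicat_real
        {quantile (Q i) (\<alpha> / 2) - \<epsilon> <..< quantile (Q i) (1 - \<alpha> / 2) + \<epsilon>} (\<beta> i)) / real p}"
      then have \<beta>: "\<beta> \<in> space P" "(\<Sum>i<p. indicat_real {lo i - \<epsilon> <..< hi i + \<epsilon>} (\<beta> i)) < real p * (1 - \<alpha> - \<epsilon>)"
        using p by (auto simp: lo_def hi_def field_simps)
      show "\<beta> \<in> space P" by fact
      have "(\<Sum>i<p. g i (\<beta> i)) \<le> e * (\<Sum>i<p. indicat_real {lo i - \<epsilon> <..< hi i + \<epsilon>} (\<beta> i))"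
        unfolding sum_distrib_left by (intro sum_mono gind)
      also have "\<dots> < e * (real p * (1 - \<alpha> - \<epsilon>))" using \<beta>(2) e by simp
      finally have 1: "(\<Sum>i<p. g i (\<beta> i)) < e * (real p * (1 - \<alpha> - \<epsilon>))" .
      have "(\<Sum>i<p. e * (1 - \<alpha>)) \<le> (\<Sum>i<p. \<integral>s. g i s \<partial>Q i)" using int by (intro sum_mono) auto
      then have 2: "real p * (e * (1 - \<alpha>)) \<le> (\<Sum>i<p. \<integral>s. g i s \<partial>Q i)" by simp
      have "(\<Sum>i<p. g i (\<beta> i) - (\<integral>s. g i s \<partial>Q i)) < - (real p * (e * \<epsilon>))"
        using 1 2 by (simp add: sum_subtractf algebra_simps)
      then show "real p * (e * \<epsilon>) < ?F \<beta>" by linarith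
    qed
  qed
  also have "\<dots> \<le> (\<integral>\<beta>. ?F \<beta> \<partial>P) / (real p * (e * \<epsilon>))"
    using p e \<epsilon> by (intro markov oF) auto
  also have "\<dots> \<le> (real p * b) / (real p * (e * \<epsilon>))"
  proof (rule divide_right_mono)
    have "\<forall>i<p. g i \<in> borel_measurable borel \<and>
      (\<forall>x y. \<bar>x\<bar> \<le> 1 \<longrightarrow> \<bar>y\<bar> \<le> 1 \<longrightarrow> \<bar>g i x - g i y\<bar> \<le> \<bar>x - y\<bar>) \<and> (\<forall>x. \<bar>x\<bar> \<le> 1 \<longrightarrow> \<bar>g i x\<bar> \<le> 1)"
      using gm glip g0 ge e by (smt (verit))
    then show "(\<integral>\<beta>. ?F \<beta> \<partial>P) \<le> real p * b" using close unfolding close_to_product_def by blast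
  qed (use e \<epsilon> in simp)
  also have "\<dots> = b / (min \<epsilon> 1 * \<epsilon>)" using p by (simp add: e_def)
  finally show ?thesis .
qed

text \<open>Testing with the signs of the errors bounds their sum of absolute values; each error is
  at most 2, so squaring costs a factor 2.\<close>

lemma close_means:
  assumes close: "close_to_product p b P Q" and Q: "\<And>i. i < p \<Longrightarrow> interval_law (Q i)"
  shows "(\<Sum>i<p. ((\<integral>\<beta>. \<beta> i \<partial>P) - (\<integral>s. s \<partial>Q i))\<^sup>2) \<le> 2 * (real p * b)"
proof -
  define m where "m i = (\<integral>\<beta>. \<beta> i \<partial>P) - (\<integral>s. s \<partial>Q i)" for i
  have m2: "\<bar>m i\<bar> \<le> 2" if i: "i < p" for i
  proof -
    have "\<bar>\<integral>\<beta>. \<beta> i \<partial>P\<bar> \<le> 1" using i by (intro integral_obs_bound obs_intros) (auto simp: PiE_iff abs_le_iff)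
    moreover have "\<bar>\<integral>s. s \<partial>Q i\<bar> \<le> 1" using interval_law.abs_integral_le[OF Q[OF i], of "\<lambda>s. s" 1] by simp
    ultimately show ?thesis unfolding m_def by linarith
  qed
  have "(\<Sum>i<p. (m i)\<^sup>2) \<le> (\<Sum>i<p. 2 * \<bar>m i\<bar>)"
  proof (rule sum_mono)
    fix i assume "i \<in> {..<p}"
    then have "\<bar>m i\<bar> * \<bar>m i\<bar> \<le> 2 * \<bar>m i\<bar>" using m2 by (intro mult_right_mono) auto
    then show "(m i)\<^sup>2 \<le> 2 * \<bar>m i\<bar>" by (simp add: power2_eq_square)
  qed
  also have "\<dots> = 2 * (\<Sum>i<p. sgn (m i) * m i)" by (simp add: sum_distrib_left abs_sgn mult.commute)
  also have "(\<Sum>i<p. sgn (m i) * m i) = (\<integral>\<beta>. (\<Sum>i<p. sgn (m i) * \<beta> i - (\<integral>s. sgn (m i) * s \<partial>Q i)) \<partial>P)"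
  proof -
    have "integrable P (\<lambda>\<beta>. \<beta> i)" if "i < p" for i using that by (intro integrable_obs obs_intros)
    then show ?thesis by (subst Bochner_Integration.integral_sum) (auto simp: m_def right_diff_distrib)
  qed
  also have "\<dots> \<le> (\<integral>\<beta>. \<bar>\<Sum>i<p. sgn (m i) * \<beta> i - (\<integral>s. sgn (m i) * s \<partial>Q i)\<bar> \<partial>P)"
    by (rule order_trans[OF abs_ge_self integral_abs_bound])
  also have "\<dots> \<le> real p * b"
  proof -
    have "\<forall>i<p. (\<lambda>s. sgn (m i) * s) \<in> borel_measurable borel \<and>
      (\<forall>x y. \<bar>x\<bar> \<le> 1 \<longrightarrow> \<bar>y\<bar> \<le> 1 \<longrightarrow> \<bar>sgn (m i) * x - sgn (m i) * y\<bar> \<le> \<bar>x - y\<bar>) \<and>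
      (\<forall>x. \<bar>x\<bar> \<le> 1 \<longrightarrow> \<bar>sgn (m i) * x\<bar> \<le> 1)"
      by (auto simp: sgn_if)
    then show ?thesis using close unfolding close_to_product_def by (elim allE[of _ "\<lambda>i s. sgn (m i) * s"]) simp
  qed
  finally show ?thesis by (simp add: m_def)
qed

end

section \<open>Replicas\<close>

definition lip_obs :: "nat \<Rightarrow> ((nat \<Rightarrow> real) \<Rightarrow> real) \<Rightarrow> bool" where
  "lip_obs L f \<longleftrightarrow> f \<in> borel_measurable (vec_space L) \<and> (\<forall>s. \<bar>f s\<bar> \<le> 1) \<and>
     (\<forall>s\<in>cube L. \<forall>t\<in>cube L. \<bar>f s - f t\<bar> \<le> (\<Sum>l<L. \<bar>s l - t l\<bar>))"

text \<open>The indicator makes the function measurable and bounded everywhere but may create a jump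
  at the boundary of the cube; hence \<open>lip_obs\<close> restricts the Lipschitz condition to the
  cube.\<close>

lemma lip_obs_test_function:
  assumes f: "test_function L f" shows "lip_obs L (\<lambda>z. indicat_real (cube L) z * f z)"
  using f unfolding lip_obs_def
  by (intro conjI test_function_measurable[OF f]) (auto simp: test_function_def indicator_def)

lemma cube_upd: "s \<in> cube L \<Longrightarrow> \<bar>x\<bar> \<le> 1 \<Longrightarrow> s(L := x) \<in> cube (Suc L)"
  unfolding lessThan_Suc by (rule PiE_fun_upd) (auto simp: abs_le_iff)

lemma measurable_upd: "(\<lambda>(s, x). s(L := x)) \<in> vec_space L \<Otimes>\<^sub>M borel \<rightarrow>\<^sub>M vec_space (Suc L)"
  unfolding lessThan_Suc by (rule measurable_add_dim)

lemma lip_obs_slice: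
  assumes f: "lip_obs (Suc L) f" and Q: "interval_law Q"
  shows "lip_obs L (\<lambda>s. \<integral>x. f (s(L := x)) \<partial>Q)"
proof -
  interpret interval_law Q by (rule Q)
  have fm: "f \<in> borel_measurable (vec_space (Suc L))" and f1: "\<bar>f s\<bar> \<le> 1" for s
    using f by (auto simp: lip_obs_def)
  have lip: "\<bar>f s - f t\<bar> \<le> (\<Sum>l<Suc L. \<bar>s l - t l\<bar>)" if "s \<in> cube (Suc L)" "t \<in> cube (Suc L)" for s t
    using f that unfolding lip_obs_def by blast
  have "(\<lambda>(s, x). s(L := x)) \<in> vec_space L \<Otimes>\<^sub>M Q \<rightarrow>\<^sub>M vec_space (Suc L)"
    using measurable_upd[of L] measurable_cong_sets[OF sets_pair_measure_cong[OF refl events_eq_borel] refl] by blast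
  from measurable_compose[OF this fm]
  have pm: "(\<lambda>(s, x). f (s(L := x))) \<in> borel_measurable (vec_space L \<Otimes>\<^sub>M Q)" by (simp add: case_prod_beta')
  have m: "(\<lambda>s. \<integral>x. f (s(L := x)) \<partial>Q) \<in> borel_measurable (vec_space L)"
    by (rule borel_measurable_lebesgue_integral[OF pm])
  have sm: "(\<lambda>x. f (s(L := x))) \<in> borel_measurable Q" if "s \<in> space (vec_space L)" for s
    using measurable_compose[OF measurable_Pair1'[OF that] pm] by simp
  have int: "integrable Q (\<lambda>x. f (s(L := x)))" if "s \<in> space (vec_space L)" for s
    using f1 by (intro integrable_const_bound[where B=1] sm that) simp
  have sp: "s \<in> space (vec_space L)" if "s \<in> cube L" for s
    using that by (auto simp: space_PiM elim: subsetD[OF PiE_mono, rotated])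
  have bd: "\<bar>\<integral>x. f (s(L := x)) \<partial>Q\<bar> \<le> 1" for s
  proof (cases "integrable Q (\<lambda>x. f (s(L := x)))")
    case True
    have "\<bar>\<integral>x. f (s(L := x)) \<partial>Q\<bar> \<le> (\<integral>x. \<bar>f (s(L := x))\<bar> \<partial>Q)" by (rule integral_abs_bound)
    also have "\<dots> \<le> (\<integral>x. 1 \<partial>Q)" using True f1 by (intro integral_mono) auto
    finally show ?thesis by (simp add: prob_space)
  qed (simp add: not_integrable_integral_eq)
  show ?thesis
    unfolding lip_obs_def
  proof (intro conjI allI ballI m bd)
    fix s t assume st: "s \<in> cube L" "t \<in> cube L"
    note ints = int[OF sp[OF st(1)]] int[OF sp[OF st(2)]]
    have "\<bar>(\<integral>x. f (s(L := x)) \<partial>Q) - (\<integral>x. f (t(L := x)) \<partial>Q)\<bar> = \<bar>\<integral>x. f (s(L := x)) - f (t(L := x)) \<partial>Q\<bar>"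
      by (simp only: Bochner_Integration.integral_diff[OF ints])
    also have "\<dots> \<le> (\<integral>x. \<bar>f (s(L := x)) - f (t(L := x))\<bar> \<partial>Q)" by (rule integral_abs_bound)
    also have "\<dots> \<le> (\<integral>x. (\<Sum>l<L. \<bar>s l - t l\<bar>) \<partial>Q)"
    proof (rule integral_mono_AE)
      show "integrable Q (\<lambda>x. \<bar>f (s(L := x)) - f (t(L := x))\<bar>)"
        by (intro integrable_abs Bochner_Integration.integrable_diff ints)
      show "AE x in Q. \<bar>f (s(L := x)) - f (t(L := x))\<bar> \<le> (\<Sum>l<L. \<bar>s l - t l\<bar>)"
        using AE_interval
      proof eventually_elim
        fix x :: real assume x: "\<bar>x\<bar> \<le> 1"
        have "\<bar>f (s(L := x)) - f (t(L := x))\<bar> \<le> (\<Sum>l<Suc L. \<bar>(s(L := x)) l - (t(L := x)) l\<bar>)"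
          using st x by (intro lip cube_upd)
        then show "\<bar>f (s(L := x)) - f (t(L := x))\<bar> \<le> (\<Sum>l<L. \<bar>s l - t l\<bar>)" by simp
      qed
    qed simp
    finally show "\<bar>(\<integral>x. f (s(L := x)) \<partial>Q) - (\<integral>x. f (t(L := x)) \<partial>Q)\<bar> \<le> (\<Sum>l<L. \<bar>s l - t l\<bar>)"
      by (simp add: prob_space)
  qed
qed

context cube_law
begin

abbreviation replicas :: "nat \<Rightarrow> (nat \<Rightarrow> nat \<Rightarrow> real) measure" where
  "replicas L \<equiv> Pi\<^sub>M {..<L} (\<lambda>_. P)"

lemma prob_space_replicas: "prob_space (replicas L)"
  by (intro prob_space_PiM prob_space_axioms)

lemma replica_coordinate:
  assumes "i < p" shows "(\<lambda>b. \<lambda>l\<in>{..<L}. b l i) \<in> replicas L \<rightarrow>\<^sub>M vec_space L"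
proof (rule measurable_restrict)
  fix l assume l: "l \<in> {..<L}"
  have "(\<lambda>\<beta>. \<beta> i) \<in> borel_measurable P"
    using assms by (simp add: measurable_cong_sets[OF sets_P refl])
  then show "(\<lambda>b. b l i) \<in> borel_measurable (replicas L)"
    by (intro measurable_compose[OF measurable_component_singleton[OF l]])
qed

text \<open>Samples from \<open>P\<close> are replaced by samples from the product law one at a time.\<close>

lemma close_replicas:
  assumes close: "close_to_product p b P Q" and Q: "\<And>i. i < p \<Longrightarrow> interval_law (Q i)"
    and f: "\<And>i. i < p \<Longrightarrow> lip_obs L (f i)"
  shows "(\<integral>b. \<bar>\<Sum>i<p. f i (\<lambda>l\<in>{..<L}. b l i) - (\<integral>z. f i z \<partial>Pi\<^sub>M {..<L} (\<lambda>_. Q i))\<bar> \<partial>replicas L)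
    \<le> real L * (real p * b)"
  using f
proof (induction L arbitrary: f)
  case 0
  show ?case by (simp add: PiM_empty lebesgue_integral_count_space_finite restrict_def)
next
  case (Suc L)
  interpret pP: product_sigma_finite "\<lambda>_::nat. P" by unfold_locales
  define f' where "f' i s = (\<integral>x. f i (s(L := x)) \<partial>Q i)" for i s
  define c where "c i = (\<integral>z. f i z \<partial>Pi\<^sub>M {..<Suc L} (\<lambda>_. Q i))" for i
  have fm: "f i \<in> borel_measurable (vec_space (Suc L))" and f1: "\<bar>f i s\<bar> \<le> 1"
    and lip: "s \<in> cube (Suc L) \<Longrightarrow> t \<in> cube (Suc L) \<Longrightarrow> \<bar>f i s - f i t\<bar> \<le> (\<Sum>l<Suc L. \<bar>s l - t l\<bar>)" if "i < p" for i s t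
    using Suc.prems[OF that] unfolding lip_obs_def by blast+
  have f': "lip_obs L (f' i)" if "i < p" for i
    unfolding f'_def using that by (intro lip_obs_slice Suc.prems Q)
  have c: "c i = (\<integral>z. f' i z \<partial>Pi\<^sub>M {..<L} (\<lambda>_. Q i))" and c1: "\<bar>c i\<bar> \<le> 1" if i: "i < p" for i
  proof -
    interpret Qi: interval_law "Q i" by (rule Q[OF i])
    interpret pQ: product_sigma_finite "\<lambda>_::nat. Q i" by unfold_locales
    interpret pr: prob_space "Pi\<^sub>M {..<Suc L} (\<lambda>_. Q i)" by (intro prob_space_PiM Qi.prob_space_axioms)
    have "sets (Pi\<^sub>M {..<Suc L} (\<lambda>_. Q i)) = sets (vec_space (Suc L))" by (rule sets_PiM_cong[OF refl]) simp
    then have fmQ: "f i \<in> borel_measurable (Pi\<^sub>M {..<Suc L} (\<lambda>_. Q i))"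
      using fm[OF i] by (subst measurable_cong_sets[OF _ refl])
    have int: "integrable (Pi\<^sub>M {..<Suc L} (\<lambda>_. Q i)) (f i)"
      using f1[OF i] fmQ by (intro pr.integrable_const_bound[where B=1]) auto
    show "c i = (\<integral>z. f' i z \<partial>Pi\<^sub>M {..<L} (\<lambda>_. Q i))"
      unfolding c_def f'_def lessThan_Suc
      by (rule pQ.product_integral_insert) (use int in \<open>auto simp: lessThan_Suc\<close>)
    have "\<bar>c i\<bar> \<le> (\<integral>z. \<bar>f i z\<bar> \<partial>Pi\<^sub>M {..<Suc L} (\<lambda>_. Q i))" unfolding c_def by (rule integral_abs_bound)
    also have "\<dots> \<le> (\<integral>z. 1 \<partial>Pi\<^sub>M {..<Suc L} (\<lambda>_. Q i))" using int f1[OF i] by (intro integral_mono) auto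
    finally show "\<bar>c i\<bar> \<le> 1" by (simp add: pr.prob_space)
  qed
  interpret R: prob_space "replicas L" by (rule prob_space_replicas)
  interpret R': prob_space "replicas (Suc L)" by (rule prob_space_replicas)
  let ?G = "\<lambda>b. \<bar>\<Sum>i<p. f i (\<lambda>l\<in>{..<Suc L}. b l i) - c i\<bar>"
  let ?G' = "\<lambda>b. \<bar>\<Sum>i<p. f' i (\<lambda>l\<in>{..<L}. b l i) - c i\<bar>"
  have abs_sum: "\<bar>\<Sum>i<p. g i - c i\<bar> \<le> 2 * real p" if "\<And>i. i < p \<Longrightarrow> \<bar>g i\<bar> \<le> 1" for g
  proof -
    have "\<bar>\<Sum>i<p. g i - c i\<bar> \<le> (\<Sum>i<p. \<bar>g i - c i\<bar>)" by (rule sum_abs)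
    also have "\<dots> \<le> (\<Sum>i<p. 2)"
    proof (rule sum_mono)
      fix i assume "i \<in> {..<p}"
      then have "\<bar>g i\<bar> \<le> 1" "\<bar>c i\<bar> \<le> 1" using that c1 by auto
      then show "\<bar>g i - c i\<bar> \<le> 2" by linarith
    qed
    finally show ?thesis by simp
  qed
  have Gm: "?G \<in> borel_measurable (replicas (Suc L))"
    by (intro borel_measurable_abs borel_measurable_sum borel_measurable_diff borel_measurable_const
        measurable_compose[OF replica_coordinate fm]) auto
  have G'm: "?G' \<in> borel_measurable (replicas L)"
    using f' by (intro borel_measurable_abs borel_measurable_sum borel_measurable_diff borel_measurable_const
        measurable_compose[OF replica_coordinate]) (auto simp: lip_obs_def)
  have Gi: "integrable (replicas (Suc L)) ?G"
    using abs_sum[OF f1] by (intro R'.integrable_const_bound[OF _ Gm, where B="2 * real p"]) auto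
  have G'i: "integrable (replicas L) ?G'"
    using abs_sum f' by (intro R.integrable_const_bound[OF _ G'm, where B="2 * real p"]) (auto simp: lip_obs_def)
  have upd: "(\<lambda>l\<in>{..<Suc L}. (x(L := y)) l i) = (\<lambda>l\<in>{..<L}. x l i)(L := y i)" for x :: "nat \<Rightarrow> nat \<Rightarrow> real" and y i
    by (auto simp: fun_eq_iff restrict_def)
  have "(\<integral>b. ?G b \<partial>replicas (Suc L)) = (\<integral>x. \<integral>y. ?G (x(L := y)) \<partial>P \<partial>replicas L)"
    unfolding lessThan_Suc by (rule pP.product_integral_insert) (use Gi in \<open>auto simp: lessThan_Suc\<close>)
  also have "\<dots> \<le> (\<integral>x. real p * b + ?G' x \<partial>replicas L)"
  proof (rule integral_mono_AE')
    show "integrable (replicas L) (\<lambda>x. real p * b + ?G' x)" using G'i by simp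
    have "AE x in replicas L. \<forall>l\<in>{..<L}. x l \<in> cube p"
      by (intro AE_finite_allI AE_PiM_component[where P="\<lambda>\<beta>. \<beta> \<in> cube p"] prob_space_axioms AE_cube) auto
    then have "AE x in replicas L. (\<integral>y. ?G (x(L := y)) \<partial>P) \<le> real p * b + ?G' x"
    proof eventually_elim
      fix x assume x: "\<forall>l\<in>{..<L}. x l \<in> cube p"
      let ?s = "\<lambda>i. \<lambda>l\<in>{..<L}. x l i"
      let ?g = "\<lambda>i y. f i ((?s i)(L := y))"
      have s: "?s i \<in> cube L" if "i < p" for i
        using x that by (intro restrict_PiE_iff[THEN iffD2] ballI) (blast intro: PiE_mem)
      have ss: "?s i \<in> space (vec_space L)" for i by (simp add: space_PiM)
      have gm: "?g i \<in> borel_measurable borel" if "i < p" for i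
        using measurable_compose[OF measurable_Pair1'[OF ss] measurable_compose[OF measurable_upd fm[OF that]]] by simp
      have glip: "\<bar>?g i y - ?g i z\<bar> \<le> \<bar>y - z\<bar>" if "i < p" "\<bar>y\<bar> \<le> 1" "\<bar>z\<bar> \<le> 1" for i y z
        using lip[OF that(1) cube_upd[OF s[OF that(1)] that(2)] cube_upd[OF s[OF that(1)] that(3)]] by simp
      \<comment> \<open>With the first \<open>L\<close> replicas fixed, \<open>f i\<close> is a
        Lipschitz function of the last one, and its mean under \<open>Q i\<close> is
        \<open>f' i\<close>.\<close>
      have cl: "(\<integral>y. \<bar>\<Sum>i<p. ?g i (y i) - f' i (?s i)\<bar> \<partial>P) \<le> real p * b"
      proof -
        have "\<forall>i<p. ?g i \<in> borel_measurable borel \<and>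
          (\<forall>x y. \<bar>x\<bar> \<le> 1 \<longrightarrow> \<bar>y\<bar> \<le> 1 \<longrightarrow> \<bar>?g i x - ?g i y\<bar> \<le> \<bar>x - y\<bar>) \<and> (\<forall>x. \<bar>x\<bar> \<le> 1 \<longrightarrow> \<bar>?g i x\<bar> \<le> 1)"
          using gm glip f1 by blast
        then show ?thesis
          unfolding f'_def by (rule close[unfolded close_to_product_def, THEN spec, THEN mp])
      qed
      have og: "obs p (\<lambda>y. ?g i (y i))" if "i < p" for i
        using f1[OF that] that by (intro obs_compose[OF gm, where B=1]) auto
      have "(\<integral>y. ?G (x(L := y)) \<partial>P) \<le> (\<integral>y. \<bar>\<Sum>i<p. ?g i (y i) - f' i (?s i)\<bar> + ?G' x \<partial>P)"
      proof (rule integral_obs_mono)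
        show "obs p (\<lambda>y. ?G (x(L := y)))" unfolding upd by (intro obs_intros og) simp
        show "obs p (\<lambda>y. \<bar>\<Sum>i<p. ?g i (y i) - f' i (?s i)\<bar> + ?G' x)" by (intro obs_intros og) simp
        fix y
        have "(\<Sum>i<p. ?g i (y i) - c i) = (\<Sum>i<p. ?g i (y i) - f' i (?s i)) + (\<Sum>i<p. f' i (?s i) - c i)"
          by (simp add: sum_subtractf)
        then show "?G (x(L := y)) \<le> \<bar>\<Sum>i<p. ?g i (y i) - f' i (?s i)\<bar> + ?G' x" unfolding upd by linarith
      qed
      also have "\<dots> = (\<integral>y. \<bar>\<Sum>i<p. ?g i (y i) - f' i (?s i)\<bar> \<partial>P) + ?G' x"
      proof -
        have "integrable P (\<lambda>y. \<bar>\<Sum>i<p. ?g i (y i) - f' i (?s i)\<bar>)" by (intro integrable_obs obs_intros og) simp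
        then show ?thesis by simp
      qed
      finally show "(\<integral>y. ?G (x(L := y)) \<partial>P) \<le> real p * b + ?G' x" using cl by linarith
    qed
    then show "AE x in replicas L. (\<integral>y. ?G (x(L := y)) \<partial>P) \<le> real p * b + ?G' x" .
    have "0 \<le> real p * b"
      using close[unfolded close_to_product_def, THEN spec[where x="\<lambda>_ _. 0"]] by simp
    then show "AE x in replicas L. 0 \<le> real p * b + ?G' x" by simp
  qed
  also have "\<dots> = real p * b + (\<integral>x. ?G' x \<partial>replicas L)" using G'i by (simp add: R.prob_space)
  also have "(\<integral>x. ?G' x \<partial>replicas L) \<le> real L * (real p * b)"
  proof -
    have "(\<integral>x. ?G' x \<partial>replicas L) = (\<integral>b. \<bar>\<Sum>i<p. f' i (\<lambda>l\<in>{..<L}. b l i) - (\<integral>z. f' i z \<partial>Pi\<^sub>M {..<L} (\<lambda>_. Q i))\<bar> \<partial>replicas L)"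
      using c by simp
    also have "\<dots> \<le> real L * (real p * b)" by (rule Suc.IH[OF f'])
    finally show ?thesis .
  qed
  finally show ?case by (simp only: c_def of_nat_Suc distrib_right mult_1_left)
qed

lemma close_replica_average:
  assumes close: "close_to_product p b P Q" and Q: "\<And>i. i < p \<Longrightarrow> interval_law (Q i)"
    and f: "\<And>i. i < p \<Longrightarrow> test_function L (f i)" and p: "0 < p" and \<epsilon>: "0 < \<epsilon>"
  shows "measure (replicas L) {b \<in> space (replicas L). \<bar>replica_average p L f b - mf_average p L f Q\<bar> > \<epsilon>}
    \<le> real L * b / \<epsilon>"
proof -
  interpret R: prob_space "replicas L" by (rule prob_space_replicas)
  define g where "g i z = indicat_real (cube L) z * f i z" for i z
  have g: "lip_obs L (g i)" if "i < p" for i unfolding g_def by (rule lip_obs_test_function[OF f[OF that]])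
  let ?c = "\<lambda>i. \<integral>z. g i z \<partial>Pi\<^sub>M {..<L} (\<lambda>_. Q i)"
  let ?G = "\<lambda>b. \<bar>\<Sum>i<p. g i (\<lambda>l\<in>{..<L}. b l i) - ?c i\<bar>"
  have eq: "\<bar>replica_average p L f b - mf_average p L f Q\<bar> = ?G b / real p" for b
    by (simp add: replica_average_def mf_average_def g_def sum_subtractf diff_divide_distrib[symmetric])
  have Gm[measurable]: "?G \<in> borel_measurable (replicas L)"
    using g by (intro borel_measurable_abs borel_measurable_sum borel_measurable_diff borel_measurable_const
        measurable_compose[OF replica_coordinate]) (auto simp: lip_obs_def)
  have Gi: "integrable (replicas L) ?G"
  proof (rule R.integrable_const_bound[OF _ Gm, where B="real p + (\<Sum>i<p. \<bar>?c i\<bar>)"], rule AE_I2)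
    fix b
    have "?G b \<le> (\<Sum>i<p. \<bar>g i (\<lambda>l\<in>{..<L}. b l i) - ?c i\<bar>)" by (rule sum_abs)
    also have "\<dots> \<le> (\<Sum>i<p. 1 + \<bar>?c i\<bar>)"
    proof (rule sum_mono)
      fix i assume "i \<in> {..<p}"
      then have "\<bar>g i (\<lambda>l\<in>{..<L}. b l i)\<bar> \<le> 1" using g unfolding lip_obs_def by blast
      then show "\<bar>g i (\<lambda>l\<in>{..<L}. b l i) - ?c i\<bar> \<le> 1 + \<bar>?c i\<bar>" by linarith
    qed
    finally show "norm (?G b) \<le> real p + (\<Sum>i<p. \<bar>?c i\<bar>)" by (simp add: sum.distrib)
  qed
  have "{b \<in> space (replicas L). \<bar>replica_average p L f b - mf_average p L f Q\<bar> > \<epsilon>}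
      = {b \<in> space (replicas L). real p * \<epsilon> < ?G b}"
    unfolding eq using p by (auto simp: field_simps)
  also have "measure (replicas L) \<dots> \<le> measure (replicas L) {b \<in> space (replicas L). real p * \<epsilon> \<le> ?G b}"
    by (intro R.finite_measure_mono) auto
  also have "\<dots> \<le> (\<integral>b. ?G b \<partial>replicas L) / (real p * \<epsilon>)"
    using p \<epsilon> by (intro integral_Markov_inequality_measure[OF Gi, where A="{}"]) auto
  also have "\<dots> \<le> real L * (real p * b) / (real p * \<epsilon>)"
    using \<epsilon> by (intro divide_right_mono close_replicas[OF close Q g]) auto
  also have "\<dots> = real L * b / \<epsilon>" using p by simp
  finally show ?thesis .
qed

end

lemma cube_coord: "\<beta> \<in> cube p \<Longrightarrow> i < p \<Longrightarrow> \<bar>\<beta> i\<bar> \<le> (1::real)"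
  using PiE_mem[of \<beta> "{..<p}" "\<lambda>_. {-1..1}" i] by (simp add: abs_le_iff)

section \<open>Size of the score, conditional means and risk\<close>

context model
begin

lemma AE_prior_cube: "AE \<beta> in prior. \<beta> \<in> cube p"
  using gibbs.AE_Cube[OF gibbs_H, of "{..<p}"] by simp

text \<open>The score is the scaled Gram matrix applied to \<open>\<beta>\<close>, of norm at most
  \<open>C * sqrt p\<close> on the cube, plus a noise vector with mean squared norm equal to the sum
  of the diagonal coefficients, at most \<open>C * p\<close>. Markov's inequality is applied to the
  noise.\<close>

lemma score_tail:
  assumes W: "C < W"
  shows "measure joint {z \<in> space joint. W * sqrt p < nrm p (score \<sigma> X (fst z))} \<le> C / (W - C)\<^sup>2"
proof -
  interpret no: prob_space "noise \<sigma> n" by (rule prob_space_noise)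
  interpret pr: prob_space prior by (rule prob_space_prior)
  interpret J: prob_space joint by (rule prob_space_joint)
  define S where "S = {z \<in> space (vec_space n \<Otimes>\<^sub>M vec_space p). W * sqrt p < nrm p (score \<sigma> X (fst z))}"
  define N where "N e i = (\<Sum>k<n. X $$ (k, i) * e k) / \<sigma>\<^sup>2" for e i
  define B where "B = {e \<in> space (noise \<sigma> n). (W - C)\<^sup>2 * p \<le> (\<Sum>i<p. (N e i)\<^sup>2)}"
  have sm: "(\<lambda>z. score \<sigma> X (fst z) i) \<in> borel_measurable (vec_space n \<Otimes>\<^sub>M vec_space p)" if "i < p" for i
    using that by (intro measurable_compose[OF measurable_fst] score_measurable)
  have "(\<lambda>z. nrm p (score \<sigma> X (fst z))) \<in> borel_measurable (vec_space n \<Otimes>\<^sub>M vec_space p)"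
    unfolding L2_set_def by (intro measurable_compose[OF _ borel_measurable_sqrt] borel_measurable_sum borel_measurable_power sm) simp
  then have S: "S \<in> sets (vec_space n \<Otimes>\<^sub>M vec_space p)" unfolding S_def by measurable
  have Ni: "integrable (noise \<sigma> n) (\<lambda>e. (N e i)\<^sup>2)" "(\<integral>e. (N e i)\<^sup>2 \<partial>noise \<sigma> n) = (\<Sum>k<n. (X $$ (k, i))\<^sup>2) / \<sigma>\<^sup>2" for i
    using noise_linear_second_moment[OF sigma_pos, of n "\<lambda>k. X $$ (k, i)"] sigma_pos
    unfolding N_def power_divide by (auto simp: field_simps)
  have Nd: "(\<integral>e. (N e i)\<^sup>2 \<partial>noise \<sigma> n) = dvec i" if "i < p" for i
    unfolding Ni(2) dvec[OF that] gram_entry[OF carrier that that] by (simp add: power2_eq_square)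
  have NI: "integrable (noise \<sigma> n) (\<lambda>e. \<Sum>i<p. (N e i)\<^sup>2)" by (intro Bochner_Integration.integrable_sum Ni)
  have [measurable]: "(\<lambda>e. \<Sum>i<p. (N e i)\<^sup>2) \<in> borel_measurable (noise \<sigma> n)" by (rule borel_measurable_integrable[OF NI])
  have Bs: "B \<in> sets (noise \<sigma> n)" unfolding B_def by measurable
  have "measure (noise \<sigma> n) B \<le> (\<integral>e. (\<Sum>i<p. (N e i)\<^sup>2) \<partial>noise \<sigma> n) / ((W - C)\<^sup>2 * p)"
    unfolding B_def using W p_pos
    by (intro integral_Markov_inequality_measure[OF NI, where A="{}"]) (auto intro!: sum_nonneg)
  also have "(\<integral>e. (\<Sum>i<p. (N e i)\<^sup>2) \<partial>noise \<sigma> n) = (\<Sum>i<p. dvec i)"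
    using Nd by (subst Bochner_Integration.integral_sum[OF Ni(1)]) simp
  also have "(\<Sum>i<p. dvec i) / ((W - C)\<^sup>2 * p) \<le> (C * p) / ((W - C)\<^sup>2 * p)"
  proof (rule divide_right_mono)
    have "(\<Sum>i<p. dvec i) \<le> (\<Sum>i<p. C)" using dvec_bounds by (intro sum_mono) auto
    then show "(\<Sum>i<p. dvec i) \<le> C * p" by (simp add: mult.commute)
  qed simp
  also have "\<dots> = C / (W - C)\<^sup>2" using p_pos by simp
  finally have Bm: "measure (noise \<sigma> n) B \<le> C / (W - C)\<^sup>2" .
  let ?s = "\<lambda>\<beta> e. \<lambda>j\<in>{..<n}. (\<Sum>i<p. X $$ (j, i) * \<beta> i) + e j"
  have inc: "e \<in> B" if \<beta>: "\<beta> \<in> cube p" and e: "e \<in> space (noise \<sigma> n)" and s: "(?s \<beta> e, \<beta>) \<in> S" for \<beta> e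
  proof -
    let ?y = "?s \<beta> e"
    have sc: "score \<sigma> X ?y i = (\<Sum>j<p. gs i j * \<beta> j) + N e i" if "i < p" for i
      unfolding N_def by (rule score_expand) (use that in auto)
    have "W * sqrt p < nrm p (score \<sigma> X ?y)" using s by (simp add: S_def)
    also have "nrm p (score \<sigma> X ?y) = nrm p (\<lambda>i. (\<Sum>j<p. gs i j * \<beta> j) + N e i)"
      by (rule L2_set_cong) (auto simp: sc)
    also have "\<dots> \<le> nrm p (\<lambda>i. \<Sum>j<p. gs i j * \<beta> j) + nrm p (N e)" by (rule L2_set_triangle_ineq)
    also have "nrm p (\<lambda>i. \<Sum>j<p. gs i j * \<beta> j) \<le> C * nrm p \<beta>" by (rule nrm_gs)
    also have "C * nrm p \<beta> \<le> C * sqrt p"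
    proof (rule mult_left_mono[OF _ C_nonneg])
      have "(\<Sum>i<p. (\<beta> i)\<^sup>2) \<le> (\<Sum>i<p. 1)"
      proof (rule sum_mono)
        fix i assume "i \<in> {..<p}"
        then have "\<bar>\<beta> i\<bar> \<le> 1" using cube_coord[OF \<beta>] by simp
        then show "(\<beta> i)\<^sup>2 \<le> 1" by (simp add: abs_square_le_1)
      qed
      then show "nrm p \<beta> \<le> sqrt p" by (simp add: L2_set_def)
    qed
    finally have "(W - C) * sqrt p \<le> nrm p (N e)" by (simp add: algebra_simps)
    then have "((W - C) * sqrt p)\<^sup>2 \<le> (nrm p (N e))\<^sup>2" using W by (intro power_mono) auto
    then have "(W - C)\<^sup>2 * p \<le> (\<Sum>i<p. (N e i)\<^sup>2)" by (simp add: power_mult_distrib L2_set_def sum_nonneg)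
    then show ?thesis using e by (simp add: B_def)
  qed
  have sj: "space joint = space (vec_space n \<Otimes>\<^sub>M vec_space p)" by (rule sets_eq_imp_space_eq[OF sets_joint])
  have "emeasure joint S = (\<integral>\<^sup>+z. indicator S z \<partial>joint)" using S by (subst nn_integral_indicator) (auto simp: sets_joint)
  also have "\<dots> = (\<integral>\<^sup>+\<beta>. \<integral>\<^sup>+e. indicator S (?s \<beta> e, \<beta>) \<partial>noise \<sigma> n \<partial>prior)"
    using S by (intro nn_integral_joint_noise) simp
  also have "\<dots> \<le> (\<integral>\<^sup>+\<beta>. emeasure (noise \<sigma> n) B \<partial>prior)"
  proof (rule nn_integral_mono_AE)
    show "AE \<beta> in prior. (\<integral>\<^sup>+e. indicator S (?s \<beta> e, \<beta>) \<partial>noise \<sigma> n) \<le> emeasure (noise \<sigma> n) B"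
      using AE_prior_cube
    proof eventually_elim
      fix \<beta> assume \<beta>: "\<beta> \<in> cube p"
      have "(\<integral>\<^sup>+e. indicator S (?s \<beta> e, \<beta>) \<partial>noise \<sigma> n) \<le> (\<integral>\<^sup>+e. indicator B e \<partial>noise \<sigma> n)"
      proof (rule nn_integral_mono)
        fix e assume "e \<in> space (noise \<sigma> n)"
        from inc[OF \<beta> this] show "indicator S (?s \<beta> e, \<beta>) \<le> (indicator B e :: ennreal)"
          by (cases "(?s \<beta> e, \<beta>) \<in> S") auto
      qed
      also have "\<dots> = emeasure (noise \<sigma> n) B" using Bs by simp
      finally show "(\<integral>\<^sup>+e. indicator S (?s \<beta> e, \<beta>) \<partial>noise \<sigma> n) \<le> emeasure (noise \<sigma> n) B" .
    qed
  qed
  also have "\<dots> = emeasure (noise \<sigma> n) B" by (simp add: pr.emeasure_space_1)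
  finally have "measure joint S \<le> measure (noise \<sigma> n) B"
    by (simp add: J.emeasure_eq_measure no.emeasure_eq_measure)
  then show ?thesis using Bm by (simp add: S_def sj)
qed

lemma integral_joint:
  fixes G :: "(nat \<Rightarrow> real) \<times> (nat \<Rightarrow> real) \<Rightarrow> real"
  assumes G: "integrable joint G"
  shows "(\<integral>z. G z \<partial>joint) = (\<integral>y. \<integral>\<beta>. G (y, \<beta>) * exp (H y \<beta>) \<partial>prior \<partial>noise \<sigma> n)"
proof -
  interpret pr: prob_space prior by (rule prob_space_prior)
  interpret no: prob_space "noise \<sigma> n" by (rule prob_space_noise)
  interpret pn: pair_sigma_finite "noise \<sigma> n" prior by unfold_locales
  let ?D = "noise \<sigma> n \<Otimes>\<^sub>M prior" and ?h = "\<lambda>z. exp (H (fst z) (snd z))"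
  have sD: "sets ?D = sets (vec_space n \<Otimes>\<^sub>M vec_space p)" by (rule sets_pair_measure_cong[OF sets_noise sets_prior])
  have hm: "?h \<in> borel_measurable ?D" using H_measurable_pair by (simp add: measurable_cong_sets[OF sD refl])
  have eq: "joint = density ?D (\<lambda>z. ennreal (?h z))"
  proof (rule measure_eqI)
    show "sets joint = sets (density ?D (\<lambda>z. ennreal (?h z)))" by (simp add: sets_joint sD)
    fix S assume S': "S \<in> sets joint"
    then have S: "S \<in> sets (vec_space n \<Otimes>\<^sub>M vec_space p)" "S \<in> sets ?D" by (simp_all add: sets_joint sD)
    have m: "(\<lambda>z. ennreal (?h z) * indicator S z) \<in> borel_measurable ?D" using hm S(2) by measurable
    have "emeasure joint S = (\<integral>\<^sup>+z. indicator S z \<partial>joint)" using S' by simp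
    also have "\<dots> = (\<integral>\<^sup>+y. \<integral>\<^sup>+\<beta>. indicator S (y, \<beta>) * ennreal (exp (H y \<beta>)) \<partial>prior \<partial>noise \<sigma> n)"
      using S by (intro nn_integral_joint) simp
    also have "\<dots> = (\<integral>\<^sup>+z. ennreal (?h z) * indicator S z \<partial>?D)"
      using pr.nn_integral_fst[OF m] by (simp add: mult.commute)
    also have "\<dots> = emeasure (density ?D (\<lambda>z. ennreal (?h z))) S"
      using hm S(2) by (subst emeasure_density) auto
    finally show "emeasure joint S = emeasure (density ?D (\<lambda>z. ennreal (?h z))) S" .
  qed
  have Gm: "G \<in> borel_measurable ?D"
    using borel_measurable_integrable[OF G] by (simp add: measurable_cong_sets[OF sets_joint refl] measurable_cong_sets[OF sD refl])
  have int: "integrable ?D (\<lambda>z. ?h z * G z)"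
    using G hm Gm unfolding eq by (subst (asm) integrable_density) auto
  have "(\<integral>z. G z \<partial>joint) = (\<integral>z. ?h z * G z \<partial>?D)"
    unfolding eq using hm Gm by (subst integral_density) auto
  also have "\<dots> = (\<integral>y. \<integral>\<beta>. ?h (y, \<beta>) * G (y, \<beta>) \<partial>prior \<partial>noise \<sigma> n)"
    by (rule pn.integral_fst'[OF int, symmetric])
  finally show ?thesis by (simp add: mult.commute)
qed

lemma AE_joint_cube: "AE z in joint. snd z \<in> cube p"
proof -
  have c: "cube p \<in> sets (vec_space p)" by (intro sets_PiM_I_finite) auto
  have m: "(\<lambda>z. indicator (- cube p) (snd z) :: ennreal) \<in> borel_measurable (vec_space n \<Otimes>\<^sub>M vec_space p)"
  proof -
    have "indicator (- cube p) x = (1 - indicator (cube p) x :: ennreal)" for x by (simp add: indicator_def)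
    then show ?thesis
      using measurable_compose[OF measurable_snd borel_measurable_indicator[OF c], of "vec_space n"] by simp
  qed
  have "(\<integral>\<^sup>+z. indicator (- cube p) (snd z) \<partial>joint)
      = (\<integral>\<^sup>+y. \<integral>\<^sup>+\<beta>. indicator (- cube p) (snd (y, \<beta>)) * ennreal (exp (H y \<beta>)) \<partial>prior \<partial>noise \<sigma> n)"
    by (rule nn_integral_joint[OF m])
  also have "\<dots> = (\<integral>\<^sup>+y. \<integral>\<^sup>+\<beta>. 0 \<partial>prior \<partial>noise \<sigma> n)"
  proof (rule nn_integral_cong)
    fix y :: "nat \<Rightarrow> real"
    show "(\<integral>\<^sup>+\<beta>. indicator (- cube p) (snd (y, \<beta>)) * ennreal (exp (H y \<beta>)) \<partial>prior) = (\<integral>\<^sup>+\<beta>. 0 \<partial>prior)"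
      by (rule nn_integral_cong_AE) (use AE_prior_cube in eventually_elim, simp)
  qed
  finally have "(\<integral>\<^sup>+z. indicator (- cube p) (snd z) \<partial>joint) = 0" by simp
  then have "AE z in joint. indicator (- cube p) (snd z) = (0::ennreal)"
    using m by (subst (asm) nn_integral_0_iff_AE) (simp_all add: measurable_cong_sets[OF sets_joint refl])
  then show ?thesis by eventually_elim (auto simp: indicator_def split: if_splits)
qed

definition posterior_mean :: "nat \<Rightarrow> (nat \<Rightarrow> real) \<Rightarrow> real" where
  "posterior_mean i y = (\<integral>\<beta>. \<beta> i \<partial>post y)"

lemma abs_posterior_mean_le: "i < p \<Longrightarrow> \<bar>posterior_mean i y\<bar> \<le> 1"
  unfolding posterior_mean_def by (intro cube_law.integral_obs_bound[OF cube_law_post] obs_coord cube_coord) simp_all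

lemma posterior_mean_times_Z: "i < p \<Longrightarrow> posterior_mean i y * Z y = (\<integral>\<beta>. \<beta> i * exp (H y \<beta>) \<partial>prior)"
  unfolding posterior_mean_def using integral_post[of "\<lambda>\<beta>. \<beta> i" y] Z_pos[of y] by (simp add: obs_coord field_simps)

lemma posterior_mean_measurable: "i < p \<Longrightarrow> posterior_mean i \<in> borel_measurable (vec_space n)"
proof -
  assume i: "i < p"
  interpret pr: prob_space prior by (rule prob_space_prior)
  have sD: "sets (vec_space n \<Otimes>\<^sub>M prior) = sets (vec_space n \<Otimes>\<^sub>M vec_space p)"
    by (rule sets_pair_measure_cong[OF refl sets_prior])
  have h: "(\<lambda>z. exp (H (fst z) (snd z))) \<in> borel_measurable (vec_space n \<Otimes>\<^sub>M prior)"
    using H_measurable_pair by (simp add: measurable_cong_sets[OF sD refl])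
  have "(\<lambda>z. snd z i) \<in> borel_measurable (vec_space n \<Otimes>\<^sub>M vec_space p)"
    using i by (intro measurable_compose[OF measurable_snd] measurable_component_singleton) simp
  then have c: "(\<lambda>z. snd z i) \<in> borel_measurable (vec_space n \<Otimes>\<^sub>M prior)" by (simp add: measurable_cong_sets[OF sD refl])
  have "(\<lambda>y. \<integral>\<beta>. \<beta> i * exp (H y \<beta>) \<partial>prior) \<in> borel_measurable (vec_space n)"
    using borel_measurable_times[OF c h] by (intro pr.borel_measurable_lebesgue_integral) (simp add: case_prod_beta')
  moreover have "Z \<in> borel_measurable (vec_space n)"
    unfolding Z_def[abs_def] using h by (intro pr.borel_measurable_lebesgue_integral) (simp add: case_prod_beta')
  moreover have "posterior_mean i y = (\<integral>\<beta>. \<beta> i * exp (H y \<beta>) \<partial>prior) / Z y" for y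
    using posterior_mean_times_Z[OF i, of y] Z_pos[of y] by (simp add: field_simps)
  ultimately show ?thesis by (simp add: borel_measurable_divide cong: measurable_cong)
qed

lemma measurable_joint: "fst \<in> joint \<rightarrow>\<^sub>M vec_space n" "i < p \<Longrightarrow> (\<lambda>z. snd z i) \<in> borel_measurable joint"
proof -
  show "fst \<in> joint \<rightarrow>\<^sub>M vec_space n" by (simp add: measurable_cong_sets[OF sets_joint refl])
  assume "i < p"
  then have "(\<lambda>z. snd z i) \<in> borel_measurable (vec_space n \<Otimes>\<^sub>M vec_space p)"
    by (intro measurable_compose[OF measurable_snd] measurable_component_singleton) simp
  then show "(\<lambda>z. snd z i) \<in> borel_measurable joint" by (simp add: measurable_cong_sets[OF sets_joint refl])
qed

lemma AE_joint_coord: "i < p \<Longrightarrow> AE z in joint. \<bar>snd z i\<bar> \<le> 1"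
  using AE_joint_cube by eventually_elim (rule cube_coord)

text \<open>The defining property of a conditional expectation: for fixed \<open>y\<close>,
  integrating a coordinate against the prior weight gives the posterior mean times
  \<open>Z y\<close>, and \<open>Z\<close> is the marginal density.\<close>

lemma posterior_mean_orthogonal:
  fixes \<phi> :: "(nat \<Rightarrow> real) \<Rightarrow> real"
  assumes i: "i < p" and \<phi>: "\<phi> \<in> borel_measurable (vec_space n)" and bd: "\<And>y. y \<in> space (vec_space n) \<Longrightarrow> \<bar>\<phi> y\<bar> \<le> c"
  shows "integrable joint (\<lambda>z. \<phi> (fst z) * snd z i)" "integrable joint (\<lambda>z. \<phi> (fst z) * posterior_mean i (fst z))"
    "(\<integral>z. \<phi> (fst z) * snd z i \<partial>joint) = (\<integral>z. \<phi> (fst z) * posterior_mean i (fst z) \<partial>joint)"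
proof -
  interpret J: prob_space joint by (rule prob_space_joint)
  interpret pr: prob_space prior by (rule prob_space_prior)
  have fm: "(\<lambda>z. \<phi> (fst z)) \<in> borel_measurable joint" by (rule measurable_compose[OF measurable_joint(1) \<phi>])
  have pmm: "(\<lambda>z. posterior_mean i (fst z)) \<in> borel_measurable joint" by (rule measurable_compose[OF measurable_joint(1) posterior_mean_measurable[OF i]])
  have sp: "AE z in joint. fst z \<in> space (vec_space n)" using measurable_space[OF measurable_joint(1)] by (intro AE_I2)
  show i1: "integrable joint (\<lambda>z. \<phi> (fst z) * snd z i)"
  proof (rule J.integrable_const_bound[where B="c"])
    show "AE z in joint. norm (\<phi> (fst z) * snd z i) \<le> c"
      using sp AE_joint_coord[OF i]
    proof eventually_elim
      fix z :: "(nat \<Rightarrow> real) \<times> (nat \<Rightarrow> real)" assume "fst z \<in> space (vec_space n)" "\<bar>snd z i\<bar> \<le> 1"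
      then have "\<bar>\<phi> (fst z)\<bar> * \<bar>snd z i\<bar> \<le> c * 1" using bd by (intro mult_mono) (auto intro: order_trans[OF abs_ge_zero])
      then show "norm (\<phi> (fst z) * snd z i) \<le> c" by (simp add: abs_mult)
    qed
  qed (intro borel_measurable_times fm measurable_joint i)
  show i2: "integrable joint (\<lambda>z. \<phi> (fst z) * posterior_mean i (fst z))"
  proof (rule J.integrable_const_bound[where B="c"])
    show "AE z in joint. norm (\<phi> (fst z) * posterior_mean i (fst z)) \<le> c"
      using sp
    proof eventually_elim
      fix z :: "(nat \<Rightarrow> real) \<times> (nat \<Rightarrow> real)" assume "fst z \<in> space (vec_space n)"
      then have "\<bar>\<phi> (fst z)\<bar> * \<bar>posterior_mean i (fst z)\<bar> \<le> c * 1"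
        using bd abs_posterior_mean_le[OF i] by (intro mult_mono) (auto intro: order_trans[OF abs_ge_zero])
      then show "norm (\<phi> (fst z) * posterior_mean i (fst z)) \<le> c" by (simp add: abs_mult)
    qed
  qed (intro borel_measurable_times fm pmm)
  have "(\<integral>z. \<phi> (fst z) * snd z i \<partial>joint) = (\<integral>y. \<phi> y * (posterior_mean i y * Z y) \<partial>noise \<sigma> n)"
    unfolding integral_joint[OF i1] posterior_mean_times_Z[OF i] by (simp add: mult.assoc)
  also have "\<dots> = (\<integral>z. \<phi> (fst z) * posterior_mean i (fst z) \<partial>joint)"
    unfolding integral_joint[OF i2] Z_def by (simp add: mult.assoc)
  finally show "(\<integral>z. \<phi> (fst z) * snd z i \<partial>joint) = (\<integral>z. \<phi> (fst z) * posterior_mean i (fst z) \<partial>joint)" .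
qed

lemma cond_mean_eq:
  assumes i: "i < p" shows "AE z in joint. cond_mean \<sigma> X \<mu> i z = posterior_mean i (fst z)"
proof -
  interpret J: prob_space joint by (rule prob_space_joint)
  let ?F = "vimage_algebra (space joint) fst (vec_space n)"
  have fsp: "fst \<in> space joint \<rightarrow> space (vec_space n)" using measurable_space[OF measurable_joint(1)] by auto
  have sF: "sets ?F = {fst -` A \<inter> space joint | A. A \<in> sets (vec_space n)}" by (rule sets_vimage_algebra2[OF fsp])
  interpret F: finite_measure_subalgebra joint ?F
  proof
    show "subalgebra joint ?F"
      unfolding subalgebra_def sF using measurable_sets[OF measurable_joint(1)] by auto
  qed
  have one: "\<bar>1::real\<bar> \<le> 1" by simp
  show ?thesis
    unfolding cond_mean_def dims
  proof (rule F.real_cond_exp_charact)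
    show "integrable joint (\<lambda>z. snd z i)" "integrable joint (\<lambda>z. posterior_mean i (fst z))"
      using posterior_mean_orthogonal(1,2)[OF i borel_measurable_const one] by simp_all
    show "(\<lambda>z. posterior_mean i (fst z)) \<in> borel_measurable ?F"
      by (rule measurable_compose[OF measurable_vimage_algebra1[OF fsp] posterior_mean_measurable[OF i]])
    fix S assume "S \<in> sets ?F"
    then obtain A where A: "A \<in> sets (vec_space n)" and S: "S = fst -` A \<inter> space joint" unfolding sF by blast
    have ind: "indicat_real S z = indicat_real A (fst z)" if "z \<in> space joint" for z
      using that unfolding S by (simp add: indicator_def)
    have "(\<integral>z. indicat_real A (fst z) * snd z i \<partial>joint) = (\<integral>z. indicat_real A (fst z) * posterior_mean i (fst z) \<partial>joint)"
      by (rule posterior_mean_orthogonal(3)[OF i, where c=1]) (use A in auto)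
    then show "set_lebesgue_integral joint S (\<lambda>z. snd z i) = set_lebesgue_integral joint S (\<lambda>z. posterior_mean i (fst z))"
      unfolding set_lebesgue_integral_def by (simp add: ind cong: Bochner_Integration.integral_cong)
  qed
qed

text \<open>By Pythagoras the excess risk is the mean squared distance of \<open>q\<close> from the
  posterior mean. It is at most \<open>2 * (p * b)\<close> on \<open>E\<close> and at most
  \<open>4 * p\<close> off it, which has probability at most \<open>b\<close>; together this gives
  6.\<close>

lemma risk_difference:
  assumes q: "\<And>i. i < p \<Longrightarrow> q i \<in> borel_measurable (vec_space n)"
    and q1: "\<And>i y. i < p \<Longrightarrow> y \<in> space (vec_space n) \<Longrightarrow> \<bar>q i y\<bar> \<le> 1"
    and E: "E \<in> sets joint" "1 - b \<le> measure joint E"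
    and close: "\<And>z. z \<in> E \<Longrightarrow> (\<Sum>i<p. (posterior_mean i (fst z) - q i (fst z))\<^sup>2) \<le> 2 * (real p * b)"
  shows "\<bar>(\<integral>z. (\<Sum>i<p. (snd z i - cond_mean \<sigma> X \<mu> i z)\<^sup>2) \<partial>joint)
     - (\<integral>z. (\<Sum>i<p. (snd z i - q i (fst z))\<^sup>2) \<partial>joint)\<bar> \<le> 6 * (real p * b)"
proof -
  interpret J: prob_space joint by (rule prob_space_joint)
  let ?m = "\<lambda>i z. posterior_mean i (fst z)" and ?q = "\<lambda>i z. q i (fst z)"
  have sp: "AE z in joint. fst z \<in> space (vec_space n)" using measurable_space[OF measurable_joint(1)] by (intro AE_I2)
  have mm: "?m i \<in> borel_measurable joint" and qm: "?q i \<in> borel_measurable joint" and bm: "(\<lambda>z. snd z i) \<in> borel_measurable joint" if "i < p" for i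
    using measurable_compose[OF measurable_joint(1) posterior_mean_measurable[OF that]] measurable_compose[OF measurable_joint(1) q[OF that]]
      measurable_joint(2)[OF that] by blast+
  have sq: "integrable joint (\<lambda>z. (f z - g z)\<^sup>2)"
    if "f \<in> borel_measurable joint" "g \<in> borel_measurable joint" "AE z in joint. \<bar>f z\<bar> \<le> 1" "AE z in joint. \<bar>g z\<bar> \<le> (1::real)" for f g
  proof (rule J.integrable_const_bound[where B=4])
    show "AE z in joint. norm ((f z - g z)\<^sup>2) \<le> 4"
      using that(3,4)
    proof eventually_elim
      fix z assume "\<bar>f z\<bar> \<le> 1" "\<bar>g z\<bar> \<le> 1"
      then have "\<bar>f z - g z\<bar> \<le> 2" by linarith
      then have "(f z - g z)\<^sup>2 \<le> 2\<^sup>2" by (metis abs_ge_zero power2_abs power_mono)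
      then show "norm ((f z - g z)\<^sup>2) \<le> 4" by simp
    qed
  qed (use that in measurable)
  have m1: "AE z in joint. \<bar>?m i z\<bar> \<le> 1" and qq1: "AE z in joint. \<bar>?q i z\<bar> \<le> 1" if "i < p" for i
    using sp q1[OF that] abs_posterior_mean_le[OF that] by (auto elim: eventually_mono)
  have I: "integrable joint (\<lambda>z. (snd z i - ?m i z)\<^sup>2)" "integrable joint (\<lambda>z. (snd z i - ?q i z)\<^sup>2)"
    "integrable joint (\<lambda>z. (?m i z - ?q i z)\<^sup>2)" if "i < p" for i
    using that by (intro sq bm mm qm m1 qq1 AE_joint_coord; simp)+
  have pyth: "(\<integral>z. (snd z i - ?q i z)\<^sup>2 \<partial>joint) = (\<integral>z. (snd z i - ?m i z)\<^sup>2 \<partial>joint) + (\<integral>z. (?m i z - ?q i z)\<^sup>2 \<partial>joint)"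
    if i: "i < p" for i
  proof -
    let ?f = "\<lambda>y. 2 * (posterior_mean i y - q i y)"
    have fm: "?f \<in> borel_measurable (vec_space n)" using posterior_mean_measurable[OF i] q[OF i] by measurable
    have f4: "\<bar>?f y\<bar> \<le> 4" if "y \<in> space (vec_space n)" for y
      using q1[OF i that] abs_posterior_mean_le[OF i, of y] by argo
    note o = posterior_mean_orthogonal[OF i fm f4]
    have "(\<integral>z. (snd z i - ?q i z)\<^sup>2 \<partial>joint) = (\<integral>z. ((snd z i - ?m i z)\<^sup>2 + (?m i z - ?q i z)\<^sup>2) +
        (?f (fst z) * snd z i - ?f (fst z) * ?m i z) \<partial>joint)"
      by (rule Bochner_Integration.integral_cong) (auto simp: power2_eq_square algebra_simps)
    also have "\<dots> = (\<integral>z. (snd z i - ?m i z)\<^sup>2 + (?m i z - ?q i z)\<^sup>2 \<partial>joint) +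
        ((\<integral>z. ?f (fst z) * snd z i \<partial>joint) - (\<integral>z. ?f (fst z) * ?m i z \<partial>joint))"
      by (simp only: Bochner_Integration.integral_add[OF Bochner_Integration.integrable_add[OF I(1)[OF i] I(3)[OF i]] Bochner_Integration.integrable_diff[OF o(1,2)]]
          Bochner_Integration.integral_diff[OF o(1,2)])
    also have "\<dots> = (\<integral>z. (snd z i - ?m i z)\<^sup>2 \<partial>joint) + (\<integral>z. (?m i z - ?q i z)\<^sup>2 \<partial>joint)"
      using o(3) by (simp add: Bochner_Integration.integral_add[OF I(1)[OF i] I(3)[OF i]])
    finally show ?thesis .
  qed
  have cm: "(\<integral>z. (\<Sum>i<p. (snd z i - cond_mean \<sigma> X \<mu> i z)\<^sup>2) \<partial>joint) = (\<Sum>i<p. \<integral>z. (snd z i - ?m i z)\<^sup>2 \<partial>joint)"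
  proof -
    have "AE z in joint. \<forall>i\<in>{..<p}. cond_mean \<sigma> X \<mu> i z = ?m i z" by (intro AE_finite_allI cond_mean_eq) auto
    then have ae: "AE z in joint. (\<Sum>i<p. (snd z i - cond_mean \<sigma> X \<mu> i z)\<^sup>2) = (\<Sum>i<p. (snd z i - ?m i z)\<^sup>2)"
      by eventually_elim simp
    have "cond_mean \<sigma> X \<mu> i \<in> borel_measurable joint" for i
      unfolding cond_mean_def by (rule borel_measurable_cond_exp2)
    then have "(\<integral>z. (\<Sum>i<p. (snd z i - cond_mean \<sigma> X \<mu> i z)\<^sup>2) \<partial>joint) = (\<integral>z. (\<Sum>i<p. (snd z i - ?m i z)\<^sup>2) \<partial>joint)"
      using bm mm by (intro integral_cong_AE ae borel_measurable_sum borel_measurable_power borel_measurable_diff) auto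
    then show ?thesis using I by simp
  qed
  have qs: "(\<integral>z. (\<Sum>i<p. (snd z i - ?q i z)\<^sup>2) \<partial>joint) = (\<Sum>i<p. \<integral>z. (snd z i - ?q i z)\<^sup>2 \<partial>joint)"
    using I by simp
  let ?G = "\<lambda>z. \<Sum>i<p. (?m i z - ?q i z)\<^sup>2"
  have Gi: "integrable joint ?G" by (intro Bochner_Integration.integrable_sum I) simp
  have G4: "AE z in joint. ?G z \<le> 4 * real p"
    using sp
  proof eventually_elim
    fix z :: "(nat \<Rightarrow> real) \<times> (nat \<Rightarrow> real)" assume z: "fst z \<in> space (vec_space n)"
    have "?G z \<le> (\<Sum>i<p. 4)"
    proof (rule sum_mono)
      fix i assume "i \<in> {..<p}"
      then have "\<bar>?m i z - ?q i z\<bar> \<le> 2" using q1[OF _ z, of i] abs_posterior_mean_le[of i "fst z"] by simp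
      then have "(?m i z - ?q i z)\<^sup>2 \<le> 2\<^sup>2" by (metis abs_ge_zero power2_abs power_mono)
      then show "(?m i z - ?q i z)\<^sup>2 \<le> 4" by simp
    qed
    then show "?G z \<le> 4 * real p" by simp
  qed
  have b0: "0 \<le> b" using E(2) J.prob_le_1[of E] by linarith
  have "(\<integral>z. ?G z \<partial>joint) \<le> (\<integral>z. 2 * (real p * b) + 4 * real p * indicat_real (space joint - E) z \<partial>joint)"
  proof (rule integral_mono_AE[OF Gi])
    show "integrable joint (\<lambda>z. 2 * (real p * b) + 4 * real p * indicat_real (space joint - E) z)"
      using E by (intro Bochner_Integration.integrable_add integrable_mult_right integrable_real_indicator) (auto simp: less_top[symmetric])
    show "AE z in joint. ?G z \<le> 2 * (real p * b) + 4 * real p * indicat_real (space joint - E) z"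
      using G4 AE_space
    proof eventually_elim
      fix z assume *: "?G z \<le> 4 * real p" "z \<in> space joint"
      have "0 \<le> 2 * (real p * b)" using b0 by simp
      then show "?G z \<le> 2 * (real p * b) + 4 * real p * indicat_real (space joint - E) z"
      proof (cases "z \<in> E")
        case True
        then show ?thesis using close[OF True] by simp
      next
        case False
        then have "indicat_real (space joint - E) z = 1" using * by simp
        then show ?thesis using * \<open>0 \<le> 2 * (real p * b)\<close> by (simp only: mult_1_right)
      qed
    qed
  qed
  also have "\<dots> = 2 * (real p * b) + 4 * real p * measure joint (space joint - E)"
  proof -
    have A: "space joint - E \<in> sets joint" using E by simp
    then have "integrable joint (\<lambda>z. 4 * real p * indicat_real (space joint - E) z)"
      by (intro integrable_mult_right integrable_real_indicator) (simp_all add: J.emeasure_eq_measure)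
    moreover have "(\<integral>z. indicat_real (space joint - E) z \<partial>joint) = measure joint (space joint - E)"
      using A by (simp add: Int_absorb2)
    ultimately show ?thesis by (simp add: J.prob_space)
  qed
  also have "\<dots> \<le> 2 * (real p * b) + 4 * real p * b"
    using E by (intro add_left_mono mult_left_mono) (auto simp: J.prob_compl)
  finally have up: "(\<integral>z. ?G z \<partial>joint) \<le> 6 * (real p * b)" by argo
  have lo: "0 \<le> (\<integral>z. ?G z \<partial>joint)" by (intro integral_nonneg_AE AE_I2 sum_nonneg) simp
  have "(\<integral>z. ?G z \<partial>joint) = (\<Sum>i<p. \<integral>z. (?m i z - ?q i z)\<^sup>2 \<partial>joint)" using I by simp
  then have "(\<Sum>i<p. \<integral>z. (snd z i - ?q i z)\<^sup>2 \<partial>joint) = (\<Sum>i<p. \<integral>z. (snd z i - ?m i z)\<^sup>2 \<partial>joint) + (\<integral>z. ?G z \<partial>joint)"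
    using pyth by (simp add: sum.distrib)
  then show ?thesis unfolding cm qs using up lo by linarith
qed

end

section \<open>Choice of the constants and the limit\<close>

context model
begin

text \<open>The random separating vector enters through its value \<open>us\<close> alone, so at a
  good observation the statement is \<open>mean_field_core\<close> for the system of that
  observation.\<close>

lemma close_at:
  fixes T \<omega> \<rho> A \<epsilon> \<delta> \<theta> \<eta> W b :: real and us :: "nat \<Rightarrow> real"
  assumes \<nu>: "interval_law \<nu>" "nondegenerate \<nu>" and within: "laws_within \<rho> \<nu> \<mu>"
    and T: "0 < T" and \<omega>: "0 \<le> \<omega>"
    and tail: "\<And>e. 0 \<le> e \<Longrightarrow> e \<le> C \<Longrightarrow>
      Sup (supp \<mu>) - \<omega> \<le> tilt_mean \<mu> T e \<and> tilt_mean \<mu> (- T) e \<le> Inf (supp \<mu>) + \<omega>"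
    and opt: "is_arg_max (mf_objective \<sigma> X \<nu> (score \<sigma> X y)) (\<lambda>v. v \<in> mean_box \<nu> p) (u y)"
    and W: "nrm p (score \<sigma> X y) \<le> W * sqrt p" "0 \<le> W"
  defines "L \<equiv> tilt_lip T C * \<rho>" and "V \<equiv> 2 * C + W"
  assumes A: "mat_trace (offdiag \<sigma> X * offdiag \<sigma> X) \<le> A * p"
    and \<epsilon>: "0 < \<epsilon>" "V * \<omega> + 2 * (V + T + 2) * L + 6 * V\<^sup>2 / T \<le> \<epsilon>"
    and sep: "(SUP v \<in> {v \<in> mean_box \<mu> p. (\<Sum>i<p. (v i - us i)\<^sup>2) > real p * \<delta>}.
          ereal (mf_objective \<sigma> X \<mu> (score \<sigma> X y) v))
        < (SUP v \<in> mean_box \<mu> p. ereal (mf_objective \<sigma> X \<mu> (score \<sigma> X y) v)) - ereal (real p * \<epsilon>)"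
    and \<theta>: "0 < \<theta>" "\<theta> \<le> 1 / 2" and \<eta>: "0 < \<eta>" and \<delta>: "0 \<le> \<delta>"
  defines "\<Gamma> \<equiv> sqrt (A * \<eta>) / 2 + 4 * V / sqrt \<eta>"
  assumes b: "\<Gamma> / \<theta> + ln 2 / (p * \<theta>) + 4 * \<theta> + 2 * sqrt \<delta> + L + 2 * V\<^sup>2 / T\<^sup>2 + 2 / \<eta> + 2 * \<Gamma> / \<epsilon> \<le> b"
  shows "close_to_product p b (post y) (mf_marginal \<sigma> X \<nu> u y)"
proof -
  let ?w = "score \<sigma> X y"
  interpret mf_law p amat dvec ?w "2 * C" W C \<mu>
    by (intro mf_law.intro mf_system_design W interval_law_axioms mf_law_axioms.intro nondeg)
  have V: "2 * C + W = V" by (simp add: V_def)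
  have opt': "is_arg_max (mf_obj p amat dvec ?w \<nu>) (\<lambda>v. v \<in> mean_box \<nu> p) (u y)"
    using opt unfolding mf_objective_eq[OF \<nu>(1), abs_def] .
  have sep': "(\<Sum>i<p. (x i - us i)\<^sup>2) \<le> p * \<delta>"
    if x: "x \<in> mean_box \<mu> p" and le: "\<And>y. y \<in> mean_box \<mu> p \<Longrightarrow> M y \<le> M x + p * \<epsilon>" for x
  proof (rule ccontr)
    assume "\<not> ?thesis"
    \<comment> \<open>Separation, stated with suprema, becomes pointwise: a near-maximiser
      \<open>x\<close> far from \<open>us\<close> would be counted in the left supremum, while the
      right one is at most \<open>M x + p * \<epsilon>\<close>.\<close>
    then have "ereal (M x) \<le> (SUP v \<in> {v \<in> mean_box \<mu> p. (\<Sum>i<p. (v i - us i)\<^sup>2) > real p * \<delta>}. ereal (M v))"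
      using x by (intro SUP_upper) simp
    also have "\<dots> < (SUP v \<in> mean_box \<mu> p. ereal (M v)) - ereal (real p * \<epsilon>)"
      using sep unfolding mf_objective_eq[OF interval_law_axioms, abs_def] .
    also have "\<dots> \<le> ereal (M x + p * \<epsilon>) - ereal (real p * \<epsilon>)"
      by (intro ereal_minus_mono SUP_least) (simp_all only: ereal_less_eq le order_refl)
    finally show False by simp
  qed
  have trA: "(\<Sum>i<p. \<Sum>j<p. (amat i j)\<^sup>2) \<le> A * p" using A by (simp only: trace_amat)
  show ?thesis
    unfolding close_to_product_def
  proof (intro allI impI)
    fix g assume g: "\<forall>i<p. g i \<in> borel_measurable borel \<and>
      (\<forall>x y. \<bar>x\<bar> \<le> 1 \<longrightarrow> \<bar>y\<bar> \<le> 1 \<longrightarrow> \<bar>g i x - g i y\<bar> \<le> \<bar>x - y\<bar>) \<and> (\<forall>x. \<bar>x\<bar> \<le> 1 \<longrightarrow> \<bar>g i x\<bar> \<le> (1::real))"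
    have "(\<integral>b. \<bar>\<Sum>i<p. g i (b i) - (\<integral>s. g i s \<partial>tilt \<nu> (tilt_param \<nu> (dvec i) (u y i)) (dvec i))\<bar> \<partial>G)
      \<le> p * ((sqrt (A * \<eta>) / 2 + 4 * (2 * C + W) / sqrt \<eta>) / \<theta> + ln 2 / (p * \<theta>) + 4 * \<theta> + 2 * sqrt \<delta> +
        tilt_lip T C * \<rho> + 2 * (2 * C + W)\<^sup>2 / T\<^sup>2 + 2 / \<eta> + 2 * (sqrt (A * \<eta>) / 2 + 4 * (2 * C + W) / sqrt \<eta>) / \<epsilon>)"
    proof (rule mean_field_core[where us=us, OF \<nu> within T \<omega> tail opt' p_pos trA \<epsilon>(1) _ sep' \<theta> \<eta> \<delta>])
      show "(2 * C + W) * \<omega> + 2 * (2 * C + W + T + 2) * (tilt_lip T C * \<rho>) + 6 * (2 * C + W)\<^sup>2 / T \<le> \<epsilon>"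
        using \<epsilon>(2) unfolding V L_def .
    qed (use g in blast)+
    also have "\<dots> \<le> p * b"
      using b unfolding V L_def \<Gamma>_def by (intro mult_left_mono) auto
    finally show "(\<integral>\<beta>. \<bar>\<Sum>i<p. g i (\<beta> i) - (\<integral>s. g i s \<partial>mf_marginal \<sigma> X \<nu> u y i)\<bar> \<partial>post y) \<le> real p * b"
      unfolding mf_marginal_def post_def .
  qed
qed

end

lemma eventually_divide_le:
  fixes c e :: real assumes "0 < e" shows "eventually (\<lambda>T. c / T \<le> e) at_top"
proof -
  have "((\<lambda>T. c / T) \<longlongrightarrow> 0) at_top"
    by (intro tendsto_divide_0[OF tendsto_const] filterlim_at_top_imp_at_infinity filterlim_ident)
  from order_tendstoD(2)[OF this assms] show ?thesis by (rule eventually_mono) simp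
qed

text \<open>The sequence is shifted by one because nothing is known about the law at index
  0.\<close>

lemma eventually_laws_within:
  assumes law: "\<And>p. 0 < p \<Longrightarrow> interval_law (\<mu> p)" "interval_law \<mu>s" and weak: "weak_conv_m \<mu> \<mu>s" and \<rho>: "0 < \<rho>"
  shows "eventually (\<lambda>p. laws_within \<rho> (\<mu> p) \<mu>s) sequentially"
proof -
  have "weak_conv_m (\<lambda>n. \<mu> (Suc n)) \<mu>s"
    using weak LIMSEQ_Suc unfolding weak_conv_m_def weak_conv_def by blast
  with law \<rho> have "eventually (\<lambda>p. laws_within \<rho> (\<mu> (Suc p)) \<mu>s) sequentially"
    by (intro weak_conv_laws_within) auto
  then show ?thesis by (subst eventually_sequentially_Suc[symmetric])
qed

text \<open>The error of \<open>mean_field_core\<close> splits into seven shares of at most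
  \<open>b / 8\<close>, the two terms with \<open>\<Gamma>\<close> forming one of them. Each
  constant depends only on those before it: separation supplies \<open>\<epsilon>\<close> for the
  chosen \<open>\<delta>\<close>, then \<open>\<eta>\<close> and \<open>A\<close> are fitted to it,
  then \<open>T\<close>, and the closeness \<open>\<rho>\<close> of the priors last.\<close>

lemma eventually_close:
  fixes n :: "nat \<Rightarrow> nat" and X :: "nat \<Rightarrow> real mat" and \<sigma> C b :: real
    and \<mu> :: "nat \<Rightarrow> real measure" and \<mu>s :: "real measure" and u :: "nat \<Rightarrow> (nat \<Rightarrow> real) \<Rightarrow> nat \<Rightarrow> real"
  assumes model: "\<And>p. 0 < p \<Longrightarrow> model (X p) (n p) p \<sigma> C \<mu>s"
    and trace: "(\<lambda>p. mat_trace (offdiag \<sigma> (X p) * offdiag \<sigma> (X p))) \<in> o(\<lambda>p. real p)"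
    and law: "\<And>p. 0 < p \<Longrightarrow> interval_law (\<mu> p)" and weak: "weak_conv_m \<mu> \<mu>s"
    and separated: "well_separated_optimizer \<sigma> X \<mu>s"
    and optimizer: "\<And>p y. p > 0 \<Longrightarrow> nondegenerate (\<mu> p) \<Longrightarrow> y \<in> space (vec_space (n p)) \<Longrightarrow>
          is_arg_max (mf_objective \<sigma> (X p) (\<mu> p) (score \<sigma> (X p) y))
            (\<lambda>v. v \<in> mean_box (\<mu> p) p) (u p y)"
    and b: "0 < b"
  shows "eventually (\<lambda>p. 0 < p \<and> nondegenerate (\<mu> p) \<and> (\<exists>E\<in>sets (joint_law \<sigma> (X p) \<mu>s).
     1 - b \<le> measure (joint_law \<sigma> (X p) \<mu>s) E \<and>
     (\<forall>z\<in>E. close_to_product p b (model.post (X p) p \<sigma> \<mu>s (fst z)) (mf_marginal \<sigma> (X p) (\<mu> p) (u p) (fst z))))) sequentially"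
proof -
  have m1: "model (X 1) (n 1) 1 \<sigma> C \<mu>s" by (rule model) simp
  interpret interval_law \<mu>s using m1 by (simp add: model_def)
  have nondeg: "nondegenerate \<mu>s" using m1 by (rule model.nondeg)
  have C: "0 \<le> C" using m1 by (simp add: model_def design_def)
  \<comment> \<open>Solves for a tail probability of the score of at most \<open>b / 2\<close>; the
    summand 1 keeps \<open>W\<close> above \<open>C\<close>.\<close>
  define W where "W = C + sqrt (2 * C / b) + 1"
  define V where "V = 2 * C + W"
  have WC: "C < W" and W0: "0 < W" using C b by (auto simp: W_def intro!: add_nonneg_pos)
  have V: "0 < V" using C W0 by (simp add: V_def)
  have tailW: "C / (W - C)\<^sup>2 \<le> b / 2"
  proof -
    have "2 * C / b = (sqrt (2 * C / b))\<^sup>2" using C b by simp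
    also have "\<dots> \<le> (W - C)\<^sup>2" unfolding W_def using C b by (intro power_mono) auto
    finally have "2 * C / b \<le> (W - C)\<^sup>2" .
    moreover have "0 < (W - C)\<^sup>2" using WC by simp
    ultimately show ?thesis using b by (simp add: field_simps)
  qed
  define \<delta> where "\<delta> = (b / 16)\<^sup>2"
  have \<delta>: "0 < \<delta>" "2 * sqrt \<delta> = b / 8" using b by (simp_all add: \<delta>_def)
  obtain us where usep: "\<And>\<delta>. 0 < \<delta> \<Longrightarrow> \<exists>\<epsilon>>0. (\<lambda>p. measure (joint_law \<sigma> (X p) \<mu>s)
             {z \<in> space (joint_law \<sigma> (X p) \<mu>s).
                (SUP u \<in> {u \<in> mean_box \<mu>s p. (\<Sum>i<p. (u i - us p z i)\<^sup>2) > real p * \<delta>}.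
                   ereal (mf_objective \<sigma> (X p) \<mu>s (score \<sigma> (X p) (fst z)) u))
                < (SUP u \<in> mean_box \<mu>s p. ereal (mf_objective \<sigma> (X p) \<mu>s (score \<sigma> (X p) (fst z)) u))
                  - ereal (real p * \<epsilon>)}) \<longlonglongrightarrow> 1"
    using separated unfolding well_separated_optimizer_def by blast
  obtain \<epsilon> where \<epsilon>: "0 < \<epsilon>" and lim: "(\<lambda>p. measure (joint_law \<sigma> (X p) \<mu>s)
             {z \<in> space (joint_law \<sigma> (X p) \<mu>s).
                (SUP u \<in> {u \<in> mean_box \<mu>s p. (\<Sum>i<p. (u i - us p z i)\<^sup>2) > real p * \<delta>}.
                   ereal (mf_objective \<sigma> (X p) \<mu>s (score \<sigma> (X p) (fst z)) u))
                < (SUP u \<in> mean_box \<mu>s p. ereal (mf_objective \<sigma> (X p) \<mu>s (score \<sigma> (X p) (fst z)) u))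
                  - ereal (real p * \<epsilon>)}) \<longlonglongrightarrow> 1" (is "(\<lambda>p. measure _ (?S p)) \<longlonglongrightarrow> 1")
    using usep[OF \<delta>(1)] by blast
  define \<theta> where "\<theta> = min (1 / 2) (b / 32)"
  have \<theta>: "0 < \<theta>" "\<theta> \<le> 1 / 2" "4 * \<theta> \<le> b / 8" using b by (auto simp: \<theta>_def)
  define R where "R = 1 / \<theta> + 2 / \<epsilon>"
  have R: "0 < R" using \<theta> \<epsilon> by (simp add: R_def add_pos_pos)
  \<comment> \<open>The first entry pays for the pinned coordinates, the second for the cost of
    pinning in the entropy, multiplied by the factor \<open>R\<close> with which
    \<open>\<Gamma>\<close> enters the bound.\<close>
  define \<eta> where "\<eta> = max (16 / b) ((64 * V * R / b)\<^sup>2)"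
  have \<eta>: "0 < \<eta>" "2 / \<eta> \<le> b / 8"
  proof -
    show *: "0 < \<eta>" unfolding \<eta>_def using b by (simp add: less_max_iff_disj)
    have "16 / b \<le> \<eta>" by (simp add: \<eta>_def)
    then show "2 / \<eta> \<le> b / 8" using * b by (simp add: field_simps)
  qed
  have \<eta>R: "4 * V / sqrt \<eta> * R \<le> b / 16"
  proof -
    have "64 * V * R / b \<le> sqrt \<eta>" by (rule real_le_rsqrt) (simp add: \<eta>_def)
    then show ?thesis using b \<eta> by (simp add: field_simps)
  qed
  \<comment> \<open>Given \<open>\<eta>\<close>, this makes the correlation part of the
    \<open>\<Gamma>\<close> terms exactly \<open>b / 16\<close>; the trace condition is used for
    this value.\<close>
  define A where "A = (b / (8 * R))\<^sup>2 / \<eta>"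
  have A: "0 < A" using b R \<eta> by (simp add: A_def)
  have AR: "sqrt (A * \<eta>) / 2 * R = b / 16"
  proof -
    have "A * \<eta> = (b / (8 * R))\<^sup>2" using \<eta> by (simp add: A_def)
    then have "sqrt (A * \<eta>) = b / (8 * R)" using b R by simp
    then show ?thesis using R by simp
  qed
  \<comment> \<open>The optimality gap \<open>\<epsilon>\<close> is divided in three: clamping,
    parameters beyond \<open>T\<close>, and exchange of the prior.\<close>
  define \<omega> where "\<omega> = \<epsilon> / (3 * V)"
  have \<omega>: "0 < \<omega>" "V * \<omega> = \<epsilon> / 3" using \<epsilon> V by (simp_all add: \<omega>_def)
  obtain T where T: "1 \<le> T" "6 * V\<^sup>2 / T \<le> \<epsilon> / 3" "2 * V\<^sup>2 / T \<le> b / 8"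
    and tail: "\<And>e. 0 \<le> e \<Longrightarrow> e \<le> C \<Longrightarrow> Sup (supp \<mu>s) - \<omega> \<le> tilt_mean \<mu>s T e \<and> tilt_mean \<mu>s (- T) e \<le> Inf (supp \<mu>s) + \<omega>"
  proof -
    have "eventually (\<lambda>T. 1 \<le> T \<and> 6 * V\<^sup>2 / T \<le> \<epsilon> / 3 \<and> 2 * V\<^sup>2 / T \<le> b / 8 \<and> (\<forall>d. 0 \<le> d \<and> d \<le> C \<longrightarrow>
      Sup (supp \<mu>s) - \<omega> \<le> tilt_mean \<mu>s T d \<and> tilt_mean \<mu>s (- T) d \<le> Inf (supp \<mu>s) + \<omega>)) at_top"
      using \<epsilon> b by (intro eventually_conj eventually_ge_at_top eventually_divide_le tilt_mean_near_ends \<omega>) auto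
    from eventually_happens'[OF _ this] show ?thesis using that by auto
  qed
  have TV: "2 * V\<^sup>2 / T\<^sup>2 \<le> b / 8"
  proof -
    have "2 * V\<^sup>2 / T\<^sup>2 \<le> 2 * V\<^sup>2 / T" using T(1) by (intro divide_left_mono) (auto simp: power2_eq_square)
    then show ?thesis using T(3) by linarith
  qed
  \<comment> \<open>The admissible Lipschitz error of the tilts: a share of \<open>b\<close> in the
    final bound and a third of \<open>\<epsilon>\<close> in the optimality gap.\<close>
  define c where "c = min (b / 8) (\<epsilon> / (6 * (V + T + 2)))"
  have c: "0 < c" "c \<le> b / 8" "2 * (V + T + 2) * c \<le> \<epsilon> / 3"
  proof -
    have VT: "0 < V + T + 2" using V T by simp
    show "0 < c" using b \<epsilon> VT by (simp add: c_def)
    show "c \<le> b / 8" unfolding c_def by (rule min.cobounded1)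
    have "c \<le> \<epsilon> / (6 * (V + T + 2))" by (simp add: c_def)
    then show "2 * (V + T + 2) * c \<le> \<epsilon> / 3" using VT by (simp add: field_simps)
  qed
  define \<rho> where "\<rho> = c / (\<bar>tilt_lip T C\<bar> + 1)"
  have \<rho>: "0 < \<rho>" using c by (simp add: \<rho>_def)
  have L: "tilt_lip T C * \<rho> \<le> c"
  proof -
    have "tilt_lip T C * \<rho> \<le> (\<bar>tilt_lip T C\<bar> + 1) * \<rho>" using \<rho> by (intro mult_right_mono) auto
    then show ?thesis by (simp add: \<rho>_def)
  qed
  obtain \<rho>' where \<rho>': "0 < \<rho>'" "\<And>\<nu>. interval_law \<nu> \<Longrightarrow> laws_within \<rho>' \<nu> \<mu>s \<Longrightarrow> nondegenerate \<nu>"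
    using laws_within_nondegenerate[OF interval_law_axioms nondeg] by blast
  define B where "B = sqrt (A * \<eta>) / 2 + 4 * V / sqrt \<eta>"
  have B: "B / \<theta> + 2 * B / \<epsilon> \<le> b / 8"
  proof -
    have "B / \<theta> + 2 * B / \<epsilon> = sqrt (A * \<eta>) / 2 * R + 4 * V / sqrt \<eta> * R"
      unfolding B_def R_def by (simp add: add_divide_distrib distrib_left distrib_right)
    also have "\<dots> \<le> b / 16 + b / 16" by (rule add_mono[OF eq_refl[OF AR] \<eta>R])
    finally show ?thesis by simp
  qed
  \<comment> \<open>The maximum with \<open>1 / 2\<close> makes the measure positive. As
    \<open>measure\<close> is 0 on non-measurable sets, this proves that the separation event is
    measurable.\<close>
  have ev1: "eventually (\<lambda>p. max (1 / 2) (1 - b / 2) < measure (joint_law \<sigma> (X p) \<mu>s) (?S p)) sequentially"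
    using b by (intro order_tendstoD(1)[OF lim]) auto
  have ev2: "eventually (\<lambda>p. ln 2 / \<theta> / real p \<le> b / 8) sequentially"
    using b by (intro eventually_compose_filterlim[OF eventually_divide_le filterlim_real_sequentially]) simp
  have ev3: "eventually (\<lambda>p. norm (mat_trace (offdiag \<sigma> (X p) * offdiag \<sigma> (X p))) \<le> A * norm (real p)) sequentially"
    by (rule landau_o.smallD[OF trace A])
  have within: "eventually (\<lambda>p. laws_within r (\<mu> p) \<mu>s) sequentially" if "0 < r" for r
    using that by (intro eventually_laws_within law interval_law_axioms weak)
  show ?thesis
    using ev1 ev2 ev3 eventually_gt_at_top[of 0] within[OF \<rho>] within[OF \<rho>'(1)]
  proof eventually_elim
    case (elim p)
    have p: "0 < p" by fact
    interpret m: model "X p" "n p" p \<sigma> C \<mu>s by (rule model[OF p])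
    interpret J: prob_space "joint_law \<sigma> (X p) \<mu>s" by (rule m.prob_space_joint)
    have nd: "nondegenerate (\<mu> p)" by (rule \<rho>'(2)[OF law[OF p]]) fact
    have S: "?S p \<in> sets (joint_law \<sigma> (X p) \<mu>s)"
    proof (rule ccontr)
      assume "?S p \<notin> sets (joint_law \<sigma> (X p) \<mu>s)"
      then have "measure (joint_law \<sigma> (X p) \<mu>s) (?S p) = 0" by (rule measure_notin_sets)
      with elim(1) show False by simp
    qed
    define F where "F = {z \<in> space (joint_law \<sigma> (X p) \<mu>s). W * sqrt p < nrm p (score \<sigma> (X p) (fst z))}"
    have Fm: "F \<in> sets (joint_law \<sigma> (X p) \<mu>s)"
    proof -
      have "(\<lambda>z. nrm p (score \<sigma> (X p) (fst z))) \<in> borel_measurable (joint_law \<sigma> (X p) \<mu>s)"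
        unfolding L2_set_def
        by (intro measurable_compose[OF _ borel_measurable_sqrt] borel_measurable_sum borel_measurable_power
            measurable_compose[OF m.measurable_joint(1) m.score_measurable]) simp
      then show ?thesis unfolding F_def by measurable
    qed
    have F: "measure (joint_law \<sigma> (X p) \<mu>s) F \<le> b / 2"
      using m.score_tail[OF WC] tailW unfolding F_def by linarith
    have E: "1 - b \<le> measure (joint_law \<sigma> (X p) \<mu>s) (?S p - F)"
    proof -
      have "measure (joint_law \<sigma> (X p) \<mu>s) (?S p) \<le> measure (joint_law \<sigma> (X p) \<mu>s) ((?S p - F) \<union> F)"
        using S Fm by (intro J.finite_measure_mono) auto
      also have "\<dots> \<le> measure (joint_law \<sigma> (X p) \<mu>s) (?S p - F) + measure (joint_law \<sigma> (X p) \<mu>s) F"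
        using S Fm by (intro measure_Un_le) auto
      finally show ?thesis using F elim(1) by simp
    qed
    have cl: "close_to_product p b (m.post (fst z)) (mf_marginal \<sigma> (X p) (\<mu> p) (u p) (fst z))" if z: "z \<in> ?S p - F" for z
    proof (rule m.close_at[where us="us p z" and T=T and \<omega>=\<omega> and \<rho>=\<rho> and A=A and \<epsilon>=\<epsilon> and \<delta>=\<delta> and \<theta>=\<theta> and \<eta>=\<eta> and W=W])
      have zs: "z \<in> space (joint_law \<sigma> (X p) \<mu>s)" using z by blast
      show "is_arg_max (mf_objective \<sigma> (X p) (\<mu> p) (score \<sigma> (X p) (fst z))) (\<lambda>v. v \<in> mean_box (\<mu> p) p) (u p (fst z))"
        by (rule optimizer[OF p nd measurable_space[OF m.measurable_joint(1) zs]])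
      show "nrm p (score \<sigma> (X p) (fst z)) \<le> W * sqrt p" using z zs by (simp add: F_def not_less)
      show "mat_trace (offdiag \<sigma> (X p) * offdiag \<sigma> (X p)) \<le> A * real p"
        using elim(3) abs_ge_self[of "mat_trace (offdiag \<sigma> (X p) * offdiag \<sigma> (X p))"] by simp
      have "2 * (V + T + 2) * (tilt_lip T C * \<rho>) \<le> 2 * (V + T + 2) * c"
        using L V T by (intro mult_left_mono) auto
      then show "(2 * C + W) * \<omega> + 2 * (2 * C + W + T + 2) * (tilt_lip T C * \<rho>) + 6 * (2 * C + W)\<^sup>2 / T \<le> \<epsilon>"
        unfolding V_def[symmetric] using c(3) \<omega>(2) T(2) by linarith
      show "(SUP v \<in> {v \<in> mean_box \<mu>s p. (\<Sum>i<p. (v i - us p z i)\<^sup>2) > real p * \<delta>}.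
          ereal (mf_objective \<sigma> (X p) \<mu>s (score \<sigma> (X p) (fst z)) v))
        < (SUP v \<in> mean_box \<mu>s p. ereal (mf_objective \<sigma> (X p) \<mu>s (score \<sigma> (X p) (fst z)) v)) - ereal (real p * \<epsilon>)"
        using z by blast
      have "ln 2 / (p * \<theta>) \<le> b / 8" using elim(2) by (simp add: mult.commute)
      then show "(sqrt (A * \<eta>) / 2 + 4 * (2 * C + W) / sqrt \<eta>) / \<theta> + ln 2 / (p * \<theta>) + 4 * \<theta> + 2 * sqrt \<delta> +
        tilt_lip T C * \<rho> + 2 * (2 * C + W)\<^sup>2 / T\<^sup>2 + 2 / \<eta> + 2 * (sqrt (A * \<eta>) / 2 + 4 * (2 * C + W) / sqrt \<eta>) / \<epsilon> \<le> b"
        unfolding V_def[symmetric] B_def[symmetric] using B \<theta>(3) \<delta>(2) L c(2) TV \<eta>(2) b by linarith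
    qed (use law[OF p] nd elim(5) T(1) \<omega>(1) tail W0 \<epsilon> \<theta>(1,2) \<eta>(1) \<delta>(1) in auto)
    show ?case
      using p nd S Fm E cl by (intro conjI bexI[of _ "?S p - F"] ballI) auto
  qed
qed

text \<open>The single parameter \<open>b\<close> bounds both the exceptional probability and, up to
  \<open>k\<close>, the deviation. Only the complement of \<open>E\<close> has to be measurable for
  the comparison of measures.\<close>

lemma conv_in_probI:
  assumes k: "0 \<le> k" and good: "\<And>b. 0 < b \<Longrightarrow> eventually (\<lambda>p. prob_space (M p) \<and>
    (\<exists>E\<in>sets (M p). 1 - b \<le> measure (M p) E \<and> (AE z in M p. z \<in> E \<longrightarrow> \<bar>Z p z - c\<bar> \<le> k * b))) sequentially"
  shows "conv_in_prob M Z c"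
  unfolding conv_in_prob_def
proof (intro allI impI LIMSEQ_I)
  fix \<delta> e :: real assume \<delta>: "0 < \<delta>" and e: "0 < e"
  define b where "b = min (e / 2) (\<delta> / (k + 1))"
  have b: "0 < b" "b < e" "k * b \<le> \<delta>"
  proof -
    show "0 < b" "b < e" using \<delta> e k by (auto simp: b_def min_less_iff_disj)
    have "b \<le> \<delta> / (k + 1)" by (simp add: b_def)
    then have "(k + 1) * b \<le> \<delta>" using k by (simp add: field_simps)
    then show "k * b \<le> \<delta>" using \<open>0 < b\<close> by (simp add: distrib_right)
  qed
  have "eventually (\<lambda>p. norm (measure (M p) {\<omega> \<in> space (M p). \<bar>Z p \<omega> - c\<bar> > \<delta>} - 0) < e) sequentially"
    using good[OF b(1)]
  proof eventually_elim
    case (elim p)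
    then obtain E where E: "E \<in> sets (M p)" "1 - b \<le> measure (M p) E"
      and ae: "AE z in M p. z \<in> E \<longrightarrow> \<bar>Z p z - c\<bar> \<le> k * b" by blast
    interpret prob_space "M p" using elim by simp
    have "measure (M p) {\<omega> \<in> space (M p). \<bar>Z p \<omega> - c\<bar> > \<delta>} \<le> measure (M p) (space (M p) - E)"
    proof (rule finite_measure_mono_AE)
      show "AE z in M p. z \<in> {\<omega> \<in> space (M p). \<bar>Z p \<omega> - c\<bar> > \<delta>} \<longrightarrow> z \<in> space (M p) - E"
        using ae by eventually_elim (use b(3) in auto)
    qed (use E in auto)
    also have "\<dots> \<le> b" using E by (simp add: prob_compl)
    finally show ?case using b(2) by simp
  qed
  then show "\<exists>N. \<forall>p\<ge>N. norm (measure (M p) {\<omega> \<in> space (M p). \<bar>Z p \<omega> - c\<bar> > \<delta>} - 0) < e"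
    by (simp only: eventually_sequentially)
qed

theorem corollary1:
  fixes n :: "nat \<Rightarrow> nat" and X :: "nat \<Rightarrow> real mat"
    and \<sigma> C1 C2 :: real
    and \<P> :: "real measure set"
    and \<mu> :: "nat \<Rightarrow> real measure" and \<mu>s :: "real measure"
    and u :: "nat \<Rightarrow> (nat \<Rightarrow> real) \<Rightarrow> nat \<Rightarrow> real"
    and K :: "nat \<Rightarrow> (nat \<Rightarrow> real) \<Rightarrow> (nat \<Rightarrow> real) measure"
  assumes sigma: "\<sigma> > 0"
    and design: "\<And>p. p > 0 \<Longrightarrow> X p \<in> carrier_mat (n p) p"
    and prior: "\<mu>s \<in> prob_on_interval" "nondegenerate \<mu>s"
    and C1: "0 < C1" "C1 \<le> 1" and C2: "1 \<le> C2"
    and eig_lower: "\<And>p. p > 0 \<Longrightarrow> C1 \<le> lambda_min (gram (X p)) / \<sigma>\<^sup>2"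
    and eig_upper: "\<And>p. p > 0 \<Longrightarrow> lambda_max (gram (X p)) / \<sigma>\<^sup>2 \<le> C2"
    and closed: "closedin weak_topology \<P>"
    and trace: "(\<lambda>p. mat_trace (offdiag \<sigma> (X p) * offdiag \<sigma> (X p))) \<in> o(\<lambda>p. real p)"
    and priors: "\<And>p. p > 0 \<Longrightarrow> \<mu> p \<in> \<P>"
    and weak: "weak_conv_m \<mu> \<mu>s"
    and separated: "well_separated_optimizer \<sigma> X \<mu>s"
    and optimizer_measurable: "\<And>p. p > 0 \<Longrightarrow> nondegenerate (\<mu> p) \<Longrightarrow>
          u p \<in> vec_space (n p) \<rightarrow>\<^sub>M vec_space p"
    and optimizer: "\<And>p y. p > 0 \<Longrightarrow> nondegenerate (\<mu> p) \<Longrightarrow> y \<in> space (vec_space (n p)) \<Longrightarrow>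
          is_arg_max (mf_objective \<sigma> (X p) (\<mu> p) (score \<sigma> (X p) y))
            (\<lambda>v. v \<in> mean_box (\<mu> p) p) (u p y)"
    and posterior: "\<And>p. p > 0 \<Longrightarrow> is_posterior \<sigma> (X p) \<mu>s (K p)"
  shows
    "(\<forall>L>0. \<forall>f :: nat \<Rightarrow> nat \<Rightarrow> (nat \<Rightarrow> real) \<Rightarrow> real.
        (\<forall>p. \<forall>i<p. test_function L (f p i)) \<longrightarrow>
        (\<forall>\<epsilon>>0. conv_in_prob (\<lambda>p. joint_law \<sigma> (X p) \<mu>s)
           (\<lambda>p (y, _). measure (Pi\<^sub>M {..<L} (\<lambda>_. K p y))
              {b \<in> space (Pi\<^sub>M {..<L} (\<lambda>_. K p y)).
                 \<bar>replica_average p L (f p) b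
                  - mf_average p L (f p) (mf_marginal \<sigma> (X p) (\<mu> p) (u p) y)\<bar> > \<epsilon>})
           0))
     \<and>
     (\<forall>\<alpha>. 0 < \<alpha> \<and> \<alpha> < 1 \<longrightarrow>
        (\<forall>\<epsilon>>0. conv_in_prob (\<lambda>p. joint_law \<sigma> (X p) \<mu>s)
           (\<lambda>p (y, _). measure (K p y)
              {\<beta> \<in> space (K p y).
                 (\<Sum>i<p. indicat_real (credible_interval \<sigma> (X p) (\<mu> p) (u p) \<alpha> \<epsilon> y i) (\<beta> i))
                   / real p \<ge> 1 - \<alpha> - \<epsilon>})
           1))
     \<and>
     (\<lambda>p. (\<integral>(y, \<beta>). (\<Sum>i<p. (\<beta> i - cond_mean \<sigma> (X p) \<mu>s i (y, \<beta>))\<^sup>2)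
              \<partial>joint_law \<sigma> (X p) \<mu>s) / real p
          - (\<integral>(y, \<beta>). (\<Sum>i<p. (\<beta> i - mf_mean \<sigma> (X p) (\<mu> p) (u p) y i)\<^sup>2)
              \<partial>joint_law \<sigma> (X p) \<mu>s) / real p)
       \<longlonglongrightarrow> 0"
proof -
  have model: "model (X p) (n p) p \<sigma> C2 \<mu>s" if "0 < p" for p
    using design[OF that] eig_upper[OF that] that sigma prior C2
    by (intro model.intro design.intro model_axioms.intro) (auto simp: interval_law_iff)
  \<comment> \<open>A closed set lies in the underlying space of its topology, and every generating
    set consists of laws on the interval; this is how each \<open>\<mu> p\<close> is known to be
    one.\<close>
  have "topspace weak_topology \<subseteq> prob_on_interval"
    unfolding weak_topology_def topology_generated_by_topspace by blast
  then have law: "interval_law (\<mu> p)" if "0 < p" for p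
    using priors[OF that] closedin_subset[OF closed] unfolding interval_law_iff by blast
  let ?J = "\<lambda>p. joint_law \<sigma> (X p) \<mu>s" and ?Q = "\<lambda>p. mf_marginal \<sigma> (X p) (\<mu> p) (u p)"
    and ?post = "\<lambda>p. model.post (X p) p \<sigma> \<mu>s"
  have Q: "interval_law (?Q p y i)" if "0 < p" for p y i
    unfolding mf_marginal_def by (rule interval_law.interval_law_tilt[OF law[OF that]])
  have good: "eventually (\<lambda>p. 0 < p \<and> nondegenerate (\<mu> p) \<and> (\<exists>E\<in>sets (?J p). 1 - b \<le> measure (?J p) E \<and>
     (\<forall>z\<in>E. close_to_product p b (?post p (fst z)) (?Q p (fst z))))) sequentially" if "0 < b" for b
    by (rule eventually_close[OF model trace law weak separated optimizer that])
  \<comment> \<open>Common scheme of the first two claims: on the good event the kernel is replaced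
    by the explicit posterior, and a bound linear in \<open>b\<close> remains to be shown.\<close>
  have conv: "conv_in_prob ?J Z c"
    if k: "0 \<le> k" and Z: "\<And>p b z. 0 < p \<Longrightarrow> 0 < b \<Longrightarrow> K p (fst z) = ?post p (fst z) \<Longrightarrow>
      close_to_product p b (?post p (fst z)) (?Q p (fst z)) \<Longrightarrow> \<bar>Z p z - c\<bar> \<le> k * b" for Z k c
  proof (rule conv_in_probI[OF k])
    fix b :: real assume b: "0 < b"
    show "eventually (\<lambda>p. prob_space (?J p) \<and> (\<exists>E\<in>sets (?J p). 1 - b \<le> measure (?J p) E \<and>
        (AE z in ?J p. z \<in> E \<longrightarrow> \<bar>Z p z - c\<bar> \<le> k * b))) sequentially"
      using good[OF b]
    proof eventually_elim
      case (elim p)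
      then obtain E where p: "0 < p" and E: "E \<in> sets (?J p)" "1 - b \<le> measure (?J p) E"
        "\<And>z. z \<in> E \<Longrightarrow> close_to_product p b (?post p (fst z)) (?Q p (fst z))" by blast
      interpret m: model "X p" "n p" p \<sigma> C2 \<mu>s by (rule model[OF p])
      have "AE z in ?J p. z \<in> E \<longrightarrow> \<bar>Z p z - c\<bar> \<le> k * b"
        using m.posterior_unique[OF posterior[OF p]]
      proof eventually_elim
        case (elim z)
        show ?case using Z[OF p b elim E(3)] by blast
      qed
      then show ?case using m.prob_space_joint E(1,2) by blast
    qed
  qed
  show ?thesis
  proof (intro conjI allI impI)
    fix L :: nat and f :: "nat \<Rightarrow> nat \<Rightarrow> (nat \<Rightarrow> real) \<Rightarrow> real" and \<epsilon> :: real
    assume f: "\<forall>p. \<forall>i<p. test_function L (f p i)" and \<epsilon>: "0 < \<epsilon>"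
    show "conv_in_prob ?J (\<lambda>p (y, _). measure (Pi\<^sub>M {..<L} (\<lambda>_. K p y))
              {b \<in> space (Pi\<^sub>M {..<L} (\<lambda>_. K p y)).
                 \<bar>replica_average p L (f p) b - mf_average p L (f p) (?Q p y)\<bar> > \<epsilon>}) 0"
    proof (rule conv[where k="real L / \<epsilon>"])
      fix p b and z :: "(nat \<Rightarrow> real) \<times> (nat \<Rightarrow> real)"
      assume p: "0 < p" and K: "K p (fst z) = ?post p (fst z)"
        and cl: "close_to_product p b (?post p (fst z)) (?Q p (fst z))"
      interpret P: cube_law "?post p (fst z)" p by (rule model.cube_law_post[OF model[OF p]])
      have "measure (P.replicas L) {b \<in> space (P.replicas L).
          \<bar>replica_average p L (f p) b - mf_average p L (f p) (?Q p (fst z))\<bar> > \<epsilon>} \<le> real L * b / \<epsilon>"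
        using f p \<epsilon> by (intro P.close_replica_average[OF cl Q[OF p]]) auto
      then show "\<bar>(case z of (y, _) \<Rightarrow> measure (Pi\<^sub>M {..<L} (\<lambda>_. K p y))
              {b \<in> space (Pi\<^sub>M {..<L} (\<lambda>_. K p y)).
                 \<bar>replica_average p L (f p) b - mf_average p L (f p) (?Q p y)\<bar> > \<epsilon>}) - 0\<bar> \<le> real L / \<epsilon> * b"
        by (simp add: case_prod_beta K)
    qed (use \<epsilon> in simp)
  next
    fix \<alpha> \<epsilon> :: real assume \<alpha>: "0 < \<alpha> \<and> \<alpha> < 1" and \<epsilon>: "0 < \<epsilon>"
    show "conv_in_prob ?J (\<lambda>p (y, _). measure (K p y) {\<beta> \<in> space (K p y).
                 (\<Sum>i<p. indicat_real (credible_interval \<sigma> (X p) (\<mu> p) (u p) \<alpha> \<epsilon> y i) (\<beta> i))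
                   / real p \<ge> 1 - \<alpha> - \<epsilon>}) 1"
    proof (rule conv[where k="1 / (min \<epsilon> 1 * \<epsilon>)"])
      fix p b and z :: "(nat \<Rightarrow> real) \<times> (nat \<Rightarrow> real)"
      assume p: "0 < p" and K: "K p (fst z) = ?post p (fst z)"
        and cl: "close_to_product p b (?post p (fst z)) (?Q p (fst z))"
      let ?P = "?post p (fst z)"
      interpret P: cube_law ?P p by (rule model.cube_law_post[OF model[OF p]])
      define N where "N \<beta> = (\<Sum>i<p. indicat_real (credible_interval \<sigma> (X p) (\<mu> p) (u p) \<alpha> \<epsilon> (fst z) i) (\<beta> i)) / real p"
        for \<beta> :: "nat \<Rightarrow> real"
      have "(\<lambda>\<beta>. indicat_real (credible_interval \<sigma> (X p) (\<mu> p) (u p) \<alpha> \<epsilon> (fst z) i) (\<beta> i)) \<in> borel_measurable ?P"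
        if "i < p" for i
        using that unfolding credible_interval_def
        by (intro measurable_compose[OF _ borel_measurable_indicator, where N=borel])
          (auto simp: measurable_cong_sets[OF P.sets_P refl])
      then have [measurable]: "N \<in> borel_measurable ?P"
        unfolding N_def[abs_def] by (intro borel_measurable_divide borel_measurable_sum) auto
      have "measure ?P {\<beta> \<in> space ?P. \<not> 1 - \<alpha> - \<epsilon> \<le> N \<beta>} \<le> b / (min \<epsilon> 1 * \<epsilon>)"
        unfolding N_def credible_interval_def using p \<alpha> \<epsilon> by (intro P.close_count[OF cl Q[OF p]]) auto
      moreover have "measure ?P {\<beta> \<in> space ?P. \<not> 1 - \<alpha> - \<epsilon> \<le> N \<beta>} = 1 - measure ?P {\<beta> \<in> space ?P. 1 - \<alpha> - \<epsilon> \<le> N \<beta>}"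
        by (rule P.prob_neg) measurable
      moreover have "measure ?P {\<beta> \<in> space ?P. 1 - \<alpha> - \<epsilon> \<le> N \<beta>} \<le> 1" by (rule P.prob_le_1)
      ultimately show "\<bar>(case z of (y, _) \<Rightarrow> measure (K p y) {\<beta> \<in> space (K p y).
                 (\<Sum>i<p. indicat_real (credible_interval \<sigma> (X p) (\<mu> p) (u p) \<alpha> \<epsilon> y i) (\<beta> i))
                   / real p \<ge> 1 - \<alpha> - \<epsilon>}) - 1\<bar> \<le> 1 / (min \<epsilon> 1 * \<epsilon>) * b"
        by (simp add: case_prod_beta K N_def[symmetric])
    qed (use \<epsilon> in simp)
  next
    let ?r = "\<lambda>p. (\<integral>(y, \<beta>). (\<Sum>i<p. (\<beta> i - cond_mean \<sigma> (X p) \<mu>s i (y, \<beta>))\<^sup>2) \<partial>?J p) / real p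
          - (\<integral>(y, \<beta>). (\<Sum>i<p. (\<beta> i - mf_mean \<sigma> (X p) (\<mu> p) (u p) y i)\<^sup>2) \<partial>?J p) / real p"
    show "?r \<longlonglongrightarrow> 0"
    proof (rule LIMSEQ_I)
      fix e :: real assume e: "0 < e"
      \<comment> \<open>The risk bound has the constant 6, so dividing by 7 leaves it strictly below
        \<open>e\<close>.\<close>
      define b where "b = e / 7"
      have b: "0 < b" "6 * b < e" using e by (simp_all add: b_def)
      have "eventually (\<lambda>p. norm (?r p - 0) < e) sequentially"
        using good[OF b(1)]
      proof eventually_elim
        case (elim p)
        then obtain E where p: "0 < p" and nd: "nondegenerate (\<mu> p)" and E: "E \<in> sets (?J p)" "1 - b \<le> measure (?J p) E"
          "\<And>z. z \<in> E \<Longrightarrow> close_to_product p b (?post p (fst z)) (?Q p (fst z))" by blast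
        interpret m: model "X p" "n p" p \<sigma> C2 \<mu>s by (rule model[OF p])
        interpret l: interval_law "\<mu> p" by (rule law[OF p])
        define q where "q i y = mf_mean \<sigma> (X p) (\<mu> p) (u p) y i" for i y
        \<comment> \<open>The mean of the tilt at the parameter of \<open>u\<close> is
          \<open>u\<close> itself, so the estimator inherits its measurability from the
          optimizer.\<close>
        have qu: "q i y = u p y i" if i: "i < p" and y: "y \<in> space (vec_space (n p))" for i y
        proof -
          have "u p y \<in> mean_box (\<mu> p) p" using optimizer[OF p nd y] by (simp add: is_arg_max_def)
          then have "u p y i \<in> mean_range (\<mu> p)" using i by (auto intro: PiE_mem)
          then show ?thesis
            unfolding q_def mf_mean_def mf_marginal_def l.tilt_mean_eq[symmetric]
            using m.dvec_bounds(1)[OF i] by (intro l.mean_tilt_param[OF nd])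
        qed
        have "\<bar>(\<integral>z. (\<Sum>i<p. (snd z i - cond_mean \<sigma> (X p) \<mu>s i z)\<^sup>2) \<partial>?J p)
          - (\<integral>z. (\<Sum>i<p. (snd z i - q i (fst z))\<^sup>2) \<partial>?J p)\<bar> \<le> 6 * (real p * b)"
        proof (rule m.risk_difference[OF _ _ E(1,2)])
          fix i assume i: "i < p"
          have "(\<lambda>y. u p y i) \<in> borel_measurable (vec_space (n p))"
            using measurable_compose[OF optimizer_measurable[OF p nd] measurable_component_singleton[of i "{..<p}"]] i by simp
          then show "q i \<in> borel_measurable (vec_space (n p))"
            by (subst measurable_cong[OF qu[OF i]])
          show "\<bar>q i y\<bar> \<le> 1" for y
            unfolding q_def mf_mean_def by (rule interval_law.abs_integral_le[OF Q[OF p]]) auto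
        next
          fix z assume z: "z \<in> E"
          interpret P: cube_law "?post p (fst z)" p by (rule m.cube_law_post)
          show "(\<Sum>i<p. (m.posterior_mean i (fst z) - q i (fst z))\<^sup>2) \<le> 2 * (real p * b)"
            unfolding m.posterior_mean_def q_def mf_mean_def by (rule P.close_means[OF E(3)[OF z] Q[OF p]])
        qed
        then have "\<bar>(\<integral>z. (\<Sum>i<p. (snd z i - cond_mean \<sigma> (X p) \<mu>s i z)\<^sup>2) \<partial>?J p)
          - (\<integral>z. (\<Sum>i<p. (snd z i - q i (fst z))\<^sup>2) \<partial>?J p)\<bar> / real p \<le> 6 * b"
          using p by (simp add: field_simps)
        then have "\<bar>?r p\<bar> \<le> 6 * b"
          unfolding q_def by (simp add: case_prod_beta' diff_divide_distrib[symmetric])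
        then show ?case using b(2) by simp
      qed
      then show "\<exists>N. \<forall>p\<ge>N. norm (?r p - 0) < e" by (simp only: eventually_sequentially)
    qed
  qed
qed

end
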